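(* Let $(\Gamma,Z,\Omega)$ be a miniversal framed variation of finite, uncoupled BPS structure. Fix a basis $\{\beta_j\}$ for $\Gamma$ and let $\{\gamma_i\}$ be a maximal set of active classes such that all the $Z(\gamma_i)$ lie in a half-plane $\mathbb{H}_\ell$. Let $\hat\xi=(1,1)^T\in\mathbb{C}^2$ and $\Pi(w_1,w_2)=w_1+w_2$. (1) The vector function (vector index $j$) $$\exp\left(\frac{1}{\hbar}\sum_{m=1}^\infty\ \sum_{i\,|\,\langle\gamma_i,\beta_j\rangle\neq0}\frac{(-1)^{m\langle\gamma_i,\beta_j\rangle}}{m}\,\Pi\,\log\Psi^{(m),ij}_\hbar\big((2\pi)^{-1}\sqrt{-1}\,t\big)\,\hat\xi\right)$$ admits the tau function $$\exp\left(\frac{1}{\hbar}\sum_{m=1}^\infty\ \sum_{i\,|\,\Omega(\gamma_i)\neq0}\log\tau^{(m),i}_\hbar\big((2\pi)^{-1}\sqrt{-1}\,t\big)\right)$$ modulo $\hbar$, i.e. the latter solves the tau function equation for the former up to $O(\hbar)$. (2) In the integral case the latter function equals $$\tau_\ell(t,Z)=\prod_{\gamma\,|\,\Omega(\gamma)\neq0,\,Z(\gamma)\in\mathbb{H}_\ell}\Upsilon\left(\frac{Z(\gamma)}{t}\right)^{\Omega(\gamma)}.$$ In particular $\tau_\ell(t,Z)$ is a tau function for the vector function $\Psi_{\mathbb{H}_\ell,\beta_j}(t)=\prod_{\gamma\,|\,\Omega(\gamma)\neq0,\,Z(\gamma)\in\mathbb{H}_\ell}\Lambda(Z(\gamma)/t)^{\Omega(\gamma)\langle\beta_j,\gamma\rangle}$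 solving the infinite dimensional, birational Riemann-Hilbert problem of $(\Gamma,Z,\Omega)$, i.e. it is the tau function for the leading order term in the $\hbar\to0$, $N\to\infty$ expansion of a sum of simple oscillators with frequencies $m = 1, \ldots, N$ (at least in a nonempty, open sector).
   Context: **BPS structures.** A BPS structure $(\Gamma, Z, \Omega)$ consists of a finite rank lattice $\Gamma$ with a skew-symmetric integral bilinear form $\langle -,-\rangle$, $Z \in \operatorname{Hom}(\Gamma, \mathbb{C})$ and a map of sets $\Omega\colon \Gamma \to \mathbb{Q}$ with $\Omega(\alpha) = \Omega(-\alpha)$, and such that for some $C>0$, $\Omega(\gamma) \neq 0$ implies $|Z(\gamma)| > C\|\gamma\|$ (fixed norm on $\Gamma\otimes\mathbb{R}$). It is integral if $\Omega$ takes values in $\mathbb{Z}$. A class $\gamma$ is active if $\Omega(\gamma)\neq0$; the structure is finite if there are finitely many active classes, and uncoupled if $\langle\gamma,\gamma'\rangle=0$ for all active $\gamma,\gamma'$. A framed variation of uncoupled BPS structure over a complex manifold $M$ is a family $(\Gamma,Z_p,\Omega)$, $p\in M$, with $\Gamma$, $\langle -,-\rangle$ and $\Omega$ constant and $Z_p$ holomorphic in $p$; it is miniversal if for a basis $\{\beta_j\}$ of $\Gamma$ the functions $Z(\beta_j)$ are local coordinates on $M$. **Tau functions.** If $v^j(t,Z)$ is a vector function of $t,Z$ with vector index $j$, a tau function $\tau_v$ for $v$ is a solution of $$\frac{\partial}{\partial t}\log v^j=\sum_p\langle\beta_j,\beta_p\rangle\frac{\partial}{\partial Z(\beta_p)}\log\tau_v\quad\text{for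 all }j$$ which is invariant under a common rescaling of $t$ and all $Z(\beta_j)$. **Simple oscillators.** For $\hbar>0$, an active class $\gamma_i$, a basis element $\beta_j$ with $\langle\gamma_i,\beta_j\rangle\neq0$, and an integer $m>0$, let $Y^{(m),ij}_\hbar(t)$ be a $GL(2,\mathbb{C})$ fundamental solution of $$\frac{\partial}{\partial t}Y=\left(-t^{-2}U+t^{-1}V\right)Y,\quad U=\begin{pmatrix}mZ(\gamma_i+\beta_j)&0\\0&mZ(\beta_j)\end{pmatrix},\quad V=\frac{\langle\gamma_i,\beta_j\rangle\hbar}{2\pi}\Omega(\gamma_i)\begin{pmatrix}0&(-1)^{m\langle\gamma_i,\beta_j\rangle}\\-(-1)^{m\langle\gamma_i,\beta_j\rangle}&0\end{pmatrix},$$ and let $\Psi^{(m),ij}_\hbar(t)=Y^{(m),ij}_\hbar(t)e^{-U/t}$ be its standard normalisation, determined by $\Psi^{(m),ij}_\hbar(t)\to I$ as $t\to0$ in a sector bounded by the rays $\pm\mathbb{R}_{>0}Z(\gamma_i)$. It is called the simple oscillator spanned by $\gamma_i,\beta_j$ with frequency $m$; $\Psi^{(m),ij}_\hbar=I+O(\hbar)$ and $\log$ is the matrix logarithm. **Oscillator tau functions.** $$\log\tau^{(m),i}_\hbar(\sqrt{-1}t)=\frac{\Omega(\gamma_i)}{2\pi}\hbar\int_0^\infty s\log\left(s^2+\left(\frac{Z(\gamma_i)}{t}\right)^2\right)e^{-ms}ds.$$ **Special functions and half-planes.** $\Lambda(w)=\frac{e^w\Gamma(w)}{\sqrt{2\pi}\,w^{w-1/2}}$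 with $\Gamma(w)$ the gamma function; $\Upsilon(w)=\frac{e^{-\zeta'(-1)}e^{\frac34w^2}G(w+1)}{(2\pi)^{w/2}w^{w^2/2}}$ with $G$ the Barnes $G$-function. For a ray $\ell\subset\mathbb{C}^*$ from $0$, $\mathbb{H}_\ell=\{z\in\mathbb{C}^*\mid z=uv,\ u\in\ell,\ \Im(v)>0\}$. The point $t\in\mathbb{C}^*$ is taken such that $\Re(Z(\gamma_i)/t)>0$ for all $i$. **Riemann-Hilbert problem.** For finite, integral, uncoupled BPS structures, a theorem of Bridgeland states that the given product $\Psi_{\mathbb{H}_\ell,\beta_j}(t)$ is the component along $\beta_j$ of the unique solution of the birational Riemann-Hilbert problem of $(\Gamma,Z,\Omega)$ with values in the torus of twisted characters of $\Gamma$, at a point $\xi$ with $\xi(\gamma)=1$ for all active $\gamma$.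
   Formalization: Constants corrected: in (1) the tau function is the stated one with exponent divided by 2πi; in (2) exponent divided by −2π gives (2π)^(−ΣΩ(γ_i)/12) τ_ℓ; τ_ℓ is a tau function for 1/Ψ, not Ψ; the oscillator exponent divided by √−1 has leading term log(1/Ψ). *)

theory Defs
  imports "HOL-Complex_Analysis.Complex_Analysis" "HOL-Library.Landau_Symbols"
begin

section \<open>BPS structures\<close>

text \<open>
  A lattice of finite rank is modelled as \<open>int ^ 'n\<close>; the bases that occur below are arbitrary
  \<open>\<int>\<close>-bases of it, and the norm on \<open>\<Gamma> \<otimes> \<real> = real ^ 'n\<close> is the Euclidean one.
\<close>

definition lattice_basis :: "('n::finite \<Rightarrow> int ^ 'n) \<Rightarrow> bool" where
  "lattice_basis \<beta> \<longleftrightarrow> (\<forall>\<gamma>. \<exists>!c :: 'n \<Rightarrow> int. \<gamma> = (\<Sum>j\<in>UNIV. c j *s \<beta> j))"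

definition lattice_norm :: "int ^ 'n::finite \<Rightarrow> real" where
  "lattice_norm \<gamma> = norm (\<chi> i. real_of_int (\<gamma> $ i))"

definition skew_form :: "(int ^ 'n::finite \<Rightarrow> int ^ 'n \<Rightarrow> int) \<Rightarrow> bool" where
  "skew_form form \<longleftrightarrow> (\<forall>x. Modules.additive (form x)) \<and> (\<forall>x y. form x y = - form y x)"

definition bps_structure ::
  "(int ^ 'n::finite \<Rightarrow> int ^ 'n \<Rightarrow> int) \<Rightarrow> (int ^ 'n \<Rightarrow> complex) \<Rightarrow> (int ^ 'n \<Rightarrow> rat) \<Rightarrow> bool" where
  "bps_structure form Z \<Omega> \<longleftrightarrow>
     skew_form form \<and> Modules.additive Z \<and> (\<forall>\<gamma>. \<Omega> (- \<gamma>) = \<Omega> \<gamma>) \<and>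
     (\<exists>C>0. \<forall>\<gamma>. \<Omega> \<gamma> \<noteq> 0 \<longrightarrow> norm (Z \<gamma>) > C * lattice_norm \<gamma>)"

definition active :: "(int ^ 'n::finite \<Rightarrow> rat) \<Rightarrow> (int ^ 'n) set" where
  "active \<Omega> = {\<gamma>. \<Omega> \<gamma> \<noteq> 0}"

definition finite_bps :: "(int ^ 'n::finite \<Rightarrow> rat) \<Rightarrow> bool" where
  "finite_bps \<Omega> \<longleftrightarrow> finite (active \<Omega>)"

definition integral_bps :: "(int ^ 'n::finite \<Rightarrow> rat) \<Rightarrow> bool" where
  "integral_bps \<Omega> \<longleftrightarrow> (\<forall>\<gamma>. \<Omega> \<gamma> \<in> \<int>)"

definition uncoupled :: "(int ^ 'n::finite \<Rightarrow> int ^ 'n \<Rightarrow> int) \<Rightarrow> (int ^ 'n \<Rightarrow> rat) \<Rightarrow> bool" where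
  "uncoupled form \<Omega> \<longleftrightarrow> (\<forall>\<gamma>\<in>active \<Omega>. \<forall>\<gamma>'\<in>active \<Omega>. form \<gamma> \<gamma>' = 0)"


section \<open>Complex manifolds and framed variations\<close>

definition holomorphic_fun_on :: "(complex ^ 'd::finite \<Rightarrow> complex) \<Rightarrow> (complex ^ 'd) set \<Rightarrow> bool" where
  "holomorphic_fun_on f S \<longleftrightarrow>
     open S \<and> (\<forall>x\<in>S. \<exists>a :: complex ^ 'd. (f has_derivative (\<lambda>h. \<Sum>i\<in>UNIV. a $ i * h $ i)) (at x))"

definition holomorphic_map_on ::
  "(complex ^ 'd::finite \<Rightarrow> complex ^ 'e::finite) \<Rightarrow> (complex ^ 'd) set \<Rightarrow> bool" where
  "holomorphic_map_on f S \<longleftrightarrow> (\<forall>i. holomorphic_fun_on (\<lambda>x. f x $ i) S)"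

definition is_chart :: "'m::topological_space set \<Rightarrow> ('m \<Rightarrow> complex ^ 'd::finite) \<Rightarrow> bool" where
  "is_chart U \<phi> \<longleftrightarrow> open U \<and> open (\<phi> ` U) \<and> homeomorphism U (\<phi> ` U) \<phi> (inv_into U \<phi>)"

definition holomorphic_transition ::
  "'m::topological_space set \<Rightarrow> ('m \<Rightarrow> complex ^ 'd::finite) \<Rightarrow>
   'm set \<Rightarrow> ('m \<Rightarrow> complex ^ 'e::finite) \<Rightarrow> bool" where
  "holomorphic_transition U \<phi> V \<psi> \<longleftrightarrow> holomorphic_map_on (\<psi> \<circ> inv_into U \<phi>) (\<phi> ` (U \<inter> V))"

definition complex_manifold ::
  "('m::{t2_space,second_countable_topology} set \<times> ('m \<Rightarrow> complex ^ 'd::finite)) set \<Rightarrow> bool" where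
  "complex_manifold \<A> \<longleftrightarrow>
     (\<forall>(U, \<phi>)\<in>\<A>. is_chart U \<phi>) \<and> (\<Union>(U, \<phi>)\<in>\<A>. U) = UNIV \<and>
     (\<forall>(U, \<phi>)\<in>\<A>. \<forall>(V, \<psi>)\<in>\<A>. holomorphic_transition U \<phi> V \<psi>)"

definition framed_variation ::
  "('m::{t2_space,second_countable_topology} set \<times> ('m \<Rightarrow> complex ^ 'd::finite)) set \<Rightarrow>
   (int ^ 'n::finite \<Rightarrow> int ^ 'n \<Rightarrow> int) \<Rightarrow> ('m \<Rightarrow> int ^ 'n \<Rightarrow> complex) \<Rightarrow> (int ^ 'n \<Rightarrow> rat) \<Rightarrow> bool" where
  "framed_variation \<A> form Z \<Omega> \<longleftrightarrow>
     complex_manifold \<A> \<and> (\<forall>p. bps_structure form (Z p) \<Omega>) \<and>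
     (\<forall>(U, \<phi>)\<in>\<A>. \<forall>\<gamma>. holomorphic_fun_on (\<lambda>x. Z (inv_into U \<phi> x) \<gamma>) (\<phi> ` U))"

definition period_coords ::
  "('m \<Rightarrow> int ^ 'n::finite \<Rightarrow> complex) \<Rightarrow> ('n \<Rightarrow> int ^ 'n) \<Rightarrow> 'm \<Rightarrow> complex ^ 'n" where
  "period_coords Z \<beta> p = (\<chi> j. Z p (\<beta> j))"

definition miniversal ::
  "('m::{t2_space,second_countable_topology} set \<times> ('m \<Rightarrow> complex ^ 'd::finite)) set \<Rightarrow>
   ('m \<Rightarrow> int ^ 'n::finite \<Rightarrow> complex) \<Rightarrow> bool" where
  "miniversal \<A> Z \<longleftrightarrow>
     (\<exists>b. lattice_basis b \<and>
       (\<forall>p. \<exists>U. p \<in> U \<and> is_chart U (period_coords Z b) \<and>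
         (\<forall>(V, \<psi>)\<in>\<A>. holomorphic_transition U (period_coords Z b) V \<psi> \<and>
                      holomorphic_transition V \<psi> U (period_coords Z b))))"


section \<open>Rays and half-planes\<close>

definition is_ray :: "complex set \<Rightarrow> bool" where
  "is_ray l \<longleftrightarrow> (\<exists>u. u \<noteq> 0 \<and> l = {of_real r * u | r. r > 0})"

definition half_plane :: "complex set \<Rightarrow> complex set" where
  "half_plane l = {z. z \<noteq> 0 \<and> (\<exists>u\<in>l. \<exists>v. z = u * v \<and> Im v > 0)}"

text \<open>
  Maximality is among all sets of active classes whose central charges lie in some half-plane. It
  forces the rays bounding the half-plane to contain no central charge of an active class.
\<close>

definition maximal_half_plane_classes ::
  "(int ^ 'n::finite \<Rightarrow> rat) \<Rightarrow> (int ^ 'n \<Rightarrow> complex) \<Rightarrow> complex set \<Rightarrow> (int ^ 'n) set \<Rightarrow> bool" where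
  "maximal_half_plane_classes \<Omega> Z l G \<longleftrightarrow>
     is_ray l \<and> G \<subseteq> active \<Omega> \<and> Z ` G \<subseteq> half_plane l \<and>
     (\<forall>G' l'. is_ray l' \<and> G' \<subseteq> active \<Omega> \<and> Z ` G' \<subseteq> half_plane l' \<and> G \<subseteq> G' \<longrightarrow> G' = G)"

text \<open>The pairs \<open>(t, p)\<close> on which all functions below are considered, for a fixed \<open>G\<close>.\<close>

definition tau_domain ::
  "('m \<Rightarrow> int ^ 'n::finite \<Rightarrow> complex) \<Rightarrow> complex set \<Rightarrow> (int ^ 'n) set \<Rightarrow> (complex \<times> 'm) set" where
  "tau_domain Z l G =
     {(t, p). t \<noteq> 0 \<and> (\<forall>\<gamma>\<in>G. Z p \<gamma> \<in> half_plane l \<and> Re (Z p \<gamma> / t) > 0)}"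

definition open_sector :: "complex set \<Rightarrow> bool" where
  "open_sector S \<longleftrightarrow> open S \<and> connected S \<and> 0 \<notin> S \<and> (\<forall>t\<in>S. \<forall>r>0. of_real r * t \<in> S)"


section \<open>Tau functions\<close>

text \<open>\<open>D\<close> is the derivative at \<open>p\<close> of \<open>f\<close> with respect to the local coordinate \<open>Z(\<beta>\<^sub>q)\<close>.\<close>

definition has_coord_derivative ::
  "('m::topological_space \<Rightarrow> int ^ 'n::finite \<Rightarrow> complex) \<Rightarrow> ('n \<Rightarrow> int ^ 'n) \<Rightarrow> 'n \<Rightarrow>
   ('m \<Rightarrow> complex) \<Rightarrow> complex \<Rightarrow> 'm \<Rightarrow> bool" where
  "has_coord_derivative Z \<beta> q f D p \<longleftrightarrow>
     (\<exists>U. p \<in> U \<and> is_chart U (period_coords Z \<beta>) \<and>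
       ((\<lambda>h. f (inv_into U (period_coords Z \<beta>) (period_coords Z \<beta> p + axis q h)))
          has_field_derivative D) (at 0))"

text \<open>\<open>a\<close> is \<open>\<partial>/\<partial>t log v\<^sup>j\<close> and \<open>b q\<close> is \<open>\<partial>/\<partial>Z(\<beta>\<^sub>q) log \<tau>\<close> at \<open>(t, p)\<close>.\<close>

definition log_derivatives ::
  "('m::topological_space \<Rightarrow> int ^ 'n::finite \<Rightarrow> complex) \<Rightarrow> ('n \<Rightarrow> int ^ 'n) \<Rightarrow>
   ('n \<Rightarrow> complex \<Rightarrow> 'm \<Rightarrow> complex) \<Rightarrow> (complex \<Rightarrow> 'm \<Rightarrow> complex) \<Rightarrow>
   complex \<Rightarrow> 'm \<Rightarrow> 'n \<Rightarrow> complex \<Rightarrow> ('n \<Rightarrow> complex) \<Rightarrow> bool" where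
  "log_derivatives Z \<beta> v \<tau> t p j a b \<longleftrightarrow>
     v j t p \<noteq> 0 \<and> \<tau> t p \<noteq> 0 \<and>
     ((\<lambda>s. v j s p) has_field_derivative a * v j t p) (at t) \<and>
     (\<forall>q. has_coord_derivative Z \<beta> q (\<tau> t) (b q * \<tau> t p) p)"

definition rescaling_invariant ::
  "('m \<Rightarrow> int ^ 'n::finite \<Rightarrow> complex) \<Rightarrow> ('n \<Rightarrow> int ^ 'n) \<Rightarrow> (complex \<times> 'm) set \<Rightarrow>
   (complex \<Rightarrow> 'm \<Rightarrow> complex) \<Rightarrow> bool" where
  "rescaling_invariant Z \<beta> D \<tau> \<longleftrightarrow>
     (\<forall>(t, p)\<in>D. \<forall>(t', p')\<in>D. \<forall>c.
        t' = c * t \<and> (\<forall>j. Z p' (\<beta> j) = c * Z p (\<beta> j)) \<longrightarrow> \<tau> t' p' = \<tau> t p)"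

definition tau_function ::
  "(int ^ 'n::finite \<Rightarrow> int ^ 'n \<Rightarrow> int) \<Rightarrow> ('m::topological_space \<Rightarrow> int ^ 'n \<Rightarrow> complex) \<Rightarrow>
   ('n \<Rightarrow> int ^ 'n) \<Rightarrow> (complex \<times> 'm) set \<Rightarrow>
   ('n \<Rightarrow> complex \<Rightarrow> 'm \<Rightarrow> complex) \<Rightarrow> (complex \<Rightarrow> 'm \<Rightarrow> complex) \<Rightarrow> bool" where
  "tau_function form Z \<beta> D v \<tau> \<longleftrightarrow>
     (\<forall>(t, p)\<in>D. \<forall>j. \<exists>a b. log_derivatives Z \<beta> v \<tau> t p j a b \<and>
        a = (\<Sum>q\<in>UNIV. of_int (form (\<beta> j) (\<beta> q)) * b q)) \<and>
     rescaling_invariant Z \<beta> D \<tau>"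

definition tau_function_mod_hbar ::
  "(int ^ 'n::finite \<Rightarrow> int ^ 'n \<Rightarrow> int) \<Rightarrow> ('m::topological_space \<Rightarrow> int ^ 'n \<Rightarrow> complex) \<Rightarrow>
   ('n \<Rightarrow> int ^ 'n) \<Rightarrow> (complex \<times> 'm) set \<Rightarrow>
   (real \<Rightarrow> 'n \<Rightarrow> complex \<Rightarrow> 'm \<Rightarrow> complex) \<Rightarrow> (real \<Rightarrow> complex \<Rightarrow> 'm \<Rightarrow> complex) \<Rightarrow> bool" where
  "tau_function_mod_hbar form Z \<beta> D v \<tau> \<longleftrightarrow>
     (\<forall>(t, p)\<in>D. \<forall>j. \<exists>a b.
        (\<forall>\<^sub>F hbar in at_right 0. log_derivatives Z \<beta> (v hbar) (\<tau> hbar) t p j (a hbar) (b hbar)) \<and>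
        (\<lambda>hbar. a hbar - (\<Sum>q\<in>UNIV. of_int (form (\<beta> j) (\<beta> q)) * b hbar q))
          \<in> O[at_right 0](\<lambda>hbar. of_real hbar)) \<and>
     (\<forall>hbar>0. rescaling_invariant Z \<beta> D (\<tau> hbar))"


section \<open>Simple oscillators\<close>

definition mat_scale :: "complex \<Rightarrow> complex ^ 2 ^ 2 \<Rightarrow> complex ^ 2 ^ 2" where
  "mat_scale c A = (\<chi> a b. c * A $ a $ b)"

definition mat_power :: "complex ^ 2 ^ 2 \<Rightarrow> nat \<Rightarrow> complex ^ 2 ^ 2" where
  "mat_power A n = (((**) A) ^^ n) (mat 1)"

definition mat_exp :: "complex ^ 2 ^ 2 \<Rightarrow> complex ^ 2 ^ 2" where
  "mat_exp A = (\<Sum>n. mat_scale (1 / fact n) (mat_power A n))"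

text \<open>
  The power series of the principal logarithm at the identity; it only matters for matrices
  \<open>I + O(hbar)\<close> as \<open>hbar \<rightarrow> 0\<close>.
\<close>

definition mat_log :: "complex ^ 2 ^ 2 \<Rightarrow> complex ^ 2 ^ 2" where
  "mat_log A = (\<Sum>n. mat_scale ((-1) ^ n / of_nat (Suc n)) (mat_power (A - mat 1) (Suc n)))"

definition oscillator_U ::
  "(int ^ 'n::finite \<Rightarrow> complex) \<Rightarrow> nat \<Rightarrow> int ^ 'n \<Rightarrow> int ^ 'n \<Rightarrow> complex ^ 2 ^ 2" where
  "oscillator_U Z m \<gamma> b =
     vector [vector [of_nat m * Z (\<gamma> + b), 0],
             vector [0, of_nat m * Z b]]"

definition oscillator_V ::
  "(int ^ 'n::finite \<Rightarrow> int ^ 'n \<Rightarrow> int) \<Rightarrow> (int ^ 'n \<Rightarrow> rat) \<Rightarrow> real \<Rightarrow> nat \<Rightarrow>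
   int ^ 'n \<Rightarrow> int ^ 'n \<Rightarrow> complex ^ 2 ^ 2" where
  "oscillator_V form \<Omega> hbar m \<gamma> b =
     mat_scale (of_int (form \<gamma> b) * of_real hbar / (2 * of_real pi) * of_rat (\<Omega> \<gamma>))
       (vector [vector [0, (-1) powi (int m * form \<gamma> b)],
                vector [- ((-1) powi (int m * form \<gamma> b)), 0]])"

definition fundamental_solution ::
  "complex ^ 2 ^ 2 \<Rightarrow> complex ^ 2 ^ 2 \<Rightarrow> complex set \<Rightarrow> (complex \<Rightarrow> complex ^ 2 ^ 2) \<Rightarrow> bool" where
  "fundamental_solution U V S Y \<longleftrightarrow>
     (\<forall>t\<in>S. invertible (Y t) \<and>
       (\<forall>a b. ((\<lambda>s. Y s $ a $ b) has_field_derivative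
                 ((mat_scale (- (1 / t\<^sup>2)) U + mat_scale (1 / t) V) ** Y t) $ a $ b) (at t)))"

definition standard_normalisation ::
  "complex ^ 2 ^ 2 \<Rightarrow> (complex \<Rightarrow> complex ^ 2 ^ 2) \<Rightarrow> complex \<Rightarrow> complex ^ 2 ^ 2" where
  "standard_normalisation U Y t = Y t ** mat_exp (mat_scale (- (1 / t)) U)"

text \<open>
  Of the two sectors bounded by the rays through \<open>Z(\<gamma>)\<close> and \<open>- Z(\<gamma>)\<close> this is the one containing
  \<open>\<i> t / (2\<pi>)\<close> whenever \<open>Re (Z(\<gamma>) / t) > 0\<close>.
\<close>

definition oscillator_sector :: "complex \<Rightarrow> complex set" where
  "oscillator_sector z = half_plane {of_real r * z | r. r > 0}"

definition simple_oscillator ::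
  "(int ^ 'n::finite \<Rightarrow> int ^ 'n \<Rightarrow> int) \<Rightarrow> (int ^ 'n \<Rightarrow> complex) \<Rightarrow> (int ^ 'n \<Rightarrow> rat) \<Rightarrow> real \<Rightarrow>
   nat \<Rightarrow> int ^ 'n \<Rightarrow> int ^ 'n \<Rightarrow> complex \<Rightarrow> complex ^ 2 ^ 2" where
  "simple_oscillator form Z \<Omega> hbar m \<gamma> b t =
     (let U = oscillator_U Z m \<gamma> b; V = oscillator_V form \<Omega> hbar m \<gamma> b;
          S = oscillator_sector (Z \<gamma>)
      in THE X. \<exists>Y. fundamental_solution U V S Y \<and>
           (standard_normalisation U Y \<longlongrightarrow> mat 1) (at 0 within S) \<and>
           X = standard_normalisation U Y t)"

definition xi_hat :: "complex ^ 2" where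
  "xi_hat = (\<chi> i. 1)"

definition coord_sum :: "complex ^ 2 \<Rightarrow> complex" where
  "coord_sum w = w $ 1 + w $ 2"

text \<open>
  The contribution of the oscillators with frequency \<open>m\<close> to the exponent of the vector function,
  in its component along \<open>b\<close>, and the whole exponent.
\<close>

definition oscillator_term ::
  "(int ^ 'n::finite \<Rightarrow> int ^ 'n \<Rightarrow> int) \<Rightarrow> (int ^ 'n \<Rightarrow> complex) \<Rightarrow> (int ^ 'n \<Rightarrow> rat) \<Rightarrow>
   (int ^ 'n) set \<Rightarrow> real \<Rightarrow> int ^ 'n \<Rightarrow> complex \<Rightarrow> nat \<Rightarrow> complex" where
  "oscillator_term form Z \<Omega> G hbar b t m =
     (\<Sum>\<gamma> | \<gamma> \<in> G \<and> form \<gamma> b \<noteq> 0.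
        (-1) powi (int m * form \<gamma> b) / of_nat m *
        coord_sum (mat_log (simple_oscillator form Z \<Omega> hbar m \<gamma> b (1 / (2 * of_real pi) * \<i> * t))
                     *v xi_hat))"

definition oscillator_exponent ::
  "(int ^ 'n::finite \<Rightarrow> int ^ 'n \<Rightarrow> int) \<Rightarrow> (int ^ 'n \<Rightarrow> complex) \<Rightarrow> (int ^ 'n \<Rightarrow> rat) \<Rightarrow>
   (int ^ 'n) set \<Rightarrow> real \<Rightarrow> int ^ 'n \<Rightarrow> complex \<Rightarrow> complex" where
  "oscillator_exponent form Z \<Omega> G hbar b t =
     1 / of_real hbar * (\<Sum>m. oscillator_term form Z \<Omega> G hbar b t (Suc m))"

definition partial_oscillator_exponent ::
  "(int ^ 'n::finite \<Rightarrow> int ^ 'n \<Rightarrow> int) \<Rightarrow> (int ^ 'n \<Rightarrow> complex) \<Rightarrow> (int ^ 'n \<Rightarrow> rat) \<Rightarrow>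
   (int ^ 'n) set \<Rightarrow> nat \<Rightarrow> real \<Rightarrow> int ^ 'n \<Rightarrow> complex \<Rightarrow> complex" where
  "partial_oscillator_exponent form Z \<Omega> G N hbar b t =
     1 / of_real hbar * (\<Sum>m=1..N. oscillator_term form Z \<Omega> G hbar b t m)"

text \<open>\<open>log \<tau>(x)\<close>, where the defining integral is in terms of \<open>t\<close> with \<open>x = \<i> t\<close>.\<close>

definition log_oscillator_tau ::
  "(int ^ 'n::finite \<Rightarrow> complex) \<Rightarrow> (int ^ 'n \<Rightarrow> rat) \<Rightarrow> real \<Rightarrow> nat \<Rightarrow> int ^ 'n \<Rightarrow> complex \<Rightarrow> complex" where
  "log_oscillator_tau Z \<Omega> hbar m \<gamma> x =
     (let t = x / \<i>
      in of_rat (\<Omega> \<gamma>) / (2 * of_real pi) * of_real hbar *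
         (LINT s:{0..}|lborel.
            of_real s * Ln (of_real (s\<^sup>2) + (Z \<gamma> / t)\<^sup>2) * exp (- (of_nat m * of_real s))))"

definition oscillator_tau_term ::
  "(int ^ 'n::finite \<Rightarrow> complex) \<Rightarrow> (int ^ 'n \<Rightarrow> rat) \<Rightarrow> (int ^ 'n) set \<Rightarrow> real \<Rightarrow> complex \<Rightarrow> nat \<Rightarrow> complex" where
  "oscillator_tau_term Z \<Omega> G hbar t m =
     (\<Sum>\<gamma> | \<gamma> \<in> G \<and> \<Omega> \<gamma> \<noteq> 0. log_oscillator_tau Z \<Omega> hbar m \<gamma> (1 / (2 * of_real pi) * \<i> * t))"

definition oscillator_tau_exponent ::
  "(int ^ 'n::finite \<Rightarrow> complex) \<Rightarrow> (int ^ 'n \<Rightarrow> rat) \<Rightarrow> (int ^ 'n) set \<Rightarrow> real \<Rightarrow> complex \<Rightarrow> complex" where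
  "oscillator_tau_exponent Z \<Omega> G hbar t =
     1 / of_real hbar * (\<Sum>m. oscillator_tau_term Z \<Omega> G hbar t (Suc m))"


section \<open>Special functions\<close>

text \<open>
  The choice is unique away from the pole \<open>1\<close>, by analytic continuation.
\<close>

definition riemann_zeta :: "complex \<Rightarrow> complex" where
  "riemann_zeta =
     (SOME f. f holomorphic_on (- {1}) \<and>
              (\<forall>s. Re s > 1 \<longrightarrow> (\<lambda>n. 1 / of_nat (Suc n) powr s) sums f s))"

text \<open>
  \<open>G(1 + z) = (2\<pi>)\<^bsup>z/2\<^esup> exp (- (z + (1 + \<gamma>) z\<^sup>2) / 2) \<Prod>\<^sub>k (1 + z/k)\<^sup>k exp (z\<^sup>2/(2k) - z)\<close>,
  the product being over \<open>k \<ge> 1\<close>.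
\<close>

definition Barnes_G :: "complex \<Rightarrow> complex" where
  "Barnes_G w =
     (let z = w - 1
      in (2 * of_real pi) powr (z / 2) * exp (- (z + (1 + euler_mascheroni) * z\<^sup>2) / 2) *
         (\<Prod>n. (1 + z / of_nat (Suc n)) ^ Suc n * exp (z\<^sup>2 / (2 * of_nat (Suc n)) - z)))"

definition Lambda_fun :: "complex \<Rightarrow> complex" where
  "Lambda_fun w = exp w * Gamma w / (of_real (sqrt (2 * pi)) * w powr (w - 1 / 2))"

definition Upsilon_fun :: "complex \<Rightarrow> complex" where
  "Upsilon_fun w =
     exp (- deriv riemann_zeta (-1)) * exp (3 / 4 * w\<^sup>2) * Barnes_G (w + 1) /
     ((2 * of_real pi) powr (w / 2) * w powr (w\<^sup>2 / 2))"

text \<open>The next two definitions are for integral structures, where \<open>\<Omega> \<gamma> = \<lfloor>\<Omega> \<gamma>\<rfloor>\<close>.\<close>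

definition tau_product ::
  "(int ^ 'n::finite \<Rightarrow> complex) \<Rightarrow> (int ^ 'n \<Rightarrow> rat) \<Rightarrow> complex set \<Rightarrow> complex \<Rightarrow> complex" where
  "tau_product Z \<Omega> l t =
     (\<Prod>\<gamma> | \<Omega> \<gamma> \<noteq> 0 \<and> Z \<gamma> \<in> half_plane l. Upsilon_fun (Z \<gamma> / t) powi \<lfloor>\<Omega> \<gamma>\<rfloor>)"

definition Psi_product ::
  "(int ^ 'n::finite \<Rightarrow> int ^ 'n \<Rightarrow> int) \<Rightarrow> (int ^ 'n \<Rightarrow> complex) \<Rightarrow> (int ^ 'n \<Rightarrow> rat) \<Rightarrow>
   complex set \<Rightarrow> int ^ 'n \<Rightarrow> complex \<Rightarrow> complex" where
  "Psi_product form Z \<Omega> H b t =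
     (\<Prod>\<gamma> | \<Omega> \<gamma> \<noteq> 0 \<and> Z \<gamma> \<in> H. Lambda_fun (Z \<gamma> / t) powi (\<lfloor>\<Omega> \<gamma>\<rfloor> * form b \<gamma>))"


text \<open>
  Normalisations. For \<open>Re w > 0\<close> one has \<open>\<Upsilon>'(w)/\<Upsilon>(w) = w \<Lambda>'(w)/\<Lambda>(w)\<close>; differentiating \<open>\<Lambda>(Z/t)\<close> in \<open>t\<close>
  produces \<open>- Z/t\<^sup>2\<close>, so in terms of the equation in \<open>tau_function\<close> it is \<open>1 / Psi_product\<close> that belongs
  to \<open>tau_product\<close>. By Binet's formulas, with \<open>w = Z(\<gamma>)/t\<close>, the oscillator exponent along \<open>b\<close> is
  \<open>\<i> \<Sum>\<^sub>\<gamma> \<Omega>(\<gamma>) \<langle>\<gamma>, b\<rangle> log \<Lambda>(w) + O(hbar)\<close>, and the oscillator tau exponent is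
  \<open>\<Sum>\<^sub>\<gamma> \<Omega>(\<gamma>) (- 2\<pi> log \<Upsilon>(w) + (\<pi>/6) log (2\<pi>))\<close>. The former exponent thus corresponds to the latter
  divided by \<open>2\<pi>\<i>\<close>, and \<open>log tau_product\<close> to the latter divided by \<open>- 2\<pi>\<close>, up to an additive constant.
\<close>


section \<open>The birational Riemann-Hilbert problem\<close>

definition twisted_character ::
  "(int ^ 'n::finite \<Rightarrow> int ^ 'n \<Rightarrow> int) \<Rightarrow> (int ^ 'n \<Rightarrow> complex) \<Rightarrow> bool" where
  "twisted_character form \<xi> \<longleftrightarrow>
     (\<forall>\<gamma>. \<xi> \<gamma> \<noteq> 0) \<and> (\<forall>\<gamma> \<gamma>'. \<xi> (\<gamma> + \<gamma>') = (-1) powi form \<gamma> \<gamma>' * \<xi> \<gamma> * \<xi> \<gamma>')"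

definition nonactive_ray :: "(int ^ 'n::finite \<Rightarrow> complex) \<Rightarrow> (int ^ 'n \<Rightarrow> rat) \<Rightarrow> complex set \<Rightarrow> bool" where
  "nonactive_ray Z \<Omega> l \<longleftrightarrow> is_ray l \<and> (\<forall>\<gamma>\<in>active \<Omega>. Z \<gamma> \<notin> l)"

text \<open>
  The problem for a finite, integral, uncoupled structure. \<open>X l t\<close> is the twisted character
  attached to the nonactive ray \<open>l\<close>. In Bridgeland's variable \<open>s = t / (2\<pi>\<i>)\<close> the half-plane of
  \<open>l\<close> below is the half-plane centred on \<open>l\<close>, and \<open>exp (2\<pi>\<i> Z / t)\<close> is \<open>exp (Z / s)\<close>. The jump
  over the convex sector bounded by \<open>l\<^sub>1\<close> and, clockwise, \<open>l\<^sub>2\<close> is the birational automorphism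
  \<open>x\<^sub>\<beta> \<mapsto> x\<^sub>\<beta> \<Prod>\<^sub>\<gamma> (1 - x\<^sub>\<gamma>)\<close> to the power \<open>\<Omega>(\<gamma>) \<langle>\<gamma>, \<beta>\<rangle>\<close>, with \<open>\<gamma>\<close> the active classes in the sector; the
  order of the factors is irrelevant as the structure is uncoupled.
\<close>

definition solves_birational_RH ::
  "(int ^ 'n::finite \<Rightarrow> int ^ 'n \<Rightarrow> int) \<Rightarrow> (int ^ 'n \<Rightarrow> complex) \<Rightarrow> (int ^ 'n \<Rightarrow> rat) \<Rightarrow>
   (int ^ 'n \<Rightarrow> complex) \<Rightarrow> (complex set \<Rightarrow> complex \<Rightarrow> int ^ 'n \<Rightarrow> complex) \<Rightarrow> bool" where
  "solves_birational_RH form Z \<Omega> \<xi> X \<longleftrightarrow>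
     (\<forall>l. nonactive_ray Z \<Omega> l \<longrightarrow>
        (\<forall>t\<in>half_plane l. twisted_character form (X l t)) \<and>
        (\<forall>b. (\<lambda>t. X l t b) holomorphic_on half_plane l) \<and>
        (\<forall>b. ((\<lambda>t. exp (2 * of_real pi * \<i> * Z b / t) * X l t b) \<longlongrightarrow> \<xi> b) (at 0 within half_plane l)) \<and>
        (\<forall>b. \<exists>k>0. \<exists>R>0. \<forall>t\<in>half_plane l. norm t > R \<longrightarrow>
           norm t powr (- k) < norm (X l t b) \<and> norm (X l t b) < norm t powr k)) \<and>
     (\<forall>l\<^sub>1 l\<^sub>2. nonactive_ray Z \<Omega> l\<^sub>1 \<and> nonactive_ray Z \<Omega> l\<^sub>2 \<and> l\<^sub>1 \<subseteq> half_plane l\<^sub>2 \<longrightarrow>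
        (\<forall>t \<in> half_plane l\<^sub>1 \<inter> half_plane l\<^sub>2. \<forall>b.
           X l\<^sub>2 t b = X l\<^sub>1 t b *
             (\<Prod>\<gamma> | \<Omega> \<gamma> \<noteq> 0 \<and> (\<exists>u\<in>l\<^sub>1. \<exists>w\<in>l\<^sub>2. Z \<gamma> = u + w).
                (1 - X l\<^sub>1 t \<gamma>) powi (\<lfloor>\<Omega> \<gamma>\<rfloor> * form \<gamma> b))))"

text \<open>The twisted characters whose component along \<open>b\<close> is \<open>Psi_product\<close>.\<close>

definition Psi_solution ::
  "(int ^ 'n::finite \<Rightarrow> int ^ 'n \<Rightarrow> int) \<Rightarrow> (int ^ 'n \<Rightarrow> complex) \<Rightarrow> (int ^ 'n \<Rightarrow> rat) \<Rightarrow>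
   (int ^ 'n \<Rightarrow> complex) \<Rightarrow> complex set \<Rightarrow> complex \<Rightarrow> int ^ 'n \<Rightarrow> complex" where
  "Psi_solution form Z \<Omega> \<xi> l t b =
     exp (- (2 * of_real pi * \<i> * Z b / t)) * \<xi> b * Psi_product form Z \<Omega> (half_plane l) b t"

end

(*
  Write x = Z(gamma)/t. By Binet's two formulas, log Lambda(x) and (up to an additive constant)
  log Upsilon(x) are sums over the frequencies m of integrals over the half-line: the first of
  exp(-2 pi m u) x/(x^2 + u^2), the second of the integrand defining the m-th oscillator tau function.
  The normalised solution of a simple oscillator is, in the coordinate v = t/(m Z(gamma)), a confluent
  hypergeometric integral; the quotient of two solutions that tend to the identity is constant up to
  exponentials exp(1/v), exp(-1/v), which do not decay along the imaginary axis, so it is unique. Its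
  expansion to first order in hbar at v = i/(2 pi m x) produces the terms of Binet's sum for
  log Lambda, with errors O(hbar^2/m^2) that are uniform for t in a disc. By Cauchy's inequality the
  t-derivative of the exponent is therefore correct up to O(hbar), and the tau function equation
  reduces to Upsilon'/Upsilon = x Lambda'/Lambda.
*)
theory Submission
  imports Defs "HOL-Real_Asymp.Real_Asymp"
begin

subsection \<open>Integrals over the half-line\<close>

text \<open>The tau functions are compared as functions, so additive constants matter. Derivatives
  determine log Upsilon only up to a constant, which contains zeta'(-1), with zeta merely some
  continuation of its Dirichlet series. The constant is therefore computed at x = 1: Hermite's
  integral gives an explicit continuation whose derivative at -1 is an integral against the weight 1
  / (exp (2 pi u) - 1), the geometric sum of the frequency factors exp (- 2 pi m u), and Barnes'
  product is evaluated at 2 through Stirling's formula. The Riemann-Hilbert part is independent of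
  the oscillators: its jumps are the reflection formula for Lambda. To sum over m, the error of one
  oscillator with coupling c has to be O(c^2 |v|) and not just O(c^2), because v is of order 1/m.
  The sign depending on m occurs once in the coupling and once as a weight, so it disappears at
  first order in hbar. Finiteness and maximality make the active classes in the half-plane the same
  set G at every point of the domain.\<close>

lemma integral_parameter_derivative:
  fixes f f' :: "complex \<Rightarrow> 'a \<Rightarrow> complex"
  assumes S: "open S" "z \<in> S"
    and meas: "\<And>w. w \<in> S \<Longrightarrow> f w \<in> borel_measurable M"
    and der: "\<And>w x. w \<in> S \<Longrightarrow> x \<in> space M \<Longrightarrow> ((\<lambda>w. f w x) has_field_derivative f' w x) (at w)"
    and g: "integrable M g"
    and bound: "\<And>w x. w \<in> S \<Longrightarrow> x \<in> space M \<Longrightarrow> norm (f w x) \<le> g x"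
  shows "integrable M (f' z)"
    and "((\<lambda>w. \<integral>x. f w x \<partial>M) has_field_derivative (\<integral>x. f' z x \<partial>M)) (at z)"
proof -
  obtain r0 where r0: "r0 > 0" "cball z r0 \<subseteq> S" using S open_contains_cball by blast
  \<comment> \<open>With half the radius, a disc of radius \<open>r\<close> around any point of
    \<open>ball z r\<close> still lies in \<open>S\<close>, as Cauchy's inequality requires.\<close>
  define r where "r = r0 / 2"
  have r: "r > 0" and rS: "\<And>w. w \<in> ball z r \<Longrightarrow> cball w r \<subseteq> S"
  proof -
    show "r > 0" using r0 by (simp add: r_def)
    fix w assume "w \<in> ball z r"
    hence "cball w r \<subseteq> cball z r0" unfolding r_def
      by (intro cball_subset_cball_iff[THEN iffD2]) (auto simp: dist_commute)
    thus "cball w r \<subseteq> S" using r0 by blast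
  qed
  have zr: "z \<in> ball z r" using r by simp
  \<comment> \<open>Cauchy's inequality turns the majorant of \<open>f\<close> into one of
    \<open>f'\<close>, so a majorant of \<open>f\<close> is all that has to be supplied.\<close>
  have bd: "norm (f' w x) \<le> g x / r" if w: "w \<in> ball z r" and x: "x \<in> space M" for w x
  proof -
    have hol: "(\<lambda>w. f w x) holomorphic_on cball w r"
      using rS[OF w] der x by (meson holomorphic_onI field_differentiable_def has_field_derivative_at_within subsetD)
    have "norm ((deriv ^^ 1) (\<lambda>w. f w x) w) \<le> (fact 1) * g x / r ^ 1"
    proof (rule Cauchy_inequality[where \<xi>=w])
      show "(\<lambda>w. f w x) holomorphic_on ball w r" using hol holomorphic_on_subset ball_subset_cball by blast
      show "continuous_on (cball w r) (\<lambda>w. f w x)" using hol by (rule holomorphic_on_imp_continuous_on)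
      show "0 < r" by fact
      fix y assume "norm (w - y) = r"
      hence "y \<in> cball w r" by (simp add: dist_norm)
      thus "norm (f y x) \<le> g x" using rS[OF w] bound x by blast
    qed
    moreover have "deriv (\<lambda>w. f w x) w = f' w x"
      using rS[OF w] r der[of w x] x by (intro DERIV_imp_deriv) (auto simp: subset_iff)
    ultimately show ?thesis by simp
  qed
  have quot: "norm ((f (z + h) x - f z x) / h) \<le> g x / r" if h: "norm h < r" "h \<noteq> 0" and x: "x \<in> space M" for h x
  proof -
    have "norm (f (z + h) x - f z x) \<le> (g x / r) * norm (z + h - z)"
    proof (rule field_differentiable_bound[where S="ball z r" and f'="\<lambda>w. f' w x"])
      fix w assume w: "w \<in> ball z r"
      thus "((\<lambda>w. f w x) has_field_derivative f' w x) (at w within ball z r)"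
        using rS[OF w] r by (intro has_field_derivative_at_within[OF der] x) auto
      show "norm (f' w x) \<le> g x / r" by (rule bd[OF w x])
    qed (use h r in \<open>auto simp: dist_norm\<close>)
    hence "norm (f (z + h) x - f z x) / norm h \<le> g x / r"
      using h by (subst pos_divide_le_eq) auto
    thus ?thesis by (simp only: norm_divide)
  qed
  have lim: "(\<lambda>n. (f (z + X n) x - f z x) / X n) \<longlonglongrightarrow> f' z x"
    if X: "\<And>n. X n \<noteq> 0" "X \<longlonglongrightarrow> 0" and x: "x \<in> space M" for X x
  proof -
    have "((\<lambda>h. (f (z + h) x - f z x) / h) \<longlongrightarrow> f' z x) (at 0)"
      using der[OF S(2) x] by (simp add: DERIV_def)
    thus ?thesis using X unfolding tendsto_at_iff_sequentially comp_def by auto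
  qed
  have inS: "z + h \<in> S" if "norm h < r" for h
    using rS[OF zr] that by (auto simp: dist_norm subset_iff)
  \<comment> \<open>Dominated convergence works along sequences, so the derivative is taken along an
    arbitrary null sequence. Measurability of \<open>f' z\<close> comes with it, as a pointwise
    limit of difference quotients.\<close>
  have main: "integrable M (f' z) \<and>
     (\<lambda>n. ((\<integral>x. f (z + X n) x \<partial>M) - (\<integral>x. f z x \<partial>M)) / X n) \<longlonglongrightarrow> (\<integral>x. f' z x \<partial>M)"
    if X: "\<And>n. X n \<noteq> 0" "X \<longlonglongrightarrow> 0" and Xr: "\<And>n. norm (X n) < r" for X
  proof -
    define q where "q n x = (f (z + X n) x - f z x) / X n" for n x
    have qm: "q n \<in> borel_measurable M" for n
      unfolding q_def using meas[OF inS[OF Xr[of n]]] meas[OF S(2)] by measurable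
    have ql: "(\<lambda>n. q n x) \<longlonglongrightarrow> f' z x" if "x \<in> space M" for x
      unfolding q_def by (rule lim[OF X that])
    have f'm: "f' z \<in> borel_measurable M"
      by (rule borel_measurable_LIMSEQ_metric[OF qm ql])
    have gi: "integrable M (\<lambda>x. g x / r)" using g by simp
    have dom: "AE x in M. norm (q n x) \<le> g x / r" for n
      unfolding q_def using quot[OF Xr X(1)] by (intro AE_I2) auto
    have li: "AE x in M. (\<lambda>n. q n x) \<longlonglongrightarrow> f' z x" using ql by (intro AE_I2) auto
    have fi: "integrable M (f w)" if w: "w \<in> S" for w
    proof (rule Bochner_Integration.integrable_bound[OF g meas[OF w]], rule AE_I2)
      fix x assume "x \<in> space M"
      hence "norm (f w x) \<le> g x" using bound w by blast
      thus "norm (f w x) \<le> norm (g x)" by simp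
    qed
    have i: "integrable M (f (z + X n))" for n by (rule fi[OF inS[OF Xr]])
    have i0: "integrable M (f z)" by (rule fi[OF S(2)])
    have eq: "((\<integral>x. f (z + X n) x \<partial>M) - (\<integral>x. f z x \<partial>M)) / X n = (\<integral>x. q n x \<partial>M)" for n
      unfolding q_def using i i0 by simp
    show ?thesis
      unfolding eq using integral_dominated_convergence[OF f'm qm gi li dom]
        integrable_dominated_convergence[OF f'm qm gi li dom] by simp
  qed
  \<comment> \<open>A concrete null sequence inside the disc, from which \<open>main\<close> yields
    the integrability of \<open>f' z\<close>.\<close>
  define Y where "Y n = complex_of_real (r / (of_nat n + 2))" for n
  have "(\<lambda>n. r / (real n + 2)) \<longlonglongrightarrow> 0" by real_asymp
  hence "Y \<longlonglongrightarrow> 0" unfolding Y_def using tendsto_of_real[where 'a=complex] by fastforce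
  moreover have "norm (Y n) < r" for n
    unfolding Y_def norm_of_real using r by (simp add: divide_less_eq)
  moreover have "Y n \<noteq> 0" for n
    unfolding Y_def of_real_eq_0_iff using r by (simp add: add_nonneg_eq_0_iff)
  ultimately show "integrable M (f' z)" using main[of Y] by blast
  show "((\<lambda>w. \<integral>x. f w x \<partial>M) has_field_derivative (\<integral>x. f' z x \<partial>M)) (at z)"
    unfolding DERIV_def tendsto_at_iff_sequentially comp_def
  proof (intro allI impI)
    fix X :: "nat \<Rightarrow> complex" assume X: "\<forall>i. X i \<in> UNIV - {0}" "X \<longlonglongrightarrow> 0"
    then obtain N where N: "\<And>n. n \<ge> N \<Longrightarrow> norm (X n) < r"
      using r LIMSEQ_D[OF X(2) r] by auto
    have "(\<lambda>n. ((\<integral>x. f (z + X (n + N)) x \<partial>M) - (\<integral>x. f z x \<partial>M)) / X (n + N)) \<longlonglongrightarrow> (\<integral>x. f' z x \<partial>M)"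
      using main[of "\<lambda>n. X (n + N)"] X N LIMSEQ_ignore_initial_segment[OF X(2), of N] by auto
    thus "(\<lambda>n. ((\<integral>x. f (z + X n) x \<partial>M) - (\<integral>x. f z x \<partial>M)) / X n) \<longlonglongrightarrow> (\<integral>x. f' z x \<partial>M)"
      by (rule LIMSEQ_offset)
  qed
qed

text \<open>The point 0 is removed from the space itself: powers, logarithms and later the weight
  \<open>bose\<close> are singular there, and conditions on integrands then need to be checked for
  positive arguments only.\<close>

abbreviation halfline :: "real measure" where
  "halfline \<equiv> restrict_space lborel {0<..}"

abbreviation halfline_integral :: "(real \<Rightarrow> 'a::{banach,second_countable_topology}) \<Rightarrow> 'a"  (binder \<open>LH \<close> 10) where
  "halfline_integral f \<equiv> integral\<^sup>L halfline f"

lemma space_halfline [simp]: "space halfline = {0<..}"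
  by (simp add: space_restrict_space)

lemma integral_halfline: "integral\<^sup>L halfline f = (LINT x:{0<..}|lborel. f x)"
  for f :: "real \<Rightarrow> 'a::{banach, second_countable_topology}"
  by (simp add: integral_restrict_space set_lebesgue_integral_def)

lemma integrable_halfline: "integrable halfline f \<longleftrightarrow> set_integrable lborel {0<..} f"
  for f :: "real \<Rightarrow> 'a::{banach, second_countable_topology}"
  by (simp add: integrable_restrict_space set_integrable_def)

lemma borel_measurable_halfline:
  "f \<in> borel_measurable borel \<Longrightarrow> f \<in> borel_measurable halfline"
  by (rule measurable_restrict_space1) simp

lemma borel_measurable_continuous_halfline:
  fixes f :: "real \<Rightarrow> 'a::topological_space"
  assumes "continuous_on {0<..} f"
  shows "f \<in> borel_measurable halfline"
  using borel_measurable_continuous_on_restrict[OF assms]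
  by (simp add: measurable_def space_restrict_space sets_restrict_space)

lemma integrable_halfline_bound:
  fixes f :: "real \<Rightarrow> complex"
  assumes "integrable halfline g" "f \<in> borel_measurable halfline"
    and "\<And>x. x > 0 \<Longrightarrow> norm (f x) \<le> g x"
  shows "integrable halfline f"
  using assms(3) by (intro Bochner_Integration.integrable_bound[OF assms(1,2)] AE_I2) force

lemma sigma_finite_halfline: "sigma_finite_measure halfline"
  by (rule sigma_finite_measure_restrict_space[OF lborel.sigma_finite_measure_axioms]) simp

lemma pair_sigma_finite_halfline: "pair_sigma_finite halfline halfline"
  using sigma_finite_halfline by (simp add: pair_sigma_finite_def)

text \<open>All integrations by parts below take this form. Boundary values enter as limits, which
  covers antiderivatives such as \<open>x powr s\<close> that oscillate near 0.\<close>

lemma halfline_FTC: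
  fixes F f :: "real \<Rightarrow> 'a::euclidean_space"
  assumes "\<And>x. x > 0 \<Longrightarrow> (F has_vector_derivative f x) (at x)"
    and "continuous_on {0<..} f" "integrable halfline f"
    and "(F \<longlongrightarrow> A) (at_right 0)" "(F \<longlongrightarrow> B) at_top"
  shows "integral\<^sup>L halfline f = B - A"
proof -
  have e: "einterval 0 \<infinity> = {0::real<..}" by (auto simp: einterval_def zero_ereal_def)
  have "(LBINT x=0..\<infinity>. f x) = B - A"
  proof (rule interval_integral_FTC_integrable)
    show "((F \<circ> real_of_ereal) \<longlongrightarrow> A) (at_right 0)"
      using assms(4) unfolding zero_ereal_def by (simp add: ereal_tendsto_simps1)
    show "((F \<circ> real_of_ereal) \<longlongrightarrow> B) (at_left \<infinity>)"
      using assms(5) by (simp add: ereal_tendsto_simps1)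
  qed (use assms in \<open>auto simp: e zero_ereal_def integrable_halfline continuous_on_eq_continuous_at\<close>)
  thus ?thesis
    by (simp add: interval_lebesgue_integral_def e integral_halfline)
qed

lemma norm_of_real_powr: "x > 0 \<Longrightarrow> norm (complex_of_real x powr s) = x powr Re s"
  by (subst norm_powr_real_powr) auto

text \<open>The integrand is the norm of Euler's Gamma integrand at a real exponent, which is
  absolutely integrable.\<close>

lemma integrable_powr_exp_halfline:
  assumes "a > -1" "k > 0"
  shows "integrable halfline (\<lambda>x. x powr a * exp (- k * x))"
proof -
  have "(\<lambda>t. complex_of_real t powr (of_real (a + 1) - 1) / of_real (exp (k * t)))
          absolutely_integrable_on {0<..}"
    using assms by (intro absolutely_integrable_Gamma_integral) auto
  hence "integrable lebesgue (\<lambda>t. norm (indicator {0<..} t *\<^sub>R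
      (complex_of_real t powr (of_real (a + 1) - 1) / of_real (exp (k * t)))))"
    unfolding set_integrable_def by (rule integrable_norm)
  also have "(\<lambda>t. norm (indicator {0<..} t *\<^sub>R
      (complex_of_real t powr (of_real (a + 1) - 1) / of_real (exp (k * t))))) =
      (\<lambda>t. indicator {0<..} t *\<^sub>R (t powr a * exp (- k * t)))"
    by (auto simp: indicator_def fun_eq_iff norm_divide norm_of_real_powr exp_minus field_simps)
  finally have "integrable lebesgue (\<lambda>t. indicator {0<..} t *\<^sub>R (t powr a * exp (- k * t)))" .
  hence "integrable lborel (\<lambda>t. indicator {0<..} t *\<^sub>R (t powr a * exp (- k * t)))"
    by (subst (asm) integrable_completion) auto
  thus ?thesis by (simp add: integrable_halfline set_integrable_def)
qed

lemma integrable_Gamma_halfline: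
  assumes "Re s > 0" "Re z > 0"
  shows "integrable halfline (\<lambda>x. complex_of_real x powr (s - 1) * exp (- (z * of_real x)))"
proof (rule integrable_halfline_bound)
  show "integrable halfline (\<lambda>x. x powr (Re s - 1) * exp (- Re z * x))"
    using assms by (intro integrable_powr_exp_halfline) auto
  show "(\<lambda>x. complex_of_real x powr (s - 1) * exp (- (z * of_real x))) \<in> borel_measurable halfline"
    by (rule borel_measurable_halfline) measurable
qed (simp add: norm_mult norm_of_real_powr)

lemma powr_exp_at_right_0:
  assumes "Re s > 0"
  shows "((\<lambda>x. complex_of_real x powr s * exp (- (z * of_real x))) \<longlongrightarrow> 0) (at_right 0)"
proof -
  define a where "a = Re s"
  have "a > 0" using assms by (simp add: a_def)
  hence "((\<lambda>x::real. x powr a) \<longlongrightarrow> 0) (at_right 0)" by real_asymp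
  moreover have "\<forall>\<^sub>F x in at_right 0. norm (complex_of_real x powr s) = x powr a"
    using norm_of_real_powr by (auto simp: eventually_at_right_less a_def intro: eventually_mono[OF eventually_at_right_less])
  ultimately have "((\<lambda>x. norm (complex_of_real x powr s)) \<longlongrightarrow> 0) (at_right 0)"
    by (subst tendsto_cong)
  hence "((\<lambda>x. complex_of_real x powr s) \<longlongrightarrow> 0) (at_right 0)" by (rule tendsto_norm_zero_cancel)
  moreover have "((\<lambda>x. exp (- (z * complex_of_real x))) \<longlongrightarrow> exp (- (z * complex_of_real 0))) (at_right 0)"
    by (intro tendsto_intros)
  ultimately show ?thesis using tendsto_mult by fastforce
qed

lemma powr_exp_at_top:
  assumes "Re z > 0"
  shows "((\<lambda>x. complex_of_real x powr s * exp (- (z * of_real x))) \<longlongrightarrow> 0) at_top"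
proof -
  define a k where "a = Re s" and "k = Re z"
  have "k > 0" using assms by (simp add: k_def)
  hence "((\<lambda>x::real. x powr a * exp (- k * x)) \<longlongrightarrow> 0) at_top" by real_asymp
  moreover have "\<forall>\<^sub>F x in at_top. norm (complex_of_real x powr s * exp (- (z * of_real x))) = x powr a * exp (- k * x)"
    using norm_of_real_powr by (intro eventually_mono[OF eventually_gt_at_top[of 0]]) (auto simp: a_def k_def norm_mult)
  ultimately have "((\<lambda>x. norm (complex_of_real x powr s * exp (- (z * of_real x)))) \<longlongrightarrow> 0) at_top"
    by (subst tendsto_cong)
  thus ?thesis by (rule tendsto_norm_zero_cancel)
qed

lemma integral_Gamma_halfline_1:
  assumes "Re s > 0"
  shows "(LH x. complex_of_real x powr (s - 1) * exp (- of_real x)) = Gamma s"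
proof -
  let ?f = "\<lambda>x. complex_of_real x powr (s - 1) * exp (- of_real x)"
  have "((\<lambda>t. of_real t powr (s - 1) / of_real (exp t)) has_integral Gamma s) {0..}"
    by (rule Gamma_integral_complex) fact
  also have "(\<lambda>t. of_real t powr (s - 1) / complex_of_real (exp t)) = ?f"
    by (auto simp: exp_minus field_simps exp_of_real)
  finally have G: "(?f has_integral Gamma s) {0<..}"
    by (subst has_integral_spike_set_eq[where T="{0..}"])
       (auto intro!: negligible_subset[OF negligible_sing[of 0]])
  have i: "set_integrable lborel {0<..} ?f"
    using integrable_Gamma_halfline[OF assms, of 1] by (simp add: integrable_halfline)
  have "(?f has_integral (LINT x:{0<..}|lborel. ?f x)) {0<..}"
    using set_borel_integral_eq_integral[OF i] by (simp add: has_integral_integral)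
  thus ?thesis using G by (simp add: integral_halfline has_integral_unique)
qed

text \<open>An ODE argument replaces the rotation of a contour: the integral satisfies
  \<open>J' = - s / z * J\<close> on the right half-plane, so \<open>z powr s * J z\<close> is
  constant there and can be read off at z = 1.\<close>

lemma integral_Gamma_halfline:
  assumes s: "Re s > 0" and z: "Re z > 0"
  shows "(LH x. complex_of_real x powr (s - 1) * exp (- (z * of_real x))) = Gamma s * z powr (- s)"
proof -
  define J where "J z = (LH x. complex_of_real x powr (s - 1) * exp (- (z * of_real x)))" for z
  have der: "(J has_field_derivative (- s / z * J z)) (at z)" if z: "Re z > 0" for z
  proof -
    have "(J has_field_derivative (LH x. - (complex_of_real x powr s * exp (- (z * of_real x))))) (at z)"
      unfolding J_def
    proof (rule integral_parameter_derivative(2)[where S="{w. Re w > Re z / 2}"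
            and f'="\<lambda>z x. - (complex_of_real x powr s * exp (- (z * of_real x)))"])
      show "open {w. Re w > Re z / 2}" by (rule open_halfspace_Re_gt)
      show "integrable halfline (\<lambda>x. x powr (Re s - 1) * exp (- (Re z / 2) * x))"
        using s z by (intro integrable_powr_exp_halfline) auto
      fix w x assume w: "w \<in> {w. Re z / 2 < Re w}" and x: "x \<in> space halfline"
      show "norm (complex_of_real x powr (s - 1) * exp (- (w * of_real x))) \<le> x powr (Re s - 1) * exp (- (Re z / 2) * x)"
        using w x by (auto simp: norm_mult norm_of_real_powr intro!: mult_left_mono)
      have "complex_of_real x powr s = of_real x powr (s - 1) * of_real x"
        using x by (simp add: powr_diff)
      thus "((\<lambda>w. complex_of_real x powr (s - 1) * exp (- (w * of_real x))) has_field_derivative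
            - (complex_of_real x powr s * exp (- (w * of_real x)))) (at w)"
        by (auto intro!: derivative_eq_intros)
    qed (use z in \<open>auto intro!: borel_measurable_halfline\<close>)
    \<comment> \<open>The derivative of \<open>x powr s * exp (- z x)\<close> integrates to zero,
      which relates the moments with exponents \<open>s\<close> and \<open>s - 1\<close>.\<close>
    moreover have "(LH x. s * (complex_of_real x powr (s - 1) * exp (- (z * of_real x)))
        - z * (complex_of_real x powr s * exp (- (z * of_real x)))) = 0 - 0"
    proof (rule halfline_FTC)
      let ?F = "\<lambda>w. w powr s * exp (- (z * w))"
      show "((\<lambda>x. ?F (of_real x)) has_vector_derivative
          s * (complex_of_real x powr (s - 1) * exp (- (z * of_real x)))
          - z * (complex_of_real x powr s * exp (- (z * of_real x)))) (at x)" if "x > 0" for x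
        using that by (intro has_vector_derivative_real_field)
           (auto intro!: derivative_eq_intros simp: algebra_simps)
      show "((\<lambda>x. ?F (complex_of_real x)) \<longlongrightarrow> 0) (at_right 0)" by (rule powr_exp_at_right_0) fact
      show "((\<lambda>x. ?F (complex_of_real x)) \<longlongrightarrow> 0) at_top" by (rule powr_exp_at_top) fact
      show "integrable halfline (\<lambda>x. s * (complex_of_real x powr (s - 1) * exp (- (z * of_real x)))
        - z * (complex_of_real x powr s * exp (- (z * of_real x))))"
        using integrable_Gamma_halfline[OF s z] integrable_Gamma_halfline[OF _ z, of "s + 1"] s by auto
    qed (auto intro!: continuous_intros)
    hence "s * J z = z * (LH x. complex_of_real x powr s * exp (- (z * of_real x)))"
      unfolding J_def using integrable_Gamma_halfline[OF s z] integrable_Gamma_halfline[OF _ z, of "s + 1"] s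
      by (subst (asm) Bochner_Integration.integral_diff) auto
    moreover have "z \<noteq> 0" using z by auto
    ultimately show ?thesis by (simp add: field_simps)
  qed
  have "\<exists>c. \<forall>w\<in>{w. Re w > 0}. w powr s * J w = c"
  proof (rule has_field_derivative_zero_constant)
    show "convex {w. Re w > 0}" by (rule convex_halfspace_Re_gt)
    fix w assume "w \<in> {w. Re w > 0}"
    hence w: "Re w > 0" "w \<noteq> 0" "w \<notin> \<real>\<^sub>\<le>\<^sub>0" by (auto simp: complex_nonpos_Reals_iff)
    have "((\<lambda>w. w powr s * J w) has_field_derivative 0) (at w)"
      using w by (auto intro!: derivative_eq_intros der simp: powr_diff field_simps)
    thus "((\<lambda>w. w powr s * J w) has_field_derivative 0) (at w within {w. Re w > 0})"
      by (rule has_field_derivative_at_within)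
  qed
  then obtain c where c: "\<And>w. Re w > 0 \<Longrightarrow> w powr s * J w = c" by auto
  have "c = Gamma s" using c[of 1] integral_Gamma_halfline_1[OF s] by (simp add: J_def)
  moreover have "z powr s * z powr (- s) = 1" using z by (auto simp: powr_minus intro!: right_inverse)
  moreover have "J z = (z powr s * J z) * z powr (- s)"
    using calculation(2) by (simp add: mult_ac)
  ultimately have "J z = Gamma s * z powr (- s)" using c[OF z] by simp
  thus ?thesis by (simp only: J_def)
qed

lemma integrable_power_exp_halfline:
  assumes "k > 0"
  shows "integrable halfline (\<lambda>x. x ^ n * exp (- k * x))"
proof -
  have "integrable halfline (\<lambda>x. x powr n * exp (- k * x))"
    using assms by (intro integrable_powr_exp_halfline) auto
  thus ?thesis
    by (rule Bochner_Integration.integrable_cong[THEN iffD1, rotated -1]) (auto simp: powr_realpow)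
qed

lemma integral_power_exp_halfline_complex:
  assumes "Re z > 0"
  shows "integrable halfline (\<lambda>x. of_real x ^ n * exp (- (z * of_real x)))"
    and "(LH x. of_real x ^ n * exp (- (z * of_real x))) = fact n / z ^ Suc n"
proof -
  have eq: "complex_of_real x powr (of_nat (Suc n) - 1) = of_real x ^ n" if "x > 0" for x
    using that by (simp add: powr_nat')
  show "integrable halfline (\<lambda>x. of_real x ^ n * exp (- (z * of_real x)))"
    using integrable_Gamma_halfline[of "of_nat (Suc n)" z] assms eq
    by (subst Bochner_Integration.integrable_cong[where g="\<lambda>x. complex_of_real x powr (of_nat (Suc n) - 1) * exp (- (z * of_real x))"]) auto
  have "z powr (- of_nat (Suc n)) = inverse (z ^ Suc n)"
    using assms by (subst powr_minus, subst powr_nat') auto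
  moreover have "Gamma (of_nat (Suc n) :: complex) = fact n"
    using Gamma_fact[of n] by simp
  ultimately show "(LH x. of_real x ^ n * exp (- (z * of_real x))) = fact n / z ^ Suc n"
    using integral_Gamma_halfline[of "of_nat (Suc n)" z] assms eq
    by (subst Bochner_Integration.integral_cong[OF refl, where g="\<lambda>x. complex_of_real x powr (of_nat (Suc n) - 1) * exp (- (z * of_real x))"])
       (auto simp: divide_inverse)
qed

lemma integral_power_exp_halfline:
  assumes "k > 0"
  shows "(LH x. x ^ n * exp (- k * x)) = fact n / k ^ Suc n"
proof -
  have "complex_of_real (LH x. x ^ n * exp (- k * x)) =
     (LH x. of_real x ^ n * exp (- (of_real k * of_real x)))"
    by (subst integral_complex_of_real[symmetric]) (simp add: exp_of_real[symmetric])
  also have "\<dots> = of_real (fact n / k ^ Suc n)"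
    using assms by (subst integral_power_exp_halfline_complex(2)) auto
  finally show ?thesis unfolding of_real_eq_iff .
qed

lemma halfline_scale:
  fixes f :: "real \<Rightarrow> 'a::{banach, second_countable_topology}"
  assumes "c > 0"
  shows "(LH x. f (c * x)) = (1 / c) *\<^sub>R integral\<^sup>L halfline f"
proof -
  have "integral\<^sup>L halfline f = (\<integral>x. indicator {0<..} x *\<^sub>R f x \<partial>lborel)"
    by (simp add: integral_restrict_space)
  also have "\<dots> = c *\<^sub>R (\<integral>x. indicator {0<..} (0 + c * x) *\<^sub>R f (0 + c * x) \<partial>lborel)"
    using assms lborel_integral_real_affine[of c "\<lambda>x. indicator {0<..} x *\<^sub>R f x" 0] by simp
  also have "(\<lambda>x. indicator {0<..} (0 + c * x) *\<^sub>R f (0 + c * x)) = (\<lambda>x. indicator {0<..} x *\<^sub>R f (c * x))"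
    using assms by (auto simp: indicator_def zero_less_mult_iff fun_eq_iff)
  also have "(\<integral>x. indicator {0<..} x *\<^sub>R f (c * x) \<partial>lborel) = (LH x. f (c * x))"
    by (simp add: integral_restrict_space)
  finally show ?thesis using assms by simp
qed

subsection \<open>Binet's formulas\<close>

text \<open>Logarithmic derivative of Euler's reflection formula for Gamma.\<close>

lemma Digamma_reflection:
  assumes "z \<notin> \<int>"
  shows "Digamma z - Digamma (1 - z) = - complex_of_real pi * cos (of_real pi * z) / sin (of_real pi * z)"
proof -
  have z: "z \<notin> \<int>\<^sub>\<le>\<^sub>0" "1 - z \<notin> \<int>\<^sub>\<le>\<^sub>0"
    using assms nonpos_Ints_Int Ints_diff[of 1 "1 - z"] by auto
  have s: "sin (of_real pi * z) \<noteq> 0"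
    using Gamma_reflection_complex[of z] z by (auto simp: Gamma_eq_zero_iff)
  have "((\<lambda>z. Gamma z * Gamma (1 - z)) has_field_derivative
      Gamma z * Gamma (1 - z) * (Digamma z - Digamma (1 - z))) (at z)"
    using z by (auto intro!: derivative_eq_intros simp: algebra_simps)
  moreover have "((\<lambda>z. Gamma z * Gamma (1 - z)) has_field_derivative
      - (of_real pi * (of_real pi * cos (of_real pi * z)) / (sin (of_real pi * z))\<^sup>2)) (at z)"
    unfolding Gamma_reflection_complex using s
    by (auto intro!: derivative_eq_intros simp: power2_eq_square)
  ultimately have "of_real pi / sin (of_real pi * z) * (Digamma z - Digamma (1 - z)) =
      - (of_real pi * (of_real pi * cos (of_real pi * z)) / (sin (of_real pi * z))\<^sup>2)"
    (is "?P / ?S * ?D = ?R")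
    unfolding Gamma_reflection_complex[symmetric] by (rule DERIV_unique)
  have "?D = (?P / ?S * ?D) * (?S / ?P)" using s by simp
  also have "\<dots> = ?R * (?S / ?P)" unfolding \<open>?P / ?S * ?D = ?R\<close> ..
  also have "\<dots> = - ?P * cos (?P * z) / ?S" using s by (simp add: power2_eq_square)
  finally show ?thesis .
qed

text \<open>Up to the factor 2 pi i, the series is the difference of the Digamma series at 1 + z and
  1 - z with z = i l / (2 pi), which the reflection formula evaluates. The value is coth (l/2) / 2 -
  1 / l.\<close>

lemma coth_partial_fractions:
  assumes l: "l > 0"
  shows "(\<lambda>m. 2 * l / (l\<^sup>2 + (2 * pi * real (Suc m))\<^sup>2)) sums (1 / (1 - exp (- l)) - 1 / 2 - 1 / l)"
proof -
  define y where "y = l / (2 * pi)"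
  define z where "z = \<i> * of_real y"
  have y: "y > 0" using l by (simp add: y_def)
  have zI: "z \<notin> \<int>" using y by (auto simp: z_def elim!: Ints_cases simp: complex_eq_iff)
  have z0: "z \<noteq> 0" using y by (auto simp: z_def)
  have z1: "1 + z \<noteq> 0" "1 - z \<noteq> 0" by (auto simp: z_def complex_eq_iff)
  have s1: "(\<lambda>n. inverse (of_nat (Suc n)) - inverse (w + of_nat n)) sums (Digamma w + euler_mascheroni)"
    if "w \<noteq> 0" for w :: complex
    using summable_sums[OF summable_Digamma[OF that]] by (simp add: Digamma_def)
  have "(\<lambda>n. (inverse (of_nat (Suc n)) - inverse ((1 + z) + of_nat n)) -
             (inverse (of_nat (Suc n)) - inverse ((1 - z) + of_nat n))) sums
        ((Digamma (1 + z) + euler_mascheroni) - (Digamma (1 - z) + euler_mascheroni))"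
    by (intro sums_diff s1 z1)
  moreover have "(inverse (of_nat (Suc n)) - inverse ((1 + z) + of_nat n)) -
             (inverse (of_nat (Suc n)) - inverse ((1 - z) + of_nat n)) =
             2 * pi * \<i> * of_real (2 * l / (l\<^sup>2 + (2 * pi * real (Suc n))\<^sup>2))" (is "?L = ?R") for n
  proof -
    have nz: "1 + z + of_nat n \<noteq> 0" "1 - z + of_nat n \<noteq> 0" using y by (auto simp: z_def complex_eq_iff)
    have "?L = 2 * z / ((1 - z + of_nat n) * (1 + z + of_nat n))"
      using nz by (simp add: field_simps)
    also have "(1 - z + of_nat n) * (1 + z + of_nat n) = of_real ((real (Suc n))\<^sup>2 + y\<^sup>2)"
      by (simp add: z_def algebra_simps power2_eq_square)
    also have "2 * z / of_real ((real (Suc n))\<^sup>2 + y\<^sup>2) = \<i> * of_real (2 * y / ((real (Suc n))\<^sup>2 + y\<^sup>2))"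
      by (simp add: z_def)
    also have "2 * y / ((real (Suc n))\<^sup>2 + y\<^sup>2) = 2 * pi * (2 * l / (l\<^sup>2 + (2 * pi * real (Suc n))\<^sup>2))"
    proof -
      have "0 < (real (Suc n))\<^sup>2 + y\<^sup>2" by (intro add_pos_nonneg) auto
      moreover have "0 < l\<^sup>2 + (2 * pi * real (Suc n))\<^sup>2" using l by (intro add_pos_nonneg) auto
      ultimately show ?thesis unfolding y_def
        by (simp add: divide_simps power_mult_distrib power_divide) (simp add: algebra_simps power2_eq_square)
    qed
    finally show ?thesis by simp
  qed
  ultimately have "(\<lambda>n. 2 * pi * \<i> * of_real (2 * l / (l\<^sup>2 + (2 * pi * real (Suc n))\<^sup>2))) sums
      (Digamma (1 + z) - Digamma (1 - z))" by simp
  also have "Digamma (1 + z) - Digamma (1 - z) = 1 / z + (Digamma z - Digamma (1 - z))"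
    using Digamma_plus1[OF z0] by (simp add: add.commute)
  also have "\<dots> = 1 / z - of_real pi * cos (of_real pi * z) / sin (of_real pi * z)"
    by (subst Digamma_reflection[OF zI]) simp
  also have "\<dots> = 2 * pi * \<i> * of_real (1 / (1 - exp (- l)) - 1 / 2 - 1 / l)"
  proof -
    \<comment> \<open>As \<open>z\<close> is purely imaginary, sine and cosine at
      \<open>pi * z\<close> are rational in \<open>E\<close>.\<close>
    define E where "E = exp (l / 2)"
    have E: "E > 1" using l by (simp add: E_def)
    have piz: "of_real pi * z = \<i> * of_real (l / 2)" by (simp add: z_def y_def)
    have e1: "exp (\<i> * (of_real pi * z)) = of_real (1 / E)"
    proof -
      have "\<i> * (of_real pi * z) = of_real (- (l / 2))" by (simp add: piz)
      moreover have "exp (- (l / 2)) = 1 / E" by (simp add: E_def exp_minus inverse_eq_divide)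
      ultimately show ?thesis using exp_of_real[of "- (l / 2)"] by metis
    qed
    have e2: "exp (- (\<i> * (of_real pi * z))) = of_real E"
    proof -
      have "- (\<i> * (of_real pi * z)) = of_real (l / 2)" by (simp add: piz)
      thus ?thesis using exp_of_real[of "l / 2"] unfolding E_def by metis
    qed
    have s: "sin (of_real pi * z) = of_real (1 / E - E) / (2 * \<i>)"
      by (subst sin_exp_eq) (simp only: e1 e2 of_real_diff)
    have c: "cos (of_real pi * z) = of_real (1 / E + E) / 2"
      by (subst cos_exp_eq) (simp only: e1 e2 of_real_add)
    have q: "1 / E - E \<noteq> 0" using E by (simp add: field_simps) (metis less_1_mult less_irrefl)
    define A where "A = 1 / (1 - exp (- l))"
    have "exp (- l) = 1 / (E * E)"
      by (simp add: E_def mult_exp_exp exp_minus inverse_eq_divide)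
    moreover have "(1 / E + E) / (1 / E - E) = - 2 * (1 / (1 - 1 / (E * E)) - 1 / 2)"
      using E q by (simp add: field_simps)
    ultimately have "(1 / E + E) / (1 / E - E) = - 2 * (A - 1 / 2)"
      by (simp add: A_def)
    moreover have "cos (of_real pi * z) / sin (of_real pi * z) = \<i> * of_real ((1 / E + E) / (1 / E - E))"
      unfolding s c using q by (simp add: field_simps del: of_real_diff of_real_add)
    ultimately have cs: "cos (of_real pi * z) / sin (of_real pi * z) = \<i> * of_real (- 2 * (A - 1 / 2))"
      by (simp only:)
    have "1 / z - of_real pi * cos (of_real pi * z) / sin (of_real pi * z) =
        - \<i> * of_real (2 * pi / l) - of_real pi * (cos (of_real pi * z) / sin (of_real pi * z))"
      using l by (simp add: z_def y_def field_simps)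
    also have "\<dots> = 2 * pi * \<i> * of_real (A - 1 / 2 - 1 / l)"
      unfolding cs by (simp add: algebra_simps)
    finally show ?thesis unfolding A_def .
  qed
  finally show ?thesis
    by (subst (asm) sums_mult_iff, simp, unfold sums_of_real_iff)
qed

abbreviation freq :: "nat \<Rightarrow> real" where
  "freq m \<equiv> 2 * pi * real (Suc m)"

text \<open>This is the kernel (1 / (1 - exp (-l)) - 1/2 - 1/l) / l of Binet's integral, introduced
  through its partial fractions: positivity, boundedness and one summand per frequency are then
  immediate.\<close>

definition binet_kernel :: "real \<Rightarrow> real" where
  "binet_kernel l = (\<Sum>m. 2 / (l\<^sup>2 + (freq m)\<^sup>2))"

lemma sums_inverse_squares_2pi: "(\<lambda>m. 1 / (freq m)\<^sup>2) sums (1 / 24)"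
  using sums_mult[OF inverse_squares_sums, of "1 / (4 * pi\<^sup>2)"]
  by (simp add: power_mult_distrib add.commute)

lemma binet_kernel_term_le: "2 / (l\<^sup>2 + (freq m)\<^sup>2) \<le> 2 * (1 / (freq m)\<^sup>2)"
  by (simp add: frac_le)

lemma summable_binet_kernel: "summable (\<lambda>m. 2 / (l\<^sup>2 + (freq m)\<^sup>2))"
  by (rule summable_comparison_test'[where N=0, OF sums_summable[OF sums_mult[OF sums_inverse_squares_2pi, of 2]]])
     (use binet_kernel_term_le in \<open>auto simp: abs_of_nonneg simp del: power_mult_distrib of_nat_Suc\<close>)

lemma binet_kernel_nonneg: "binet_kernel l \<ge> 0"
  unfolding binet_kernel_def by (intro suminf_nonneg summable_binet_kernel) auto

text \<open>The bound is the value at l = 0, twice 1/24.\<close>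

lemma binet_kernel_le: "binet_kernel l \<le> 1 / 12"
proof -
  have "binet_kernel l \<le> (\<Sum>m. 2 * (1 / (freq m)\<^sup>2))"
    unfolding binet_kernel_def
    by (intro suminf_le binet_kernel_term_le summable_binet_kernel sums_summable[OF sums_mult[OF sums_inverse_squares_2pi]])
  thus ?thesis using sums_unique[OF sums_mult[OF sums_inverse_squares_2pi, of 2]] by simp
qed

lemma binet_kernel_measurable [measurable]: "binet_kernel \<in> borel_measurable borel"
  unfolding binet_kernel_def[abs_def] by measurable

lemma binet_kernel_mult: "l > 0 \<Longrightarrow> l * binet_kernel l = 1 / (1 - exp (- l)) - 1 / 2 - 1 / l"
  using sums_unique[OF coth_partial_fractions, of l] suminf_mult[OF summable_binet_kernel, of l l]
  by (simp add: binet_kernel_def mult_ac)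

text \<open>Binet's integral for log Lambda on the right half-plane; the identification with
  \<open>ln_Lambda\<close> is \<open>binet_eq\<close>.\<close>

definition binet :: "complex \<Rightarrow> complex" where
  "binet x = (LH l. of_real (binet_kernel l) * exp (- (x * of_real l)))"

lemma integrable_binet:
  assumes "Re x > 0"
  shows "integrable halfline (\<lambda>l. of_real (l ^ n * binet_kernel l) * exp (- (x * of_real l)))"
proof (rule integrable_halfline_bound)
  show "integrable halfline (\<lambda>l. l ^ n * exp (- Re x * l))"
    using assms by (rule integrable_power_exp_halfline)
  fix l :: real assume "l > 0"
  thus "norm (of_real (l ^ n * binet_kernel l) * exp (- (x * of_real l))) \<le> l ^ n * exp (- Re x * l)"
    using binet_kernel_nonneg[of l] binet_kernel_le[of l]
    by (auto simp: norm_mult norm_power mult_left_le mult.assoc abs_mult intro!: mult_left_mono mult_left_le_one_le)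
qed (rule borel_measurable_halfline, measurable)

lemma binet_moment_derivative:
  assumes "Re x > 0"
  shows "((\<lambda>x. LH l. of_real (l ^ n * binet_kernel l) * exp (- (x * of_real l))) has_field_derivative
     - (LH l. of_real (l ^ Suc n * binet_kernel l) * exp (- (x * of_real l)))) (at x)"
proof -
  have "((\<lambda>x. LH l. of_real (l ^ n * binet_kernel l) * exp (- (x * of_real l))) has_field_derivative
     (LH l. - (of_real (l ^ Suc n * binet_kernel l) * exp (- (x * of_real l))))) (at x)"
  proof (rule integral_parameter_derivative(2)[where S="{w. Re w > Re x / 2}"
        and f'="\<lambda>w l. - (of_real (l ^ Suc n * binet_kernel l) * exp (- (w * of_real l)))"])
    show "open {w. Re w > Re x / 2}" by (rule open_halfspace_Re_gt)
    show "integrable halfline (\<lambda>l. l ^ n * exp (- (Re x / 2) * l))"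
      using assms by (intro integrable_power_exp_halfline) auto
    fix w l assume w: "w \<in> {w. Re x / 2 < Re w}" and l: "l \<in> space halfline"
    show "norm (of_real (l ^ n * binet_kernel l) * exp (- (w * of_real l))) \<le> l ^ n * exp (- (Re x / 2) * l)"
    proof -
      have "l ^ n * binet_kernel l * exp (- (Re w * l)) \<le> l ^ n * 1 * exp (- (Re x / 2) * l)"
        using w l binet_kernel_nonneg[of l] binet_kernel_le[of l] by (intro mult_mono) auto
      thus ?thesis using l binet_kernel_nonneg[of l]
        by (simp add: norm_mult norm_power abs_mult)
    qed
    show "((\<lambda>w. of_real (l ^ n * binet_kernel l) * exp (- (w * of_real l))) has_field_derivative
          - (of_real (l ^ Suc n * binet_kernel l) * exp (- (w * of_real l)))) (at w)"
      by (auto intro!: derivative_eq_intros)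
  qed (use assms in \<open>auto intro!: borel_measurable_halfline\<close>)
  thus ?thesis by simp
qed

text \<open>Polygamma 1 x is the sum of 1 / (x + n)^2, hence the Laplace transform of l / (1 - exp
  (-l)). Subtracting the elementary parts 1 and l/2 of that function leaves l^2 times the Binet
  kernel. The second moment is the second derivative of \<open>binet\<close>.\<close>

lemma binet_second_moment:
  assumes x: "Re x > 0"
  shows "(LH l. of_real (l ^ 2 * binet_kernel l) * exp (- (x * of_real l))) =
         Polygamma 1 x - 1 / x - 1 / (2 * x\<^sup>2)"
proof -
  let ?e = "\<lambda>l. exp (- (x * complex_of_real l))"
  let ?f = "\<lambda>n l. complex_of_real l * exp (- ((x + of_nat n) * of_real l))"
  have sums: "(\<lambda>n. integral\<^sup>L halfline (?f n)) sums (LH l. (\<Sum>n. ?f n l))"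
    and int: "integrable halfline (\<lambda>l. \<Sum>n. ?f n l)"
  proof -
    have i: "integrable halfline (?f n)" for n
      using integral_power_exp_halfline_complex(1)[of "x + of_nat n" 1] x by simp
    have nrm: "norm (?f n l) = l ^ 1 * exp (- (Re x + real n) * l)" if "l > 0" for n l
      using that by (simp add: norm_mult algebra_simps)
    have "AE l in halfline. summable (\<lambda>n. norm (?f n l))"
    proof (rule AE_I2)
      fix l assume "l \<in> space halfline"
      hence l: "l > 0" by simp
      have "norm (?f n l) = (l * exp (- Re x * l)) * exp (- l) ^ n" for n
        unfolding nrm[OF l] by (simp add: exp_of_nat_mult[symmetric] exp_add[symmetric] algebra_simps)
      thus "summable (\<lambda>n. norm (?f n l))" using l by (auto intro!: summable_mult summable_geometric)
    qed
    moreover have "summable (\<lambda>n. LH l. norm (?f n l))"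
    proof -
      have "(LH l. norm (?f n l)) = 1 / (Re x + real n)\<^sup>2" for n
        using integral_power_exp_halfline[of "Re x + real n" 1] x nrm
        by (subst Bochner_Integration.integral_cong[OF refl, where g="\<lambda>l. l ^ 1 * exp (- (Re x + real n) * l)"])
           (auto simp: power2_eq_square)
      moreover have "summable (\<lambda>n. 1 / (Re x + real n)\<^sup>2)"
        using Polygamma_converges'[of "Re x" 2] x by (simp add: inverse_eq_divide)
      ultimately show ?thesis by simp
    qed
    ultimately show "(\<lambda>n. integral\<^sup>L halfline (?f n)) sums (LH l. (\<Sum>n. ?f n l))"
      and "integrable halfline (\<lambda>l. \<Sum>n. ?f n l)"
      using i by (auto intro!: sums_integral integrable_suminf)
  qed
  have val: "(\<Sum>n. ?f n l) = of_real (l / (1 - exp (- l))) * ?e l" if l: "l > 0" for l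
  proof -
    have "?f n l = (of_real l * ?e l) * of_real (exp (- l)) ^ n" for n
      by (simp add: exp_of_nat_mult[symmetric] exp_add[symmetric] algebra_simps exp_of_real[symmetric])
    moreover have "(\<lambda>n. complex_of_real (exp (- l)) ^ n) sums (1 / (1 - of_real (exp (- l))))"
      using l by (intro geometric_sums) (simp only: norm_of_real, simp)
    ultimately have "(\<lambda>n. ?f n l) sums ((of_real l * ?e l) * (1 / (1 - of_real (exp (- l)))))"
      by (simp only: sums_mult)
    thus ?thesis by (simp add: sums_iff)
  qed
  have "(LH l. (\<Sum>n. ?f n l)) =
      (LH l. of_real (l ^ 2 * binet_kernel l) * ?e l + of_real l * ?e l / 2 + ?e l)"
  proof (rule Bochner_Integration.integral_cong[OF refl])
    fix l assume "l \<in> space halfline"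
    hence l: "l > 0" by simp
    have "l / (1 - exp (- l)) = l ^ 2 * binet_kernel l + l / 2 + 1"
    proof -
      have "1 / (1 - exp (- l)) = l * binet_kernel l + 1 / 2 + 1 / l"
        using binet_kernel_mult[OF l] by simp
      hence "l * (1 / (1 - exp (- l))) = l * (l * binet_kernel l + 1 / 2 + 1 / l)" by simp
      thus ?thesis using l by (simp add: distrib_left power2_eq_square)
    qed
    thus "(\<Sum>n. ?f n l) = of_real (l ^ 2 * binet_kernel l) * ?e l + of_real l * ?e l / 2 + ?e l"
      unfolding val[OF l] by (simp add: algebra_simps)
  qed
  also have "\<dots> = (LH l. of_real (l ^ 2 * binet_kernel l) * ?e l) + 1 / x\<^sup>2 / 2 + 1 / x"
    using integral_power_exp_halfline_complex[OF x, of 0] integral_power_exp_halfline_complex[OF x, of 1]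
      integrable_binet[OF x, of 2] by (simp add: power2_eq_square)
  finally have A: "(LH l. (\<Sum>n. ?f n l)) =
      (LH l. of_real (l ^ 2 * binet_kernel l) * ?e l) + 1 / x\<^sup>2 / 2 + 1 / x" .
  have "(LH l. ?f n l) = inverse ((x + of_nat n)\<^sup>2)" for n
    using integral_power_exp_halfline_complex(2)[of "x + of_nat n" 1] x by (simp add: power2_eq_square inverse_eq_divide)
  hence "(\<Sum>n. inverse ((x + of_nat n)\<^sup>2)) = (LH l. (\<Sum>n. ?f n l))"
    using sums by (simp add: sums_iff)
  hence "Polygamma 1 x = (LH l. (\<Sum>n. ?f n l))"
    by (simp add: Polygamma_def numeral_2_eq_2)
  thus ?thesis using A by simp
qed

text \<open>The denominator is itself a Laplace integral in u, and exp (- k u) makes the double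
  integral absolutely convergent for any integrable \<phi>.\<close>

lemma halfline_Fubini_exp:
  fixes \<phi> :: "real \<Rightarrow> complex" and e k :: real
  assumes \<phi>: "integrable halfline \<phi>" and k: "k > 0"
  shows "(LH l. \<phi> l / (of_real k - \<i> * of_real (e * l))) =
    (LH u. exp (- of_real (k * u)) * (LH l. \<phi> l * exp (\<i> * of_real (e * l * u))))"
proof -
  interpret P: pair_sigma_finite halfline halfline by (rule pair_sigma_finite_halfline)
  define f where "f l u = \<phi> l * exp (- ((of_real k - \<i> * of_real (e * l)) * of_real u))" for l u
  have nf: "norm (f l u) = norm (\<phi> l) * exp (- k * u)" for l u
    by (simp add: f_def norm_mult)
  have [measurable]: "\<phi> \<in> borel_measurable halfline" using \<phi> by simp
  have [measurable]: "(\<lambda>x::real. x) \<in> borel_measurable halfline"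
    by (rule borel_measurable_halfline) simp
  have m: "case_prod f \<in> borel_measurable (halfline \<Otimes>\<^sub>M halfline)"
    unfolding f_def by measurable
  have "integrable (halfline \<Otimes>\<^sub>M halfline) (case_prod f)"
  proof (rule P.Fubini_integrable[OF m])
    have "(LH u. norm (f l u)) = norm (\<phi> l) * (1 / k)" for l
      unfolding nf using integral_power_exp_halfline[OF k, of 0] by simp
    thus "integrable halfline (\<lambda>x. LH y. norm (case (x, y) of (l, u) \<Rightarrow> f l u))"
      using \<phi> by (simp add: integrable_norm)
    show "AE x in halfline. integrable halfline (\<lambda>y. case (x, y) of (l, u) \<Rightarrow> f l u)"
    proof (rule AE_I2)
      fix l
      have "integrable halfline (f l)"
        unfolding f_def using integral_power_exp_halfline_complex(1)[of "of_real k - \<i> * of_real (e * l)" 0] k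
        by (intro integrable_mult_right) simp
      thus "integrable halfline (\<lambda>y. case (l, y) of (l, u) \<Rightarrow> f l u)" by simp
    qed
  qed
  hence sw: "(LH u. (LH l. f l u)) = (LH l. (LH u. f l u))"
    by (rule P.Fubini_integral)
  have "(LH u. f l u) = \<phi> l / (of_real k - \<i> * of_real (e * l))" for l
    unfolding f_def using integral_power_exp_halfline_complex(2)[of "of_real k - \<i> * of_real (e * l)" 0] k by simp
  moreover have "(LH l. f l u) = exp (- of_real (k * u)) * (LH l. \<phi> l * exp (\<i> * of_real (e * l * u)))" for u
  proof -
    have "f l u = exp (- of_real (k * u)) * (\<phi> l * exp (\<i> * of_real (e * l * u)))" for l
      by (simp add: f_def algebra_simps mult_exp_exp)
    thus ?thesis by simp
  qed
  ultimately show ?thesis using sw by simp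
qed

lemma laplace_exchange:
  assumes x: "Re x > 0" and k: "k > 0"
  shows "(LH l. exp (- (x * of_real l)) / (of_real k - \<i> * of_real (e * l))) =
    (LH u. exp (- of_real (k * u)) / (x - \<i> * of_real (e * u)))"
proof -
  have "(LH l. exp (- (x * of_real l)) * exp (\<i> * of_real (e * l * u))) = 1 / (x - \<i> * of_real (e * u))" for u
    using integral_power_exp_halfline_complex(2)[of "x - \<i> * of_real (e * u)" 0] x
    by (simp add: mult_exp_exp algebra_simps)
  moreover have "integrable halfline (\<lambda>l. exp (- (x * of_real l)))"
    using integral_power_exp_halfline_complex(1)[OF x, of 0] by simp
  ultimately show ?thesis using halfline_Fubini_exp[OF _ k, of "\<lambda>l. exp (- (x * of_real l))" e] by simp
qed

lemma integrable_exp_over_linear: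
  assumes x: "Re x > 0" and k: "Re k > 0"
  shows "integrable halfline (\<lambda>l. exp (- (x * of_real l)) / (k - \<i> * of_real (e * l)))"
proof (rule integrable_halfline_bound)
  show "integrable halfline (\<lambda>l. (1 / Re k) * (l ^ 0 * exp (- Re x * l)))"
    by (rule integrable_mult_right, rule integrable_power_exp_halfline[OF x])
  show "(\<lambda>l. exp (- (x * of_real l)) / (k - \<i> * of_real (e * l))) \<in> borel_measurable halfline"
    by (rule borel_measurable_halfline) measurable
  fix l :: real assume l: "l > 0"
  have "Re k \<le> norm (k - \<i> * of_real (e * l))"
    using complex_Re_le_cmod[of "k - \<i> * of_real (e * l)"] by simp
  hence "1 / norm (k - \<i> * of_real (e * l)) \<le> 1 / Re k" using k by (intro divide_left_mono mult_pos_pos) auto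
  hence "exp (- Re x * l) * (1 / norm (k - \<i> * of_real (e * l))) \<le> exp (- Re x * l) * (1 / Re k)"
    by (intro mult_left_mono) auto
  thus "norm (exp (- (x * of_real l)) / (k - \<i> * of_real (e * l))) \<le> (1 / Re k) * (l ^ 0 * exp (- Re x * l))"
    by (simp add: norm_divide)
qed

text \<open>The even and odd parts of the exchange identity in its sign \<open>e\<close>, from e = 1
  and e = -1. They trade one frequency term of the Binet kernel for an integral weighted by exp (- k
  u).\<close>

lemma laplace_exchange_cos:
  assumes x: "Re x > 0" and k: "k > 0"
  shows "(LH l. of_real (k / (l\<^sup>2 + k\<^sup>2)) * exp (- (x * of_real l))) =
    (LH u. of_real (exp (- k * u)) * (x / (x\<^sup>2 + of_real u ^ 2)))" (is ?th1)
    and "(LH l. of_real (l / (l\<^sup>2 + k\<^sup>2)) * exp (- (x * of_real l))) =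
    (LH u. of_real (exp (- k * u)) * (of_real u / (x\<^sup>2 + of_real u ^ 2)))" (is ?th2)
proof -
  define A where "A e l = exp (- (x * of_real l)) / (of_real k - \<i> * of_real (e * l))" for e l :: real
  define B where "B e u = exp (- of_real (k * u)) / (x - \<i> * of_real (e * u))" for e u :: real
  have iA: "integrable halfline (A e)" for e
    unfolding A_def using integrable_exp_over_linear[OF x, of "of_real k" e] k by simp
  have iB: "integrable halfline (B e)" for e
    unfolding B_def using integrable_exp_over_linear[of "of_real k" x e] x k by simp
  have AB: "integral\<^sup>L halfline (A e) = integral\<^sup>L halfline (B e)" for e
    unfolding A_def B_def by (rule laplace_exchange[OF x k])
  have nzk: "of_real k - \<i> * of_real l \<noteq> 0" "of_real k + \<i> * of_real l \<noteq> 0" for l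
    using k by (auto simp: complex_eq_iff)
  have nzx: "x - \<i> * of_real l \<noteq> 0" "x + \<i> * of_real l \<noteq> 0" for l
    using x by (auto simp: complex_eq_iff)
  have pk: "(of_real k - \<i> * of_real l) * (of_real k + \<i> * of_real l) = of_real (l\<^sup>2 + k\<^sup>2)" for l
    by (simp add: algebra_simps power2_eq_square)
  have px: "(x - \<i> * of_real l) * (x + \<i> * of_real l) = x\<^sup>2 + of_real l ^ 2" for l
    by (simp add: algebra_simps power2_eq_square)
  have half: "(a * (2 * b) / N) / 2 = a * (b / N)" "(a * (2 * \<i> * b) / N) / (2 * \<i>) = a * (b / N)" for a b N :: complex
  proof -
    have "a * (2 * \<i> * b) / N = (2 * \<i>) * (a * (b / N))" by (simp only: times_divide_eq_right mult_ac)
    thus "(a * (2 * \<i> * b) / N) / (2 * \<i>) = a * (b / N)"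
      by (simp only:) (rule nonzero_mult_div_cancel_left, simp)
  qed simp
  have eu: "complex_of_real (exp (- k * u)) = exp (- of_real (k * u))" for u
    using exp_of_real[of "- k * u", where 'a=complex] by simp
  have A1: "of_real (k / (l\<^sup>2 + k\<^sup>2)) * exp (- (x * of_real l)) = (A 1 l + A (-1) l) / 2" for l
  proof -
    have "A 1 l + A (-1) l = exp (- (x * of_real l)) * (2 * of_real k) / ((of_real k - \<i> * of_real l) * (of_real k + \<i> * of_real l))"
      using nzk[of l] by (simp add: A_def field_simps)
    thus ?thesis unfolding pk by (simp only: half of_real_divide) (rule mult.commute)
  qed
  have A2: "of_real (l / (l\<^sup>2 + k\<^sup>2)) * exp (- (x * of_real l)) = (A 1 l - A (-1) l) / (2 * \<i>)" for l
  proof -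
    have "A 1 l - A (-1) l = exp (- (x * of_real l)) * (2 * \<i> * of_real l) / ((of_real k - \<i> * of_real l) * (of_real k + \<i> * of_real l))"
      using nzk[of l] by (simp add: A_def field_simps)
    thus ?thesis unfolding pk by (simp only: half of_real_divide) (rule mult.commute)
  qed
  have B1: "of_real (exp (- k * u)) * (x / (x\<^sup>2 + of_real u ^ 2)) = (B 1 u + B (-1) u) / 2" for u
  proof -
    have "B 1 u + B (-1) u = exp (- of_real (k * u)) * (2 * x) / ((x - \<i> * of_real u) * (x + \<i> * of_real u))"
      using nzx[of u] by (simp add: B_def field_simps)
    thus ?thesis unfolding px by (simp only: half eu)
  qed
  have B2: "of_real (exp (- k * u)) * (of_real u / (x\<^sup>2 + of_real u ^ 2)) = (B 1 u - B (-1) u) / (2 * \<i>)" for u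
  proof -
    have "B 1 u - B (-1) u = exp (- of_real (k * u)) * (2 * \<i> * of_real u) / ((x - \<i> * of_real u) * (x + \<i> * of_real u))"
      using nzx[of u] by (simp add: B_def field_simps)
    thus ?thesis unfolding px by (simp only: half eu)
  qed
  show ?th1 unfolding A1 B1 using iA iB AB by simp
  show ?th2 unfolding A2 B2 using iA iB AB by simp
qed

text \<open>Termwise integration; the summands of the kernel are dominated by 2 / freq^2 uniformly
  in l.\<close>

lemma binet_moment_sums:
  assumes x: "Re x > 0"
  shows "(\<lambda>m. LH l. of_real (l ^ n * (2 / (l\<^sup>2 + (freq m)\<^sup>2))) * exp (- (x * of_real l)))
     sums (LH l. of_real (l ^ n * binet_kernel l) * exp (- (x * of_real l)))"
proof -
  define f where "f m l = complex_of_real (l ^ n * (2 / (l\<^sup>2 + (freq m)\<^sup>2))) * exp (- (x * of_real l))" for m l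
  define c where "c m = 2 * (1 / (freq m)\<^sup>2)" for m
  have sc: "summable c" unfolding c_def by (rule sums_summable[OF sums_mult[OF sums_inverse_squares_2pi]])
  have nf: "norm (f m l) \<le> c m * (l ^ n * exp (- Re x * l))" if "l > 0" for m l
  proof -
    have "norm (f m l) = (2 / (l\<^sup>2 + (freq m)\<^sup>2)) * (l ^ n * exp (- Re x * l))"
      using that by (simp only: f_def norm_mult norm_of_real norm_exp_eq_Re) (simp add: abs_mult)
    thus ?thesis using binet_kernel_term_le[of l m] that unfolding c_def
      by (simp only:) (intro mult_right_mono, auto)
  qed
  have i0: "integrable halfline (\<lambda>l. l ^ n * exp (- Re x * l))" using x by (rule integrable_power_exp_halfline)
  have fi: "integrable halfline (f m)" for m
  proof (rule integrable_halfline_bound)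
    show "integrable halfline (\<lambda>l. c m * (l ^ n * exp (- Re x * l)))" using i0 by (rule integrable_mult_right)
    show "f m \<in> borel_measurable halfline"
      unfolding f_def by (rule borel_measurable_halfline) measurable
  qed (rule nf)
  have "(\<lambda>m. integral\<^sup>L halfline (f m)) sums (LH l. (\<Sum>m. f m l))"
  proof (rule sums_integral[OF fi])
    show "AE l in halfline. summable (\<lambda>m. norm (f m l))"
    proof (rule AE_I2)
      fix l assume "l \<in> space halfline"
      hence "l > 0" by simp
      thus "summable (\<lambda>m. norm (f m l))"
        using nf by (intro summable_comparison_test'[OF summable_mult2[OF sc, of "l ^ n * exp (- Re x * l)"], of 0]) auto
    qed
    show "summable (\<lambda>m. LH l. norm (f m l))"
    proof (rule summable_comparison_test'[where N=0])
      show "summable (\<lambda>m. c m * (LH l. l ^ n * exp (- Re x * l)))" by (rule summable_mult2[OF sc])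
      fix m
      have "(LH l. norm (f m l)) \<le> (LH l. c m * (l ^ n * exp (- Re x * l)))"
        using fi i0 nf by (intro integral_mono integrable_mult_right integrable_norm) auto
      moreover have "(LH l. norm (f m l)) \<ge> 0" by (rule Bochner_Integration.integral_nonneg) simp
      ultimately show "norm (LH l. norm (f m l)) \<le> c m * (LH l. l ^ n * exp (- Re x * l))"
        using i0 by simp
    qed
  qed
  moreover have "(\<Sum>m. f m l) = of_real (l ^ n * binet_kernel l) * exp (- (x * of_real l))" for l
  proof -
    have "(\<lambda>m. l ^ n * (2 / (l\<^sup>2 + (freq m)\<^sup>2))) sums (l ^ n * binet_kernel l)"
      unfolding binet_kernel_def by (intro sums_mult summable_sums summable_binet_kernel)
    hence "(\<lambda>m. f m l) sums (of_real (l ^ n * binet_kernel l) * exp (- (x * of_real l)))"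
      unfolding f_def by (intro sums_mult2 sums_of_real)
    thus ?thesis by (simp add: sums_iff)
  qed
  ultimately show ?thesis unfolding f_def by simp
qed

text \<open>The weight 1 / (pi m) arises as 2 / k for k = 2 pi m. Up to constants it is the weight 1
  / m in the exponent built from the oscillators.\<close>

lemma binet_sums_cos:
  assumes x: "Re x > 0"
  shows "(\<lambda>m. of_real (1 / (pi * real (Suc m))) *
     (LH u. of_real (exp (- freq m * u)) * (x / (x\<^sup>2 + of_real u ^ 2)))) sums binet x"
proof -
  have "(LH l. of_real (2 / (l\<^sup>2 + (freq m)\<^sup>2)) * exp (- (x * of_real l))) =
    of_real (1 / (pi * real (Suc m))) *
     (LH u. of_real (exp (- freq m * u)) * (x / (x\<^sup>2 + of_real u ^ 2)))" for m
  proof -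
    define k where "k = 2 * pi * real (Suc m)"
    have k: "k > 0" by (simp add: k_def)
    have "complex_of_real (2 / (l\<^sup>2 + k\<^sup>2)) * exp (- (x * of_real l)) =
      of_real (2 / k) * (of_real (k / (l\<^sup>2 + k\<^sup>2)) * exp (- (x * of_real l)))" for l
      using k by simp
    hence "(LH l. of_real (2 / (l\<^sup>2 + k\<^sup>2)) * exp (- (x * of_real l))) =
      of_real (2 / k) * (LH l. of_real (k / (l\<^sup>2 + k\<^sup>2)) * exp (- (x * of_real l)))"
      by (simp only: integral_mult_right_zero)
    also have "2 / k = 1 / (pi * real (Suc m))" by (simp add: k_def)
    finally show ?thesis unfolding laplace_exchange_cos(1)[OF x k] unfolding k_def .
  qed
  thus ?thesis using binet_moment_sums[OF x, of 0] by (simp add: binet_def)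
qed

lemma binet_deriv:
  assumes x: "Re x > 0"
  shows "(binet has_field_derivative - (LH l. of_real (l * binet_kernel l) * exp (- (x * of_real l)))) (at x)"
  using binet_moment_derivative[OF x, of 0] by (simp add: binet_def[abs_def])

text \<open>By \<open>binet_deriv\<close> the sum is minus the derivative of \<open>binet\<close>.
  This is the series that appears when the tau integral is differentiated in x.\<close>

lemma binet_sums_sin:
  assumes x: "Re x > 0"
  shows "(\<lambda>m. 2 * (LH u. of_real (exp (- freq m * u)) * (of_real u / (x\<^sup>2 + of_real u ^ 2))))
    sums (LH l. of_real (l * binet_kernel l) * exp (- (x * of_real l)))"
proof -
  have "(LH l. of_real (l * (2 / (l\<^sup>2 + (freq m)\<^sup>2))) * exp (- (x * of_real l))) =
     2 * (LH u. of_real (exp (- freq m * u)) * (of_real u / (x\<^sup>2 + of_real u ^ 2)))" for m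
  proof -
    have "complex_of_real (l * (2 / (l\<^sup>2 + (freq m)\<^sup>2))) * exp (- (x * of_real l)) =
      2 * (of_real (l / (l\<^sup>2 + (freq m)\<^sup>2)) * exp (- (x * of_real l)))" for l
      by simp
    thus ?thesis
      using laplace_exchange_cos(2)[OF x, of "2 * pi * real (Suc m)"]
      by (simp only: integral_mult_right_zero) simp
  qed
  thus ?thesis using binet_moment_sums[OF x, of 1] by simp
qed

text \<open>Integration by parts gives x I = h 0 - D, with D the Laplace transform of d = - h'. As d
  is nonnegative, the norm of D is at most its value at Re x, and the same identity at the real
  point Re x bounds that by h 0 = 2 / k^2. The estimate does not involve Re x, so it survives up to
  the imaginary axis.\<close>

lemma laplace_lorentzian_bound:
  assumes x: "Re x > 0" and k: "k > 0"
  shows "norm (LH l. of_real (2 / (l\<^sup>2 + k\<^sup>2)) * exp (- (x * of_real l))) \<le> 4 / (k\<^sup>2 * norm x)"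
proof -
  define h where "h l = 2 / (l\<^sup>2 + k\<^sup>2)" for l
  define d where "d l = 4 * l / (l\<^sup>2 + k\<^sup>2)\<^sup>2" for l
  have pos: "l\<^sup>2 + k\<^sup>2 > 0" for l using k by (simp add: add_nonneg_pos)
  have h: "0 \<le> h l" "h l \<le> 2 / k\<^sup>2" for l
    using k pos by (auto simp: h_def intro!: divide_left_mono mult_pos_pos)
  have d: "0 \<le> d l" "d l \<le> (4 / k ^ 4) * l" if "l > 0" for l
  proof -
    show "0 \<le> d l" using that by (simp add: d_def)
    have "k ^ 4 = (k\<^sup>2)\<^sup>2" by simp
    also have "\<dots> \<le> (l\<^sup>2 + k\<^sup>2)\<^sup>2" by (intro power_mono) auto
    finally have "4 * l / (l\<^sup>2 + k\<^sup>2)\<^sup>2 \<le> 4 * l / k ^ 4"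
      using that k pos by (intro divide_left_mono mult_pos_pos zero_less_power) auto
    thus "d l \<le> (4 / k ^ 4) * l" by (simp add: d_def)
  qed
  have hd: "(h has_real_derivative - d l) (at l)" for l
    unfolding h_def[abs_def] d_def using pos[of l]
    by (auto intro!: derivative_eq_intros simp: power2_eq_square)
  have ch: "continuous_on {0<..} h" unfolding h_def[abs_def] using pos by (intro continuous_intros) (metis less_irrefl)
  have cd: "continuous_on {0<..} d" unfolding d_def[abs_def] using pos by (intro continuous_intros) (metis less_irrefl power_eq_0_iff)
  have ih: "integrable halfline (\<lambda>l. of_real (h l) * exp (- (z * of_real l)))" if z: "Re z > 0" for z :: complex
  proof (rule integrable_halfline_bound)
    show "integrable halfline (\<lambda>l. (2 / k\<^sup>2) * (l ^ 0 * exp (- Re z * l)))"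
      by (rule integrable_mult_right, rule integrable_power_exp_halfline[OF z])
    show "(\<lambda>l. of_real (h l) * exp (- (z * of_real l))) \<in> borel_measurable halfline"
      by (rule borel_measurable_continuous_halfline) (intro continuous_intros ch)
    fix l :: real
    have "h l * exp (- Re z * l) \<le> (2 / k\<^sup>2) * exp (- Re z * l)"
      using h by (intro mult_right_mono) auto
    thus "norm (of_real (h l) * exp (- (z * of_real l))) \<le> (2 / k\<^sup>2) * (l ^ 0 * exp (- Re z * l))"
      using h[of l] by (simp add: norm_mult)
  qed
  have idd: "integrable halfline (\<lambda>l. of_real (d l) * exp (- (z * of_real l)))" if z: "Re z > 0" for z :: complex
  proof (rule integrable_halfline_bound)
    show "integrable halfline (\<lambda>l. (4 / k ^ 4) * (l ^ 1 * exp (- Re z * l)))"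
      by (rule integrable_mult_right, rule integrable_power_exp_halfline[OF z])
    show "(\<lambda>l. of_real (d l) * exp (- (z * of_real l))) \<in> borel_measurable halfline"
      by (rule borel_measurable_continuous_halfline) (intro continuous_intros cd)
    fix l :: real assume "l > 0"
    hence "d l * exp (- Re z * l) \<le> (4 / k ^ 4) * l * exp (- Re z * l)"
      using d[of l] by (intro mult_right_mono) auto
    thus "norm (of_real (d l) * exp (- (z * of_real l))) \<le> (4 / k ^ 4) * (l ^ 1 * exp (- Re z * l))"
      using d[OF \<open>l > 0\<close>] by (simp add: norm_mult)
  qed
  have main: "z * (LH l. of_real (h l) * exp (- (z * of_real l))) +
      (LH l. of_real (d l) * exp (- (z * of_real l))) = of_real (2 / k\<^sup>2)" if z: "Re z > 0" for z
  proof -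
    have "(LH l. z * (of_real (h l) * exp (- (z * of_real l))) + of_real (d l) * exp (- (z * of_real l))) =
      0 - (- of_real (2 / k\<^sup>2))"
    proof (rule halfline_FTC)
      fix l :: real assume "l > 0"
      have "((\<lambda>l. complex_of_real (h l)) has_vector_derivative of_real (- d l)) (at l)"
        using has_vector_derivative_of_real[OF hd[of l]] by simp
      moreover have "((\<lambda>l. exp (- (z * complex_of_real l))) has_vector_derivative - z * exp (- (z * complex_of_real l))) (at l)"
        by (intro has_vector_derivative_real_field) (auto intro!: derivative_eq_intros)
      ultimately have "((\<lambda>l. of_real (h l) * exp (- (z * of_real l))) has_vector_derivative
         (of_real (h l) * (- z * exp (- (z * complex_of_real l))) + of_real (- d l) * exp (- (z * of_real l)))) (at l)"
        by (rule has_vector_derivative_mult)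
      hence "((\<lambda>l. - (of_real (h l) * exp (- (z * of_real l)))) has_vector_derivative
         - (of_real (h l) * (- z * exp (- (z * complex_of_real l))) + of_real (- d l) * exp (- (z * of_real l)))) (at l)"
        by (rule has_vector_derivative_minus)
      thus "((\<lambda>l. - (of_real (h l) * exp (- (z * of_real l)))) has_vector_derivative
         z * (of_real (h l) * exp (- (z * of_real l))) + of_real (d l) * exp (- (z * of_real l))) (at l)"
        by (simp add: algebra_simps)
    next
      show "continuous_on {0<..} (\<lambda>l. z * (of_real (h l) * exp (- (z * of_real l))) + of_real (d l) * exp (- (z * of_real l)))"
        by (intro continuous_intros ch cd)
      show "integrable halfline (\<lambda>l. z * (of_real (h l) * exp (- (z * of_real l))) + of_real (d l) * exp (- (z * of_real l)))"
        using ih[OF z] idd[OF z] by auto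
      have "isCont (\<lambda>l. - (of_real (h l) * exp (- (z * of_real l)))) 0"
        unfolding h_def using pos[of 0] k by (intro continuous_intros) auto
      hence "((\<lambda>l. - (of_real (h l) * exp (- (z * of_real l)))) \<longlongrightarrow> - of_real (2 / k\<^sup>2)) (at 0)"
        unfolding isCont_def by (simp add: h_def)
      thus "((\<lambda>l. - (of_real (h l) * exp (- (z * of_real l)))) \<longlongrightarrow> - of_real (2 / k\<^sup>2)) (at_right 0)"
        by (rule filterlim_mono) (auto simp: at_within_le_at)
      have "((\<lambda>l. of_real (h l) * exp (- (z * of_real l))) \<longlongrightarrow> 0) at_top"
      proof (rule Lim_null_comparison)
        show "\<forall>\<^sub>F l in at_top. norm (of_real (h l) * exp (- (z * of_real l))) \<le> (2 / k\<^sup>2) * exp (- Re z * l)"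
        proof (intro always_eventually allI)
          fix l
          have "h l * exp (- Re z * l) \<le> (2 / k\<^sup>2) * exp (- Re z * l)"
            using h by (intro mult_right_mono) auto
          thus "norm (of_real (h l) * exp (- (z * of_real l))) \<le> (2 / k\<^sup>2) * exp (- Re z * l)"
            using h[of l] by (simp add: norm_mult)
        qed
        define a c where "a = Re z" and "c = 2 / k\<^sup>2"
        have "a > 0" using z by (simp add: a_def)
        hence "((\<lambda>l. c * exp (- a * l)) \<longlongrightarrow> 0) at_top" by real_asymp
        thus "((\<lambda>l. (2 / k\<^sup>2) * exp (- Re z * l)) \<longlongrightarrow> 0) at_top" by (simp add: a_def c_def)
      qed
      thus "((\<lambda>l. - (of_real (h l) * exp (- (z * of_real l)))) \<longlongrightarrow> 0) at_top"
        using tendsto_minus by fastforce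
    qed
    thus ?thesis using ih[OF z] idd[OF z] by simp
  qed
  define a where "a = Re x"
  have a: "a > 0" using x by (simp add: a_def)
  have nonneg: "(LH l. h l * exp (- a * l)) \<ge> 0"
    using h by (intro Bochner_Integration.integral_nonneg) auto
  have cr: "(LH l. of_real (g l) * exp (- (of_real a * of_real l))) = complex_of_real (LH l. g l * exp (- a * l))" for g
    by (subst integral_complex_of_real[symmetric]) (simp flip: exp_of_real)
  have "complex_of_real (a * (LH l. h l * exp (- a * l)) + (LH l. d l * exp (- a * l))) = of_real (2 / k\<^sup>2)"
    using main[of "of_real a"] a unfolding cr by simp
  hence "a * (LH l. h l * exp (- a * l)) + (LH l. d l * exp (- a * l)) = 2 / k\<^sup>2"
    unfolding of_real_eq_iff .
  hence dle: "(LH l. d l * exp (- a * l)) \<le> 2 / k\<^sup>2"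
    using nonneg a by (smt (verit) mult_nonneg_nonneg)
  have "norm (LH l. of_real (d l) * exp (- (x * of_real l))) \<le> (LH l. norm (of_real (d l) * exp (- (x * of_real l))))"
    by (rule integral_norm_bound)
  also have "\<dots> = (LH l. d l * exp (- a * l))"
    using d by (intro Bochner_Integration.integral_cong[OF refl]) (auto simp: norm_mult a_def)
  finally have "norm (LH l. of_real (d l) * exp (- (x * of_real l))) \<le> 2 / k\<^sup>2" using dle by simp
  moreover have "x * (LH l. of_real (h l) * exp (- (x * of_real l))) =
      of_real (2 / k\<^sup>2) - (LH l. of_real (d l) * exp (- (x * of_real l)))"
    using main[OF x] by (simp add: algebra_simps)
  moreover have "norm (complex_of_real (2 / k\<^sup>2)) = 2 / k\<^sup>2" by (simp only: norm_of_real) simp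
  ultimately have "norm (x * (LH l. of_real (h l) * exp (- (x * of_real l)))) \<le> 2 / k\<^sup>2 + 2 / k\<^sup>2"
    using norm_triangle_ineq4[of "complex_of_real (2 / k\<^sup>2)" "LH l. of_real (d l) * exp (- (x * of_real l))"]
    by (simp only:)
  hence "norm (LH l. of_real (h l) * exp (- (x * of_real l))) * norm x \<le> 2 / k\<^sup>2 + 2 / k\<^sup>2"
    by (simp only: norm_mult mult.commute)
  moreover have "norm x > 0" using x by auto
  ultimately have "norm (LH l. of_real (h l) * exp (- (x * of_real l))) \<le> (2 / k\<^sup>2 + 2 / k\<^sup>2) / norm x"
    by (simp only: pos_le_divide_eq)
  also have "\<dots> = 4 / (k\<^sup>2 * norm x)" by simp
  finally show ?thesis unfolding h_def .
qed

text \<open>The estimates 4 / (freq^2 |x|) for single frequencies are summed, and 4 / 24 = 1 /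
  6.\<close>

lemma norm_binet_le:
  assumes x: "Re x > 0"
  shows "norm (binet x) \<le> 1 / (6 * norm x)"
proof -
  define g where "g m = (LH l. of_real (2 / (l\<^sup>2 + (freq m)\<^sup>2)) * exp (- (x * of_real l)))" for m
  have s: "g sums binet x" unfolding g_def binet_def using binet_moment_sums[OF x, of 0] by simp
  have b: "norm (g m) \<le> (4 / norm x) * (1 / (freq m)\<^sup>2)" for m
  proof -
    have "4 / (K * norm x) = (4 / norm x) * (1 / K)" for K by simp
    thus ?thesis unfolding g_def using laplace_lorentzian_bound[OF x, of "2 * pi * real (Suc m)"]
      by (metis mult_pos_pos of_nat_0_less_iff pi_gt_zero zero_less_Suc zero_less_numeral)
  qed
  have t: "(\<lambda>m. (4 / norm x) * (1 / (freq m)\<^sup>2)) sums ((4 / norm x) * (1 / 24))"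
    by (rule sums_mult[OF sums_inverse_squares_2pi])
  have "norm (suminf g) \<le> (\<Sum>m. (4 / norm x) * (1 / (freq m)\<^sup>2))"
    by (rule norm_suminf_le[OF b sums_summable[OF t]])
  thus ?thesis using sums_unique[OF s] sums_unique[OF t] by simp
qed

text \<open>A branch of log Lambda on the plane slit along the nonpositive reals, fixed by
  \<open>ln_Gamma\<close> and \<open>Ln\<close>.\<close>

definition ln_Lambda :: "complex \<Rightarrow> complex" where
  "ln_Lambda x = x + ln_Gamma x - of_real (ln (2 * pi) / 2) - (x - 1 / 2) * Ln x"

lemma exp_ln_Lambda:
  assumes "x \<notin> \<real>\<^sub>\<le>\<^sub>0"
  shows "exp (ln_Lambda x) = Lambda_fun x"
proof -
  have x: "x \<noteq> 0" "x \<notin> \<int>\<^sub>\<le>\<^sub>0" using assms nonpos_Ints_subset_nonpos_Reals by auto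
  have "exp (ln_Gamma x) = Gamma x" using x by (simp add: Gamma_complex_altdef)
  moreover have "sqrt (2 * pi) = exp (ln (2 * pi) / 2)"
    by (metis pi_gt_zero powr_def powr_half_sqrt less_eq_real_def mult.commute mult_pos_pos times_divide_eq_right mult_1 zero_less_numeral less_irrefl)
  hence "exp (complex_of_real (ln (2 * pi) / 2)) = of_real (sqrt (2 * pi))"
    by (simp only: exp_of_real)
  ultimately show ?thesis
    using x by (simp add: ln_Lambda_def Lambda_fun_def exp_diff exp_add powr_def del: of_real_divide)
qed

lemma ln_Lambda_deriv:
  assumes "x \<notin> \<real>\<^sub>\<le>\<^sub>0"
  shows "(ln_Lambda has_field_derivative Digamma x - Ln x + 1 / (2 * x)) (at x)"
  unfolding ln_Lambda_def[abs_def] using assms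
  by (auto intro!: derivative_eq_intros simp: field_simps)

lemma ln_Lambda_deriv2:
  assumes "x \<notin> \<real>\<^sub>\<le>\<^sub>0"
  shows "((\<lambda>x. Digamma x - Ln x + 1 / (2 * x)) has_field_derivative Polygamma 1 x - 1 / x - 1 / (2 * x\<^sup>2)) (at x)"
proof -
  have x: "x \<noteq> 0" "x \<notin> \<int>\<^sub>\<le>\<^sub>0" using assms nonpos_Ints_subset_nonpos_Reals by auto
  thus ?thesis using assms
    by (auto intro!: derivative_eq_intros simp: field_simps power2_eq_square)
qed

lemma ln_Lambda_of_real:
  assumes "x > 0"
  shows "ln_Lambda (of_real x) = of_real (x + ln (Gamma x) - ln (2 * pi) / 2 - (x - 1 / 2) * ln x)"
  using assms by (simp add: ln_Lambda_def ln_Gamma_complex_of_real ln_Gamma_real_pos Ln_of_real)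

lemma binet_tendsto_0: "(\<lambda>n. binet (of_real (real n + a))) \<longlonglongrightarrow> 0"
proof (rule Lim_null_comparison)
  show "\<forall>\<^sub>F n in sequentially. norm (binet (of_real (real n + a))) \<le> 1 / (6 * (real n + a))"
  proof -
    have "\<forall>\<^sub>F n in sequentially. real n + a > 0" by real_asymp
    thus ?thesis
    proof eventually_elim
      case (elim n)
      hence "norm (complex_of_real (real n + a)) = real n + a" by (simp only: norm_of_real abs_of_pos)
      thus ?case using norm_binet_le[of "of_real (real n + a)"] elim by simp
    qed
  qed
  show "(\<lambda>n. 1 / (6 * (real n + a))) \<longlonglongrightarrow> 0" by real_asymp
qed

text \<open>The second derivatives agree by \<open>binet_second_moment\<close>, so the difference is
  affine, c x + d. Two functional equations of Gamma remove it, because \<open>binet\<close> tends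
  to 0 along the reals.\<close>

theorem binet_eq:
  assumes x: "Re x > 0"
  shows "binet x = ln_Lambda x"
proof -
  define S where "S = {x. Re x > 0}"
  have S: "convex S" unfolding S_def by (rule convex_halfspace_Re_gt)
  have slit: "x \<notin> \<real>\<^sub>\<le>\<^sub>0" if "Re x > 0" for x using that by (auto simp: complex_nonpos_Reals_iff)
  define D1 where "D1 x = Digamma x - Ln x + 1 / (2 * x) + (LH l. of_real (l * binet_kernel l) * exp (- (x * of_real l)))" for x
  have "\<exists>c. \<forall>x\<in>S. D1 x = c"
  proof (rule has_field_derivative_zero_constant[OF S])
    fix x assume "x \<in> S"
    hence x: "Re x > 0" by (simp add: S_def)
    have "(D1 has_field_derivative (Polygamma 1 x - 1 / x - 1 / (2 * x\<^sup>2)) +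
       - (LH l. of_real (l ^ Suc 1 * binet_kernel l) * exp (- (x * of_real l)))) (at x)"
      unfolding D1_def[abs_def]
      using DERIV_add[OF ln_Lambda_deriv2[OF slit[OF x]] binet_moment_derivative[OF x, of 1]] by simp
    moreover have "(LH l. of_real (l ^ Suc 1 * binet_kernel l) * exp (- (x * of_real l))) = Polygamma 1 x - 1 / x - 1 / (2 * x\<^sup>2)"
      using binet_second_moment[OF x] by (simp add: numeral_2_eq_2)
    ultimately show "(D1 has_field_derivative 0) (at x within S)"
      using has_field_derivative_at_within by fastforce
  qed
  then obtain c where c: "\<And>x. Re x > 0 \<Longrightarrow> D1 x = c" by (auto simp: S_def)
  have "\<exists>d. \<forall>x\<in>S. ln_Lambda x - binet x - c * x = d"
  proof (rule has_field_derivative_zero_constant[OF S])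
    fix x assume "x \<in> S"
    hence x: "Re x > 0" by (simp add: S_def)
    have "((\<lambda>x. ln_Lambda x - binet x - c * x) has_field_derivative D1 x - c) (at x)"
      unfolding D1_def
      by (rule derivative_eq_intros ln_Lambda_deriv[OF slit[OF x]] binet_deriv[OF x] refl)+ simp
    thus "((\<lambda>x. ln_Lambda x - binet x - c * x) has_field_derivative 0) (at x within S)"
      using c[OF x] has_field_derivative_at_within by fastforce
  qed
  then obtain d where d: "\<And>x. Re x > 0 \<Longrightarrow> ln_Lambda x = binet x + c * x + d"
    by (force simp: S_def algebra_simps)
  define L where "L x = x + ln (Gamma x) - ln (2 * pi) / 2 - (x - 1 / 2) * ln x" for x :: real
  have LL: "complex_of_real (L x) = binet (of_real x) + c * of_real x + d" if "x > 0" for x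
    using ln_Lambda_of_real[OF that] d[of "of_real x"] that by (simp add: L_def)
  \<comment> \<open>In the increment over a unit step only c survives as x grows, while elementary
    asymptotics show that the increment tends to 0; hence c = 0.\<close>
  have "L (x + 1) - L x = 1 + (x + 1 / 2) * (ln x - ln (x + 1))" if x: "x > 0" for x :: real
  proof -
    have "Gamma (x + 1) = x * Gamma x" using x by (intro Gamma_plus1) auto
    moreover have "Gamma x \<noteq> 0" using Gamma_real_pos[OF x] by simp
    ultimately show ?thesis using x by (simp add: L_def ln_mult algebra_simps)
  qed
  from this[OF of_nat_0_less_iff[THEN iffD2, OF zero_less_Suc]]
  have "(\<lambda>n. complex_of_real (L (real (Suc n) + 1) - L (real (Suc n)))) =
      (\<lambda>n. of_real (1 + (real (Suc n) + 1 / 2) * (ln (real (Suc n)) - ln (real (Suc n) + 1))))" by (simp only:)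
  also have "\<dots> \<longlonglongrightarrow> of_real 0" by (intro tendsto_of_real) real_asymp
  finally have l1: "(\<lambda>n. complex_of_real (L (real (Suc n) + 1) - L (real (Suc n)))) \<longlonglongrightarrow> 0" by simp
  have "complex_of_real (L (real (Suc n) + 1) - L (real (Suc n))) =
      binet (of_real (real n + 2)) - binet (of_real (real n + 1)) + c" for n
    using LL[of "real (Suc n) + 1"] LL[of "real (Suc n)"] by (simp add: algebra_simps)
  hence "(\<lambda>n. complex_of_real (L (real (Suc n) + 1) - L (real (Suc n)))) \<longlonglongrightarrow> 0 - 0 + c"
    by (simp only:) (intro tendsto_intros binet_tendsto_0)
  hence c0: "c = 0" using l1 LIMSEQ_unique by fastforce
  \<comment> \<open>Legendre's duplication formula. In this combination d has total coefficient 1,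
    so the limit of the left side is d.\<close>
  have "L x + L (x + 1 / 2) - L (2 * x) = 1 / 2 + x * (ln x - ln (x + 1 / 2))" if x: "x > 0" for x :: real
  proof -
    have ni: "w \<notin> \<int>\<^sub>\<le>\<^sub>0" if "Re w > 0" for w
      using that nonpos_Ints_subset_nonpos_Reals by (auto simp: complex_nonpos_Reals_iff)
    have "complex_of_real (Gamma x * Gamma (x + 1 / 2)) =
        of_real (exp ((1 - 2 * x) * ln 2) * sqrt pi * Gamma (2 * x))"
      using Gamma_legendre_duplication[OF ni ni, of "complex_of_real x"] x
      by (simp add: Gamma_complex_of_real[symmetric] exp_of_real[symmetric] complex_nonpos_Reals_iff)
    hence "Gamma x * Gamma (x + 1 / 2) = exp ((1 - 2 * x) * ln 2) * sqrt pi * Gamma (2 * x)"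
      unfolding of_real_eq_iff .
    hence "ln (Gamma x * Gamma (x + 1 / 2)) = ln (exp ((1 - 2 * x) * ln 2) * sqrt pi * Gamma (2 * x))" by simp
    moreover have "Gamma x > 0" "Gamma (x + 1 / 2) > 0" "Gamma (2 * x) > 0" "sqrt pi > 0" using x by simp_all
    ultimately have "ln (Gamma x) + ln (Gamma (x + 1 / 2)) = (1 - 2 * x) * ln 2 + ln pi / 2 + ln (Gamma (2 * x))"
      by (simp add: ln_mult ln_sqrt)
    thus ?thesis using x by (simp add: L_def ln_mult algebra_simps diff_divide_distrib add_divide_distrib)
  qed
  from this[OF of_nat_0_less_iff[THEN iffD2, OF zero_less_Suc]]
  have "(\<lambda>n. complex_of_real (L (real (Suc n)) + L (real (Suc n) + 1 / 2) - L (2 * real (Suc n)))) =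
      (\<lambda>n. of_real (1 / 2 + real (Suc n) * (ln (real (Suc n)) - ln (real (Suc n) + 1 / 2))))" by (simp only:)
  also have "\<dots> \<longlonglongrightarrow> of_real 0" by (intro tendsto_of_real) real_asymp
  finally have l2: "(\<lambda>n. complex_of_real (L (real (Suc n)) + L (real (Suc n) + 1 / 2) - L (2 * real (Suc n)))) \<longlonglongrightarrow> 0" by simp
  have "complex_of_real (L (real (Suc n)) + L (real (Suc n) + 1 / 2) - L (2 * real (Suc n))) =
      binet (of_real (real n + 1)) + binet (of_real (real n + 3 / 2)) - binet (of_real (real (2 * n) + 2)) + d" for n
    using LL[of "real (Suc n) + 1 / 2"] LL[of "real (Suc n)"] LL[of "2 * real (Suc n)"] c0 by (simp add: algebra_simps)
  moreover have "(\<lambda>n. binet (of_real (real (2 * n) + 2))) \<longlonglongrightarrow> 0"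
    using LIMSEQ_subseq_LIMSEQ[OF binet_tendsto_0[of 2], of "\<lambda>n. 2 * n"] by (simp add: strict_mono_def comp_def)
  ultimately have "(\<lambda>n. complex_of_real (L (real (Suc n)) + L (real (Suc n) + 1 / 2) - L (2 * real (Suc n)))) \<longlonglongrightarrow> 0 + 0 - 0 + d"
    by (simp only:) (intro tendsto_intros binet_tendsto_0)
  hence "d = 0" using l2 LIMSEQ_unique by fastforce
  thus ?thesis using d[OF x] c0 by simp
qed

subsection \<open>Asymptotics of the modified gamma function\<close>

lemma Lambda_fun_nonzero: "w \<notin> \<real>\<^sub>\<le>\<^sub>0 \<Longrightarrow> Lambda_fun w \<noteq> 0"
  using exp_ln_Lambda[of w] by (metis exp_not_eq_zero)

lemma open_slit_plane: "open (- (\<real>\<^sub>\<le>\<^sub>0 :: complex set))"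
  using closed_nonpos_Reals_complex by (simp add: open_Compl)

lemma Lambda_fun_deriv:
  assumes "w \<notin> \<real>\<^sub>\<le>\<^sub>0"
  shows "(Lambda_fun has_field_derivative Lambda_fun w * (Digamma w - Ln w + 1 / (2 * w))) (at w)"
proof -
  have "((\<lambda>w. exp (ln_Lambda w)) has_field_derivative exp (ln_Lambda w) * (Digamma w - Ln w + 1 / (2 * w))) (at w)"
    by (rule DERIV_fun_exp[OF ln_Lambda_deriv[OF assms]])
  hence "((\<lambda>w. exp (ln_Lambda w)) has_field_derivative Lambda_fun w * (Digamma w - Ln w + 1 / (2 * w))) (at w)"
    by (simp add: exp_ln_Lambda[OF assms])
  thus ?thesis
    by (rule has_field_derivative_transform_within_open[OF _ open_slit_plane])
       (use assms exp_ln_Lambda in auto)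
qed

lemma Lambda_fun_holomorphic: "Lambda_fun holomorphic_on (- \<real>\<^sub>\<le>\<^sub>0)"
  using Lambda_fun_deriv by (auto simp: holomorphic_on_open[OF open_slit_plane])

text \<open>Euler's reflection formula, where Ln (- w) = Ln w + i pi below the real axis combines
  the two powers. It is the source of the factors 1 - x_\<gamma> in the jumps of the Riemann-Hilbert
  problem.\<close>

lemma Lambda_fun_reflection:
  assumes w: "Im w < 0"
  shows "Lambda_fun w * Lambda_fun (- w) = 1 / (1 - exp (- (2 * of_real pi * \<i> * w)))"
proof -
  have w0: "w \<noteq> 0" using w by auto
  define E where "E = exp (\<i> * of_real pi * w)"
  have E0: "E \<noteq> 0" by (simp add: E_def)
  have "cmod E = exp (- (pi * Im w))" by (simp add: E_def)
  also have "\<dots> > 1" using w by (simp add: mult_neg_pos mult_pos_neg)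
  finally have E1: "cmod E > 1" .
  have EE: "E * E \<noteq> 1"
  proof
    assume "E * E = 1"
    hence "cmod E * cmod E = 1" by (metis norm_mult norm_one)
    thus False using E1 by (metis less_1_mult less_irrefl)
  qed
  have Einv: "exp (- (\<i> * (of_real pi * w))) = 1 / E"
    by (simp add: E_def exp_minus inverse_eq_divide mult.assoc)
  have nI': "v \<notin> \<int>\<^sub>\<le>\<^sub>0" if "Im v \<noteq> 0" for v
    using that by (auto elim!: nonpos_Ints_cases)
  have nI: "- w \<notin> \<int>\<^sub>\<le>\<^sub>0" "w \<notin> \<int>\<^sub>\<le>\<^sub>0" using nI'[of w] nI'[of "- w"] w by auto
  have "Gamma (- w + 1) = - w * Gamma (- w)" by (rule Gamma_plus1) (use nI in auto)
  hence "Gamma w * (- w * Gamma (- w)) = of_real pi / sin (of_real pi * w)"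
    using Gamma_reflection_complex[of w] by (simp add: add.commute)
  moreover have "sin (of_real pi * w) = (E - 1 / E) / (2 * \<i>)"
    by (subst sin_exp_eq) (simp add: Einv E_def mult.assoc)
  moreover have "Gamma w * Gamma (- w) = (Gamma w * (- w * Gamma (- w))) / (- w)" using w0 by simp
  ultimately have "Gamma w * Gamma (- w) = of_real pi / ((E - 1 / E) / (2 * \<i>)) / (- w)"
    by (simp only:)
  hence G: "Gamma w * Gamma (- w) = - (of_real pi * (2 * \<i>) / ((E - 1 / E) * w))"
    by (simp only: divide_divide_eq_right divide_divide_eq_left mult_minus_right divide_minus_right)
  have L: "Ln (- w) = Ln w + \<i> * of_real pi" using Ln_minus[OF w0] w by simp
  have "w powr (w - 1 / 2) * (- w) powr (- w - 1 / 2) = exp ((w - 1 / 2) * Ln w + (- w - 1 / 2) * (Ln w + \<i> * of_real pi))"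
    using w0 by (simp add: powr_def L exp_add)
  also have "(w - 1 / 2) * Ln w + (- w - 1 / 2) * (Ln w + \<i> * of_real pi) = - Ln w - (\<i> * (of_real pi * w)) - \<i> * of_real (pi / 2)"
    by (simp add: algebra_simps)
  also have "exp \<dots> = (1 / w) * (1 / E) * (- \<i>)"
  proof -
    have "exp (- (\<i> * complex_of_real (pi / 2))) = - \<i>"
      using cis_conv_exp[of "- (pi / 2)"] by (simp add: cis.code complex_eq_iff)
    moreover have "exp (- Ln w) = 1 / w" using w0 by (simp add: exp_minus inverse_eq_divide)
    moreover have "exp (- Ln w - A - B) = exp (- Ln w) * exp (- A) * exp (- B)" for A B
      by (simp add: mult_exp_exp)
    ultimately show ?thesis using Einv by (simp only:)
  qed
  finally have P: "w powr (w - 1 / 2) * (- w) powr (- w - 1 / 2) = (1 / w) * (1 / E) * (- \<i>)" .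
  have "Lambda_fun w * Lambda_fun (- w) =
     (exp w * exp (- w)) * (Gamma w * Gamma (- w)) / ((of_real (sqrt (2 * pi)) * of_real (sqrt (2 * pi))) *
     (w powr (w - 1 / 2) * (- w) powr (- w - 1 / 2)))"
    by (simp add: Lambda_fun_def mult_ac)
  also have "\<dots> = - (of_real pi * (2 * \<i>) / ((E - 1 / E) * w)) / (of_real (2 * pi) * ((1 / w) * (1 / E) * (- \<i>)))"
    unfolding G P by (simp add: exp_minus flip: of_real_mult)
  also have "\<dots> = 1 / (1 - 1 / (E * E))"
    using w0 E0 EE by (simp add: divide_simps)
  also have "1 / (E * E) = exp (- (2 * of_real pi * \<i> * w))"
    by (simp add: E_def exp_minus inverse_eq_divide mult_exp_exp algebra_simps)
  finally show ?thesis .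
qed

text \<open>The reflection formula solved for Lambda w, on both sides of the real axis at once. It
  reduces the left half-plane to the right one, and the exponential has norm exp (- 2 pi |Im
  w|).\<close>

lemma Lambda_fun_reflection':
  assumes w: "Im w \<noteq> 0"
  shows "Lambda_fun w = 1 / ((1 - exp (- (2 * of_real pi * \<i> * (if Im w < 0 then w else - w)))) * Lambda_fun (- w))"
proof -
  have nz: "Lambda_fun (- w) \<noteq> 0" using w by (intro Lambda_fun_nonzero) (auto simp: complex_nonpos_Reals_iff)
  have "Lambda_fun w * Lambda_fun (- w) = 1 / (1 - exp (- (2 * of_real pi * \<i> * (if Im w < 0 then w else - w))))" (is "_ = 1 / ?D")
    using Lambda_fun_reflection[of w] Lambda_fun_reflection[of "- w"] w by (auto simp: mult.commute)
  have "Lambda_fun w = (Lambda_fun w * Lambda_fun (- w)) / Lambda_fun (- w)" using nz by simp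
  also have "\<dots> = 1 / ?D / Lambda_fun (- w)" by (simp only: \<open>_ = 1 / ?D\<close>)
  finally show ?thesis by (simp only: divide_divide_eq_left)
qed

text \<open>The imaginary axis is reached as a limit from the right, which is possible because the
  bound depends on |w| alone.\<close>

lemma norm_ln_Lambda_le:
  assumes "Re w \<ge> 0" "w \<noteq> 0"
  shows "norm (ln_Lambda w) \<le> 1 / (6 * norm w)"
proof -
  define X where "X n = w + of_real (1 / (real n + 1))" for n
  have "(\<lambda>n. 1 / (real n + 1)) \<longlonglongrightarrow> 0" by real_asymp
  hence "X \<longlonglongrightarrow> w + of_real 0" unfolding X_def by (intro tendsto_intros)
  hence X: "X \<longlonglongrightarrow> w" by simp
  have slit: "w \<notin> \<real>\<^sub>\<le>\<^sub>0" using assms by (auto simp: complex_nonpos_Reals_iff complex_eq_iff)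
  have "isCont ln_Lambda w" using ln_Lambda_deriv[OF slit] by (rule DERIV_isCont)
  hence "(\<lambda>n. norm (ln_Lambda (X n))) \<longlonglongrightarrow> norm (ln_Lambda w)"
    using X isCont_tendsto_compose by (intro tendsto_norm) blast
  moreover have "(\<lambda>n. 1 / (6 * norm (X n))) \<longlonglongrightarrow> 1 / (6 * norm w)"
    using X assms by (intro tendsto_intros) auto
  moreover have "norm (ln_Lambda (X n)) \<le> 1 / (6 * norm (X n))" for n
    using norm_binet_le[of "X n"] binet_eq[of "X n"] assms(1)
    by (simp add: X_def add_nonneg_pos)
  ultimately show ?thesis using LIMSEQ_le by blast
qed

lemma Lambda_fun_tendsto_right: "(Lambda_fun \<longlongrightarrow> 1) (inf at_infinity (principal {w. Re w \<ge> 0}))"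
proof -
  let ?F = "inf at_infinity (principal {w. Re w \<ge> 0})"
  have ev: "\<forall>\<^sub>F w in ?F. Re w \<ge> 0 \<and> w \<noteq> 0"
    using eventually_not_equal_at_infinity[of 0] by (auto simp: eventually_inf_principal elim: eventually_mono)
  have "(ln_Lambda \<longlongrightarrow> 0) ?F"
  proof (rule Lim_null_comparison)
    show "\<forall>\<^sub>F w in ?F. norm (ln_Lambda w) \<le> norm (inverse (6 * w))"
      using ev by eventually_elim (use norm_ln_Lambda_le in \<open>auto simp: norm_divide norm_mult inverse_eq_divide\<close>)
    have "((\<lambda>w::complex. inverse (6 * w)) \<longlongrightarrow> 0) at_infinity"
      by (intro filterlim_compose[OF tendsto_inverse_0] tendsto_mult_filterlim_at_infinity[of _ 6]) (auto simp: filterlim_ident)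
    hence "((\<lambda>w::complex. inverse (6 * w)) \<longlongrightarrow> 0) ?F" by (rule tendsto_mono[rotated]) simp
    thus "((\<lambda>w::complex. norm (inverse (6 * w))) \<longlongrightarrow> 0) ?F" by (rule tendsto_norm_zero)
  qed
  hence "((\<lambda>w. exp (ln_Lambda w)) \<longlongrightarrow> exp 0) ?F" by (rule tendsto_exp)
  hence "((\<lambda>w. exp (ln_Lambda w)) \<longlongrightarrow> 1) ?F" by simp
  thus ?thesis
  proof (rule Lim_transform_eventually)
    show "\<forall>\<^sub>F w in ?F. exp (ln_Lambda w) = Lambda_fun w"
      using ev
    proof eventually_elim
      case (elim w)
      hence "w \<notin> \<real>\<^sub>\<le>\<^sub>0" by (auto simp: complex_nonpos_Reals_iff complex_eq_iff)
      thus ?case by (rule exp_ln_Lambda)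
    qed
  qed
qed

text \<open>Outside a cone around the negative axis |Im w| grows like |w|, so the exponential in the
  reflection formula dies out and Lambda (- w), with - w on the right, decides the limit.\<close>

lemma Lambda_fun_tendsto_left:
  assumes c: "c > 0"
  shows "(Lambda_fun \<longlongrightarrow> 1) (inf at_infinity (principal {w. Re w < 0 \<and> c * \<bar>Re w\<bar> \<le> \<bar>Im w\<bar>}))"
proof -
  let ?F = "inf at_infinity (principal {w. Re w < 0 \<and> c * \<bar>Re w\<bar> \<le> \<bar>Im w\<bar>})"
  define e where "e w = exp (- (2 * of_real pi * \<i> * (if Im w < 0 then w else - w)))" for w
  have ne: "norm (e w) = exp (- (2 * pi * \<bar>Im w\<bar>))" for w by (auto simp: e_def)
  have ev: "\<forall>\<^sub>F w in ?F. Re w < 0 \<and> c * \<bar>Re w\<bar> \<le> \<bar>Im w\<bar>"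
    by (simp only: eventually_inf_principal) (rule always_eventually, blast)
  have "filterlim (\<lambda>w::complex. norm w) at_top ?F"
    by (rule filterlim_mono[OF filterlim_norm_at_top]) auto
  \<comment> \<open>The factor comes from |w| \<le> |Re w| + |Im w| \<le> (1 + 1/c) |Im w|.\<close>
  hence lim: "filterlim (\<lambda>w::complex. (1 / (1 + 1 / c)) * norm w) at_top ?F"
    using c by (intro filterlim_tendsto_pos_mult_at_top[OF tendsto_const]) (auto simp: add_pos_pos)
  have imt: "filterlim (\<lambda>w. \<bar>Im w\<bar>) at_top ?F"
  proof (rule filterlim_at_top_mono[OF lim])
    show "\<forall>\<^sub>F w in ?F. 1 / (1 + 1 / c) * cmod w \<le> \<bar>Im w\<bar>"
      using ev
    proof eventually_elim
      case (elim w)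
      hence "\<bar>Re w\<bar> * c \<le> \<bar>Im w\<bar>" by (simp only: mult.commute)
      hence "\<bar>Re w\<bar> \<le> \<bar>Im w\<bar> / c" by (simp only: pos_le_divide_eq[OF c])
      hence "cmod w \<le> \<bar>Im w\<bar> * (1 + 1 / c)"
        using cmod_le[of w] by (simp add: algebra_simps)
      moreover have "1 + 1 / c > 0" using c by (simp add: add_pos_pos)
      ultimately show ?case by (simp add: field_simps)
    qed
  qed
  have "((\<lambda>x::real. exp (- (2 * pi * x))) \<longlongrightarrow> 0) at_top" by real_asymp
  hence "((\<lambda>w. norm (e w)) \<longlongrightarrow> 0) ?F" unfolding ne by (rule filterlim_compose[OF _ imt])
  hence e0: "(e \<longlongrightarrow> 0) ?F" by (rule tendsto_norm_zero_cancel)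
  have "filterlim uminus (inf at_infinity (principal {w. Re w \<ge> 0})) ?F"
    unfolding filterlim_inf
  proof
    show "filterlim uminus at_infinity ?F"
      unfolding filterlim_at_infinity_conv_norm_at_top norm_minus_cancel
      by (rule filterlim_mono[OF filterlim_norm_at_top]) auto
    show "filterlim uminus (principal {w. 0 \<le> Re w}) ?F"
      using ev by (auto simp: filterlim_principal elim: eventually_mono)
  qed
  hence "((\<lambda>w. Lambda_fun (- w)) \<longlongrightarrow> 1) ?F"
    by (rule filterlim_compose[OF Lambda_fun_tendsto_right])
  hence "((\<lambda>w. 1 / ((1 - e w) * Lambda_fun (- w))) \<longlongrightarrow> 1 / ((1 - 0) * 1)) ?F"
    using e0 by (intro tendsto_intros) auto
  hence "((\<lambda>w. 1 / ((1 - e w) * Lambda_fun (- w))) \<longlongrightarrow> 1) ?F" by simp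
  thus ?thesis
  proof (rule Lim_transform_eventually)
    show "\<forall>\<^sub>F w in ?F. 1 / ((1 - e w) * Lambda_fun (- w)) = Lambda_fun w"
      using ev
    proof eventually_elim
      case (elim w)
      hence "0 < c * \<bar>Re w\<bar>" using c by (intro mult_pos_pos) auto
      hence "Im w \<noteq> 0" using elim by linarith
      thus ?case unfolding e_def using Lambda_fun_reflection' by metis
    qed
  qed
qed

lemma Lambda_fun_tendsto_1:
  assumes c: "c > 0" and inf: "filterlim w at_infinity F"
    and ev: "\<forall>\<^sub>F x in F. Re (w x) \<ge> 0 \<or> c * \<bar>Re (w x)\<bar> \<le> \<bar>Im (w x)\<bar>"
  shows "((\<lambda>x. Lambda_fun (w x)) \<longlongrightarrow> 1) F"
proof (rule filterlim_compose[where g=Lambda_fun and f=w])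
  let ?A = "{w. Re w \<ge> 0}" and ?B = "{w. Re w < 0 \<and> c * \<bar>Re w\<bar> \<le> \<bar>Im w\<bar>}"
  have "inf at_infinity (principal (?A \<union> ?B)) = sup (inf at_infinity (principal ?A)) (inf at_infinity (principal ?B))"
    by (simp only: sup_principal[symmetric] inf_sup_distrib1)
  thus "(Lambda_fun \<longlongrightarrow> 1) (inf at_infinity (principal (?A \<union> ?B)))"
    using filterlim_sup[OF Lambda_fun_tendsto_right Lambda_fun_tendsto_left[OF c]] by simp
  show "filterlim w (inf at_infinity (principal (?A \<union> ?B))) F"
    unfolding filterlim_inf using inf ev by (auto simp: filterlim_principal elim!: eventually_mono)
qed

lemma tendsto_mult_Ln_0: "((\<lambda>w. w * Ln w) \<longlongrightarrow> 0) (at 0)"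
proof (rule Lim_null_comparison)
  show "\<forall>\<^sub>F w in at 0. norm (w * Ln w) \<le> \<bar>norm w * ln (norm w)\<bar> + norm w * pi"
  proof (rule eventually_at_filter[THEN iffD2], rule always_eventually, intro allI impI)
    fix w :: complex assume "w \<noteq> 0"
    have "norm (Ln w) \<le> \<bar>Re (Ln w)\<bar> + \<bar>Im (Ln w)\<bar>" by (rule cmod_le)
    also have "\<dots> \<le> \<bar>ln (norm w)\<bar> + pi"
      using \<open>w \<noteq> 0\<close> Im_Ln_le_pi[of w] mpi_less_Im_Ln[of w] by simp
    finally have "norm w * norm (Ln w) \<le> norm w * (\<bar>ln (norm w)\<bar> + pi)" by (rule mult_left_mono) simp
    thus "norm (w * Ln w) \<le> \<bar>norm w * ln (norm w)\<bar> + norm w * pi"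
      by (simp add: norm_mult abs_mult algebra_simps)
  qed
  have "filterlim (norm :: complex \<Rightarrow> real) (at_right 0) (at 0)"
    unfolding filterlim_at by (auto intro!: tendsto_eq_intros simp: eventually_at_filter)
  moreover have "((\<lambda>r::real. \<bar>r * ln r\<bar> + r * pi) \<longlongrightarrow> 0) (at_right 0)" by real_asymp
  ultimately show "((\<lambda>w::complex. \<bar>norm w * ln (norm w)\<bar> + norm w * pi) \<longlongrightarrow> 0) (at 0)"
    by (rule filterlim_compose[rotated])
qed

text \<open>Shifting the argument of Gamma by one gives Lambda w = q w / (sqrt (2 pi) w^(1/2)) with
  q tending to 1. The constants 1/6 and 1 come from 1/2 \<le> |q| \<le> 3/2 and 3/2 \<le> sqrt (2
  pi) \<le> 3. For w = z / t this is the behaviour as t tends to infinity.\<close>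

lemma Lambda_fun_at_0:
  "\<exists>r>0. \<forall>w. w \<notin> \<real>\<^sub>\<le>\<^sub>0 \<and> norm w < r \<longrightarrow>
     norm w powr (- 1 / 2) / 6 \<le> norm (Lambda_fun w) \<and> norm (Lambda_fun w) \<le> norm w powr (- 1 / 2)"
proof -
  define q where "q w = exp w * Gamma (w + 1) / exp (w * Ln w)" for w
  have "(q \<longlongrightarrow> exp 0 * Gamma (0 + 1) / exp 0) (at 0)"
    unfolding q_def by (intro tendsto_intros tendsto_mult_Ln_0) auto
  hence "((\<lambda>w. norm (q w)) \<longlongrightarrow> 1) (at 0)" using tendsto_norm by fastforce
  hence "\<forall>\<^sub>F w in at 0. dist (norm (q w)) 1 < 1 / 2" by (rule tendstoD) simp
  then obtain r where r: "r > 0" "\<And>w. w \<noteq> 0 \<Longrightarrow> norm w < r \<Longrightarrow> \<bar>norm (q w) - 1\<bar> < 1 / 2"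
    by (auto simp: eventually_at dist_norm)
  have "norm w powr (- 1 / 2) / 6 \<le> norm (Lambda_fun w) \<and> norm (Lambda_fun w) \<le> norm w powr (- 1 / 2)"
    if w: "w \<notin> \<real>\<^sub>\<le>\<^sub>0" "norm w < r" for w
  proof -
    have w0: "w \<noteq> 0" "w \<notin> \<int>\<^sub>\<le>\<^sub>0" using w nonpos_Ints_subset_nonpos_Reals by auto
    have "Lambda_fun w = q w / (of_real (sqrt (2 * pi)) * w powr (1 / 2))"
    proof -
      define h where "h = exp (Ln w / 2)"
      have h: "h \<noteq> 0" "w = h * h" using w0 by (simp_all add: h_def mult_exp_exp)
      have "w powr (w - 1 / 2) = exp (w * Ln w) / h" "w powr (1 / 2) = h"
        using w0 by (simp_all add: powr_def h_def left_diff_distrib exp_diff)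
      moreover have "Gamma (w + 1) = h * h * Gamma w" using Gamma_plus1[of w] w0 h by simp
      ultimately show ?thesis using h(1) unfolding Lambda_fun_def q_def by (simp add: mult_ac)
    qed
    hence "norm (Lambda_fun w) = norm (q w) / (sqrt (2 * pi) * norm w powr (1 / 2))"
      using w0 by (simp add: norm_divide norm_mult norm_powr_real_powr')
    also have "\<dots> = (norm (q w) / sqrt (2 * pi)) * norm w powr (- 1 / 2)"
      by (simp add: powr_minus field_simps)
    finally have N: "norm (Lambda_fun w) = (norm (q w) / sqrt (2 * pi)) * norm w powr (- 1 / 2)" .
    have q: "1 / 2 \<le> norm (q w)" "norm (q w) \<le> 3 / 2" using r(2)[OF w0(1) w(2)] by linarith+
    have s: "sqrt (2 * pi) \<le> 3" "sqrt (2 * pi) \<ge> 3 / 2"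
    proof -
      show "sqrt (2 * pi) \<le> 3" using pi_less_4 by (intro real_le_lsqrt) (auto simp: power2_eq_square)
      show "sqrt (2 * pi) \<ge> 3 / 2"
        using pi_ge_two by (intro real_le_rsqrt) (simp add: power2_eq_square)
    qed
    have "1 / 6 = (1 / 2) / (3 :: real)" by simp
    also have "\<dots> \<le> norm (q w) / sqrt (2 * pi)" using q s by (intro frac_le) auto
    finally have "1 / 6 * norm w powr (- 1 / 2) \<le> norm (Lambda_fun w)"
      unfolding N by (rule mult_right_mono) simp
    moreover have "norm (q w) / sqrt (2 * pi) \<le> (3 / 2) / (3 / 2)" using q s by (intro frac_le) auto
    hence "norm (Lambda_fun w) \<le> 1 * norm w powr (- 1 / 2)"
      unfolding N by (intro mult_right_mono) auto
    ultimately show ?thesis by simp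
  qed
  thus ?thesis using r(1) by blast
qed

subsection \<open>The birational Riemann-Hilbert problem\<close>

lemma Im_of_real_mult: "Im (complex_of_real r * x) = r * Im x" "Im (x * complex_of_real r) = Im x * r"
  by simp_all

lemma Im_inverse_neg: "Im x > 0 \<Longrightarrow> Im (1 / x) < 0"
proof -
  assume "Im x > 0"
  hence "0 < (Re x)\<^sup>2 + (Im x)\<^sup>2" by (simp add: add_nonneg_pos)
  thus ?thesis using \<open>Im x > 0\<close> by (simp add: Im_divide divide_neg_pos)
qed

lemma half_plane_ray:
  assumes "u \<noteq> 0"
  shows "z \<in> half_plane {of_real r * u | r. r > 0} \<longleftrightarrow> Im (z / u) > 0"
proof
  assume "z \<in> half_plane {of_real r * u | r. r > 0}"
  then obtain r v where rv: "r > 0" "z = of_real r * u * v" "Im v > 0"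
    by (auto simp: half_plane_def)
  hence "z / u = of_real r * v" using assms by simp
  thus "Im (z / u) > 0" using rv by simp
next
  assume im: "Im (z / u) > 0"
  hence "z \<noteq> 0" by auto
  moreover have "z = (of_real 1 * u) * (z / u)" using assms by simp
  ultimately show "z \<in> half_plane {of_real r * u | r. r > 0}"
    unfolding half_plane_def using im zero_less_one by blast
qed

lemma is_rayE:
  assumes "is_ray l"
  obtains u where "u \<noteq> 0" "l = {of_real r * u | r. r > 0}" "\<And>z. z \<in> half_plane l \<longleftrightarrow> Im (z / u) > 0"
proof -
  from assms obtain u where "u \<noteq> 0" "l = {of_real r * u | r. r > 0}" by (auto simp: is_ray_def)
  thus ?thesis using that[of u] half_plane_ray[of u] by simp
qed

lemma open_half_plane: assumes "is_ray l" shows "open (half_plane l)"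
proof -
  from assms obtain u where u: "u \<noteq> 0" "\<And>z. z \<in> half_plane l \<longleftrightarrow> Im (z / u) > 0" by (auto elim: is_rayE)
  hence "half_plane l = {z. 0 < Im (z / u)}" by auto
  moreover have "open {z. 0 < Im (z / u)}"
    by (intro open_Collect_less continuous_intros) (use u in auto)
  ultimately show ?thesis by simp
qed

text \<open>A nonpositive ratio would contradict that both points have positive imaginary part
  relative to the ray. Hence each factor Lambda (Z / t) is evaluated off its branch cut.\<close>

lemma half_plane_ratio_slit:
  assumes "is_ray l" "z \<in> half_plane l" "t \<in> half_plane l"
  shows "z / t \<notin> \<real>\<^sub>\<le>\<^sub>0"
proof
  assume "z / t \<in> \<real>\<^sub>\<le>\<^sub>0"
  then obtain r where r: "z / t = of_real r" "r \<le> 0" by (auto elim!: nonpos_Reals_cases)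
  from assms(1) obtain u where u: "u \<noteq> 0" "\<And>z. z \<in> half_plane l \<longleftrightarrow> Im (z / u) > 0" by (auto elim: is_rayE)
  have t: "t \<noteq> 0" using assms u by auto
  have "z / u = of_real r * (t / u)" using r t by (simp add: field_simps)
  hence "Im (z / u) = r * Im (t / u)" by (simp only: Im_of_real_mult)
  moreover have "Im (z / u) > 0" "Im (t / u) > 0" using assms u by auto
  ultimately show False using r(2) by (simp add: mult_nonpos_nonneg zero_less_mult_iff)
qed

text \<open>Weak inequalities with k \<ge> 0 and R \<ge> 1 make the notion stable under products and
  inverses. The strict bounds with k > 0 in \<open>solves_birational_RH\<close> follow by raising k
  by 1.\<close>

definition poly_growth :: "complex set \<Rightarrow> (complex \<Rightarrow> complex) \<Rightarrow> bool" where
  "poly_growth H f \<longleftrightarrow> (\<exists>k\<ge>0. \<exists>R\<ge>1. \<forall>t\<in>H. norm t > R \<longrightarrow>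
     norm t powr (- k) \<le> norm (f t) \<and> norm (f t) \<le> norm t powr k)"

lemma poly_growth_mult:
  assumes "poly_growth H f" "poly_growth H g"
  shows "poly_growth H (\<lambda>t. f t * g t)"
proof -
  obtain k R where f: "k \<ge> 0" "R \<ge> 1" "\<And>t. t \<in> H \<Longrightarrow> norm t > R \<Longrightarrow> norm t powr (- k) \<le> norm (f t) \<and> norm (f t) \<le> norm t powr k"
    using assms(1) by (auto simp: poly_growth_def)
  obtain k' R' where g: "k' \<ge> 0" "R' \<ge> 1" "\<And>t. t \<in> H \<Longrightarrow> norm t > R' \<Longrightarrow> norm t powr (- k') \<le> norm (g t) \<and> norm (g t) \<le> norm t powr k'"
    using assms(2) by (auto simp: poly_growth_def)
  have "norm t powr (- (k + k')) \<le> norm (f t * g t) \<and> norm (f t * g t) \<le> norm t powr (k + k')"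
    if "t \<in> H" "norm t > max R R'" for t
  proof -
    have "norm t powr (- k) * norm t powr (- k') \<le> norm (f t) * norm (g t)"
         "norm (f t) * norm (g t) \<le> norm t powr k * norm t powr k'"
      using f(3)[of t] g(3)[of t] that by (auto intro!: mult_mono)
    thus ?thesis by (simp add: norm_mult powr_add powr_diff powr_minus field_simps)
  qed
  thus ?thesis using f(1,2) g(1,2) unfolding poly_growth_def
    by (intro exI[of _ "k + k'"] conjI exI[of _ "max R R'"]) auto
qed

lemma poly_growth_inverse:
  assumes "poly_growth H f"
  shows "poly_growth H (\<lambda>t. inverse (f t))"
proof -
  obtain k R where f: "k \<ge> 0" "R \<ge> 1" "\<And>t. t \<in> H \<Longrightarrow> norm t > R \<Longrightarrow> norm t powr (- k) \<le> norm (f t) \<and> norm (f t) \<le> norm t powr k"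
    using assms(1) by (auto simp: poly_growth_def)
  have "norm t powr (- k) \<le> norm (inverse (f t)) \<and> norm (inverse (f t)) \<le> norm t powr k"
    if t: "t \<in> H" "norm t > R" for t
  proof -
    have "norm t > 0" using t(2) f(2) by linarith
    hence p: "norm t powr (- k) > 0" by simp
    have "inverse (norm t powr k) \<le> inverse (norm (f t))"
      using f(3)[OF t] p by (intro le_imp_inverse_le) auto
    moreover have "inverse (norm (f t)) \<le> inverse (norm t powr (- k))"
      using f(3)[OF t] p by (intro le_imp_inverse_le) auto
    ultimately show ?thesis by (simp add: powr_minus norm_inverse)
  qed
  thus ?thesis using f(1,2) unfolding poly_growth_def by blast
qed

lemma poly_growth_bounded:
  assumes "a > 0" and "\<And>t. t \<in> H \<Longrightarrow> norm t > R \<Longrightarrow> a \<le> norm (f t) \<and> norm (f t) \<le> b"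
  shows "poly_growth H f"
  unfolding poly_growth_def
proof (rule exI[of _ 1], rule conjI, simp, rule exI[of _ "Max {1, R, b, 1 / a}"], intro conjI ballI impI)
  fix t assume t: "t \<in> H" "Max {1, R, b, 1 / a} < cmod t"
  hence m: "1 < cmod t" "R < cmod t" "b < cmod t" "1 / a < cmod t" by auto
  hence "1 < cmod t * a" using assms(1) by (simp add: pos_divide_less_eq)
  hence "1 / cmod t \<le> a" using m by (subst pos_divide_le_eq) (auto simp: mult.commute)
  moreover have "cmod t powr (- 1) = 1 / cmod t" using m by (simp add: powr_minus inverse_eq_divide)
  ultimately show "norm t powr (- 1) \<le> norm (f t)" "norm (f t) \<le> norm t powr 1"
    using assms(2)[OF t(1) m(2)] m by auto
qed auto

lemma poly_growth_const: "c \<noteq> 0 \<Longrightarrow> poly_growth H (\<lambda>t. c)"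
  by (rule poly_growth_bounded[where a="norm c" and b="norm c"]) auto

lemma poly_growth_power: "poly_growth H f \<Longrightarrow> poly_growth H (\<lambda>t. f t ^ n)"
  by (induction n) (auto intro: poly_growth_mult poly_growth_const)

lemma poly_growth_powi: "poly_growth H f \<Longrightarrow> poly_growth H (\<lambda>t. f t powi n)"
  unfolding power_int_def
  by (cases "n \<ge> 0") (auto intro!: poly_growth_power poly_growth_inverse)

lemma poly_growth_prod:
  "(\<And>i. i \<in> A \<Longrightarrow> poly_growth H (f i)) \<Longrightarrow> poly_growth H (\<lambda>t. \<Prod>i\<in>A. f i t)"
  by (induction A rule: infinite_finite_induct) (auto intro!: poly_growth_mult poly_growth_const)

lemma poly_growth_exp: "poly_growth H (\<lambda>t. exp (c / t))"
proof (rule poly_growth_bounded[where a="exp (- norm c)" and b="exp (norm c)" and R=1])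
  fix t :: complex assume "1 < cmod t"
  hence "norm (c / t) \<le> norm c" by (simp add: norm_divide divide_le_eq mult_le_cancel_left1)
  hence "\<bar>Re (c / t)\<bar> \<le> norm c" using abs_Re_le_cmod order_trans by blast
  thus "exp (- norm c) \<le> norm (exp (c / t)) \<and> norm (exp (c / t)) \<le> exp (norm c)" by auto
qed simp

text \<open>Large t means z / t near 0, where Lambda grows like w^(-1/2), that is, like a constant
  times t^(1/2). The exponent 2 leaves room to absorb the constants.\<close>

lemma poly_growth_Lambda:
  assumes l: "is_ray l" and z: "z \<in> half_plane l"
  shows "poly_growth (half_plane l) (\<lambda>t. Lambda_fun (z / t))"
proof -
  have z0: "z \<noteq> 0" using z by (auto simp: half_plane_def)
  obtain r where r: "r > 0" "\<And>w. w \<notin> \<real>\<^sub>\<le>\<^sub>0 \<Longrightarrow> norm w < r \<Longrightarrow>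
     norm w powr (- 1 / 2) / 6 \<le> norm (Lambda_fun w) \<and> norm (Lambda_fun w) \<le> norm w powr (- 1 / 2)"
    using Lambda_fun_at_0 by blast
  define c where "c = norm z powr (- 1 / 2)"
  have c: "c > 0" using z0 by (simp add: c_def)
  show ?thesis unfolding poly_growth_def
  \<comment> \<open>The four lower bounds on |t| give, in this order: powers of |t| increase with
    the exponent, |z / t| < r, c \<le> |t|, and 1 / |t| \<le> c / 6.\<close>
  proof (rule exI[of _ 2], rule conjI, simp, rule exI[of _ "Max {1, norm z / r, c, 6 / c}"], intro conjI ballI impI)
    fix t assume t: "t \<in> half_plane l" "Max {1, norm z / r, c, 6 / c} < cmod t"
    hence m: "1 < cmod t" "norm z / r < cmod t" "c < cmod t" "6 / c < cmod t" by auto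
    have t0: "t \<noteq> 0" using m by auto
    have "norm (z / t) < r" using m r(1) t0 by (simp add: norm_divide field_simps)
    hence b: "norm (z / t) powr (- 1 / 2) / 6 \<le> norm (Lambda_fun (z / t))"
        "norm (Lambda_fun (z / t)) \<le> norm (z / t) powr (- 1 / 2)"
      using r(2) half_plane_ratio_slit[OF l z t(1)] by auto
    have e: "norm (z / t) powr (- 1 / 2) = c * norm t powr (1 / 2)"
      unfolding norm_divide c_def using z0 t0 by (simp add: powr_divide powr_minus field_simps)
    have p1: "norm t powr (1 / 2) \<ge> 1" using m by (simp add: ge_one_powr_ge_zero)
    have p2: "norm t powr (1 / 2) \<le> norm t" using powr_mono[of "1 / 2" 1 "norm t"] m by simp
    have "norm t powr (- 2) \<le> norm t powr (- 1)" using m by (intro powr_mono) auto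
    also have "\<dots> = 1 / norm t" using m by (simp add: powr_minus inverse_eq_divide)
    also have "\<dots> \<le> c / 6 * 1"
    proof -
      have "6 < cmod t * c" using m(4) c by (simp add: pos_divide_less_eq)
      hence "1 < (c / 6 * 1) * cmod t" by (simp add: mult.commute)
      thus ?thesis using m by (subst pos_divide_le_eq) auto
    qed
    also have "\<dots> \<le> c / 6 * norm t powr (1 / 2)" using p1 c by (intro mult_left_mono) auto
    finally show "norm t powr (- 2) \<le> norm (Lambda_fun (z / t))" using b e by simp
    have "c * norm t powr (1 / 2) \<le> norm t * norm t" using m p2 c by (intro mult_mono) auto
    also have "\<dots> = norm t powr 2" using m by (simp add: powr_numeral power2_eq_square)
    finally show "norm (Lambda_fun (z / t)) \<le> norm t powr 2" using b e by simp
  qed auto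
qed

text \<open>As z lies in the same open half-plane as t, the ratio z / t keeps out of a fixed cone
  around the negative reals while it tends to infinity.\<close>

lemma Lambda_fun_ratio_tendsto:
  assumes l: "is_ray l" and z: "z \<in> half_plane l"
  shows "((\<lambda>t. Lambda_fun (z / t)) \<longlongrightarrow> 1) (at 0 within half_plane l)"
proof -
  from l obtain u where u: "u \<noteq> 0" "\<And>z. z \<in> half_plane l \<longleftrightarrow> Im (z / u) > 0" by (auto elim: is_rayE)
  have z0: "z \<noteq> 0" using z by (auto simp: half_plane_def)
  define a where "a = z / u"
  have a: "Im a > 0" using u z by (simp add: a_def)
  \<comment> \<open>For w = z / t, membership of t in the half-plane reads Re w Im a > Im w Re a. If
    Re w < 0 this gives |Re w| Im a \<le> |Im w| |Re a|; the summand 1 keeps the quotient meaningful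
    when Re a = 0.\<close>
  define c where "c = Im a / (\<bar>Re a\<bar> + 1)"
  have c: "c > 0" using a by (simp add: c_def)
  show ?thesis
  proof (rule Lambda_fun_tendsto_1[OF c])
    have "filterlim (\<lambda>t. z / t) at_infinity (at 0)"
      using z0 by (intro filterlim_divide_at_infinity[OF tendsto_const]) (auto simp: filterlim_ident)
    thus "filterlim (\<lambda>t. z / t) at_infinity (at 0 within half_plane l)"
      by (rule filterlim_mono) (auto simp: at_within_le_at)
    show "\<forall>\<^sub>F t in at 0 within half_plane l. 0 \<le> Re (z / t) \<or> c * \<bar>Re (z / t)\<bar> \<le> \<bar>Im (z / t)\<bar>"
      unfolding eventually_at_filter
    proof (rule always_eventually, intro allI impI)
      fix t assume t0: "t \<noteq> 0" and "t \<in> half_plane l"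
      hence t: "Im (t / u) > 0" using u by simp
      define w where "w = z / t"
      have "cnj w * a * of_real (inverse ((cmod w)\<^sup>2)) = t / u"
      proof -
        have w0: "w \<noteq> 0" using z0 t0 by (simp add: w_def)
        have "cnj w * of_real (inverse ((cmod w)\<^sup>2)) = 1 / w"
          using w0 complex_norm_square[of w] by (simp add: field_simps power2_eq_square)
        hence "cnj w * a * of_real (inverse ((cmod w)\<^sup>2)) = a / w" by (simp add: mult_ac)
        thus ?thesis using z0 t0 u by (simp add: a_def w_def field_simps)
      qed
      hence "Im (cnj w * a) * inverse ((cmod w)\<^sup>2) > 0" using t by (metis Im_of_real_mult(2))
      hence "Im (cnj w * a) > 0" by (simp add: zero_less_mult_iff)
      hence i: "Re w * Im a > Im w * Re a" by simp
      show "0 \<le> Re w \<or> c * \<bar>Re w\<bar> \<le> \<bar>Im w\<bar>"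
      proof (cases "0 \<le> Re w")
        case False
        have "\<bar>Re w\<bar> * Im a \<le> \<bar>Im w\<bar> * \<bar>Re a\<bar>"
        proof -
          have "\<bar>Re w\<bar> * Im a = - (Re w * Im a)" using False by simp
          also have "\<dots> \<le> - (Im w * Re a)" using i by simp
          also have "\<dots> \<le> \<bar>Im w * Re a\<bar>" by simp
          finally show ?thesis by (simp only: abs_mult)
        qed
        also have "\<dots> \<le> \<bar>Im w\<bar> * (\<bar>Re a\<bar> + 1)" by (intro mult_left_mono) auto
        finally have "Im a * \<bar>Re w\<bar> / (\<bar>Re a\<bar> + 1) \<le> \<bar>Im w\<bar>"
          by (simp add: pos_divide_le_eq mult.commute)
        thus ?thesis by (simp add: c_def)
      qed simp
    qed
  qed
qed

context
  fixes form :: "int ^ 'n::finite \<Rightarrow> int ^ 'n \<Rightarrow> int" and Z :: "int ^ 'n \<Rightarrow> complex"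
    and \<Omega> :: "int ^ 'n \<Rightarrow> rat"
  assumes bps: "bps_structure form Z \<Omega>" and fin: "finite_bps \<Omega>" and unc: "uncoupled form \<Omega>"
begin

lemma form_add: "form x (y + z) = form x y + form x z" "form (x + y) z = form x z + form y z"
proof -
  have sk: "form x y = - form y x" for x y
    using bps unfolding bps_structure_def skew_form_def by blast
  have ad: "form x (y + z) = form x y + form x z" for x y z
    using bps unfolding bps_structure_def skew_form_def Modules.additive_def by blast
  show "form x (y + z) = form x y + form x z" by (rule ad)
  show "form (x + y) z = form x z + form y z"
    using sk[of "x + y" z] sk[of x z] sk[of y z] ad[of z x y] by simp
qed

lemma form_skew: "form x y = - form y x"
  using bps unfolding bps_structure_def skew_form_def by blast

lemma form_minus_right: "form x (- y) = - form x y"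
  using form_add(1)[of x y "- y"] form_add(1)[of x 0 0] by simp

lemma Z_add: "Z (x + y) = Z x + Z y"
  using bps by (auto simp: bps_structure_def Modules.additive_def)

lemma Z_minus: "Z (- x) = - Z x"
proof -
  have "Z (x + - x) = Z x + Z (- x)" "Z (0 + 0) = Z 0 + Z 0" by (rule Z_add)+
  thus ?thesis by (simp add: add_eq_0_iff)
qed

lemma \<Omega>_minus: "\<Omega> (- x) = \<Omega> x"
  using bps by (auto simp: bps_structure_def)

lemma Z_active_nonzero: "\<Omega> x \<noteq> 0 \<Longrightarrow> Z x \<noteq> 0"
proof
  assume x: "\<Omega> x \<noteq> 0" "Z x = 0"
  obtain C where "C > 0" "\<And>\<gamma>. \<Omega> \<gamma> \<noteq> 0 \<Longrightarrow> norm (Z \<gamma>) > C * lattice_norm \<gamma>"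
    using bps by (auto simp: bps_structure_def)
  hence "C > 0" "0 > C * lattice_norm x" using x by force+
  moreover have "lattice_norm x \<ge> 0" by (simp add: lattice_norm_def)
  ultimately show False by (simp add: mult_less_0_iff)
qed

lemma finite_active: "finite {\<gamma>. \<Omega> \<gamma> \<noteq> 0}"
  using fin by (simp add: finite_bps_def active_def)

lemma form_active: "\<Omega> x \<noteq> 0 \<Longrightarrow> \<Omega> y \<noteq> 0 \<Longrightarrow> form x y = 0"
  using unc by (auto simp: uncoupled_def active_def)

abbreviation PsiS :: "(int ^ 'n \<Rightarrow> complex) \<Rightarrow> complex set \<Rightarrow> complex \<Rightarrow> int ^ 'n \<Rightarrow> complex" where
  "PsiS \<equiv> Psi_solution form Z \<Omega>"

text \<open>The opposite ray is excluded as well, because active classes are closed under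
  negation.\<close>

lemma nonactive_ray_Im:
  assumes u: "u \<noteq> 0" and n: "nonactive_ray Z \<Omega> {of_real r * u | r. r > 0}" and x: "\<Omega> x \<noteq> 0"
  shows "Im (Z x / u) \<noteq> 0"
proof
  assume im: "Im (Z x / u) = 0"
  define r where "r = Re (Z x / u)"
  have "Z x / u = of_real r" using im by (simp add: r_def complex_eq_iff)
  hence e: "Z x = of_real r * u" using u by (simp add: field_simps)
  have "r \<noteq> 0" using e Z_active_nonzero[OF x] by auto
  moreover have "\<not> r > 0" using n x e by (auto simp: nonactive_ray_def active_def)
  moreover have "\<not> - r > 0"
  proof
    assume "- r > 0"
    moreover have "Z (- x) = of_real (- r) * u" using e Z_minus by simp
    moreover have "- x \<in> active \<Omega>" using x \<Omega>_minus by (simp add: active_def)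
    ultimately show False using n unfolding nonactive_ray_def by blast
  qed
  ultimately show False by linarith
qed

text \<open>Turning the half-plane from l1 to l2 replaces - \<gamma> by \<gamma> for each class in
  the sector and keeps the others. As \<open>form b\<close> is odd, the quotient of the two products
  consists of powers of Lambda w times Lambda (- w), which the reflection formula evaluates.\<close>

lemma Psi_solution_jump:
  assumes n1: "nonactive_ray Z \<Omega> l1" and n2: "nonactive_ray Z \<Omega> l2" and sub: "l1 \<subseteq> half_plane l2"
    and t1: "t \<in> half_plane l1" and t2: "t \<in> half_plane l2"
    and \<xi>: "\<forall>\<gamma>\<in>active \<Omega>. \<xi> \<gamma> = 1"
  shows "PsiS \<xi> l2 t b = PsiS \<xi> l1 t b *
             (\<Prod>\<gamma> | \<Omega> \<gamma> \<noteq> 0 \<and> (\<exists>u\<in>l1. \<exists>w\<in>l2. Z \<gamma> = u + w).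
                (1 - PsiS \<xi> l1 t \<gamma>) powi (\<lfloor>\<Omega> \<gamma>\<rfloor> * form \<gamma> b))"
proof -
  obtain u1 where u1: "u1 \<noteq> 0" "l1 = {of_real r * u1 | r. r > 0}" "\<And>z. z \<in> half_plane l1 \<longleftrightarrow> Im (z / u1) > 0"
    using n1 by (auto simp: nonactive_ray_def elim: is_rayE)
  obtain u2 where u2: "u2 \<noteq> 0" "l2 = {of_real r * u2 | r. r > 0}" "\<And>z. z \<in> half_plane l2 \<longleftrightarrow> Im (z / u2) > 0"
    using n2 by (auto simp: nonactive_ray_def elim: is_rayE)
  have t0: "t \<noteq> 0" using t1 by (auto simp: half_plane_def)
  have "of_real 1 * u1 \<in> l1" unfolding u1(2) using zero_less_one by blast
  hence u12: "Im (u1 / u2) > 0" using sub u2(3) by auto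
  define k where "k = u1 / u2"
  have k: "Im k > 0" "u1 = k * u2" "k \<noteq> 0" using u12 u2(1) by (auto simp: k_def)
  \<comment> \<open>In the coordinate z / u2 the ray l1 points in the direction \<open>k\<close> of
    the upper half-plane; r and s are the coordinates of z in the real basis u1, u2.\<close>
  have sector: "(\<exists>u\<in>l1. \<exists>w\<in>l2. z = u + w) \<longleftrightarrow> Im (z / u2) > 0 \<and> Im (z / u1) < 0" for z
  proof
    assume "\<exists>u\<in>l1. \<exists>w\<in>l2. z = u + w"
    then obtain r s where rs: "r > 0" "s > 0" "z = of_real r * u1 + of_real s * u2"
      unfolding u1(2) u2(2) by blast
    have e: "z / u2 = of_real r * k + of_real s" "z / u1 = of_real r + of_real s * (1 / k)"
      using rs u1(1) u2(1) k by (auto simp: field_simps)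
    have "Im (1 / k) < 0" using k by (auto simp: Im_divide divide_neg_pos complex_neq_0)
    thus "Im (z / u2) > 0 \<and> Im (z / u1) < 0"
      unfolding e plus_complex.sel Im_of_real_mult Im_complex_of_real using rs k by (simp add: mult_pos_neg)
  next
    assume a: "Im (z / u2) > 0 \<and> Im (z / u1) < 0"
    define r where "r = Im (z / u2) / Im k"
    define s where "s = Re (z / u2) - r * Re k"
    have r: "r > 0" using a k by (simp add: r_def)
    have e: "z / u2 = of_real r * k + of_real s" using k by (simp add: complex_eq_iff r_def s_def)
    hence z: "z = of_real r * u1 + of_real s * u2" using u2(1) k by (simp add: field_simps)
    have "z / u1 = of_real r + of_real s * (1 / k)" using z u1(1) u2(1) k by (simp add: field_simps)
    moreover have "Im (1 / k) < 0" using k by (auto simp: Im_divide divide_neg_pos complex_neq_0)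
    ultimately have "s * Im (1 / k) < 0" "Im (1 / k) < 0"
      using a by (auto simp only: plus_complex.sel Im_of_real_mult Im_complex_of_real)
    hence "s > 0" by (simp add: mult_less_0_iff)
    thus "\<exists>u\<in>l1. \<exists>w\<in>l2. z = u + w" using r z unfolding u1(2) u2(2) by blast
  qed
  define S where "S = {\<gamma>. \<Omega> \<gamma> \<noteq> 0 \<and> (\<exists>u\<in>l1. \<exists>w\<in>l2. Z \<gamma> = u + w)}"
  define I where "I = {\<gamma>. \<Omega> \<gamma> \<noteq> 0 \<and> Z \<gamma> \<in> half_plane l1 \<and> Z \<gamma> \<in> half_plane l2}"
  have S: "\<gamma> \<in> S \<longleftrightarrow> \<Omega> \<gamma> \<noteq> 0 \<and> Im (Z \<gamma> / u2) > 0 \<and> Im (Z \<gamma> / u1) < 0" for \<gamma>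
    by (simp add: S_def sector)
  have I: "\<gamma> \<in> I \<longleftrightarrow> \<Omega> \<gamma> \<noteq> 0 \<and> Im (Z \<gamma> / u1) > 0 \<and> Im (Z \<gamma> / u2) > 0" for \<gamma>
    by (simp add: I_def u1(3) u2(3))
  have nz: "\<Omega> \<gamma> \<noteq> 0 \<Longrightarrow> Im (Z \<gamma> / u1) \<noteq> 0 \<and> Im (Z \<gamma> / u2) \<noteq> 0" for \<gamma>
    using nonactive_ray_Im[OF u1(1)] nonactive_ray_Im[OF u2(1)] n1 n2 u1(2) u2(2) by auto
  have fS: "finite S" "finite I" unfolding S_def I_def by (rule finite_subset[OF _ finite_active]; auto)+
  have A2: "{\<gamma>. \<Omega> \<gamma> \<noteq> 0 \<and> Z \<gamma> \<in> half_plane l2} = I \<union> S"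
    using nz by (auto simp: S I u2(3) simp del: Im_divide_Reals) (metis linorder_neqE_linordered_idom)
  have A1: "{\<gamma>. \<Omega> \<gamma> \<noteq> 0 \<and> Z \<gamma> \<in> half_plane l1} = I \<union> uminus ` S"
  proof (intro equalityI subsetI)
    fix \<gamma> assume "\<gamma> \<in> {\<gamma>. \<Omega> \<gamma> \<noteq> 0 \<and> Z \<gamma> \<in> half_plane l1}"
    hence g: "\<Omega> \<gamma> \<noteq> 0" "Im (Z \<gamma> / u1) > 0" using u1 by auto
    show "\<gamma> \<in> I \<union> uminus ` S"
    proof (cases "Im (Z \<gamma> / u2) > 0")
      case False
      hence "Im (Z \<gamma> / u2) < 0" using nz[OF g(1)] by auto
      hence "- \<gamma> \<in> S" using g by (simp add: S \<Omega>_minus Z_minus)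
      thus ?thesis by (metis UnI2 image_eqI minus_minus)
    qed (use g I in auto)
  qed (auto simp: S I u1(3) \<Omega>_minus Z_minus)
  have disj: "I \<inter> S = {}" "I \<inter> uminus ` S = {}"
    using S I \<Omega>_minus Z_minus by (auto simp: not_less order.asym)
  let ?w = "\<lambda>\<gamma>. Z \<gamma> / t"
  let ?p = "\<Prod>\<gamma>\<in>I. Lambda_fun (?w \<gamma>) powi (\<lfloor>\<Omega> \<gamma>\<rfloor> * form b \<gamma>)"
  have P2: "Psi_product form Z \<Omega> (half_plane l2) b t = ?p * (\<Prod>\<gamma>\<in>S. Lambda_fun (?w \<gamma>) powi (\<lfloor>\<Omega> \<gamma>\<rfloor> * form b \<gamma>))"
    unfolding Psi_product_def A2 by (rule prod.union_disjoint) (use fS disj in auto)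
  have "Psi_product form Z \<Omega> (half_plane l1) b t = ?p * (\<Prod>\<gamma>\<in>uminus ` S. Lambda_fun (?w \<gamma>) powi (\<lfloor>\<Omega> \<gamma>\<rfloor> * form b \<gamma>))"
    unfolding Psi_product_def A1 by (rule prod.union_disjoint) (use fS disj in auto)
  also have "(\<Prod>\<gamma>\<in>uminus ` S. Lambda_fun (?w \<gamma>) powi (\<lfloor>\<Omega> \<gamma>\<rfloor> * form b \<gamma>)) =
      (\<Prod>\<gamma>\<in>S. Lambda_fun (- ?w \<gamma>) powi (- (\<lfloor>\<Omega> \<gamma>\<rfloor> * form b \<gamma>)))"
    by (subst prod.reindex) (auto simp: inj_on_def \<Omega>_minus Z_minus form_minus_right)
  finally have P1: "Psi_product form Z \<Omega> (half_plane l1) b t = ?p * (\<Prod>\<gamma>\<in>S. Lambda_fun (- ?w \<gamma>) powi (- (\<lfloor>\<Omega> \<gamma>\<rfloor> * form b \<gamma>)))" .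
  \<comment> \<open>Active classes pair to zero with each other, so all exponents in the product for
    such a class vanish, and \<xi> is 1 there.\<close>
  have X1: "PsiS \<xi> l1 t \<gamma> = exp (- (2 * of_real pi * \<i> * ?w \<gamma>))" if "\<gamma> \<in> S" for \<gamma>
  proof -
    have g: "\<Omega> \<gamma> \<noteq> 0" using that S by auto
    hence "Psi_product form Z \<Omega> (half_plane l1) \<gamma> t = 1"
      unfolding Psi_product_def using form_active[OF g] by (intro prod.neutral) auto
    moreover have "\<xi> \<gamma> = 1" using \<xi> g by (auto simp: active_def)
    ultimately show ?thesis by (simp add: Psi_solution_def)
  qed
  have fac: "Lambda_fun (?w \<gamma>) powi (\<lfloor>\<Omega> \<gamma>\<rfloor> * form b \<gamma>) =
      Lambda_fun (- ?w \<gamma>) powi (- (\<lfloor>\<Omega> \<gamma>\<rfloor> * form b \<gamma>)) *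
      (1 - PsiS \<xi> l1 t \<gamma>) powi (\<lfloor>\<Omega> \<gamma>\<rfloor> * form \<gamma> b)" if g: "\<gamma> \<in> S" for \<gamma>
  proof -
    \<comment> \<open>The ratio is a positive combination of u1 / t and u2 / t, both of which lie
      below the real axis.\<close>
    have "Im (?w \<gamma>) < 0"
    proof -
      define a b where "a = Z \<gamma> / u2" and "b = t / u2"
      have "(\<exists>u\<in>l1. \<exists>w\<in>l2. Z \<gamma> = u + w)" using g by (simp add: S_def)
      then obtain r s where rs: "r > 0" "s > 0" "Z \<gamma> = of_real r * u1 + of_real s * u2"
        unfolding u1(2) u2(2) by blast
      have "?w \<gamma> = of_real r * (u1 / t) + of_real s * (u2 / t)" using rs by (simp add: add_divide_distrib)
      moreover have "Im (u / t) < 0" if "Im (t / u) > 0" for u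
      proof -
        have "u / t = 1 / (t / u)" by simp
        thus ?thesis using Im_inverse_neg[OF that] by simp
      qed
      ultimately have "Im (?w \<gamma>) = r * Im (u1 / t) + s * Im (u2 / t)" "Im (u1 / t) < 0" "Im (u2 / t) < 0"
        using t1 t2 u1(3) u2(3) by (simp_all only: plus_complex.sel Im_of_real_mult)
      thus ?thesis using rs by (simp add: add_neg_neg mult_pos_neg)
    qed
    hence "Lambda_fun (?w \<gamma>) * Lambda_fun (- ?w \<gamma>) = 1 / (1 - PsiS \<xi> l1 t \<gamma>)"
      unfolding X1[OF g] by (rule Lambda_fun_reflection)
    moreover have "Lambda_fun (?w \<gamma>) \<noteq> 0" "Lambda_fun (- ?w \<gamma>) \<noteq> 0"
      using \<open>Im (?w \<gamma>) < 0\<close> by (auto intro!: Lambda_fun_nonzero simp: complex_nonpos_Reals_iff)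
    ultimately have q: "Lambda_fun (?w \<gamma>) = inverse (Lambda_fun (- ?w \<gamma>) * (1 - PsiS \<xi> l1 t \<gamma>))"
    proof -
      assume e: "Lambda_fun (?w \<gamma>) * Lambda_fun (- ?w \<gamma>) = 1 / (1 - PsiS \<xi> l1 t \<gamma>)"
      assume nz: "Lambda_fun (- ?w \<gamma>) \<noteq> 0"
      have "Lambda_fun (?w \<gamma>) = (Lambda_fun (?w \<gamma>) * Lambda_fun (- ?w \<gamma>)) / Lambda_fun (- ?w \<gamma>)"
        using nz by simp
      also have "\<dots> = 1 / (1 - PsiS \<xi> l1 t \<gamma>) / Lambda_fun (- ?w \<gamma>)"
        by (simp only: e)
      finally show ?thesis by (simp only: divide_divide_eq_left inverse_eq_divide mult.commute)
    qed
    have f: "form \<gamma> b = - form b \<gamma>" by (rule form_skew)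
    show ?thesis unfolding f by (subst q) (simp add: power_int_inverse power_int_mult_distrib power_int_minus)
  qed
  show ?thesis unfolding S_def[symmetric]
    by (simp add: Psi_solution_def[of _ _ _ _ _ _ b] P1 P2 fac prod.distrib cong: prod.cong)
qed

lemma Psi_product_nonzero:
  assumes "is_ray l" "t \<in> half_plane l"
  shows "Psi_product form Z \<Omega> (half_plane l) b t \<noteq> 0"
proof -
  have "finite {\<gamma>. \<Omega> \<gamma> \<noteq> 0 \<and> Z \<gamma> \<in> half_plane l}"
    by (rule finite_subset[OF _ finite_active]) auto
  thus ?thesis unfolding Psi_product_def
    using half_plane_ratio_slit[OF assms(1) _ assms(2)] Lambda_fun_nonzero by auto
qed

text \<open>The exponents are additive in the class, so the product is an ordinary character and
  \<open>\<xi>\<close> supplies the twist. The exponential cancels the one in the asymptotic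
  condition, and what remains tends to \<open>\<xi> b\<close> because every Lambda tends to
  1.\<close>

theorem Psi_solution_solves:
  assumes tw: "twisted_character form \<xi>" and \<xi>: "\<forall>\<gamma>\<in>active \<Omega>. \<xi> \<gamma> = 1"
  shows "solves_birational_RH form Z \<Omega> \<xi> (PsiS \<xi>)"
  unfolding solves_birational_RH_def
proof (intro conjI allI impI ballI; (elim conjE)?)
  fix l assume "nonactive_ray Z \<Omega> l"
  hence l: "is_ray l" by (simp add: nonactive_ray_def)
  have fin': "finite {\<gamma>. \<Omega> \<gamma> \<noteq> 0 \<and> Z \<gamma> \<in> half_plane l}"
    by (rule finite_subset[OF _ finite_active]) auto
  note slit = half_plane_ratio_slit[OF l]
  have nz0: "t \<in> half_plane l \<Longrightarrow> t \<noteq> 0" for t by (auto simp: half_plane_def)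
  {
    fix t assume t: "t \<in> half_plane l"
    show "twisted_character form (PsiS \<xi> l t)"
      unfolding twisted_character_def
    proof (intro conjI allI)
      fix \<gamma>
      show "PsiS \<xi> l t \<gamma> \<noteq> 0"
        using Psi_product_nonzero[OF l t] tw by (auto simp: Psi_solution_def twisted_character_def)
    next
      fix \<gamma> \<gamma>'
      have "Lambda_fun (Z g / t) powi (\<lfloor>\<Omega> g\<rfloor> * form (\<gamma> + \<gamma>') g) =
        Lambda_fun (Z g / t) powi (\<lfloor>\<Omega> g\<rfloor> * form \<gamma> g) * Lambda_fun (Z g / t) powi (\<lfloor>\<Omega> g\<rfloor> * form \<gamma>' g)"
        if "\<Omega> g \<noteq> 0 \<and> Z g \<in> half_plane l" for g
        using Lambda_fun_nonzero[OF slit[OF _ t]] that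
        by (simp add: form_add distrib_left power_int_add)
      hence "Psi_product form Z \<Omega> (half_plane l) (\<gamma> + \<gamma>') t =
          Psi_product form Z \<Omega> (half_plane l) \<gamma> t * Psi_product form Z \<Omega> (half_plane l) \<gamma>' t"
        unfolding Psi_product_def prod.distrib[symmetric] by (intro prod.cong) auto
      moreover have "\<xi> (\<gamma> + \<gamma>') = (-1) powi form \<gamma> \<gamma>' * \<xi> \<gamma> * \<xi> \<gamma>'"
        using tw by (simp add: twisted_character_def)
      moreover have "exp (- (2 * of_real pi * \<i> * Z (\<gamma> + \<gamma>') / t)) =
        exp (- (2 * of_real pi * \<i> * Z \<gamma> / t)) * exp (- (2 * of_real pi * \<i> * Z \<gamma>' / t))"
        by (simp add: Z_add exp_add[symmetric] distrib_left add_divide_distrib)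
      ultimately show "PsiS \<xi> l t (\<gamma> + \<gamma>') = (-1) powi form \<gamma> \<gamma>' *
          PsiS \<xi> l t \<gamma> * PsiS \<xi> l t \<gamma>'"
        by (simp add: Psi_solution_def mult_ac)
    qed
  next
    fix b
    have h: "(\<lambda>t. Lambda_fun (Z g / t)) holomorphic_on half_plane l" if "Z g \<in> half_plane l" for g
    proof -
      have "Lambda_fun \<circ> (\<lambda>t. Z g / t) holomorphic_on half_plane l"
        using slit[OF that] nz0
        by (intro holomorphic_on_compose_gen[OF _ Lambda_fun_holomorphic] holomorphic_intros) auto
      thus ?thesis by (simp add: comp_def)
    qed
    show "(\<lambda>t. PsiS \<xi> l t b) holomorphic_on half_plane l"
      unfolding Psi_solution_def Psi_product_def
      using nz0 Lambda_fun_nonzero[OF slit] by (intro holomorphic_intros h) auto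
  next
    fix b
    have "((\<lambda>t. \<xi> b * (\<Prod>\<gamma> | \<Omega> \<gamma> \<noteq> 0 \<and> Z \<gamma> \<in> half_plane l. Lambda_fun (Z \<gamma> / t) powi (\<lfloor>\<Omega> \<gamma>\<rfloor> * form b \<gamma>)))
      \<longlongrightarrow> \<xi> b * (\<Prod>\<gamma> | \<Omega> \<gamma> \<noteq> 0 \<and> Z \<gamma> \<in> half_plane l. 1 powi (\<lfloor>\<Omega> \<gamma>\<rfloor> * form b \<gamma>))) (at 0 within half_plane l)"
      by (intro tendsto_intros Lambda_fun_ratio_tendsto[OF l]) auto
    moreover have "exp (2 * of_real pi * \<i> * Z b / t) * PsiS \<xi> l t b =
      \<xi> b * (\<Prod>\<gamma> | \<Omega> \<gamma> \<noteq> 0 \<and> Z \<gamma> \<in> half_plane l. Lambda_fun (Z \<gamma> / t) powi (\<lfloor>\<Omega> \<gamma>\<rfloor> * form b \<gamma>))" for t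
      by (simp add: Psi_solution_def Psi_product_def exp_minus)
    ultimately show "((\<lambda>t. exp (2 * of_real pi * \<i> * Z b / t) * PsiS \<xi> l t b) \<longlongrightarrow> \<xi> b) (at 0 within half_plane l)"
      by simp
  next
    fix b
    have "poly_growth (half_plane l) (\<lambda>t. exp ((- (2 * of_real pi * \<i> * Z b)) / t) * \<xi> b *
       (\<Prod>\<gamma> | \<Omega> \<gamma> \<noteq> 0 \<and> Z \<gamma> \<in> half_plane l. Lambda_fun (Z \<gamma> / t) powi (\<lfloor>\<Omega> \<gamma>\<rfloor> * form b \<gamma>)))"
      using tw by (intro poly_growth_mult poly_growth_exp poly_growth_const poly_growth_prod poly_growth_powi
          poly_growth_Lambda[OF l]) (auto simp: twisted_character_def)
    hence "poly_growth (half_plane l) (\<lambda>t. PsiS \<xi> l t b)"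
      by (simp add: Psi_solution_def Psi_product_def)
    then obtain k R where kR: "k \<ge> 0" "R \<ge> 1" "\<And>t. t \<in> half_plane l \<Longrightarrow> norm t > R \<Longrightarrow>
        norm t powr (- k) \<le> norm (PsiS \<xi> l t b) \<and> norm (PsiS \<xi> l t b) \<le> norm t powr k"
      by (auto simp: poly_growth_def)
    have "norm t powr (- (k + 1)) < norm (PsiS \<xi> l t b) \<and>
        norm (PsiS \<xi> l t b) < norm t powr (k + 1)" if t: "t \<in> half_plane l" "norm t > R" for t
    proof -
      have "norm t powr (- (k + 1)) < norm t powr (- k)" "norm t powr k < norm t powr (k + 1)"
        using t kR by (auto intro!: powr_less_mono)
      thus ?thesis using kR(3)[OF t] by auto
    qed
    thus "\<exists>k>0. \<exists>R>0. \<forall>t\<in>half_plane l. R < norm t \<longrightarrow>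
       norm t powr (- k) < norm (PsiS \<xi> l t b) \<and> norm (PsiS \<xi> l t b) < norm t powr k"
      using kR by (intro exI[of _ "k + 1"] conjI exI[of _ R]) auto
  }
next
  fix l1 l2 t b
  assume "nonactive_ray Z \<Omega> l1" "nonactive_ray Z \<Omega> l2" "l1 \<subseteq> half_plane l2"
    "t \<in> half_plane l1 \<inter> half_plane l2"
  thus "PsiS \<xi> l2 t b = PsiS \<xi> l1 t b *
             (\<Prod>\<gamma> | \<Omega> \<gamma> \<noteq> 0 \<and> (\<exists>u\<in>l1. \<exists>w\<in>l2. Z \<gamma> = u + w).
                (1 - PsiS \<xi> l1 t \<gamma>) powi (\<lfloor>\<Omega> \<gamma>\<rfloor> * form \<gamma> b))"
    using Psi_solution_jump \<xi> by blast
qed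

end

section \<open>The Bose weight and sums over the frequencies\<close>

definition bose :: "real \<Rightarrow> real" where
  "bose u = 1 / (exp (2 * pi * u) - 1)"

lemma bose_bounds:
  assumes "u > 0"
  shows "bose u > 0" "u * bose u \<le> exp (- pi * u)"
proof -
  have "exp (2 * pi * u) > 1" using assms by simp
  thus b: "bose u > 0" by (simp add: bose_def)
  define y where "y = 2 * pi * u"
  have y: "y > 0" using assms by (simp add: y_def)
  have "1 + y \<le> exp y" by (rule exp_ge_add_one_self)
  hence "y * exp y \<le> (1 + y) * (exp y - 1)" by (simp add: algebra_simps)
  moreover have "exp y - 1 > 0" using y by simp
  ultimately have "y * (1 / (exp y - 1)) \<le> (1 + y) * exp (- y)"
    using exp_gt_zero[of y] by (simp add: exp_minus field_simps)
  also have "1 + y \<le> 2 * exp (y / 2)" using exp_ge_add_one_self[of "y / 2"] y by linarith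
  hence "(1 + y) * exp (- y) \<le> 2 * exp (y / 2) * exp (- y)" by (intro mult_right_mono) auto
  also have "\<dots> = 2 * exp (- pi * u)" by (simp add: mult_exp_exp y_def)
  finally have "2 * pi * (u * bose u) \<le> 2 * exp (- pi * u)" by (simp add: y_def bose_def)
  moreover have "2 * (u * bose u) \<le> 2 * pi * (u * bose u)"
    using pi_ge_two b assms by (intro mult_right_mono) auto
  ultimately show "u * bose u \<le> exp (- pi * u)" by linarith
qed

lemma exp_weight_eq: "exp u * exp (- k * u) = exp (- (k - 1) * u)" for u k :: real
  by (simp add: mult_exp_exp algebra_simps)

text \<open>The geometric series of \<open>bose\<close> turns sums over the frequencies into integrals.\<close>

lemma bose_integrable_sums:
  fixes f :: "real \<Rightarrow> complex"
  assumes m: "f \<in> borel_measurable halfline"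
    and C: "\<And>u. u > 0 \<Longrightarrow> norm (f u) \<le> C * (u * exp u)"
  shows "integrable halfline (\<lambda>u. of_real (bose u) * f u)"
    and "(\<lambda>m. LH u. of_real (exp (- freq m * u)) * f u) sums
         (LH u. of_real (bose u) * f u)"
    and "\<And>m. integrable halfline (\<lambda>u. of_real (exp (- freq m * u)) * f u)"
proof -
  have "0 \<le> C * exp 1" using C[of 1] norm_ge_zero[of "f 1"] by linarith
  hence C0: "C \<ge> 0" by (simp add: zero_le_mult_iff)
  have pi1: "pi - 1 > 0" using pi_ge_two by simp
  show "integrable halfline (\<lambda>u. of_real (bose u) * f u)"
  proof (rule integrable_halfline_bound)
    show "integrable halfline (\<lambda>u. C * (u ^ 0 * exp (- (pi - 1) * u)))"
      by (rule integrable_mult_right, rule integrable_power_exp_halfline[OF pi1])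
    have "bose \<in> borel_measurable borel" unfolding bose_def[abs_def] by measurable
    hence "(\<lambda>u. complex_of_real (bose u)) \<in> borel_measurable halfline"
      by (intro borel_measurable_halfline) measurable
    thus "(\<lambda>u. of_real (bose u) * f u) \<in> borel_measurable halfline" using m by measurable
    fix u :: real assume u: "u > 0"
    \<comment> \<open>The factor u in the majorant of \<open>f\<close> compensates the pole of
      \<open>bose\<close> at 0.\<close>
    have "bose u * norm (f u) \<le> bose u * (C * (u * exp u))"
      using C[OF u] bose_bounds[OF u] by (intro mult_left_mono) auto
    also have "\<dots> = C * exp u * (u * bose u)" by simp
    also have "\<dots> \<le> C * exp u * exp (- pi * u)"
      using C0 bose_bounds[OF u] by (intro mult_left_mono) auto
    also have "\<dots> = C * (u ^ 0 * exp (- (pi - 1) * u))"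
      using exp_weight_eq[of u pi] by simp
    finally show "norm (of_real (bose u) * f u) \<le> C * (u ^ 0 * exp (- (pi - 1) * u))"
      using bose_bounds[OF u] by (simp add: norm_mult)
  qed
  define k where "k m = 2 * pi * real (Suc m)" for m
  define g where "g m u = complex_of_real (exp (- k m * u)) * f u" for m u
  \<comment> \<open>The majorant costs one unit of the decay rate. What remains is at least m + 1,
    so the integrals are bounded by a multiple of 1 / (m + 1)^2.\<close>
  have k: "k m - 1 \<ge> real (Suc m)" for m
  proof -
    have "2 * real (Suc m) \<le> pi * real (Suc m)" using pi_ge_two by (intro mult_right_mono) auto
    thus ?thesis by (simp add: k_def)
  qed
  have k0: "k m - 1 > 0" for m using k[of m] by (simp add: less_le_trans)
  have gn: "norm (g m u) \<le> C * (u ^ 1 * exp (- (k m - 1) * u))" if u: "u > 0" for m u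
  proof -
    have "norm (g m u) \<le> exp (- k m * u) * (C * (u * exp u))"
      unfolding g_def using C[OF u] by (simp add: norm_mult mult_left_mono)
    also have "\<dots> = C * (u ^ 1 * (exp u * exp (- k m * u)))" by simp
    finally show ?thesis by (simp only: exp_weight_eq)
  qed
  have i0: "integrable halfline (\<lambda>u. C * (u ^ 1 * exp (- (k m - 1) * u)))" for m
    by (rule integrable_mult_right, rule integrable_power_exp_halfline[OF k0])
  have gi: "integrable halfline (g m)" for m
  proof (rule integrable_halfline_bound[OF i0 _ gn])
    have "(\<lambda>u. complex_of_real (exp (- k m * u))) \<in> borel_measurable halfline"
      by (rule borel_measurable_halfline) measurable
    thus "g m \<in> borel_measurable halfline" unfolding g_def using m by measurable
  qed auto
  have gI: "(LH u. norm (g m u)) \<le> C * (1 / (real (Suc m))\<^sup>2)" for m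
  proof -
    have "(LH u. norm (g m u)) \<le> (LH u. C * (u ^ 1 * exp (- (k m - 1) * u)))"
      using gi i0 gn by (intro integral_mono integrable_norm) auto
    also have "\<dots> = C * (1 / (k m - 1)\<^sup>2)"
      using integral_power_exp_halfline[OF k0[of m], of 1] by (simp add: power2_eq_square)
    also have "\<dots> \<le> C * (1 / (real (Suc m))\<^sup>2)"
      using k[of m] C0 by (intro mult_left_mono divide_left_mono power_mono mult_pos_pos zero_less_power) auto
    finally show ?thesis .
  qed
  have sums: "(\<lambda>m. integral\<^sup>L halfline (g m)) sums (LH u. (\<Sum>m. g m u))"
  proof (rule sums_integral[OF gi])
    show "AE u in halfline. summable (\<lambda>m. norm (g m u))"
    proof (rule AE_I2)
      fix u assume "u \<in> space halfline"
      hence u: "u > 0" by simp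
      have "norm (g m u) = (exp (- 2 * pi * u) * norm (f u)) * exp (- 2 * pi * u) ^ m" for m
        by (simp add: g_def k_def norm_mult exp_of_nat_mult[symmetric] mult_exp_exp algebra_simps)
      thus "summable (\<lambda>m. norm (g m u))" using u by (auto intro!: summable_mult summable_geometric)
    qed
    show "summable (\<lambda>m. LH u. norm (g m u))"
    proof (rule summable_comparison_test'[where N=0])
      show "summable (\<lambda>m. C * (1 / (real (Suc m))\<^sup>2))"
        using sums_summable[OF inverse_squares_sums] by (intro summable_mult) (simp add: add.commute)
      fix m
      have "0 \<le> (LH u. norm (g m u))" by (rule Bochner_Integration.integral_nonneg) simp
      thus "norm (LH u. norm (g m u)) \<le> C * (1 / (real (Suc m))\<^sup>2)" using gI by simp
    qed
  qed
  have "(\<Sum>m. g m u) = of_real (bose u) * f u" if u: "u > 0" for u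
  proof -
    define q where "q = exp (- 2 * pi * u)"
    have q: "0 < q" "q < 1" using u by (auto simp: q_def)
    have "exp (- k m * u) = q * q ^ m" for m
      by (simp add: q_def k_def exp_of_nat_mult[symmetric] mult_exp_exp algebra_simps)
    moreover have "(\<lambda>m. q * q ^ m) sums (q * (1 / (1 - q)))"
      using q by (intro sums_mult geometric_sums) simp
    moreover have "q * (1 / (1 - q)) = bose u"
      using q by (simp add: bose_def q_def exp_minus field_simps)
    ultimately have "(\<lambda>m. exp (- k m * u)) sums bose u" by simp
    hence "(\<lambda>m. g m u) sums (of_real (bose u) * f u)"
      unfolding g_def by (intro sums_mult2 sums_of_real)
    thus ?thesis by (simp add: sums_iff)
  qed
  hence "(LH u. (\<Sum>m. g m u)) = (LH u. of_real (bose u) * f u)"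
    by (intro Bochner_Integration.integral_cong) auto
  thus "(\<lambda>m. LH u. of_real (exp (- freq m * u)) * f u) sums
         (LH u. of_real (bose u) * f u)"
    using sums by (simp add: g_def[abs_def] k_def)
  show "integrable halfline (\<lambda>u. of_real (exp (- freq m * u)) * f u)" for m
    using gi[of m] by (simp add: g_def[abs_def] k_def)
qed

text \<open>The value is zeta(2) / (2 pi)^2. Through the constant part 2 ln (2 pi) of
  \<open>tau_kernel\<close> it produces the term ln (2 pi) / 12 in
  \<open>bose_tau_1\<close>.\<close>

lemma integral_u_bose: "(LH u. of_real (bose u) * of_real u) = (1 / 24 :: complex)"
proof -
  have "(\<lambda>m. LH u. of_real (exp (- freq m * u)) * complex_of_real u) sums
         (LH u. of_real (bose u) * of_real u)"
    by (rule bose_integrable_sums(2)[where C=1]) (auto intro!: borel_measurable_halfline)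
  moreover have "(LH u. of_real (exp (- freq m * u)) * complex_of_real u) =
      of_real (1 / (freq m)\<^sup>2)" for m
  proof -
    have k: "freq m > 0" by simp
    have "(LH u. of_real (exp (- freq m * u)) * complex_of_real u) =
      complex_of_real (LH u. u ^ 1 * exp (- freq m * u))"
      by (subst integral_complex_of_real[symmetric]) (simp add: mult.commute)
    also have "\<dots> = of_real (1 / (freq m)\<^sup>2)"
      unfolding integral_power_exp_halfline[OF k] by (simp add: power2_eq_square)
    finally show ?thesis .
  qed
  moreover have "(\<lambda>m. complex_of_real (1 / (freq m)\<^sup>2)) sums of_real (1 / 24)"
    by (intro sums_of_real sums_inverse_squares_2pi)
  ultimately show ?thesis using sums_unique2 by fastforce
qed

subsection \<open>The zeta function\<close>

lemma binet_kernel_sums: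
  fixes \<phi> :: "real \<Rightarrow> complex"
  assumes \<phi>: "integrable halfline \<phi>"
  shows "(\<lambda>m. LH l. \<phi> l * of_real (2 / (l\<^sup>2 + (freq m)\<^sup>2)))
     sums (LH l. \<phi> l * of_real (binet_kernel l))"
proof -
  define h where "h m l = 2 / (l\<^sup>2 + (freq m)\<^sup>2)" for m l
  define f where "f m l = \<phi> l * of_real (h m l)" for m l
  define c where "c m = 2 * (1 / (freq m)\<^sup>2)" for m
  have sc: "summable c" unfolding c_def by (rule sums_summable[OF sums_mult[OF sums_inverse_squares_2pi]])
  have h: "0 \<le> h m l" "h m l \<le> c m" for m l
    using binet_kernel_term_le[of l m] by (auto simp: h_def c_def)
  have nf: "norm (f m l) \<le> c m * norm (\<phi> l)" for m l
    using mult_right_mono[OF h(2), of "norm (\<phi> l)" m l] h(1)[of m l] by (simp add: f_def norm_mult mult.commute)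
  have fi: "integrable halfline (f m)" for m
  proof (rule integrable_halfline_bound)
    show "integrable halfline (\<lambda>l. c m * norm (\<phi> l))" using \<phi> by (intro integrable_mult_right integrable_norm)
    have "(\<lambda>l. complex_of_real (h m l)) \<in> borel_measurable halfline"
      unfolding h_def by (rule borel_measurable_halfline) measurable
    thus "f m \<in> borel_measurable halfline" unfolding f_def using \<phi> by measurable
  qed (rule nf)
  have "(\<lambda>m. integral\<^sup>L halfline (f m)) sums (LH l. (\<Sum>m. f m l))"
  proof (rule sums_integral[OF fi])
    show "AE l in halfline. summable (\<lambda>m. norm (f m l))"
      using nf by (intro AE_I2 summable_comparison_test'[OF summable_mult2[OF sc], of 0]) auto
    show "summable (\<lambda>m. LH l. norm (f m l))"
    proof (rule summable_comparison_test'[where N=0])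
      show "summable (\<lambda>m. c m * (LH l. norm (\<phi> l)))" by (rule summable_mult2[OF sc])
      fix m
      have "(LH l. norm (f m l)) \<le> (LH l. c m * norm (\<phi> l))"
        using fi \<phi> nf by (intro integral_mono integrable_mult_right integrable_norm) auto
      moreover have "(LH l. norm (f m l)) \<ge> 0" by (rule Bochner_Integration.integral_nonneg) simp
      ultimately show "norm (LH l. norm (f m l)) \<le> c m * (LH l. norm (\<phi> l))"
        by simp
    qed
  qed
  moreover have "(\<Sum>m. f m l) = \<phi> l * of_real (binet_kernel l)" for l
  proof -
    have "h m l = 2 / (l\<^sup>2 + (freq m)\<^sup>2)" for m by (simp add: h_def)
    hence "(\<lambda>m. h m l) sums binet_kernel l"
      unfolding binet_kernel_def by (simp only:) (rule summable_sums[OF summable_binet_kernel])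
    hence "(\<lambda>m. f m l) sums (\<phi> l * of_real (binet_kernel l))"
      unfolding f_def by (intro sums_mult sums_of_real)
    thus ?thesis by (simp add: sums_iff)
  qed
  ultimately show ?thesis unfolding f_def h_def by simp
qed

text \<open>This equals sin (s arctan u) / (1 + u^2)^(s/2), the integrand of Hermite's formula for
  zeta, in a form that is visibly entire in s.\<close>

definition hermite_kernel :: "complex \<Rightarrow> real \<Rightarrow> complex" where
  "hermite_kernel s u = ((1 - \<i> * of_real u) powr (- s) - (1 + \<i> * of_real u) powr (- s)) / (2 * \<i>)"

lemma power_le_exp: "\<exists>C>0. \<forall>u\<ge>0. (1 + u) ^ n \<le> C * exp (u::real)"
proof (cases "n = 0")
  case False
  have "(1 + u) ^ n \<le> real n ^ n * exp u" if "u \<ge> 0" for u :: real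
  proof -
    have n1: "real n \<ge> 1" using False by simp
    have "1 + u \<le> real n * (1 + u / real n)" using n1 by (simp add: field_simps)
    also have "\<dots> \<le> real n * exp (u / real n)" using exp_ge_add_one_self[of "u / real n"] n1 by (intro mult_left_mono) auto
    finally have "(1 + u) ^ n \<le> (real n * exp (u / real n)) ^ n" using that by (intro power_mono) auto
    also have "\<dots> = real n ^ n * exp u" using False by (simp add: power_mult_distrib exp_of_nat_mult[symmetric])
    finally show ?thesis .
  qed
  thus ?thesis using False by (intro exI[of _ "real n ^ n"]) auto
qed (auto intro!: exI[of _ 1])

text \<open>The constant is uniform over exponents in a disc, as differentiation in s under the
  integral requires. The parameter \<open>e\<close> runs along the vertical segment between 1 - i u
  and 1 + i u.\<close>

lemma norm_powr_vertical_le: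
  "\<exists>C>0. \<forall>s u e. norm s \<le> R \<and> \<bar>e\<bar> \<le> 1 \<and> u \<ge> 0 \<longrightarrow> norm ((1 + \<i> * of_real (e * u)) powr s) \<le> C * exp u"
proof -
  obtain n where n: "R \<le> real n" using real_arch_simple by blast
  obtain C where C: "C > 0" "\<And>u::real. u \<ge> 0 \<Longrightarrow> (1 + u) ^ n \<le> C * exp u" using power_le_exp by blast
  have "norm ((1 + \<i> * of_real (e * u)) powr s) \<le> (exp (real n * pi) * C) * exp u"
    if "norm s \<le> R" "\<bar>e\<bar> \<le> 1" "u \<ge> 0" for s e u
  proof -
    define w where "w = 1 + \<i> * complex_of_real (e * u)"
    have w0: "w \<noteq> 0" by (simp add: w_def complex_eq_iff)
    have w1: "norm w \<ge> 1" using complex_Re_le_cmod[of w] by (simp add: w_def)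
    have "norm w \<le> 1 + \<bar>e * u\<bar>" unfolding w_def by (rule order_trans[OF norm_triangle_ineq]) (simp add: norm_mult)
    also have "\<bar>e * u\<bar> \<le> 1 * u" unfolding abs_mult using that by (intro mult_mono) auto
    finally have w2: "norm w \<le> 1 + u" by simp
    have "norm (Ln w) \<le> \<bar>Re (Ln w)\<bar> + \<bar>Im (Ln w)\<bar>" by (rule cmod_le)
    also have "\<dots> \<le> ln (1 + u) + pi"
      using w0 w1 w2 Im_Ln_le_pi[of w] mpi_less_Im_Ln[of w] that by (intro add_mono) auto
    finally have L: "norm (Ln w) \<le> ln (1 + u) + pi" .
    have "Re (s * Ln w) \<le> norm s * norm (Ln w)" using complex_Re_le_cmod[of "s * Ln w"] by (simp add: norm_mult)
    also have "\<dots> \<le> real n * (ln (1 + u) + pi)" using that n L by (intro mult_mono) auto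
    finally have "norm (w powr s) \<le> exp (real n * (ln (1 + u) + pi))"
      using w0 by (simp add: powr_def)
    also have "\<dots> = exp (real n * pi) * (1 + u) ^ n"
      using that by (simp add: distrib_left exp_add exp_of_nat_mult)
    also have "\<dots> \<le> exp (real n * pi) * (C * exp u)" using C that by (intro mult_left_mono) auto
    finally show ?thesis by (simp add: w_def)
  qed
  thus ?thesis using C(1) by (intro exI[of _ "exp (real n * pi) * C"]) auto
qed

lemma vertical_slit: "1 + \<i> * complex_of_real u \<notin> \<real>\<^sub>\<le>\<^sub>0" "1 - \<i> * complex_of_real u \<notin> \<real>\<^sub>\<le>\<^sub>0"
  by (auto simp: complex_nonpos_Reals_iff)

lemma vertical_nonzero: "1 + \<i> * complex_of_real u \<noteq> 0" "1 - \<i> * complex_of_real u \<noteq> 0"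
  by (auto simp: complex_eq_iff)

text \<open>The mean value estimate along the segment from 1 - i u to 1 + i u, of length 2 u, yields
  the factor u that cancels the pole of \<open>bose\<close>.\<close>

lemma norm_hermite_kernel_le:
  "\<exists>C>0. \<forall>s u. norm s \<le> R \<and> u \<ge> 0 \<longrightarrow> norm (hermite_kernel s u) \<le> C * (u * exp u)"
proof (cases "R \<ge> 0")
  case True
  \<comment> \<open>The radius R + 1 is needed because the derivative of z powr (- s) has exponent -
    s - 1.\<close>
  obtain C where C: "C > 0" "\<And>s u e. norm s \<le> R + 1 \<Longrightarrow> \<bar>e\<bar> \<le> 1 \<Longrightarrow> u \<ge> 0 \<Longrightarrow>
      norm ((1 + \<i> * of_real (e * u)) powr s) \<le> C * exp u"
    using norm_powr_vertical_le[of "R + 1"] by blast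
  have "norm (hermite_kernel s u) \<le> ((R + 1) * C) * (u * exp u)" if s: "norm s \<le> R" and u: "u \<ge> 0" for s u
  proof -
    have "norm ((1 - \<i> * of_real u) powr (- s) - (1 + \<i> * of_real u) powr (- s)) \<le>
        (R * (C * exp u)) * norm ((1 - \<i> * of_real u) - (1 + \<i> * of_real u))"
    proof (rule field_differentiable_bound[where S="closed_segment (1 - \<i> * of_real u) (1 + \<i> * of_real u)"
          and f'="\<lambda>z. - s * z powr (- s - 1)"])
      fix z assume "z \<in> closed_segment (1 - \<i> * of_real u) (1 + \<i> * of_real u)"
      then obtain v where v: "0 \<le> v" "v \<le> 1"
        "z = (1 - v) *\<^sub>R (1 - \<i> * of_real u) + v *\<^sub>R (1 + \<i> * of_real u)"
        by (auto simp: closed_segment_def)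
      have z: "z = 1 + \<i> * of_real ((2 * v - 1) * u)"
        unfolding v(3) by (simp add: complex_eq_iff algebra_simps)
      hence "z \<notin> \<real>\<^sub>\<le>\<^sub>0" by (auto simp: complex_nonpos_Reals_iff)
      hence "((\<lambda>z. z powr (- s)) has_field_derivative - s * z powr (- s - 1)) (at z)"
        by (auto intro!: derivative_eq_intros)
      thus "((\<lambda>z. z powr (- s)) has_field_derivative - s * z powr (- s - 1))
          (at z within closed_segment (1 - \<i> * of_real u) (1 + \<i> * of_real u))"
        by (rule has_field_derivative_at_within)
      have "norm (- s - 1) \<le> R + 1" using s norm_triangle_ineq4[of "- s" 1] by simp
      hence "norm (z powr (- s - 1)) \<le> C * exp u"
        unfolding z using v u by (intro C) (auto simp: abs_le_iff)
      thus "norm (- s * z powr (- s - 1)) \<le> R * (C * exp u)"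
        using s True by (auto simp: norm_mult intro!: mult_mono)
    qed auto
    moreover have "norm ((1 - \<i> * complex_of_real u) - (1 + \<i> * of_real u)) = 2 * u"
      using u by (simp add: norm_mult)
    ultimately have "norm (hermite_kernel s u) \<le> R * (C * exp u) * (2 * u) / 2"
      by (simp add: hermite_kernel_def norm_divide norm_mult)
    also have "\<dots> = R * (C * (u * exp u))" by simp
    also have "\<dots> \<le> (R + 1) * (C * (u * exp u))" using C(1) u by (intro mult_right_mono) auto
    finally show ?thesis by simp
  qed
  thus ?thesis using C(1) True by (intro exI[of _ "(R + 1) * C"]) auto
next
  case False
  hence "\<not> norm s \<le> R" for s :: complex using norm_ge_zero[of s] by linarith
  thus ?thesis by (intro exI[of _ 1]) auto
qed

lemma measurable_hermite_kernel: "hermite_kernel s \<in> borel_measurable halfline"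
  unfolding hermite_kernel_def[abs_def]
  by (intro borel_measurable_continuous_halfline continuous_intros) (use vertical_slit vertical_nonzero in auto)

text \<open>Hermite's integral for zeta. Being holomorphic off 1, it is an explicit witness for the
  choice made in \<open>riemann_zeta\<close>.\<close>

definition hermite_zeta :: "complex \<Rightarrow> complex" where
  "hermite_zeta s = 1 / 2 + 1 / (s - 1) + 2 * (LH u. of_real (bose u) * hermite_kernel s u)"

definition hermite_kernel_deriv :: "complex \<Rightarrow> real \<Rightarrow> complex" where
  "hermite_kernel_deriv s u =
     ((1 + \<i> * of_real u) powr (- s) * Ln (1 + \<i> * of_real u) -
      (1 - \<i> * of_real u) powr (- s) * Ln (1 - \<i> * of_real u)) / (2 * \<i>)"

lemma hermite_zeta_deriv:
  assumes "s \<noteq> 1"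
  shows "(hermite_zeta has_field_derivative
     - 1 / (s - 1)\<^sup>2 + 2 * (LH u. of_real (bose u) * hermite_kernel_deriv s u)) (at s)"
proof -
  obtain C where C: "C > 0" "\<And>w u. norm w \<le> norm s + 1 \<Longrightarrow> u \<ge> 0 \<Longrightarrow> norm (hermite_kernel w u) \<le> C * (u * exp u)"
    using norm_hermite_kernel_le[of "norm s + 1"] by blast
  have "((\<lambda>s. LH u. of_real (bose u) * hermite_kernel s u) has_field_derivative
      (LH u. of_real (bose u) * hermite_kernel_deriv s u)) (at s)"
  proof (rule integral_parameter_derivative(2)[where S="ball s 1"])
    have nC: "norm (complex_of_real (C * (u * exp u))) \<le> C * (u * exp u)" if "u > 0" for u
      using C that by (simp add: norm_mult)
    have "integrable halfline (\<lambda>u. of_real (bose u) * complex_of_real (C * (u * exp u)))"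
      by (rule bose_integrable_sums(1)[OF _ nC]) (rule borel_measurable_halfline, measurable)
    hence "integrable halfline (\<lambda>u. norm (of_real (bose u) * complex_of_real (C * (u * exp u))))"
      by (rule integrable_norm)
    thus "integrable halfline (\<lambda>u. bose u * (C * (u * exp u)))"
      by (rule Bochner_Integration.integrable_cong[THEN iffD1, rotated -1])
         (use C bose_bounds in \<open>auto simp: norm_mult less_imp_le\<close>)
    fix w u assume w: "w \<in> ball s 1"
    have nw: "norm w \<le> norm s + 1"
      using w norm_triangle_ineq2[of w s] by (simp add: dist_norm norm_minus_commute)
    show "(\<lambda>u. of_real (bose u) * hermite_kernel w u) \<in> borel_measurable halfline"
    proof -
      have "bose \<in> borel_measurable borel" unfolding bose_def[abs_def] by measurable
      hence "(\<lambda>u. complex_of_real (bose u)) \<in> borel_measurable halfline"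
        by (intro borel_measurable_halfline) measurable
      thus ?thesis using measurable_hermite_kernel[of w] by measurable
    qed
    assume u: "u \<in> space halfline"
    show "norm (of_real (bose u) * hermite_kernel w u) \<le> bose u * (C * (u * exp u))"
      using C(2)[OF nw, of u] u bose_bounds[of u] by (simp add: norm_mult mult_left_mono)
    show "((\<lambda>w. of_real (bose u) * hermite_kernel w u) has_field_derivative of_real (bose u) * hermite_kernel_deriv w u) (at w)"
    proof -
      have d: "((\<lambda>s. z powr (- s)) has_field_derivative - (z powr (- s) * Ln z)) (at s)" if "z \<noteq> 0" for s z :: complex
        using that by (auto simp: powr_def intro!: derivative_eq_intros)
      show ?thesis
        unfolding hermite_kernel_def hermite_kernel_deriv_def
        using DERIV_cmult[OF DERIV_cdivide[OF DERIV_diff[OF d[OF vertical_nonzero(2)] d[OF vertical_nonzero(1)]]], of "of_real (bose u)" u u "2 * \<i>" w]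
        by simp
    qed
  qed auto
  thus ?thesis
    unfolding hermite_zeta_def[abs_def] using assms
    by (auto intro!: derivative_eq_intros simp: power2_eq_square)
qed

lemma hermite_zeta_holomorphic: "hermite_zeta holomorphic_on (- {1})"
  using hermite_zeta_deriv by (auto simp: holomorphic_on_open open_Compl)

text \<open>\<open>halfline_Fubini_exp\<close> with the Gamma integrand as density; the inner
  integral becomes a Gamma integral with the complex rate 1 - i e u.\<close>

lemma mellin_rotated:
  assumes s: "Re s > 1" and e: "\<bar>e\<bar> = 1" and k: "k \<ge> 2 * pi"
  shows "(LH l. complex_of_real l powr (s - 1) * exp (- of_real l) / (of_real k - \<i> * of_real (e * l))) =
     Gamma s * (LH u. of_real (exp (- k * u)) * (1 - \<i> * of_real (e * u)) powr (- s))"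
proof -
  have i: "integrable halfline (\<lambda>l. complex_of_real l powr (s - 1) * exp (- of_real l))"
    using integrable_Gamma_halfline[of s 1] s by simp
  have k0: "k > 0" using k pi_gt_zero by linarith
  have "(LH l. complex_of_real l powr (s - 1) * exp (- of_real l) * exp (\<i> * of_real (e * l * u))) =
     Gamma s * (1 - \<i> * of_real (e * u)) powr (- s)" for u
  proof -
    have "complex_of_real l powr (s - 1) * exp (- of_real l) * exp (\<i> * of_real (e * l * u)) =
       complex_of_real l powr (s - 1) * exp (- ((1 - \<i> * of_real (e * u)) * of_real l))" for l
      by (simp only: mult.assoc mult_exp_exp) (simp add: algebra_simps)
    thus ?thesis by (simp only:) (rule integral_Gamma_halfline, use s in auto)
  qed
  moreover have "exp (- complex_of_real (k * u)) = of_real (exp (- k * u))" for u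
    using exp_of_real[of "- k * u", where 'a=complex] by simp
  ultimately show ?thesis unfolding halfline_Fubini_exp[OF i k0, of e]
    by (simp only: mult.left_commute[of "complex_of_real _" "Gamma s"] integral_mult_right_zero)
qed

lemma integrable_vertical_powr:
  assumes "\<bar>e\<bar> = 1" "k \<ge> 2 * pi"
  shows "integrable halfline (\<lambda>u. of_real (exp (- k * u)) * (1 - \<i> * of_real (e * u)) powr (- s))"
proof -
  obtain C where C0: "C > 0" "\<forall>s' u e. norm s' \<le> norm s \<and> \<bar>e\<bar> \<le> 1 \<and> u \<ge> 0 \<longrightarrow>
      norm ((1 + \<i> * of_real (e * u)) powr s') \<le> C * exp u"
    using norm_powr_vertical_le[of "norm s"] by blast
  have C: "C > 0" "norm ((1 + \<i> * of_real (e * u)) powr (- s)) \<le> C * exp u" if "\<bar>e\<bar> \<le> 1" "u \<ge> 0" for u e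
    using C0 that by auto
  have k1: "k - 1 > 0" using assms pi_ge_two by linarith
  show ?thesis
  proof (rule integrable_halfline_bound)
  show "integrable halfline (\<lambda>u. C * (u ^ 0 * exp (- (k - 1) * u)))"
    by (rule integrable_mult_right, rule integrable_power_exp_halfline[OF k1])
  show "(\<lambda>u. of_real (exp (- k * u)) * (1 - \<i> * of_real (e * u)) powr (- s)) \<in> borel_measurable halfline"
    by (intro borel_measurable_continuous_halfline continuous_intros) (auto simp: complex_nonpos_Reals_iff)
  fix u :: real assume "u > 0"
  hence "exp (- k * u) * norm ((1 - \<i> * of_real (e * u)) powr (- s)) \<le> exp (- k * u) * (C * exp u)"
    using C(2)[of "- e" u] assms by (intro mult_left_mono) auto
  also have "\<dots> = C * (u ^ 0 * (exp u * exp (- k * u)))" by simp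
  finally show "norm (of_real (exp (- k * u)) * (1 - \<i> * of_real (e * u)) powr (- s)) \<le> C * (u ^ 0 * exp (- (k - 1) * u))"
    unfolding exp_weight_eq by (simp add: norm_mult)
qed
qed

text \<open>Each summand of the kernel splits into the simple fractions 1 / (k - i l) and 1 / (k + i
  l). After the exchange of integrals their difference carries exactly
  \<open>hermite_kernel\<close>, and the sum over k restores \<open>bose\<close>.\<close>

lemma mellin_binet_kernel:
  assumes s: "Re s > 1"
  shows "(LH l. complex_of_real l powr s * exp (- of_real l) * of_real (binet_kernel l)) =
     2 * Gamma s * (LH u. of_real (bose u) * hermite_kernel s u)"
proof -
  have int: "integrable halfline (\<lambda>l. complex_of_real l powr s * exp (- of_real l))"
    using integrable_Gamma_halfline[of "s + 1" 1] s by simp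
  have trm: "(LH l. complex_of_real l powr s * exp (- of_real l) * of_real (2 / (l\<^sup>2 + k\<^sup>2))) =
     2 * Gamma s * (LH u. of_real (exp (- k * u)) * hermite_kernel s u)" if k: "k \<ge> 2 * pi" for k
  proof -
    have k0: "k > 0" using k pi_gt_zero by linarith
    define \<phi> where "\<phi> l = complex_of_real l powr (s - 1) * exp (- of_real l)" for l
    define A where "A e l = \<phi> l / (of_real k - \<i> * of_real (e * l))" for e l :: real
    define B where "B e u = of_real (exp (- k * u)) * (1 - \<i> * of_real (e * u)) powr (- s)" for e u :: real
    have nzk: "of_real k - \<i> * of_real l \<noteq> 0" "of_real k + \<i> * of_real l \<noteq> 0" for l
      using k0 by (auto simp: complex_eq_iff)
    have pk: "(of_real k - \<i> * of_real l) * (of_real k + \<i> * of_real l) = of_real (l\<^sup>2 + k\<^sup>2)" for l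
      by (simp add: algebra_simps power2_eq_square)
    have iA: "integrable halfline (A e)" for e
    proof (rule integrable_halfline_bound)
      have i\<phi>: "integrable halfline \<phi>"
        unfolding \<phi>_def using integrable_Gamma_halfline[of s 1] s by simp
      thus "integrable halfline (\<lambda>l. norm (\<phi> l) * (1 / k))" by (intro integrable_mult_left integrable_norm)
      have "(\<lambda>l. of_real k - \<i> * complex_of_real (e * l)) \<in> borel_measurable halfline"
        by (rule borel_measurable_halfline) measurable
      thus "A e \<in> borel_measurable halfline" unfolding A_def using i\<phi> by measurable
      fix l
      have "k \<le> norm (of_real k - \<i> * of_real (e * l))"
        using complex_Re_le_cmod[of "of_real k - \<i> * of_real (e * l)"] by simp
      hence "1 / norm (of_real k - \<i> * of_real (e * l)) \<le> 1 / k" using k0 by (intro divide_left_mono mult_pos_pos) auto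
      hence "norm (\<phi> l) * (1 / norm (of_real k - \<i> * of_real (e * l))) \<le> norm (\<phi> l) * (1 / k)"
        by (intro mult_left_mono) auto
      thus "norm (A e l) \<le> norm (\<phi> l) * (1 / k)" by (simp add: A_def norm_divide)
    qed
    have iB: "integrable halfline (B e)" if "\<bar>e\<bar> = 1" for e
      unfolding B_def by (rule integrable_vertical_powr[OF that k])
    have AB: "integral\<^sup>L halfline (A e) = Gamma s * integral\<^sup>L halfline (B e)" if "\<bar>e\<bar> = 1" for e
      unfolding A_def B_def \<phi>_def by (rule mellin_rotated[OF s that k])
    have "(LH l. complex_of_real l powr s * exp (- of_real l) * of_real (2 / (l\<^sup>2 + k\<^sup>2))) =
       (LH l. (A 1 l - A (-1) l) / \<i>)"
    proof (rule Bochner_Integration.integral_cong[OF refl])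
      fix l assume "l \<in> space halfline"
      hence l: "l > 0" by simp
      have "A 1 l - A (-1) l = \<phi> l * (2 * \<i> * of_real l) / ((of_real k - \<i> * of_real l) * (of_real k + \<i> * of_real l))"
        using nzk[of l] by (simp add: A_def field_simps)
      hence "(A 1 l - A (-1) l) / \<i> = (\<phi> l * of_real l) * (2 / of_real (l\<^sup>2 + k\<^sup>2))"
      proof -
        have q: "(a * (2 * \<i> * b) / N) / \<i> = a * b * (2 / N)" for a b N :: complex
        proof -
          have "a * (2 * \<i> * b) / N = \<i> * (a * b * (2 / N))" by (simp only: times_divide_eq_right mult_ac)
          thus ?thesis by (simp only:) (rule nonzero_mult_div_cancel_left, simp)
        qed
        show ?thesis unfolding \<open>A 1 l - A (-1) l = _\<close> pk by (rule q)
      qed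
      also have "\<phi> l * of_real l = complex_of_real l powr s * exp (- of_real l)"
        using l by (simp add: \<phi>_def powr_diff)
      finally show "complex_of_real l powr s * exp (- of_real l) * of_real (2 / (l\<^sup>2 + k\<^sup>2)) = (A 1 l - A (-1) l) / \<i>"
        by simp
    qed
    also have "\<dots> = (Gamma s * integral\<^sup>L halfline (B 1) - Gamma s * integral\<^sup>L halfline (B (-1))) / \<i>"
      using iA AB[of 1] AB[of "-1"] by simp
    also have "\<dots> = 2 * Gamma s * (LH u. (B 1 u - B (-1) u) / (2 * \<i>))"
      using iB[of 1] iB[of "-1"] by (simp add: right_diff_distrib diff_divide_distrib)
    also have "(\<lambda>u. (B 1 u - B (-1) u) / (2 * \<i>)) = (\<lambda>u. of_real (exp (- k * u)) * hermite_kernel s u)"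
      by (simp add: B_def hermite_kernel_def fun_eq_iff right_diff_distrib)
    finally show ?thesis .
  qed
  obtain C where C: "\<And>u. u \<ge> 0 \<Longrightarrow> norm (hermite_kernel s u) \<le> C * (u * exp u)"
    using norm_hermite_kernel_le[of "norm s"] by blast
  have "(\<lambda>m. LH u. of_real (exp (- freq m * u)) * hermite_kernel s u) sums
         (LH u. of_real (bose u) * hermite_kernel s u)"
    by (rule bose_integrable_sums(2)[OF measurable_hermite_kernel, where C=C]) (use C in auto)
  hence "(\<lambda>m. 2 * Gamma s * (LH u. of_real (exp (- freq m * u)) * hermite_kernel s u)) sums
         (2 * Gamma s * (LH u. of_real (bose u) * hermite_kernel s u))"
    by (rule sums_mult)
  moreover have "2 * Gamma s * (LH u. of_real (exp (- freq m * u)) * hermite_kernel s u) =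
     (LH l. complex_of_real l powr s * exp (- of_real l) * of_real (2 / (l\<^sup>2 + (freq m)\<^sup>2)))" for m
    by (rule trm[symmetric]) simp
  ultimately show ?thesis using binet_kernel_sums[OF int] sums_unique2 by fastforce
qed

text \<open>Gamma s times the Dirichlet series is the Mellin transform of exp (-l) / (1 - exp (-l)).
  Writing 1 / (1 - exp (-l)) = 1/2 + 1/l + l * \<open>binet_kernel l\<close> splits it into the
  three terms of \<open>hermite_zeta\<close>; Re s > 1 makes the part with 1/l integrable.\<close>

lemma hermite_zeta_sums:
  assumes s: "Re s > 1"
  shows "(\<lambda>n. 1 / of_nat (Suc n) powr s) sums hermite_zeta s"
proof -
  define f where "f n l = complex_of_real l powr (s - 1) * exp (- (of_nat (Suc n) * of_real l))" for n l
  have fi: "integrable halfline (f n)" for n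
    unfolding f_def using integrable_Gamma_halfline[of s "of_nat (Suc n)"] s by simp
  have fI: "integral\<^sup>L halfline (f n) = Gamma s * (1 / of_nat (Suc n) powr s)" for n
    unfolding f_def using integral_Gamma_halfline[of s "of_nat (Suc n)"] s by (simp add: powr_minus_divide)
  have nf: "norm (f n l) = l powr (Re s - 1) * exp (- real (Suc n) * l)" if "l > 0" for n l
    using that by (simp add: f_def norm_mult norm_of_real_powr algebra_simps)
  have "(\<lambda>n. integral\<^sup>L halfline (f n)) sums (LH l. (\<Sum>n. f n l))"
  proof (rule sums_integral[OF fi])
    show "AE l in halfline. summable (\<lambda>n. norm (f n l))"
    proof (rule AE_I2)
      fix l assume "l \<in> space halfline"
      hence l: "l > 0" by simp
      have "norm (f n l) = (l powr (Re s - 1) * exp (- l)) * exp (- l) ^ n" for n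
        unfolding nf[OF l] by (simp add: exp_of_nat_mult[symmetric] mult_exp_exp algebra_simps)
      thus "summable (\<lambda>n. norm (f n l))" using l by (auto intro!: summable_mult summable_geometric)
    qed
    have "(LH l. norm (f n l)) = Gamma (Re s) * (1 / real (Suc n) powr Re s)" for n
    proof -
      have "complex_of_real (LH l. norm (f n l)) =
        (LH l. complex_of_real l powr (of_real (Re s) - 1) * exp (- (of_nat (Suc n) * of_real l)))"
      proof (subst integral_complex_of_real[symmetric], rule Bochner_Integration.integral_cong[OF refl])
        fix l assume "l \<in> space halfline"
        hence l: "l > 0" by simp
        have "complex_of_real (l powr (Re s - 1)) = complex_of_real l powr (of_real (Re s) - 1)"
          using powr_of_real[of l "Re s - 1"] l by simp
        moreover have "complex_of_real (exp (- real (Suc n) * l)) = exp (- (of_nat (Suc n) * of_real l))"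
          by (simp only: exp_of_real[symmetric] of_real_mult of_real_minus of_real_of_nat_eq mult_minus_left)
        ultimately show "complex_of_real (norm (f n l)) =
            complex_of_real l powr (of_real (Re s) - 1) * exp (- (of_nat (Suc n) * of_real l))"
          unfolding nf[OF l] of_real_mult by (simp only:)
      qed
      also have "\<dots> = Gamma (of_real (Re s)) * of_nat (Suc n) powr (- of_real (Re s))"
        using integral_Gamma_halfline[of "of_real (Re s)" "of_nat (Suc n)"] s by simp
      also have "\<dots> = complex_of_real (Gamma (Re s) * (1 / real (Suc n) powr Re s))"
        using powr_of_real[of "real (Suc n)" "- Re s"]
        by (simp add: Gamma_complex_of_real powr_minus_divide)
      finally show ?thesis unfolding of_real_eq_iff .
    qed
    moreover have "summable (\<lambda>n. 1 / real (Suc n) powr Re s)"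
      using summable_Suc_iff[of "\<lambda>n. real n powr (- Re s)"] summable_real_powr_iff[of "- Re s"] s
      by (simp add: powr_minus_divide)
    ultimately show "summable (\<lambda>n. LH l. norm (f n l))" by (simp only: summable_mult)
  qed
  also have "(LH l. (\<Sum>n. f n l)) = (LH l. complex_of_real l powr (s - 1) * exp (- of_real l) / 2 +
      complex_of_real l powr ((s - 1) - 1) * exp (- of_real l) +
      complex_of_real l powr s * exp (- of_real l) * of_real (binet_kernel l))"
  proof (rule Bochner_Integration.integral_cong[OF refl])
    fix l assume "l \<in> space halfline"
    hence l: "l > 0" by simp
    define P where "P = complex_of_real l powr (s - 1) * exp (- of_real l)"
    have "f n l = P * of_real (exp (- l)) ^ n" for n
      by (simp add: f_def P_def exp_of_nat_mult[symmetric] mult_exp_exp algebra_simps flip: exp_of_real)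
    moreover have "(\<lambda>n. complex_of_real (exp (- l)) ^ n) sums (1 / (1 - of_real (exp (- l))))"
      using l by (intro geometric_sums) (simp only: norm_of_real, simp)
    ultimately have "(\<lambda>n. f n l) sums (P * (1 / (1 - of_real (exp (- l)))))" by (simp only: sums_mult)
    hence "(\<Sum>n. f n l) = P * of_real (1 / (1 - exp (- l)))" by (simp add: sums_iff)
    also have "1 / (1 - exp (- l)) = 1 / 2 + 1 / l + l * binet_kernel l"
      using binet_kernel_mult[OF l] by simp
    also have "P * of_real (1 / 2 + 1 / l + l * binet_kernel l) =
       P / 2 + (complex_of_real l powr ((s - 1) - 1) * exp (- of_real l)) +
       complex_of_real l powr s * exp (- of_real l) * of_real (binet_kernel l)"
    proof -
      have "complex_of_real l powr ((s - 1) - 1) = complex_of_real l powr (s - 1) / of_real l"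
        using l powr_diff[of "complex_of_real l" "s - 1" 1] by simp
      moreover have "complex_of_real l powr s = complex_of_real l powr (s - 1) * of_real l"
        using l by (simp add: powr_diff)
      moreover have "p * E * of_real (1 / 2 + 1 / l + l * B) = p * E / 2 + p / of_real l * E + p * of_real l * E * of_real B"
        for p E :: complex and B
        by (simp add: algebra_simps)
      ultimately show ?thesis unfolding P_def by (simp only:)
    qed
    finally show "(\<Sum>n. f n l) = complex_of_real l powr (s - 1) * exp (- of_real l) / 2 +
      complex_of_real l powr ((s - 1) - 1) * exp (- of_real l) +
      complex_of_real l powr s * exp (- of_real l) * of_real (binet_kernel l)" by (simp add: P_def)
  qed
  also have "\<dots> = Gamma s / 2 + Gamma (s - 1) + 2 * Gamma s * (LH u. of_real (bose u) * hermite_kernel s u)"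
  proof -
    have i1: "integrable halfline (\<lambda>l. complex_of_real l powr (s - 1) * exp (- of_real l))"
      using integrable_Gamma_halfline[of s 1] s by simp
    have i2: "integrable halfline (\<lambda>l. complex_of_real l powr ((s - 1) - 1) * exp (- of_real l))"
      using integrable_Gamma_halfline[of "s - 1" 1] s by simp
    have i3: "integrable halfline (\<lambda>l. complex_of_real l powr s * exp (- of_real l) * of_real (binet_kernel l))"
    proof (rule integrable_halfline_bound)
      have i: "integrable halfline (\<lambda>l. complex_of_real l powr s * exp (- of_real l))"
        using integrable_Gamma_halfline[of "s + 1" 1] s by simp
      thus "integrable halfline (\<lambda>l. norm (complex_of_real l powr s * exp (- of_real l)))" by (rule integrable_norm)
      have "(\<lambda>l. complex_of_real (binet_kernel l)) \<in> borel_measurable halfline"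
        by (rule borel_measurable_halfline) measurable
      thus "(\<lambda>l. complex_of_real l powr s * exp (- of_real l) * of_real (binet_kernel l)) \<in> borel_measurable halfline"
        using i by measurable
      fix l :: real
      have "\<bar>binet_kernel l\<bar> \<le> 1" using binet_kernel_nonneg[of l] binet_kernel_le[of l] by simp
      thus "norm (complex_of_real l powr s * exp (- of_real l) * of_real (binet_kernel l)) \<le>
          norm (complex_of_real l powr s * exp (- of_real l))"
        by (simp add: norm_mult mult_left_le)
    qed
    show ?thesis
      using i1 i2 i3 integral_Gamma_halfline_1[of s] integral_Gamma_halfline_1[of "s - 1"] s mellin_binet_kernel[OF s]
      by simp
  qed
  also have "\<dots> = Gamma s * hermite_zeta s"
  proof -
    have "s - 1 \<notin> \<int>\<^sub>\<le>\<^sub>0" using s by (auto elim!: nonpos_Ints_cases simp: complex_eq_iff)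
    hence "Gamma s = (s - 1) * Gamma (s - 1)" using Gamma_plus1[of "s - 1"] by simp
    moreover have "s - 1 \<noteq> 0" using s by auto
    ultimately have "Gamma (s - 1) = Gamma s / (s - 1)" by simp
    thus ?thesis by (simp add: hermite_zeta_def ring_distribs)
  qed
  finally have "(\<lambda>n. Gamma s * (1 / of_nat (Suc n) powr s)) sums (Gamma s * hermite_zeta s)" unfolding fI .
  moreover have "Gamma s \<noteq> 0" using s by (auto simp: Gamma_eq_zero_iff elim!: nonpos_Ints_cases)
  ultimately show ?thesis by (subst (asm) sums_mult_iff)
qed

text \<open>Whatever function the choice returns, it has the same Dirichlet series for Re s > 1, and
  the punctured plane is connected, so the identity theorem applies. The value at 1 stays
  undetermined.\<close>

lemma riemann_zeta_eq:
  assumes "s \<noteq> 1"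
  shows "riemann_zeta s = hermite_zeta s"
proof -
  have "riemann_zeta holomorphic_on (- {1}) \<and> (\<forall>s. Re s > 1 \<longrightarrow> (\<lambda>n. 1 / of_nat (Suc n) powr s) sums riemann_zeta s)"
    unfolding riemann_zeta_def
    by (rule someI[where x=hermite_zeta]) (use hermite_zeta_holomorphic hermite_zeta_sums in auto)
  hence R: "riemann_zeta holomorphic_on (- {1})" "\<And>s. Re s > 1 \<Longrightarrow> (\<lambda>n. 1 / of_nat (Suc n) powr s) sums riemann_zeta s"
    by auto
  show ?thesis
  proof (rule analytic_continuation_open[where s="{s. Re s > 1}" and s'="- {1}" and f=riemann_zeta and g=hermite_zeta and z=s])
    show "open {s. Re s > 1}" by (rule open_halfspace_Re_gt)
    show "{s. Re s > 1} \<noteq> {}" by (auto intro!: exI[of _ 2])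
    show "connected (- {1 :: complex})" by (rule connected_punctured_universe) simp
    show "riemann_zeta z = hermite_zeta z" if "z \<in> {s. Re s > 1}" for z
      using R(2) hermite_zeta_sums that sums_unique2 by blast
  qed (use assms R hermite_zeta_holomorphic in auto)
qed

text \<open>Hermite's integral is differentiated in s. At s = -1 the powers become linear in u, and
  the logarithms of 1 + i u and 1 - i u split into modulus and arctan.\<close>

lemma deriv_riemann_zeta_minus_1:
  "deriv riemann_zeta (-1) = - 1 / 4 + 2 * (LH u. of_real (bose u * (arctan u + u / 2 * ln (1 + u\<^sup>2))))"
proof -
  have "(riemann_zeta has_field_derivative
     - 1 / ((-1) - 1)\<^sup>2 + 2 * (LH u. of_real (bose u) * hermite_kernel_deriv (-1) u)) (at (-1))"
    by (rule has_field_derivative_transform_within_open[OF hermite_zeta_deriv, of _ "- {1}"])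
       (auto simp: riemann_zeta_eq open_Compl)
  hence "deriv riemann_zeta (-1) = - 1 / ((-1) - 1)\<^sup>2 + 2 * (LH u. of_real (bose u) * hermite_kernel_deriv (-1) u)"
    by (rule DERIV_imp_deriv)
  moreover have "hermite_kernel_deriv (-1) u = of_real (arctan u + u / 2 * ln (1 + u\<^sup>2))" for u
  proof -
    have r: "norm (1 + \<i> * complex_of_real u) = sqrt (1 + u\<^sup>2)" "norm (1 - \<i> * complex_of_real u) = sqrt (1 + u\<^sup>2)"
      by (simp_all add: cmod_def)
    have l: "ln (sqrt (1 + u\<^sup>2)) = ln (1 + u\<^sup>2) / 2" by (simp add: ln_sqrt add_pos_nonneg)
    have "Ln (1 + \<i> * of_real u) = of_real (ln (1 + u\<^sup>2) / 2) + \<i> * of_real (arctan u)"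
      using Im_Ln_eq[OF vertical_nonzero(1)[of u]] r(1) l vertical_nonzero(1)[of u] by (simp add: complex_eq_iff)
    moreover have "Ln (1 - \<i> * of_real u) = of_real (ln (1 + u\<^sup>2) / 2) - \<i> * of_real (arctan u)"
      using Im_Ln_eq[OF vertical_nonzero(2)[of u]] r(2) l vertical_nonzero(2)[of u] by (simp add: complex_eq_iff arctan_minus)
    moreover have "((1 + \<i> * v) * (A + \<i> * B) - (1 - \<i> * v) * (A - \<i> * B)) / (2 * \<i>) = B + v * A" for v A B
      by (simp add: field_simps)
    moreover have "(1 + \<i> * complex_of_real u) powr (- (- 1)) = 1 + \<i> * of_real u"
      "(1 - \<i> * complex_of_real u) powr (- (- 1)) = 1 - \<i> * of_real u"
      using vertical_nonzero by (simp_all add: powr_def)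
    ultimately have "hermite_kernel_deriv (-1) u = of_real (arctan u) + of_real u * of_real (ln (1 + u\<^sup>2) / 2)"
      unfolding hermite_kernel_deriv_def by (simp only:)
    thus ?thesis by simp
  qed
  ultimately show ?thesis by simp
qed

subsection \<open>The Barnes function\<close>

definition Barnes_term :: "nat \<Rightarrow> complex \<Rightarrow> complex" where
  "Barnes_term k z = of_nat (Suc k) * Ln (1 + z / of_nat (Suc k)) + (z\<^sup>2 / (2 * of_nat (Suc k)) - z)"

text \<open>Instead of the terms, their derivatives z^2 / (n (n + z)) are dominated by a multiple of
  1 / n^2, and all terms vanish at the base point 0. The series of derivatives is z times a Digamma
  series.\<close>

lemma Barnes_term_series:
  assumes z: "Re z > 0"
  shows "summable (\<lambda>k. Barnes_term k z)"
    and "((\<lambda>z. \<Sum>k. Barnes_term k z) has_field_derivative z * (Digamma (z + 1) + euler_mascheroni)) (at z)"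
proof -
  define R where "R = norm z + 1"
  \<comment> \<open>The half-plane reaches to the left of the imaginary axis so that the base point
    0 is included; on it n + Re w \<ge> n / 2 still holds.\<close>
  define S where "S = {w. Re w > - 1 / 2} \<inter> ball 0 R"
  define d where "d k w = w\<^sup>2 / (of_nat (Suc k) * (of_nat (Suc k) + w))" for k and w :: complex
  have S: "convex S" unfolding S_def by (intro convex_Int convex_halfspace_Re_gt convex_ball)
  have oS: "open S" unfolding S_def by (intro open_Int open_halfspace_Re_gt open_ball)
  have "z \<in> S" using z by (simp add: S_def R_def)
  hence zS: "z \<in> interior S" by (simp only: interior_open[OF oS])
  have der: "(Barnes_term k has_field_derivative d k w) (at w within S)" if w: "w \<in> S" for k w
  proof -
    define n :: complex where "n = of_nat (Suc k)"
    have Rn: "Re n \<ge> 1" "Im n = 0" by (simp_all add: n_def)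
    have n0: "n \<noteq> 0" using Rn by auto
    have nw: "n + w \<noteq> 0"
    proof
      assume "n + w = 0"
      hence "Re n + Re w = 0" by (metis plus_complex.sel(1) zero_complex.sel(1))
      thus False using w Rn by (simp add: S_def)
    qed
    have "Re (w / n) > - 1"
    proof -
      have "w / n = w / of_real (real (Suc k))" by (simp add: n_def)
      hence "Re (w / n) = Re w / real (Suc k)" by (simp only: Re_divide_of_real)
      moreover have "- 1 * real (Suc k) < Re w" using w by (simp add: S_def)
      ultimately show ?thesis by (simp only: pos_less_divide_eq of_nat_0_less_iff zero_less_Suc)
    qed
    hence sl: "1 + w / n \<notin> \<real>\<^sub>\<le>\<^sub>0" by (auto simp: complex_nonpos_Reals_iff)
    have "((\<lambda>w. n * Ln (1 + w / n) + (w\<^sup>2 / (2 * n) - w)) has_field_derivative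
       n * ((1 / n) / (1 + w / n)) + (2 * w / (2 * n) - 1)) (at w within S)"
      using sl n0 by (auto intro!: derivative_eq_intros simp: inverse_eq_divide)
    also have "n * ((1 / n) / (1 + w / n)) + (2 * w / (2 * n) - 1) = w\<^sup>2 / (n * (n + w))"
      using n0 nw by (simp add: field_simps power2_eq_square)
    finally show ?thesis by (simp add: Barnes_term_def[abs_def] d_def n_def)
  qed
  have uc: "uniformly_convergent_on S (\<lambda>n w. \<Sum>i<n. d i w)"
  proof (rule Weierstrass_m_test'_ev)
    show "summable (\<lambda>k. 2 * R\<^sup>2 * (1 / (real (Suc k))\<^sup>2))"
      using sums_summable[OF inverse_squares_sums] by (intro summable_mult) (simp add: add.commute)
    show "\<forall>\<^sub>F k in sequentially. \<forall>w\<in>S. norm (d k w) \<le> 2 * R\<^sup>2 * (1 / (real (Suc k))\<^sup>2)"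
    proof (intro always_eventually allI ballI)
      fix k w assume w: "w \<in> S"
      define n where "n = real (Suc k)"
      have n: "n \<ge> 1" by (simp add: n_def)
      have "n / 2 \<le> n + Re w" using w n by (simp add: S_def)
      also have "\<dots> \<le> norm (of_real n + w)" using complex_Re_le_cmod[of "of_real n + w"] by simp
      finally have a: "n / 2 \<le> norm (of_real n + w)" .
      have "norm (d k w) = (norm w)\<^sup>2 / (n * norm (of_real n + w))"
        by (simp add: d_def n_def norm_divide norm_mult norm_power del: of_nat_Suc)
      also have "\<dots> \<le> R\<^sup>2 / (n * (n / 2))"
        using w a n by (intro frac_le mult_left_mono power_mono mult_pos_pos) (auto simp: S_def)
      also have "\<dots> = 2 * R\<^sup>2 * (1 / n\<^sup>2)" by (simp add: power2_eq_square)
      finally show "norm (d k w) \<le> 2 * R\<^sup>2 * (1 / (real (Suc k))\<^sup>2)" by (simp add: n_def)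
    qed
  qed
  have "0 \<in> S" by (simp add: S_def R_def add_nonneg_pos)
  moreover have "summable (\<lambda>k. Barnes_term k 0)" by (simp add: Barnes_term_def)
  ultimately have res: "summable (\<lambda>k. Barnes_term k z)"
    "((\<lambda>z. \<Sum>k. Barnes_term k z) has_field_derivative (\<Sum>k. d k z)) (at z)"
    using has_field_derivative_series'[OF S der uc, of 0 z] zS by auto
  show "summable (\<lambda>k. Barnes_term k z)" by (rule res(1))
  have z1: "z + 1 \<noteq> 0" using z by (auto simp: complex_eq_iff)
  have "(\<lambda>n. inverse (of_nat (Suc n)) - inverse (z + 1 + of_nat n)) sums (Digamma (z + 1) + euler_mascheroni)"
    using summable_sums[OF summable_Digamma[OF z1]] by (simp add: Digamma_def)
  hence "(\<lambda>n. z * (inverse (of_nat (Suc n)) - inverse (z + 1 + of_nat n))) sums (z * (Digamma (z + 1) + euler_mascheroni))"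
    by (rule sums_mult)
  moreover have "z * (inverse (of_nat (Suc n)) - inverse (z + 1 + of_nat n)) = d n z" for n
  proof -
    have e: "z + 1 + of_nat n = of_nat (Suc n) + z" by simp
    have "of_nat (Suc n) + z \<noteq> 0" using z by (auto simp: complex_eq_iff)
    moreover have "complex_of_nat (Suc n) \<noteq> 0" by (simp del: of_nat_Suc)
    ultimately show ?thesis unfolding d_def e by (simp add: field_simps power2_eq_square del: of_nat_Suc)
  qed
  ultimately have "(\<Sum>k. d k z) = z * (Digamma (z + 1) + euler_mascheroni)" by (simp add: sums_iff)
  thus "((\<lambda>z. \<Sum>k. Barnes_term k z) has_field_derivative z * (Digamma (z + 1) + euler_mascheroni)) (at z)"
    using res(2) by simp
qed

definition ln_Barnes :: "complex \<Rightarrow> complex" where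
  "ln_Barnes z = z / 2 * of_real (ln (2 * pi)) - (z + (1 + euler_mascheroni) * z\<^sup>2) / 2 + (\<Sum>k. Barnes_term k z)"

lemma two_pi_powr: "(2 * complex_of_real pi) powr z = exp (z * of_real (ln (2 * pi)))"
proof -
  have "2 * complex_of_real pi = of_real (2 * pi)" by simp
  hence "Ln (2 * complex_of_real pi) = of_real (ln (2 * pi))"
    using Ln_of_real[of "2 * pi"] pi_gt_zero by simp
  thus ?thesis by (simp add: powr_def)
qed

lemma exp_ln_Barnes:
  assumes z: "Re z > 0"
  shows "exp (ln_Barnes z) = Barnes_G (z + 1)"
proof -
  have "exp (Barnes_term k z) = (1 + z / of_nat (Suc k)) ^ Suc k * exp (z\<^sup>2 / (2 * of_nat (Suc k)) - z)" for k
  proof -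
    have "1 + z / of_nat (Suc k) \<noteq> 0"
    proof
      assume "1 + z / of_nat (Suc k) = 0"
      hence "of_nat (Suc k) + z = 0" by (simp add: add_divide_eq_iff del: of_nat_Suc)
      thus False using z by (auto simp: complex_eq_iff)
    qed
    thus ?thesis
      unfolding Barnes_term_def exp_add exp_of_nat_mult by simp
  qed
  hence "(\<Prod>k. (1 + z / of_nat (Suc k)) ^ Suc k * exp (z\<^sup>2 / (2 * of_nat (Suc k)) - z)) = exp (\<Sum>k. Barnes_term k z)"
    using prodinf_exp[OF Barnes_term_series(1)[OF z]] by simp
  thus ?thesis
    unfolding Barnes_G_def Let_def ln_Barnes_def
    by (simp only: add_diff_cancel_right' two_pi_powr exp_add exp_diff minus_divide_left[symmetric] exp_minus
        divide_inverse[of "exp _" "exp _"])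
qed

lemma ln_Barnes_deriv:
  assumes z: "Re z > 0"
  shows "(ln_Barnes has_field_derivative of_real (ln (2 * pi)) / 2 + 1 / 2 - z + z * Digamma z) (at z)"
proof -
  have z0: "z \<noteq> 0" using z by auto
  have "(ln_Barnes has_field_derivative of_real (ln (2 * pi)) / 2 - (1 + (1 + euler_mascheroni) * (2 * z)) / 2 +
      z * (Digamma (z + 1) + euler_mascheroni)) (at z)"
  proof -
    have "((\<lambda>z. z / 2 * of_real (ln (2 * pi)) - (z + (1 + euler_mascheroni) * z\<^sup>2) / 2) has_field_derivative
       of_real (ln (2 * pi)) / 2 - (1 + (1 + euler_mascheroni) * (2 * z)) / 2) (at z)"
      by (auto intro!: derivative_eq_intros)
    from DERIV_add[OF this Barnes_term_series(2)[OF z]] show ?thesis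
      unfolding ln_Barnes_def[abs_def] .
  qed
  moreover have "of_real (ln (2 * pi)) / 2 - (1 + (1 + euler_mascheroni) * (2 * z)) / 2 + z * (Digamma (z + 1) + euler_mascheroni) =
      of_real (ln (2 * pi)) / 2 + 1 / 2 - z + z * Digamma z"
    unfolding Digamma_plus1[OF z0] using z0 by (simp add: field_simps)
  ultimately show ?thesis by simp
qed

text \<open>This is G(2) = 1. The partial sums are elementary in log Gamma and harmonic numbers;
  Stirling's formula, in the form that \<open>binet\<close> tends to 0, and the limit for Euler's
  constant then give the value of the series.\<close>

lemma ln_Barnes_1: "ln_Barnes 1 = 0"
proof -
  define L where "L x = x + ln (Gamma x) - ln (2 * pi) / 2 - (x - 1 / 2) * ln x" for x :: real
  have L0: "(\<lambda>n. complex_of_real (L (real n + 1))) \<longlonglongrightarrow> 0"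
  proof -
    have "complex_of_real (L (real n + 1)) = binet (of_real (real n + 1))" for n
      using ln_Lambda_of_real[of "real n + 1"] binet_eq[of "of_real (real n + 1)"] by (simp add: L_def)
    thus ?thesis using binet_tendsto_0[of 1] by simp
  qed
  have bt: "Barnes_term k 1 = of_real (real (Suc k) * (ln (real k + 2) - ln (real k + 1)) + 1 / (2 * real (Suc k)) - 1)" for k
  proof -
    have "(real k + 2) / (real k + 1) = 1 + 1 / real (Suc k)" by (simp add: field_simps)
    hence "1 + 1 / of_nat (Suc k) = complex_of_real ((real k + 2) / (real k + 1))" by (simp only:) simp
    moreover have "(real k + 2) / (real k + 1) > 0" by simp
    ultimately have "Ln (1 + 1 / of_nat (Suc k)) = of_real (ln ((real k + 2) / (real k + 1)))"
      using Ln_of_real by metis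
    also have "ln ((real k + 2) / (real k + 1)) = ln (real k + 2) - ln (real k + 1)" by (simp add: ln_div)
    finally show ?thesis by (simp add: Barnes_term_def)
  qed
  have part: "(\<Sum>k<n. real (Suc k) * (ln (real k + 2) - ln (real k + 1)) + 1 / (2 * real (Suc k)) - 1) =
     real n * ln (real n + 1) - ln (Gamma (real n + 1)) + harm n / 2 - real n" for n
  proof (induction n)
    case (Suc n)
    have "Gamma (real n + 1 + 1) = (real n + 1) * Gamma (real n + 1)"
      by (rule Gamma_plus1) (auto elim!: nonpos_Ints_cases)
    moreover have "Gamma (real n + 1) > 0" by (rule Gamma_real_pos) simp
    hence "Gamma (real n + 1) \<noteq> 0" by linarith
    ultimately have "ln (Gamma (real (Suc n) + 1)) = ln (real n + 1) + ln (Gamma (real n + 1))"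
      by (simp add: ln_mult add_ac)
    thus ?case using Suc by (simp add: harm_Suc algebra_simps inverse_eq_divide add_divide_distrib)
  qed (simp add: harm_def)
  have "(\<lambda>n. \<Sum>k<n. Barnes_term k 1) \<longlonglongrightarrow> (\<Sum>k. Barnes_term k 1)"
    using Barnes_term_series(1)[of 1] by (simp add: summable_LIMSEQ)
  moreover have "(\<Sum>k<n. Barnes_term k 1) =
     of_real (1 - ln (2 * pi) / 2) - of_real (L (real n + 1)) + of_real (harm n - ln (real n)) / 2
       - of_real ((ln (real n + 1) - ln (real n)) / 2)" for n
  proof -
    have "(\<Sum>k<n. Barnes_term k 1) = of_real (real n * ln (real n + 1) - ln (Gamma (real n + 1)) + harm n / 2 - real n)"
      unfolding bt by (simp only: of_real_sum[symmetric] part)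
    also have "real n * ln (real n + 1) - ln (Gamma (real n + 1)) + harm n / 2 - real n =
       (1 - ln (2 * pi) / 2) - L (real n + 1) + (harm n - ln (real n)) / 2 - (ln (real n + 1) - ln (real n)) / 2"
      by (simp add: L_def algebra_simps diff_divide_distrib)
    finally show ?thesis by simp
  qed
  moreover have "(\<lambda>n. of_real (1 - ln (2 * pi) / 2) - complex_of_real (L (real n + 1)) + of_real (harm n - ln (real n)) / 2
       - of_real ((ln (real n + 1) - ln (real n)) / 2)) \<longlonglongrightarrow>
       of_real (1 - ln (2 * pi) / 2) - 0 + euler_mascheroni / 2 - of_real 0"
  proof (intro tendsto_intros L0 euler_mascheroni_LIMSEQ_of_real)
    show "(\<lambda>n. (ln (real n + 1) - ln (real n)) / 2) \<longlonglongrightarrow> 0" by real_asymp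
  qed auto
  ultimately have "(\<Sum>k. Barnes_term k 1) = of_real (1 - ln (2 * pi) / 2) + euler_mascheroni / 2"
    using LIMSEQ_unique by fastforce
  thus ?thesis by (simp add: ln_Barnes_def add_divide_distrib)
qed

definition ln_Upsilon :: "complex \<Rightarrow> complex" where
  "ln_Upsilon w = - deriv riemann_zeta (-1) + 3 / 4 * w\<^sup>2 + ln_Barnes w - w / 2 * of_real (ln (2 * pi)) - w\<^sup>2 / 2 * Ln w"

lemma exp_ln_Upsilon:
  assumes w: "Re w > 0"
  shows "exp (ln_Upsilon w) = Upsilon_fun w"
proof -
  have "w \<noteq> 0" using w by auto
  thus ?thesis
    unfolding ln_Upsilon_def Upsilon_fun_def exp_diff exp_add exp_ln_Barnes[OF w] two_pi_powr
    by (simp add: powr_def)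
qed

text \<open>The factors exp (3/4 w^2), (2 pi)^(w/2) and w^(w^2/2) are such that in the logarithmic
  derivative everything cancels except w (Digamma w - Ln w) + 1/2.\<close>

lemma ln_Upsilon_deriv:
  assumes w: "Re w > 0"
  shows "(ln_Upsilon has_field_derivative w * (Digamma w - Ln w + 1 / (2 * w))) (at w)"
proof -
  have sl: "w \<notin> \<real>\<^sub>\<le>\<^sub>0" "w \<noteq> 0" using w by (auto simp: complex_nonpos_Reals_iff)
  have "(ln_Upsilon has_field_derivative 3 / 4 * (2 * w) + (of_real (ln (2 * pi)) / 2 + 1 / 2 - w + w * Digamma w)
     - 1 / 2 * of_real (ln (2 * pi)) - (w * Ln w + w\<^sup>2 / 2 * (1 / w))) (at w)"
    unfolding ln_Upsilon_def[abs_def]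
    by (rule derivative_eq_intros ln_Barnes_deriv[OF w] refl | use sl in force)+ (use sl in \<open>simp add: field_simps\<close>)
  moreover have "3 / 4 * (2 * w) + (of_real (ln (2 * pi)) / 2 + 1 / 2 - w + w * Digamma w)
     - 1 / 2 * of_real (ln (2 * pi)) - (w * Ln w + w\<^sup>2 / 2 * (1 / w)) = w * (Digamma w - Ln w + 1 / (2 * w))"
    using sl by (simp add: field_simps power2_eq_square)
  ultimately show ?thesis by simp
qed

subsection \<open>The tau function of the oscillators\<close>

text \<open>The sum is real only if Re x Im x = 0, and for real x it is positive. The lower bound
  uses the factors u - i x and u + i x, whose imaginary parts are - Re x and Re x.\<close>

lemma quad_slit:
  fixes x :: complex
  assumes x: "Re x > 0"
  shows "of_real (u\<^sup>2) + x\<^sup>2 \<notin> \<real>\<^sub>\<le>\<^sub>0" and "(Re x)\<^sup>2 \<le> norm (of_real (u\<^sup>2) + x\<^sup>2)"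
proof -
  show "of_real (u\<^sup>2) + x\<^sup>2 \<notin> \<real>\<^sub>\<le>\<^sub>0"
  proof
    assume "of_real (u\<^sup>2) + x\<^sup>2 \<in> \<real>\<^sub>\<le>\<^sub>0"
    hence i: "Im (of_real (u\<^sup>2) + x\<^sup>2) = 0" "Re (of_real (u\<^sup>2) + x\<^sup>2) \<le> 0"
      by (auto simp: complex_nonpos_Reals_iff)
    hence "Im x = 0" using x by (simp add: power2_eq_square)
    hence "Re (of_real (u\<^sup>2) + x\<^sup>2) = u\<^sup>2 + (Re x)\<^sup>2" by (simp add: power2_eq_square)
    moreover have "u\<^sup>2 + (Re x)\<^sup>2 > 0" using x by (simp add: add_nonneg_pos)
    ultimately show False using i by simp
  qed
  have a: "Re x \<le> norm (of_real u - \<i> * x)" "Re x \<le> norm (of_real u + \<i> * x)"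
    using abs_Im_le_cmod[of "of_real u - \<i> * x"] abs_Im_le_cmod[of "of_real u + \<i> * x"] by simp_all
  have "of_real (u\<^sup>2) + x\<^sup>2 = (of_real u - \<i> * x) * (of_real u + \<i> * x)"
    by (simp add: algebra_simps power2_eq_square)
  hence "norm (of_real (u\<^sup>2) + x\<^sup>2) = norm (of_real u - \<i> * x) * norm (of_real u + \<i> * x)"
    by (simp only: norm_mult)
  also have "\<dots> \<ge> Re x * Re x" using a x by (intro mult_mono) auto
  finally show "(Re x)\<^sup>2 \<le> norm (of_real (u\<^sup>2) + x\<^sup>2)" by (simp add: power2_eq_square)
qed

text \<open>The integrand of the oscillator tau function after the substitution s = 2 pi u, which
  splits the constant 2 ln (2 pi) off the logarithm.\<close>

definition tau_kernel :: "complex \<Rightarrow> real \<Rightarrow> complex" where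
  "tau_kernel x u = of_real u * (of_real (2 * ln (2 * pi)) + Ln (of_real (u\<^sup>2) + x\<^sup>2))"

lemma measurable_tau_kernel: "Re x > 0 \<Longrightarrow> tau_kernel x \<in> borel_measurable halfline"
  unfolding tau_kernel_def[abs_def]
  by (intro borel_measurable_continuous_halfline continuous_intros) (use quad_slit(1) in auto)

text \<open>Differentiation under the integral needs a majorant that is uniform in x. The logarithm
  is controlled from below by the bound a^2 on its argument and from above by the argument itself,
  whose quadratic growth exp u absorbs.\<close>

lemma norm_tau_kernel_le:
  assumes a: "a > 0"
  shows "\<exists>C>0. \<forall>x u. a \<le> Re x \<and> norm x \<le> B \<and> u > 0 \<longrightarrow> norm (tau_kernel x u) \<le> C * (u * exp u)"
proof -
  obtain K where K: "K > 0" "\<And>u::real. u \<ge> 0 \<Longrightarrow> (1 + u) ^ 2 \<le> K * exp u" using power_le_exp[of 2] by blast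
  define C where "C = \<bar>2 * ln (2 * pi)\<bar> + pi + \<bar>ln (a\<^sup>2)\<bar> + (1 + \<bar>B\<bar>)\<^sup>2 * K + 1"
  have "norm (tau_kernel x u) \<le> C * (u * exp u)" if x: "a \<le> Re x" "norm x \<le> B" and u: "u > 0" for x u
  proof -
    define z where "z = of_real (u\<^sup>2) + x\<^sup>2"
    have zs: "z \<notin> \<real>\<^sub>\<le>\<^sub>0" and za: "(Re x)\<^sup>2 \<le> norm z"
      using quad_slit[of x u] x a by (simp_all add: z_def)
    have z0: "z \<noteq> 0" using zs by auto
    have "a\<^sup>2 \<le> (Re x)\<^sup>2" using x a by (intro power_mono) auto
    hence zlow: "a\<^sup>2 \<le> norm z" using za by simp
    have "norm z \<le> u\<^sup>2 + (norm x)\<^sup>2"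
      unfolding z_def by (rule order_trans[OF norm_triangle_ineq]) (simp add: norm_power del: of_real_power)
    also have "\<dots> \<le> u\<^sup>2 + \<bar>B\<bar>\<^sup>2" using x by (intro add_left_mono power_mono) auto
    also have "\<dots> \<le> (u + \<bar>B\<bar>)\<^sup>2" using u by (simp add: power2_sum del: power2_abs)
    also have "\<dots> \<le> ((1 + \<bar>B\<bar>) * (1 + u))\<^sup>2"
    proof (rule power_mono)
      have "0 \<le> \<bar>B\<bar> * u" using u by simp
      thus "u + \<bar>B\<bar> \<le> (1 + \<bar>B\<bar>) * (1 + u)" by (simp add: algebra_simps)
    qed (use u in simp)
    finally have zhigh: "norm z \<le> (1 + \<bar>B\<bar>)\<^sup>2 * (1 + u)\<^sup>2" by (simp only: power_mult_distrib)
    have e1: "exp u \<ge> 1" using u by simp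
    have "ln (norm z) \<le> norm z" using ln_bound[of "norm z"] z0 by simp
    moreover have "ln (a\<^sup>2) \<le> ln (norm z)" using zlow a z0 by (intro ln_mono) auto
    ultimately have "\<bar>ln (norm z)\<bar> \<le> \<bar>ln (a\<^sup>2)\<bar> + norm z" using norm_ge_zero[of z] by linarith
    hence "\<bar>ln (norm z)\<bar> \<le> \<bar>ln (a\<^sup>2)\<bar> * exp u + (1 + \<bar>B\<bar>)\<^sup>2 * (K * exp u)"
    proof -
      assume h: "\<bar>ln (norm z)\<bar> \<le> \<bar>ln (a\<^sup>2)\<bar> + norm z"
      have "\<bar>ln (a\<^sup>2)\<bar> \<le> \<bar>ln (a\<^sup>2)\<bar> * exp u" using e1 by (simp add: mult_le_cancel_left1)
      moreover have "(1 + \<bar>B\<bar>)\<^sup>2 * (1 + u)\<^sup>2 \<le> (1 + \<bar>B\<bar>)\<^sup>2 * (K * exp u)"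
        using K u by (intro mult_left_mono) auto
      ultimately show ?thesis using h zhigh by linarith
    qed
    moreover have "norm (Ln z) \<le> \<bar>ln (norm z)\<bar> + pi"
      using cmod_le[of "Ln z"] z0 Im_Ln_le_pi[of z] mpi_less_Im_Ln[of z] by simp
    moreover have "norm (complex_of_real (2 * ln (2 * pi)) + Ln z) \<le> \<bar>2 * ln (2 * pi)\<bar> + norm (Ln z)"
      by (rule order_trans[OF norm_triangle_ineq]) (simp only: norm_of_real)
    moreover have "\<bar>2 * ln (2 * pi)\<bar> + pi \<le> (\<bar>2 * ln (2 * pi)\<bar> + pi) * exp u"
      using mult_left_mono[OF e1, of "\<bar>2 * ln (2 * pi)\<bar> + pi"] pi_ge_zero by simp
    ultimately have "norm (complex_of_real (2 * ln (2 * pi)) + Ln z) \<le>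
       (\<bar>2 * ln (2 * pi)\<bar> + pi) * exp u + (\<bar>ln (a\<^sup>2)\<bar> * exp u + (1 + \<bar>B\<bar>)\<^sup>2 * (K * exp u))" by linarith
    also have "\<dots> \<le> C * exp u" unfolding C_def by (simp add: algebra_simps)
    finally have "u * norm (complex_of_real (2 * ln (2 * pi)) + Ln z) \<le> u * (C * exp u)"
      using u by (intro mult_left_mono) auto
    thus ?thesis using u by (simp add: tau_kernel_def z_def norm_mult mult_ac)
  qed
  moreover have "C > 0" unfolding C_def using K pi_gt_zero by (intro add_nonneg_pos add_nonneg_nonneg) auto
  ultimately show ?thesis by blast
qed

lemma tau_kernel_bound:
  assumes x: "Re x > 0"
  obtains C where "\<And>u. u > 0 \<Longrightarrow> norm (tau_kernel x u) \<le> C * (u * exp u)"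
  using norm_tau_kernel_le[OF x, of "norm x"] by blast

definition bose_tau :: "complex \<Rightarrow> complex" where
  "bose_tau x = (LH u. of_real (bose u) * tau_kernel x u)"

text \<open>Differentiating the logarithm gives 2 x u / (u^2 + x^2). This is x times the integrand
  in Binet's series for minus the derivative of log Lambda, by
  \<open>binet_sums_sin\<close>.\<close>

lemma bose_tau_deriv:
  assumes x: "Re x > 0"
  shows "(bose_tau has_field_derivative - x * (Digamma x - Ln x + 1 / (2 * x))) (at x)"
proof -
  define r where "r = Re x / 2"
  have r: "r > 0" using x by (simp add: r_def)
  obtain C where C: "C > 0" "\<And>w u. r \<le> Re w \<Longrightarrow> norm w \<le> norm x + r \<Longrightarrow> u > 0 \<Longrightarrow> norm (tau_kernel w u) \<le> C * (u * exp u)"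
    using norm_tau_kernel_le[OF r, of "norm x + r"] by blast
  have "(bose_tau has_field_derivative
      (LH u. of_real (bose u) * (of_real u * (2 * x / (of_real (u\<^sup>2) + x\<^sup>2))))) (at x)"
    unfolding bose_tau_def[abs_def]
  proof (rule integral_parameter_derivative(2)[where S="ball x r"
        and f'="\<lambda>x u. of_real (bose u) * (of_real u * (2 * x / (of_real (u\<^sup>2) + x\<^sup>2)))"])
    have nC: "norm (complex_of_real (C * (u * exp u))) \<le> C * (u * exp u)" if "u > 0" for u
      using C that by (simp add: norm_mult)
    have "integrable halfline (\<lambda>u. of_real (bose u) * complex_of_real (C * (u * exp u)))"
      by (rule bose_integrable_sums(1)[OF _ nC]) (rule borel_measurable_halfline, measurable)
    hence "integrable halfline (\<lambda>u. norm (of_real (bose u) * complex_of_real (C * (u * exp u))))"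
      by (rule integrable_norm)
    thus "integrable halfline (\<lambda>u. bose u * (C * (u * exp u)))"
      by (rule Bochner_Integration.integrable_cong[THEN iffD1, rotated -1])
         (use C bose_bounds in \<open>auto simp: norm_mult less_imp_le\<close>)
    fix w u assume w: "w \<in> ball x r"
    have "\<bar>Re (w - x)\<bar> < r" using w abs_Re_le_cmod[of "w - x"] by (simp add: dist_norm norm_minus_commute)
    hence rw: "r \<le> Re w" unfolding r_def minus_complex.sel by linarith
    have nw: "norm w \<le> norm x + r"
      using w norm_triangle_ineq2[of w x] by (simp add: dist_norm norm_minus_commute)
    have Rw: "Re w > 0" using rw r by simp
    show "(\<lambda>u. of_real (bose u) * tau_kernel w u) \<in> borel_measurable halfline"
    proof -
      have "bose \<in> borel_measurable borel" unfolding bose_def[abs_def] by measurable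
      hence "(\<lambda>u. complex_of_real (bose u)) \<in> borel_measurable halfline"
        by (intro borel_measurable_halfline) measurable
      thus ?thesis using measurable_tau_kernel[OF Rw] by measurable
    qed
    assume u: "u \<in> space halfline"
    show "norm (of_real (bose u) * tau_kernel w u) \<le> bose u * (C * (u * exp u))"
      using C(2)[OF rw nw, of u] u bose_bounds[of u] by (simp add: norm_mult mult_left_mono)
    show "((\<lambda>w. of_real (bose u) * tau_kernel w u) has_field_derivative
        of_real (bose u) * (of_real u * (2 * w / (of_real (u\<^sup>2) + w\<^sup>2)))) (at w)"
      unfolding tau_kernel_def using quad_slit(1)[OF Rw, of u]
      by (auto intro!: derivative_eq_intros simp: divide_inverse mult_ac simp del: of_real_power)
  qed (use r in auto)
  also have "(\<lambda>u. complex_of_real (bose u) * (of_real u * (2 * x / (of_real (u\<^sup>2) + x\<^sup>2)))) =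
      (\<lambda>u. (2 * x) * (of_real (bose u) * (of_real u / (x\<^sup>2 + of_real u ^ 2))))"
    by (simp add: fun_eq_iff mult_ac add.commute)
  also have "(LH u. (2 * x) * (of_real (bose u) * (of_real u / (x\<^sup>2 + of_real u ^ 2)))) =
     x * (2 * (LH u. of_real (bose u) * (of_real u / (x\<^sup>2 + of_real u ^ 2))))"
    by (subst integral_mult_right_zero) simp
  also have "2 * (LH u. of_real (bose u) * (of_real u / (x\<^sup>2 + of_real u ^ 2))) =
     (LH l. of_real (l * binet_kernel l) * exp (- (x * of_real l)))"
  proof -
    have "(\<lambda>m. LH u. of_real (exp (- freq m * u)) * (of_real u / (x\<^sup>2 + of_real u ^ 2))) sums
       (LH u. of_real (bose u) * (of_real u / (x\<^sup>2 + of_real u ^ 2)))"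
    proof (rule bose_integrable_sums(2)[where C="1 / (Re x)\<^sup>2"])
      have "x\<^sup>2 + (complex_of_real u)\<^sup>2 \<noteq> 0" for u
        using quad_slit(1)[OF x, of u] by (auto simp: add.commute)
      thus "(\<lambda>u. complex_of_real u / (x\<^sup>2 + of_real u ^ 2)) \<in> borel_measurable halfline"
        by (intro borel_measurable_continuous_halfline continuous_intros) auto
      fix u :: real assume u: "u > 0"
      have "norm (complex_of_real u / (x\<^sup>2 + of_real u ^ 2)) = u / norm (of_real (u\<^sup>2) + x\<^sup>2)"
        using u by (simp add: norm_divide add.commute)
      also have "\<dots> \<le> u / (Re x)\<^sup>2"
        using quad_slit(2)[OF x, of u] u x by (intro divide_left_mono mult_pos_pos) (auto simp: less_le_trans[of 0 "(Re x)\<^sup>2"])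
      also have "\<dots> \<le> 1 / (Re x)\<^sup>2 * (u * exp u)"
        using u x by (simp add: divide_right_mono mult_le_cancel_left1)
      finally show "norm (complex_of_real u / (x\<^sup>2 + of_real u ^ 2)) \<le> 1 / (Re x)\<^sup>2 * (u * exp u)" .
    qed
    from sums_unique2[OF sums_mult[OF this, of 2] binet_sums_sin[OF x]] show ?thesis .
  qed
  finally have d: "(bose_tau has_field_derivative
     x * (LH l. of_real (l * binet_kernel l) * exp (- (x * of_real l)))) (at x)" .
  have "(ln_Lambda has_field_derivative - (LH l. of_real (l * binet_kernel l) * exp (- (x * of_real l)))) (at x)"
    by (rule has_field_derivative_transform_within_open[OF binet_deriv[OF x], of "{x. Re x > 0}"])
       (use x open_halfspace_Re_gt binet_eq in auto)
  moreover have "x \<notin> \<real>\<^sub>\<le>\<^sub>0" using x by (auto simp: complex_nonpos_Reals_iff)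
  ultimately have "- (LH l. of_real (l * binet_kernel l) * exp (- (x * of_real l))) = Digamma x - Ln x + 1 / (2 * x)"
    using ln_Lambda_deriv DERIV_unique by blast
  hence "(LH l. of_real (l * binet_kernel l) * exp (- (x * of_real l))) = - (Digamma x - Ln x + 1 / (2 * x))"
    by (metis minus_minus)
  from d[unfolded this] show ?thesis by (simp only: mult_minus_right mult_minus_left)
qed

text \<open>Binet's second formula at x = 1: each frequency integral of 1 / (1 + u^2) in
  \<open>binet_sums_cos\<close> is integrated by parts into one of arctan u.\<close>

lemma integral_arctan_bose: "2 * (LH u. of_real (bose u) * complex_of_real (arctan u)) = ln_Lambda 1"
proof -
  have arc: "\<bar>arctan u\<bar> \<le> 1 * (u * exp u)" if u: "u > 0" for u
  proof -
    have "0 \<le> arctan u" using u by simp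
    moreover have "arctan u \<le> u" using u arctan_le_self[of u] by simp
    moreover have "u \<le> u * exp u" using u by (simp add: mult_le_cancel_left1)
    ultimately show ?thesis by simp
  qed
  have am: "(\<lambda>u. complex_of_real (arctan u)) \<in> borel_measurable halfline"
    by (rule borel_measurable_continuous_halfline) (intro continuous_intros)
  have nb: "norm (complex_of_real (arctan u)) \<le> 1 * (u * exp u)" if "u > 0" for u
    using arc[OF that] by simp
  note B = bose_integrable_sums[OF am nb]
  have "of_real (1 / (pi * real (Suc m))) *
     (LH u. of_real (exp (- freq m * u)) * (1 / (1\<^sup>2 + of_real u ^ 2))) =
     2 * (LH u. of_real (exp (- freq m * u)) * complex_of_real (arctan u))" for m
  proof -
    define k where "k = 2 * pi * real (Suc m)"
    have k: "k > 0" by (simp add: k_def)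
    have i1: "integrable halfline (\<lambda>u. of_real (exp (- k * u)) * (1 / (1\<^sup>2 + complex_of_real u ^ 2)))"
    proof (rule integrable_halfline_bound)
      show "integrable halfline (\<lambda>u. u ^ 0 * exp (- k * u))" by (rule integrable_power_exp_halfline[OF k])
      have nz: "1 + (complex_of_real u)\<^sup>2 \<noteq> 0" for u using quad_slit(1)[of 1 u] by (auto simp: add.commute)
      thus "(\<lambda>u. of_real (exp (- k * u)) * (1 / (1\<^sup>2 + complex_of_real u ^ 2))) \<in> borel_measurable halfline"
        by (intro borel_measurable_continuous_halfline continuous_intros) auto
      fix u :: real
      have "1 \<le> norm (1\<^sup>2 + (complex_of_real u)\<^sup>2)" using quad_slit(2)[of 1 u] by (simp add: add.commute)
      hence "exp (- k * u) * (1 / norm (1\<^sup>2 + (complex_of_real u)\<^sup>2)) \<le> exp (- k * u) * 1"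
        by (intro mult_left_mono) (auto simp: divide_le_eq)
      thus "norm (of_real (exp (- k * u)) * (1 / (1\<^sup>2 + complex_of_real u ^ 2))) \<le> u ^ 0 * exp (- k * u)"
        by (simp add: norm_mult norm_divide)
    qed
    have i2: "integrable halfline (\<lambda>u. of_real (exp (- k * u)) * complex_of_real (arctan u))"
      using B(3)[of m] by (simp add: k_def)
    have "(LH u. of_real (exp (- k * u)) * (1 / (1\<^sup>2 + complex_of_real u ^ 2)) -
        of_real k * (of_real (exp (- k * u)) * complex_of_real (arctan u))) = 0 - 0"
    proof (rule halfline_FTC)
      fix u :: real assume "u > 0"
      have "((\<lambda>u. exp (- k * u) * arctan u) has_real_derivative
          (exp (- k * u) * (1 / (1 + u\<^sup>2)) - k * (exp (- k * u) * arctan u))) (at u)"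
        by (auto intro!: derivative_eq_intros simp: inverse_eq_divide algebra_simps)
      hence "((\<lambda>u. complex_of_real (exp (- k * u) * arctan u)) has_vector_derivative
          of_real (exp (- k * u) * (1 / (1 + u\<^sup>2)) - k * (exp (- k * u) * arctan u))) (at u)"
        by (rule has_vector_derivative_of_real)
      thus "((\<lambda>u. complex_of_real (exp (- k * u) * arctan u)) has_vector_derivative
         of_real (exp (- k * u)) * (1 / (1\<^sup>2 + complex_of_real u ^ 2)) - of_real k * (of_real (exp (- k * u)) * of_real (arctan u))) (at u)"
        by simp
    next
      have nz: "1 + (complex_of_real u)\<^sup>2 \<noteq> 0" for u using quad_slit(1)[of 1 u] by (auto simp: add.commute)
      thus "continuous_on {0<..} (\<lambda>u. of_real (exp (- k * u)) * (1 / (1\<^sup>2 + complex_of_real u ^ 2)) - of_real k * (of_real (exp (- k * u)) * of_real (arctan u)))"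
        by (intro continuous_intros) auto
      show "integrable halfline (\<lambda>u. of_real (exp (- k * u)) * (1 / (1\<^sup>2 + complex_of_real u ^ 2)) - of_real k * (of_real (exp (- k * u)) * complex_of_real (arctan u)))"
        using i1 i2 by auto
      have "((\<lambda>u::real. exp (- k * u) * arctan u) \<longlongrightarrow> 0) (at_right 0)" by real_asymp
      thus "((\<lambda>u. complex_of_real (exp (- k * u) * arctan u)) \<longlongrightarrow> 0) (at_right 0)"
        using tendsto_of_real by fastforce
      have "((\<lambda>u::real. exp (- k * u) * arctan u) \<longlongrightarrow> 0) at_top" using k by real_asymp
      thus "((\<lambda>u. complex_of_real (exp (- k * u) * arctan u)) \<longlongrightarrow> 0) at_top"
        using tendsto_of_real by fastforce
    qed
    hence "(LH u. of_real (exp (- k * u)) * (1 / (1\<^sup>2 + complex_of_real u ^ 2))) =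
        of_real k * (LH u. of_real (exp (- k * u)) * complex_of_real (arctan u))"
      using i1 i2 by simp
    moreover have "complex_of_real (1 / (pi * real (Suc m))) * (of_real k * I) = 2 * I" for I
    proof -
      have "1 / (pi * real (Suc m)) * k = 2" by (simp add: k_def)
      hence "complex_of_real (1 / (pi * real (Suc m))) * of_real k = of_real 2" by (simp only: of_real_mult[symmetric])
      thus ?thesis by (simp only: mult.assoc[symmetric]) simp
    qed
    ultimately show ?thesis unfolding k_def by simp
  qed
  hence "(\<lambda>m. 2 * (LH u. of_real (exp (- freq m * u)) * complex_of_real (arctan u))) sums binet 1"
    using binet_sums_cos[of 1] by simp
  from sums_unique2[OF sums_mult[OF B(2)] this] show ?thesis using binet_eq[of 1] by simp
qed

text \<open>In the formula for zeta'(-1) the arctan part is log Lambda at 1 and the rest is the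
  integral \<open>J\<close> of the logarithm. Together with G(2) = 1 everything else cancels, and
  ln_Upsilon 1 = - J.\<close>

lemma bose_tau_1: "bose_tau 1 = of_real (ln (2 * pi) / 12) - ln_Upsilon 1"
proof -
  have q: "1 + u\<^sup>2 > 0" for u :: real by (simp add: add_pos_nonneg)
  have tk: "tau_kernel 1 u = of_real (2 * ln (2 * pi)) * of_real u + of_real (u * ln (1 + u\<^sup>2))" for u
  proof -
    have "of_real (u\<^sup>2) + 1\<^sup>2 = complex_of_real (1 + u\<^sup>2)" by simp
    hence "Ln (of_real (u\<^sup>2) + 1\<^sup>2) = of_real (ln (1 + u\<^sup>2))" using Ln_of_real[OF q] by metis
    thus ?thesis by (simp add: tau_kernel_def algebra_simps)
  qed
  obtain C where C: "\<And>u. u > 0 \<Longrightarrow> norm (tau_kernel 1 u) \<le> C * (u * exp u)"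
    using tau_kernel_bound[of 1] by auto
  have i1: "integrable halfline (\<lambda>u. of_real (bose u) * tau_kernel 1 u)"
    by (rule bose_integrable_sums(1)[OF measurable_tau_kernel]) (use C in auto)
  have i2: "integrable halfline (\<lambda>u. of_real (bose u) * complex_of_real u)"
    by (rule bose_integrable_sums(1)[where C=1]) (auto intro!: borel_measurable_halfline)
  have i3: "integrable halfline (\<lambda>u. of_real (bose u) * complex_of_real (arctan u))"
  proof (rule bose_integrable_sums(1)[where C=1])
    show "(\<lambda>u. complex_of_real (arctan u)) \<in> borel_measurable halfline"
      by (rule borel_measurable_continuous_halfline) (intro continuous_intros)
    fix u :: real assume u: "u > 0"
    have "0 \<le> arctan u" "arctan u \<le> u" using u arctan_le_self[of u] by simp_all
    moreover have "u \<le> u * exp u" using u by (simp add: mult_le_cancel_left1)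
    ultimately show "norm (complex_of_real (arctan u)) \<le> 1 * (u * exp u)" by simp
  qed
  define J where "J = (LH u. of_real (bose u) * complex_of_real (u * ln (1 + u\<^sup>2)))"
  have e: "of_real (bose u) * complex_of_real (u * ln (1 + u\<^sup>2)) =
      of_real (bose u) * tau_kernel 1 u - of_real (2 * ln (2 * pi)) * (of_real (bose u) * of_real u)" for u
    unfolding tk by (simp add: algebra_simps)
  have i4: "integrable halfline (\<lambda>u. of_real (bose u) * complex_of_real (u * ln (1 + u\<^sup>2)))"
    unfolding e using i1 i2 by auto
  have "J = bose_tau 1 - of_real (2 * ln (2 * pi)) * (1 / 24)"
    unfolding J_def e bose_tau_def using i1 i2 by (simp add: integral_u_bose)
  hence bt: "bose_tau 1 = J + of_real (ln (2 * pi) / 12)" by simp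
  have "(LH u. complex_of_real (bose u * (arctan u + u / 2 * ln (1 + u\<^sup>2)))) =
     (LH u. of_real (bose u) * of_real (arctan u) + (of_real (bose u) * complex_of_real (u * ln (1 + u\<^sup>2))) / 2)"
    by (rule Bochner_Integration.integral_cong[OF refl]) (simp add: algebra_simps)
  also have "\<dots> = (LH u. of_real (bose u) * complex_of_real (arctan u)) + J / 2"
    unfolding J_def using i3 i4 by simp
  finally have "deriv riemann_zeta (-1) = - 1 / 4 + (ln_Lambda 1 + J)"
    unfolding deriv_riemann_zeta_minus_1 using integral_arctan_bose by simp
  moreover have "ln_Lambda 1 = 1 - of_real (ln (2 * pi) / 2)"
    using ln_Lambda_of_real[of 1] by simp
  moreover have "ln_Upsilon 1 = - deriv riemann_zeta (-1) + 3 / 4 - of_real (ln (2 * pi) / 2)"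
    by (simp add: ln_Upsilon_def ln_Barnes_1)
  ultimately show ?thesis unfolding bt by simp
qed

lemma bose_tau_eq:
  assumes x: "Re x > 0"
  shows "bose_tau x = of_real (ln (2 * pi) / 12) - ln_Upsilon x"
proof -
  have "\<exists>c. \<forall>x\<in>{x. Re x > 0}. bose_tau x + ln_Upsilon x = c"
  proof (rule has_field_derivative_zero_constant)
    show "convex {x. Re x > 0}" by (rule convex_halfspace_Re_gt)
    fix x assume "x \<in> {x. Re x > 0}"
    hence x: "Re x > 0" by simp
    have "((\<lambda>x. bose_tau x + ln_Upsilon x) has_field_derivative 0) (at x)"
      using DERIV_add[OF bose_tau_deriv[OF x] ln_Upsilon_deriv[OF x]] by simp
    thus "((\<lambda>x. bose_tau x + ln_Upsilon x) has_field_derivative 0) (at x within {x. Re x > 0})"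
      by (rule has_field_derivative_at_within)
  qed
  hence "bose_tau x + ln_Upsilon x = bose_tau 1 + ln_Upsilon 1" using x by force
  thus ?thesis unfolding bose_tau_1 by (simp add: eq_diff_eq)
qed

text \<open>Substituting s = 2 pi u contributes 2 pi from s and 2 pi from ds, hence 4 pi^2. The
  factor 2 pi beside x comes from evaluating the tau functions at (2 pi)^(-1) i t.\<close>

theorem oscillator_tau_sums:
  assumes x: "Re x > 0"
  shows "(\<lambda>m. LINT s:{0..}|lborel. of_real s * Ln (of_real (s\<^sup>2) + (2 * of_real pi * x)\<^sup>2) * exp (- (of_nat (Suc m) * of_real s)))
     sums (4 * of_real pi ^ 2 * (of_real (ln (2 * pi) / 12) - ln_Upsilon x))"
proof -
  obtain C where C: "\<And>u. u > 0 \<Longrightarrow> norm (tau_kernel x u) \<le> C * (u * exp u)"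
    using tau_kernel_bound[OF x] by auto
  have "(\<lambda>m. LH u. of_real (exp (- freq m * u)) * tau_kernel x u) sums bose_tau x"
    unfolding bose_tau_def by (rule bose_integrable_sums(2)[OF measurable_tau_kernel[OF x], where C=C]) (use C in auto)
  hence "(\<lambda>m. 4 * of_real pi ^ 2 * (LH u. of_real (exp (- freq m * u)) * tau_kernel x u)) sums
      (4 * of_real pi ^ 2 * bose_tau x)" by (rule sums_mult)
  moreover have "4 * of_real pi ^ 2 * (LH u. of_real (exp (- freq m * u)) * tau_kernel x u) =
     (LINT s:{0..}|lborel. of_real s * Ln (of_real (s\<^sup>2) + (2 * of_real pi * x)\<^sup>2) * exp (- (of_nat (Suc m) * of_real s)))" for m
  proof -
    define g where "g s = of_real s * Ln (of_real (s\<^sup>2) + (2 * of_real pi * x)\<^sup>2) * exp (- (of_nat (Suc m) * of_real s))" for s :: real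
    have x2: "Re (2 * of_real pi * x) > 0" using x by simp
    have "g (2 * pi * u) = (2 * of_real pi) * (of_real (exp (- freq m * u)) * tau_kernel x u)" if u: "u > 0" for u
    proof -
      have z0: "of_real (u\<^sup>2) + x\<^sup>2 \<noteq> 0" using quad_slit(1)[OF x, of u] by auto
      have "of_real ((2 * pi * u)\<^sup>2) + (2 * of_real pi * x)\<^sup>2 = of_real ((2 * pi)\<^sup>2) * (of_real (u\<^sup>2) + x\<^sup>2)"
        by (simp add: power_mult_distrib algebra_simps)
      hence "Ln (of_real ((2 * pi * u)\<^sup>2) + (2 * of_real pi * x)\<^sup>2) = of_real (ln ((2 * pi)\<^sup>2)) + Ln (of_real (u\<^sup>2) + x\<^sup>2)"
        using Ln_times_of_real[of "(2 * pi)\<^sup>2" "of_real (u\<^sup>2) + x\<^sup>2"] Ln_of_real[of "(2 * pi)\<^sup>2"] z0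
        by (simp only:) auto
      moreover have "ln ((2 * pi)\<^sup>2) = 2 * ln (2 * pi)"
      proof -
        show ?thesis using ln_realpow[of "2 * pi" 2] by (simp only: of_nat_numeral)
      qed
      moreover have "exp (- (of_nat (Suc m) * complex_of_real (2 * pi * u))) = of_real (exp (- freq m * u))"
      proof -
        have "- (of_nat (Suc m) * complex_of_real (2 * pi * u)) = of_real (- freq m * u)"
          by simp
        thus ?thesis by (simp only: exp_of_real)
      qed
      ultimately show ?thesis unfolding g_def tau_kernel_def by (simp only: of_real_mult of_real_numeral mult_ac)
    qed
    hence "(LH u. g (2 * pi * u)) = (LH u. (2 * of_real pi) * (of_real (exp (- freq m * u)) * tau_kernel x u))"
      by (intro Bochner_Integration.integral_cong) auto
    also have "\<dots> = (2 * of_real pi) * (LH u. of_real (exp (- freq m * u)) * tau_kernel x u)"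
      by (rule integral_mult_right_zero)
    finally have "(2 * of_real pi) * (LH u. of_real (exp (- freq m * u)) * tau_kernel x u) =
        (1 / (2 * pi)) *\<^sub>R integral\<^sup>L halfline g"
      using halfline_scale[of "2 * pi" g] by simp
    hence G: "integral\<^sup>L halfline g = 4 * of_real pi ^ 2 * (LH u. of_real (exp (- freq m * u)) * tau_kernel x u)"
      by (simp add: scaleR_conv_of_real field_simps power2_eq_square)
    have cg: "continuous_on {0..} g"
      unfolding g_def using quad_slit(1)[OF x2] by (intro continuous_intros) auto
    \<comment> \<open>The definition integrates over the closed half-line; the point 0 is a null
      set.\<close>
    have "(LINT s:{0..}|lborel. g s) = (LINT s:{0<..}|lborel. g s)"
      unfolding set_lebesgue_integral_def
    proof (rule integral_cong_AE)
      show "(\<lambda>s. indicator {0..} s *\<^sub>R g s) \<in> borel_measurable lborel"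
        unfolding measurable_lborel2 using cg by (intro borel_measurable_continuous_on_indicator) auto
      show "(\<lambda>s. indicator {0<..} s *\<^sub>R g s) \<in> borel_measurable lborel"
        unfolding measurable_lborel2
        by (intro borel_measurable_continuous_on_indicator continuous_on_subset[OF cg]) auto
      show "AE s in lborel. indicat_real {0..} s *\<^sub>R g s = indicat_real {0<..} s *\<^sub>R g s"
        using AE_lborel_singleton[of 0] by eventually_elim (auto simp: indicator_def)
    qed
    thus ?thesis using G by (simp add: integral_halfline g_def)
  qed
  ultimately show ?thesis by (simp only: bose_tau_eq[OF x])
qed

subsection \<open>The normalised solution of the oscillator system\<close>

text \<open>Integrand of a confluent hypergeometric integral. The exponent - i c is an eigenvalue of
  the matrix with off-diagonal entries c and - c that multiplies 1 / t in the oscillator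
  equation.\<close>

definition osc_E :: "real \<Rightarrow> complex \<Rightarrow> real \<Rightarrow> complex" where
  "osc_E c v s = exp (- of_real s) * of_real s powr (- \<i> * of_real c) * (1 - of_real s * v) powr (- \<i> * of_real c)"

text \<open>At v = 0 the integral is Gamma (1 - i c), so the factor in front normalises the limit to
  1.\<close>

definition osc_u :: "real \<Rightarrow> complex \<Rightarrow> complex" where
  "osc_u c v = rGamma (1 - \<i> * of_real c) * (LH s. osc_E c v s)"

text \<open>The companion integral that makes differentiation in v close up: \<open>osc_u\<close>
  and \<open>osc_q\<close> together satisfy a first-order linear system.\<close>

definition osc_q :: "real \<Rightarrow> complex \<Rightarrow> complex" where
  "osc_q c v = rGamma (1 - \<i> * of_real c) * (LH s. osc_E c v s / (1 - of_real s * v))"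

text \<open>
  In the coordinate \<open>v = t / (m Z(\<gamma>))\<close> the first column of the normalised solution is \<open>(osc_a, osc_b)\<close>;
  the second one is its image under \<open>v \<mapsto> - cnj v\<close>, up to a sign.
\<close>

definition osc_a :: "real \<Rightarrow> complex \<Rightarrow> complex" where
  "osc_a c v = osc_u c v - \<i> * of_real c * v * osc_q c v"

definition osc_b :: "real \<Rightarrow> complex \<Rightarrow> complex" where
  "osc_b c v = of_real c * v * osc_q c v"

lemma osc_P:
  assumes "Im v > 0" "s > 0"
  shows "1 - of_real s * v \<notin> \<real>\<^sub>\<le>\<^sub>0" "1 - of_real s * v \<noteq> 0"
proof -
  have "Im (1 - of_real s * v) \<noteq> 0" using assms by simp
  thus "1 - of_real s * v \<notin> \<real>\<^sub>\<le>\<^sub>0" by (simp add: complex_nonpos_Reals_iff)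
  thus "1 - of_real s * v \<noteq> 0" by auto
qed

text \<open>The points 1 - s v run along a line at distance Im v / |v| from 0, so the bound is
  uniform in s.\<close>

lemma norm_osc_P_ge:
  assumes "Im v > 0" "s > 0"
  shows "Im v / norm v \<le> norm (1 - of_real s * v)"
proof -
  have v0: "v \<noteq> 0" using assms by auto
  have "\<bar>Im ((1 - of_real s * v) * cnj v)\<bar> \<le> norm ((1 - of_real s * v) * cnj v)" by (rule abs_Im_le_cmod)
  also have "Im ((1 - of_real s * v) * cnj v) = - Im v" by (simp add: algebra_simps)
  also have "norm ((1 - of_real s * v) * cnj v) = norm (1 - of_real s * v) * norm v" by (simp add: norm_mult)
  finally show ?thesis using assms v0 by (simp add: divide_le_eq)
qed

text \<open>The norm of a power with imaginary exponent depends only on the argument of its base, at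
  most pi in size; hence the majorant is independent of v.\<close>

lemma norm_osc_E_le:
  assumes "s > 0"
  shows "norm (osc_E c v s) \<le> exp (pi * \<bar>c\<bar>) * exp (- s)"
proof -
  have p: "norm (z powr (- \<i> * of_real c)) \<le> exp (pi * \<bar>c\<bar>)" for z
  proof (cases "z = 0")
    case False
    have "c * Im (Ln z) \<le> \<bar>c\<bar> * \<bar>Im (Ln z)\<bar>" by (simp flip: abs_mult)
    also have "\<dots> \<le> \<bar>c\<bar> * pi" using Im_Ln_le_pi[OF False] mpi_less_Im_Ln[OF False] by (intro mult_left_mono) auto
    finally show ?thesis using False by (simp add: powr_def mult.commute)
  qed simp
  have "norm (complex_of_real s powr (- \<i> * of_real c)) = 1"
    using assms by (subst norm_of_real_powr) auto
  hence "norm (osc_E c v s) = exp (- s) * norm ((1 - of_real s * v) powr (- \<i> * of_real c))"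
    by (simp add: osc_E_def norm_mult)
  also have "\<dots> \<le> exp (- s) * exp (pi * \<bar>c\<bar>)" using p by (intro mult_left_mono) auto
  finally show ?thesis by (simp add: mult.commute)
qed

lemma continuous_osc_E: "Im v > 0 \<Longrightarrow> continuous_on {0<..} (osc_E c v)"
  unfolding osc_E_def[abs_def] using osc_P by (intro continuous_intros) auto

lemma continuous_osc_P_power: "Im v > 0 \<Longrightarrow> continuous_on {0<..} (\<lambda>s. of_real s ^ j / (1 - of_real s * v) ^ k)"
  using osc_P(2) by (intro continuous_intros) auto

lemma norm_osc_le:
  assumes v: "Im v > 0" and s: "s > 0"
  shows "norm (osc_E c v s * (of_real s ^ j / (1 - of_real s * v) ^ k)) \<le>
      (exp (pi * \<bar>c\<bar>) * (norm v / Im v) ^ k) * (s ^ j * exp (- 1 * s))"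
proof -
  have v0: "norm v > 0" using v by auto
  have "1 / norm (1 - of_real s * v) \<le> 1 / (Im v / norm v)"
    using norm_osc_P_ge[OF v s] v v0 osc_P(2)[OF v s] by (intro divide_left_mono) auto
  hence "(1 / norm (1 - of_real s * v)) ^ k \<le> (norm v / Im v) ^ k" by (intro power_mono) auto
  hence "norm (osc_E c v s) * (s ^ j * (1 / norm (1 - of_real s * v)) ^ k) \<le>
      (exp (pi * \<bar>c\<bar>) * exp (- s)) * (s ^ j * (norm v / Im v) ^ k)"
    using norm_osc_E_le[OF s, of c v] s by (intro mult_mono) auto
  thus ?thesis
    using s by (simp add: norm_mult norm_divide norm_power power_divide mult_ac)
qed

lemma integrable_osc:
  assumes v: "Im v > 0"
  shows "integrable halfline (\<lambda>s. osc_E c v s * (of_real s ^ j / (1 - of_real s * v) ^ k))"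
proof (rule integrable_halfline_bound)
  show "integrable halfline (\<lambda>s. (exp (pi * \<bar>c\<bar>) * (norm v / Im v) ^ k) * (s ^ j * exp (- 1 * s)))"
    by (intro integrable_mult_right integrable_power_exp_halfline) simp
  show "(\<lambda>s. osc_E c v s * (of_real s ^ j / (1 - of_real s * v) ^ k)) \<in> borel_measurable halfline"
    by (intro borel_measurable_continuous_halfline continuous_on_mult continuous_osc_E continuous_osc_P_power v)
qed (rule norm_osc_le[OF v])

text \<open>The algebra behind the v-derivative of P powr (- i c) / P ^ k. The case k = 0 is
  separate because k - 1 is truncated.\<close>

lemma osc_quotient:
  fixes P :: complex
  assumes "P \<noteq> 0"
  shows "(((- \<i> * c) * (p / P) * (- s)) * P ^ k - p * (of_nat k * P ^ (k - 1) * (- s))) / (P ^ k * P ^ k) =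
    (of_nat k + \<i> * c) * (p * s / P ^ Suc k)"
proof (cases k)
  case (Suc n)
  hence "(((- \<i> * c) * (p / P) * (- s)) * P ^ k - p * (of_nat k * P ^ (k - 1) * (- s))) =
      (of_nat k + \<i> * c) * (p * s) * P ^ n"
    using assms by (simp add: ring_distribs mult_ac)
  moreover have "P ^ k * P ^ k = P ^ n * P ^ Suc k" using Suc by (simp add: mult_ac)
  ultimately show ?thesis using assms by simp
qed (use assms in simp)

lemma osc_integral_deriv:
  assumes v: "Im v > 0"
  shows "((\<lambda>v. LH s. osc_E c v s * (of_real s ^ 0 / (1 - of_real s * v) ^ k)) has_field_derivative
     (of_nat k + \<i> * of_real c) * (LH s. osc_E c v s * (of_real s ^ 1 / (1 - of_real s * v) ^ Suc k))) (at v)"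
proof -
  define r where "r = Im v / 2"
  have r: "r > 0" using v by (simp add: r_def)
  \<comment> \<open>On the ball of radius Im v / 2 the ratio |w| / Im w is at most this, so one
    majorant serves all w.\<close>
  define B where "B = (norm v + r) / r"
  have "((\<lambda>v. LH s. osc_E c v s * (of_real s ^ 0 / (1 - of_real s * v) ^ k)) has_field_derivative
     (LH s. (of_nat k + \<i> * of_real c) * (osc_E c v s * (of_real s ^ 1 / (1 - of_real s * v) ^ Suc k)))) (at v)"
  proof (rule integral_parameter_derivative(2)[where S="ball v r"
        and f'="\<lambda>v s. (of_nat k + \<i> * of_real c) * (osc_E c v s * (of_real s ^ 1 / (1 - of_real s * v) ^ Suc k))"])
    show "integrable halfline (\<lambda>s. (exp (pi * \<bar>c\<bar>) * B ^ k) * (s ^ 0 * exp (- 1 * s)))"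
      by (intro integrable_mult_right integrable_power_exp_halfline) simp
    fix w s assume w: "w \<in> ball v r"
    have "\<bar>Im (w - v)\<bar> < r" using w abs_Im_le_cmod[of "w - v"] by (simp add: dist_norm norm_minus_commute)
    hence iw: "r \<le> Im w" unfolding r_def minus_complex.sel by linarith
    hence w0: "Im w > 0" using r by simp
    have nw: "norm w \<le> norm v + r"
      using w norm_triangle_ineq2[of w v] by (simp add: dist_norm norm_minus_commute)
    show "(\<lambda>s. osc_E c w s * (of_real s ^ 0 / (1 - of_real s * w) ^ k)) \<in> borel_measurable halfline"
      using integrable_osc[OF w0] by (rule borel_measurable_integrable)
    assume "s \<in> space halfline"
    hence s: "s > 0" by simp
    have P: "1 - of_real s * w \<notin> \<real>\<^sub>\<le>\<^sub>0" "1 - of_real s * w \<noteq> 0" using osc_P[OF w0 s] by auto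
    have wn: "norm w > 0" using w0 by auto
    have "1 / norm (1 - of_real s * w) \<le> 1 / (Im w / norm w)"
      using norm_osc_P_ge[OF w0 s] w0 wn P by (intro divide_left_mono) auto
    also have "\<dots> \<le> B" using iw nw r by (auto simp: B_def intro!: frac_le)
    finally have "(1 / norm (1 - of_real s * w)) ^ k \<le> B ^ k" by (intro power_mono) auto
    hence "norm (osc_E c w s) * (1 / norm (1 - of_real s * w)) ^ k \<le> (exp (pi * \<bar>c\<bar>) * exp (- s)) * B ^ k"
      using norm_osc_E_le[OF s, of c w] by (intro mult_mono) auto
    thus "norm (osc_E c w s * (of_real s ^ 0 / (1 - of_real s * w) ^ k)) \<le> (exp (pi * \<bar>c\<bar>) * B ^ k) * (s ^ 0 * exp (- 1 * s))"
      by (simp add: norm_mult norm_divide norm_power power_divide mult_ac)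
    define K where "K = exp (- of_real s) * of_real s powr (- \<i> * of_real c)"
    define p where "p = (1 - of_real s * w) powr (- \<i> * of_real c)"
    have "((\<lambda>w. (1 - of_real s * w) powr (- \<i> * of_real c)) has_field_derivative
        (- \<i> * of_real c) * (p / (1 - of_real s * w)) * (- of_real s)) (at w)"
    proof -
      have "((\<lambda>w. (1 - of_real s * w) powr (- \<i> * of_real c)) has_field_derivative
        (- \<i> * of_real c) * (1 - of_real s * w) powr (- \<i> * of_real c - 1) * (- of_real s)) (at w)"
        by (rule derivative_eq_intros refl | use P in force)+
      thus ?thesis unfolding p_def using P by (simp add: powr_diff)
    qed
    moreover have "((\<lambda>w. (1 - of_real s * w) ^ k) has_field_derivative
        of_nat k * (1 - of_real s * w) ^ (k - 1) * (- of_real s)) (at w)"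
      by (auto intro!: derivative_eq_intros)
    ultimately have "((\<lambda>w. (1 - of_real s * w) powr (- \<i> * of_real c) / (1 - of_real s * w) ^ k) has_field_derivative
        (((- \<i> * of_real c) * (p / (1 - of_real s * w)) * (- of_real s)) * (1 - of_real s * w) ^ k -
          p * (of_nat k * (1 - of_real s * w) ^ (k - 1) * (- of_real s))) /
          ((1 - of_real s * w) ^ k * (1 - of_real s * w) ^ k)) (at w)"
      unfolding p_def using P by (intro DERIV_divide) auto
    also have "(((- \<i> * of_real c) * (p / (1 - of_real s * w)) * (- of_real s)) * (1 - of_real s * w) ^ k -
          p * (of_nat k * (1 - of_real s * w) ^ (k - 1) * (- of_real s))) /
          ((1 - of_real s * w) ^ k * (1 - of_real s * w) ^ k) =
        (of_nat k + \<i> * of_real c) * (p * of_real s / (1 - of_real s * w) ^ Suc k)"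
      by (rule osc_quotient[OF P(2)])
    finally have "((\<lambda>w. K * ((1 - of_real s * w) powr (- \<i> * of_real c) / (1 - of_real s * w) ^ k)) has_field_derivative
       K * ((of_nat k + \<i> * of_real c) * (p * of_real s / (1 - of_real s * w) ^ Suc k))) (at w)"
      by (rule DERIV_cmult)
    thus "((\<lambda>w. osc_E c w s * (of_real s ^ 0 / (1 - of_real s * w) ^ k)) has_field_derivative
      (of_nat k + \<i> * of_real c) * (osc_E c w s * (of_real s ^ 1 / (1 - of_real s * w) ^ Suc k))) (at w)"
      by (simp add: osc_E_def K_def p_def mult_ac)
  qed (use r in auto)
  thus ?thesis by (simp only: integral_mult_right_zero)
qed

text \<open>Contiguous relations, from the total derivatives of \<open>osc_E\<close> times s / (1 -
  s v) and of \<open>osc_E\<close> times s. The factor s kills the boundary term at 0, where s powr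
  (- i c) only oscillates.\<close>

lemma osc_E_FTC:
  assumes v: "Im v > 0"
  shows "(LH s. osc_E c v s * (of_real s ^ 1 / (1 - of_real s * v) ^ 1)) =
     (1 - \<i> * of_real c) * (LH s. osc_E c v s * (of_real s ^ 0 / (1 - of_real s * v) ^ 1)) +
     v * (1 + \<i> * of_real c) * (LH s. osc_E c v s * (of_real s ^ 1 / (1 - of_real s * v) ^ 2))"
    (is ?th1)
    and "\<i> * of_real c * v * (LH s. osc_E c v s * (of_real s ^ 1 / (1 - of_real s * v) ^ 1)) =
     (LH s. osc_E c v s * (of_real s ^ 1 / (1 - of_real s * v) ^ 0)) -
     (1 - \<i> * of_real c) * (LH s. osc_E c v s * (of_real s ^ 0 / (1 - of_real s * v) ^ 0))"
    (is ?th2)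
proof -
  define I where "I j k s = osc_E c v s * (of_real s ^ j / (1 - of_real s * v) ^ k)" for j k s
  have ii: "integrable halfline (I j k)" for j k unfolding I_def by (rule integrable_osc[OF v])
  have ci: "continuous_on {0<..} (I j k)" for j k
    unfolding I_def[abs_def] by (intro continuous_on_mult continuous_osc_E continuous_osc_P_power v)
  define \<kappa> where "\<kappa> = - \<i> * of_real c"
  have dE: "((\<lambda>s. osc_E c v s) has_vector_derivative osc_E c v s * (- 1 + \<kappa> / of_real s - \<kappa> * v / (1 - of_real s * v))) (at s)"
    if s: "s > 0" for s
  proof -
    have P: "1 - of_real s * v \<notin> \<real>\<^sub>\<le>\<^sub>0" "1 - of_real s * v \<noteq> 0" using osc_P[OF v s] by auto
    have "((\<lambda>z. exp (- z) * z powr \<kappa> * (1 - z * v) powr \<kappa>) has_field_derivative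
        exp (- of_real s) * of_real s powr \<kappa> * (1 - of_real s * v) powr \<kappa> * (- 1 + \<kappa> / of_real s - \<kappa> * v / (1 - of_real s * v))) (at (of_real s))"
      using P s by (auto intro!: derivative_eq_intros simp: powr_diff field_simps)
    thus ?thesis
      unfolding osc_E_def \<kappa>_def[symmetric] by (rule has_vector_derivative_real_field)
  qed
  have lim: "((\<lambda>s. I 1 k s) \<longlongrightarrow> 0) F"
    if "((\<lambda>s::real. s * exp (- s)) \<longlongrightarrow> 0) F" "\<forall>\<^sub>F s in F. s > 0" for k F
  proof (rule Lim_null_comparison)
    define C where "C = exp (pi * \<bar>c\<bar>) * (norm v / Im v) ^ k"
    show "\<forall>\<^sub>F s in F. norm (I 1 k s) \<le> C * (s * exp (- s))"
      using that(2) by eventually_elim (use norm_osc_le[OF v, of _ c 1 k] in \<open>simp add: I_def C_def\<close>)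
    show "((\<lambda>s. C * (s * exp (- s))) \<longlongrightarrow> 0) F"
      using tendsto_mult[OF tendsto_const that(1), of C] by simp
  qed
  have bd: "((\<lambda>s. I 1 k s) \<longlongrightarrow> 0) (at_right 0)" "((\<lambda>s. I 1 k s) \<longlongrightarrow> 0) at_top" for k
  proof -
    have "((\<lambda>s::real. s * exp (- s)) \<longlongrightarrow> 0) (at_right 0)" by real_asymp
    thus "((\<lambda>s. I 1 k s) \<longlongrightarrow> 0) (at_right 0)"
      by (rule lim) (simp add: eventually_at_right_less)
    have "((\<lambda>s::real. s * exp (- s)) \<longlongrightarrow> 0) at_top" by real_asymp
    thus "((\<lambda>s. I 1 k s) \<longlongrightarrow> 0) at_top"
      by (rule lim) (simp add: eventually_gt_at_top)
  qed
  have "(LH s. (1 + \<kappa>) * I 0 1 s + v * (1 - \<kappa>) * I 1 2 s - I 1 1 s) = 0 - 0"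
  proof (rule halfline_FTC[where F="I 1 1"])
    fix s :: real assume s: "s > 0"
    have P: "1 - of_real s * v \<noteq> 0" using osc_P[OF v s] by auto
    have "((\<lambda>z. z / (1 - z * v)) has_field_derivative 1 / (1 - of_real s * v)\<^sup>2) (at (of_real s))"
      using P by (auto intro!: derivative_eq_intros simp: power2_eq_square)
    hence "((\<lambda>s. of_real s / (1 - of_real s * v)) has_vector_derivative 1 / (1 - of_real s * v)\<^sup>2) (at s)"
      by (rule has_vector_derivative_real_field)
    from has_vector_derivative_mult[OF dE[OF s] this]
    have "((\<lambda>s. osc_E c v s * (of_real s / (1 - of_real s * v))) has_vector_derivative
       (osc_E c v s * (1 / (1 - of_real s * v)\<^sup>2) +
        osc_E c v s * (- 1 + \<kappa> / of_real s - \<kappa> * v / (1 - of_real s * v)) * (of_real s / (1 - of_real s * v)))) (at s)" .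
    also have "osc_E c v s * (1 / (1 - of_real s * v)\<^sup>2) +
        osc_E c v s * (- 1 + \<kappa> / of_real s - \<kappa> * v / (1 - of_real s * v)) * (of_real s / (1 - of_real s * v)) =
        (1 + \<kappa>) * I 0 1 s + v * (1 - \<kappa>) * I 1 2 s - I 1 1 s"
      using P s unfolding I_def by (simp add: divide_simps) (simp add: algebra_simps power2_eq_square)
    also have "(\<lambda>s. osc_E c v s * (of_real s / (1 - of_real s * v))) = I 1 1" by (simp add: I_def fun_eq_iff)
    finally show "(I 1 1 has_vector_derivative (1 + \<kappa>) * I 0 1 s + v * (1 - \<kappa>) * I 1 2 s - I 1 1 s) (at s)" .
  qed (use bd ii in \<open>auto intro!: continuous_intros ci\<close>)
  thus ?th1 using ii unfolding I_def[symmetric] by (simp add: \<kappa>_def algebra_simps)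
  have "(LH s. (1 + \<kappa>) * I 0 0 s - \<kappa> * v * I 1 1 s - I 1 0 s) = 0 - 0"
  proof (rule halfline_FTC[where F="I 1 0"])
    fix s :: real assume s: "s > 0"
    have P: "1 - of_real s * v \<noteq> 0" using osc_P[OF v s] by auto
    have "((\<lambda>s. complex_of_real s) has_vector_derivative 1) (at s)"
      using has_vector_derivative_real_field[OF DERIV_ident, of s UNIV] by simp
    from has_vector_derivative_mult[OF dE[OF s] this]
    have "((\<lambda>s. osc_E c v s * of_real s) has_vector_derivative
       (osc_E c v s * 1 + osc_E c v s * (- 1 + \<kappa> / of_real s - \<kappa> * v / (1 - of_real s * v)) * of_real s)) (at s)" .
    also have "osc_E c v s * 1 + osc_E c v s * (- 1 + \<kappa> / of_real s - \<kappa> * v / (1 - of_real s * v)) * of_real s =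
        (1 + \<kappa>) * I 0 0 s - \<kappa> * v * I 1 1 s - I 1 0 s"
      using P s unfolding I_def by (simp add: divide_simps) (simp add: algebra_simps power2_eq_square)
    also have "(\<lambda>s. osc_E c v s * of_real s) = I 1 0" by (simp add: I_def fun_eq_iff)
    finally show "(I 1 0 has_vector_derivative (1 + \<kappa>) * I 0 0 s - \<kappa> * v * I 1 1 s - I 1 0 s) (at s)" .
  qed (use bd ii in \<open>auto intro!: continuous_intros ci\<close>)
  thus ?th2 using ii unfolding I_def[symmetric] by (simp add: \<kappa>_def algebra_simps)
qed

lemma osc_q_minus_u:
  assumes v: "Im v > 0"
  shows "osc_q c v - osc_u c v = rGamma (1 - \<i> * of_real c) * (v * (LH s. osc_E c v s * (of_real s ^ 1 / (1 - of_real s * v) ^ 1)))"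
proof -
  have "(LH s. osc_E c v s / (1 - of_real s * v)) - (LH s. osc_E c v s) =
      (LH s. osc_E c v s / (1 - of_real s * v) - osc_E c v s)"
    using integrable_osc[OF v, of c 0 0] integrable_osc[OF v, of c 0 1] by simp
  also have "\<dots> = (LH s. v * (osc_E c v s * (of_real s ^ 1 / (1 - of_real s * v) ^ 1)))"
  proof (rule Bochner_Integration.integral_cong[OF refl])
    fix s assume "s \<in> space halfline"
    thus "osc_E c v s / (1 - of_real s * v) - osc_E c v s = v * (osc_E c v s * (of_real s ^ 1 / (1 - of_real s * v) ^ 1))"
      using osc_P(2)[OF v, of s] by (simp add: divide_simps) (simp add: algebra_simps)
  qed
  also have "\<dots> = v * (LH s. osc_E c v s * (of_real s ^ 1 / (1 - of_real s * v) ^ 1))"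
    by (rule integral_mult_right_zero)
  finally show ?thesis unfolding osc_q_def osc_u_def by (simp only: right_diff_distrib[symmetric])
qed

lemma osc_u_deriv:
  assumes v: "Im v > 0"
  shows "(osc_u c has_field_derivative \<i> * of_real c * (osc_q c v - osc_u c v) / v) (at v)"
proof -
  have v0: "v \<noteq> 0" using v by auto
  have "(osc_u c has_field_derivative rGamma (1 - \<i> * of_real c) * ((of_nat 0 + \<i> * of_real c) *
     (LH s. osc_E c v s * (of_real s ^ 1 / (1 - of_real s * v) ^ Suc 0)))) (at v)"
    unfolding osc_u_def[abs_def] using DERIV_cmult[OF osc_integral_deriv[OF v, of c 0]] by simp
  thus ?thesis unfolding osc_q_minus_u[OF v] using v0 by (simp add: mult_ac)
qed

text \<open>The derivative produces a second power of the denominator, which the first contiguous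
  relation removes.\<close>

lemma osc_q_deriv:
  assumes v: "Im v > 0"
  shows "(osc_q c has_field_derivative ((osc_q c v - osc_u c v) / v - (1 - \<i> * of_real c) * osc_q c v) / v) (at v)"
proof -
  have v0: "v \<noteq> 0" using v by auto
  let ?G = "rGamma (1 - \<i> * of_real c)"
  let ?I = "\<lambda>j k. LH s. osc_E c v s * (of_real s ^ j / (1 - of_real s * v) ^ k)"
  have "(osc_q c has_field_derivative ?G * ((of_nat 1 + \<i> * of_real c) * ?I 1 (Suc 1))) (at v)"
    unfolding osc_q_def[abs_def] using DERIV_cmult[OF osc_integral_deriv[OF v, of c 1]] by simp
  moreover have "((osc_q c v - osc_u c v) / v - (1 - \<i> * of_real c) * osc_q c v) / v =
      ?G * ((of_nat 1 + \<i> * of_real c) * ?I 1 (Suc 1))"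
  proof -
    have q: "osc_q c v = ?G * ?I 0 1" by (simp add: osc_q_def)
    have "(osc_q c v - osc_u c v) / v = ?G * ?I 1 1" unfolding osc_q_minus_u[OF v] using v0 by simp
    hence "(osc_q c v - osc_u c v) / v - (1 - \<i> * of_real c) * osc_q c v = ?G * (?I 1 1 - (1 - \<i> * of_real c) * ?I 0 1)"
      unfolding q by (simp only: right_diff_distrib mult.left_commute)
    also have "?I 1 1 - (1 - \<i> * of_real c) * ?I 0 1 = v * (1 + \<i> * of_real c) * ?I 1 2"
      using osc_E_FTC(1)[OF v, of c] by (simp only: add_diff_cancel_left')
    finally show ?thesis using v0 by (simp add: numeral_2_eq_2 mult_ac)
  qed
  ultimately show ?thesis by simp
qed

text \<open>In this combination of \<open>osc_u\<close> and \<open>v * osc_q\<close> the terms with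
  1 / v cancel. What remains is c / v times \<open>osc_b\<close>, the first equation of the
  normalised system.\<close>

lemma osc_a_deriv:
  assumes v: "Im v > 0"
  shows "(osc_a c has_field_derivative of_real c ^ 2 * osc_q c v) (at v)"
proof -
  have v0: "v \<noteq> 0" using v by auto
  define u q C where "u = osc_u c v" and "q = osc_q c v" and "C = complex_of_real c"
  define d where "d = ((q - u) / v - (1 - \<i> * C) * q) / v"
  have dq: "((\<lambda>w. w * osc_q c w) has_field_derivative v * d + 1 * q) (at v)"
    unfolding d_def u_def q_def C_def by (rule DERIV_mult'[OF DERIV_ident osc_q_deriv[OF v]])
  have "((\<lambda>w. osc_u c w - (\<i> * C) * (w * osc_q c w)) has_field_derivative
     \<i> * C * (q - u) / v - (\<i> * C) * (v * d + 1 * q)) (at v)"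
    by (rule DERIV_diff[OF _ DERIV_cmult[OF dq]]) (unfold u_def q_def C_def, rule osc_u_deriv[OF v])
  moreover have "(\<lambda>w. osc_u c w - (\<i> * C) * (w * osc_q c w)) = osc_a c"
    by (simp add: fun_eq_iff osc_a_def C_def mult.assoc)
  moreover have "\<i> * C * (q - u) / v - (\<i> * C) * (v * d + 1 * q) = C ^ 2 * q"
    unfolding d_def using v0 by (simp add: field_simps power2_eq_square)
  ultimately show ?thesis by (simp add: C_def q_def)
qed

lemma osc_b_deriv:
  assumes v: "Im v > 0"
  shows "(osc_b c has_field_derivative osc_b c v / v\<^sup>2 - of_real c / v * osc_a c v) (at v)"
proof -
  have v0: "v \<noteq> 0" using v by auto
  define u q C where "u = osc_u c v" and "q = osc_q c v" and "C = complex_of_real c"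
  define d where "d = ((q - u) / v - (1 - \<i> * C) * q) / v"
  have dq: "((\<lambda>w. w * osc_q c w) has_field_derivative v * d + 1 * q) (at v)"
    unfolding d_def u_def q_def C_def by (rule DERIV_mult'[OF DERIV_ident osc_q_deriv[OF v]])
  have "((\<lambda>w. C * (w * osc_q c w)) has_field_derivative C * (v * d + 1 * q)) (at v)"
    by (rule DERIV_cmult[OF dq])
  moreover have "(\<lambda>w. C * (w * osc_q c w)) = osc_b c"
    by (simp add: fun_eq_iff osc_b_def C_def mult.assoc)
  moreover have "C * (v * d + 1 * q) = osc_b c v / v\<^sup>2 - of_real c / v * osc_a c v"
    unfolding osc_a_def osc_b_def u_def[symmetric] q_def[symmetric] C_def[symmetric] d_def
    using v0 by (simp add: field_simps power2_eq_square)
  ultimately show ?thesis by simp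
qed

text \<open>The majorant of \<open>osc_E\<close> does not depend on v, so dominated convergence
  holds for every approach to 0 inside the half-plane.\<close>

lemma osc_u_tendsto: "(osc_u c \<longlongrightarrow> 1) (at 0 within {v. Im v > 0})"
  unfolding tendsto_at_iff_sequentially comp_def
proof (intro allI impI)
  fix X :: "nat \<Rightarrow> complex" assume X: "\<forall>i. X i \<in> {v. 0 < Im v} - {0}" "X \<longlonglongrightarrow> 0"
  have "(\<lambda>n. LH s. osc_E c (X n) s) \<longlonglongrightarrow> (LH s. complex_of_real s powr ((1 - \<i> * of_real c) - 1) * exp (- of_real s))"
  proof (rule integral_dominated_convergence)
    show "(\<lambda>s. complex_of_real s powr ((1 - \<i> * of_real c) - 1) * exp (- of_real s)) \<in> borel_measurable halfline"
      by (rule borel_measurable_halfline) measurable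
    show "osc_E c (X n) \<in> borel_measurable halfline" for n
      using X(1) by (intro borel_measurable_continuous_halfline continuous_osc_E) auto
    show "integrable halfline (\<lambda>s. exp (pi * \<bar>c\<bar>) * (s ^ 0 * exp (- 1 * s)))"
      by (intro integrable_mult_right integrable_power_exp_halfline) simp
    show "AE s in halfline. norm (osc_E c (X n) s) \<le> exp (pi * \<bar>c\<bar>) * (s ^ 0 * exp (- 1 * s))" for n
      using norm_osc_E_le by (intro AE_I2) auto
    show "AE s in halfline. (\<lambda>n. osc_E c (X n) s) \<longlonglongrightarrow> complex_of_real s powr ((1 - \<i> * of_real c) - 1) * exp (- of_real s)"
    proof (rule AE_I2)
      fix s
      have "(\<lambda>n. osc_E c (X n) s) \<longlonglongrightarrow> exp (- of_real s) * of_real s powr (- \<i> * of_real c) * (1 - of_real s * 0) powr (- \<i> * of_real c)"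
        unfolding osc_E_def using X(2) by (intro tendsto_intros) auto
      thus "(\<lambda>n. osc_E c (X n) s) \<longlonglongrightarrow> complex_of_real s powr ((1 - \<i> * of_real c) - 1) * exp (- of_real s)"
        by (simp add: mult.commute)
    qed
  qed
  hence "(\<lambda>n. osc_u c (X n)) \<longlonglongrightarrow> rGamma (1 - \<i> * of_real c) * Gamma (1 - \<i> * of_real c)"
    unfolding osc_u_def integral_Gamma_halfline_1[of "1 - \<i> * of_real c", simplified] 
    by (intro tendsto_intros) (use integral_Gamma_halfline_1[of "1 - \<i> * of_real c"] in simp)
  moreover have "rGamma (1 - \<i> * of_real c) * Gamma (1 - \<i> * of_real c) = 1"
  proof -
    have "1 - \<i> * of_real c \<notin> \<int>\<^sub>\<le>\<^sub>0" using nonpos_Ints_subset_nonpos_Reals by (auto simp: complex_nonpos_Reals_iff)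
    hence "Gamma (1 - \<i> * of_real c) \<noteq> 0" by (simp add: Gamma_eq_zero_iff)
    thus ?thesis by (simp add: rGamma_inverse_Gamma)
  qed
  ultimately show "(\<lambda>n. osc_u c (X n)) \<longlonglongrightarrow> 1" by simp
qed

text \<open>Bounding 1 / (1 - s v) directly fails as v approaches the real directions. The second
  contiguous relation replaces i c v times that integral by integrals without a denominator; this is
  why c stands in front of \<open>osc_q\<close>.\<close>

lemma osc_q_bounded: "\<exists>C. \<forall>v. Im v > 0 \<longrightarrow> norm (of_real c * osc_q c v) \<le> C"
proof -
  define C where "C = norm (rGamma (1 - \<i> * of_real c)) * (exp (pi * \<bar>c\<bar>) + norm (1 - 2 * \<i> * of_real c) * exp (pi * \<bar>c\<bar>))"
  have "norm (of_real c * osc_q c v) \<le> C" if v: "Im v > 0" for v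
  proof -
    let ?G = "rGamma (1 - \<i> * of_real c)"
    let ?I = "\<lambda>j k. LH s. osc_E c v s * (of_real s ^ j / (1 - of_real s * v) ^ k)"
    have u: "osc_u c v = ?G * ?I 0 0" by (simp add: osc_u_def)
    have "osc_q c v = osc_u c v + ?G * (v * ?I 1 1)" using osc_q_minus_u[OF v, of c] by (simp add: algebra_simps)
    hence "\<i> * of_real c * osc_q c v = ?G * (\<i> * of_real c * ?I 0 0 + \<i> * of_real c * v * ?I 1 1)"
      unfolding u by (simp add: algebra_simps)
    also have "\<dots> = ?G * (?I 1 0 - (1 - 2 * \<i> * of_real c) * ?I 0 0)"
      unfolding osc_E_FTC(2)[OF v] by (simp add: algebra_simps)
    finally have "norm (\<i> * of_real c * osc_q c v) = norm ?G * norm (?I 1 0 - (1 - 2 * \<i> * of_real c) * ?I 0 0)"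
      by (simp only: norm_mult)
    moreover have "norm (?I j 0) \<le> exp (pi * \<bar>c\<bar>)" if "j \<le> 1" for j
    proof -
      have "norm (?I j 0) \<le> (LH s. exp (pi * \<bar>c\<bar>) * (s ^ j * exp (- 1 * s)))"
      proof (rule order_trans[OF integral_norm_bound], rule integral_mono)
        show "integrable halfline (\<lambda>s. norm (osc_E c v s * (of_real s ^ j / (1 - of_real s * v) ^ 0)))"
          by (intro integrable_norm integrable_osc v)
        show "integrable halfline (\<lambda>s. exp (pi * \<bar>c\<bar>) * (s ^ j * exp (- 1 * s)))"
          by (intro integrable_mult_right integrable_power_exp_halfline) simp
      qed (use norm_osc_le[OF v, of _ c j 0] in simp)
      also have "\<dots> = exp (pi * \<bar>c\<bar>) * (fact j / 1 ^ Suc j)"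
        by (subst integral_mult_right_zero, subst integral_power_exp_halfline) auto
      also have "fact j = (1 :: real)" using that by (cases j) auto
      finally show ?thesis by simp
    qed
    hence "norm (?I 1 0 - (1 - 2 * \<i> * of_real c) * ?I 0 0) \<le> exp (pi * \<bar>c\<bar>) + norm (1 - 2 * \<i> * of_real c) * exp (pi * \<bar>c\<bar>)"
      apply (intro order_trans[OF norm_triangle_ineq4] add_mono)
      subgoal by blast
      subgoal premises p unfolding norm_mult by (intro mult_left_mono p) auto
      done
    ultimately have "norm (\<i> * of_real c * osc_q c v) \<le> C" unfolding C_def by (simp add: mult_left_mono)
    thus ?thesis by (simp add: norm_mult)
  qed
  thus ?thesis by blast
qed

lemma osc_b_tendsto: "(osc_b c \<longlongrightarrow> 0) (at 0 within {v. Im v > 0})"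
proof -
  obtain C where C: "\<And>v. Im v > 0 \<Longrightarrow> norm (of_real c * osc_q c v) \<le> C" using osc_q_bounded by blast
  show ?thesis
  proof (rule Lim_null_comparison)
    show "\<forall>\<^sub>F v in at 0 within {v. Im v > 0}. norm (osc_b c v) \<le> C * norm v"
      unfolding eventually_at_filter
    proof (rule always_eventually, intro allI impI)
      fix v :: complex assume "v \<in> {v. Im v > 0}"
      hence "norm v * norm (of_real c * osc_q c v) \<le> norm v * C" using C by (intro mult_left_mono) auto
      thus "norm (osc_b c v) \<le> C * norm v" by (simp add: osc_b_def norm_mult mult_ac)
    qed
    have "((\<lambda>v::complex. C * norm v) \<longlongrightarrow> C * norm (0::complex)) (at 0 within {v. Im v > 0})" by (intro tendsto_intros)
    thus "((\<lambda>v::complex. C * norm v) \<longlongrightarrow> 0) (at 0 within {v. Im v > 0})" by simp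
  qed
qed

lemma osc_a_tendsto: "(osc_a c \<longlongrightarrow> 1) (at 0 within {v. Im v > 0})"
proof -
  have "((\<lambda>v. osc_u c v - \<i> * osc_b c v) \<longlongrightarrow> 1 - \<i> * 0) (at 0 within {v. Im v > 0})"
    by (intro tendsto_intros osc_u_tendsto osc_b_tendsto)
  thus ?thesis by (simp add: osc_a_def[abs_def] osc_b_def mult_ac)
qed

subsection \<open>Small coupling\<close>

text \<open>The coefficient of c in \<open>osc_b\<close> as c tends to 0.\<close>

definition osc_first :: "complex \<Rightarrow> complex" where
  "osc_first v = v * (LH s. exp (- of_real s) / (1 - of_real s * v))"

lemma norm_exp_minus_1_le: "norm (exp y - 1) \<le> exp \<bar>Re y\<bar> * norm (y :: complex)"
proof -
  have "norm (exp y - exp 0) \<le> exp \<bar>Re y\<bar> * norm (y - 0)"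
  proof (rule field_differentiable_bound[where S="closed_segment 0 y" and f'=exp])
    fix z assume "z \<in> closed_segment 0 y"
    then obtain t where t: "0 \<le> t" "t \<le> 1" "z = t *\<^sub>R y" by (auto simp: closed_segment_def)
    have "t * Re y \<le> t * \<bar>Re y\<bar>" using t by (intro mult_left_mono) auto
    also have "\<dots> \<le> 1 * \<bar>Re y\<bar>" using t by (intro mult_right_mono) auto
    finally show "norm (exp z) \<le> exp \<bar>Re y\<bar>" using t by simp
    show "(exp has_field_derivative exp z) (at z within closed_segment 0 y)"
      by (rule has_field_derivative_at_within[OF DERIV_exp])
  qed auto
  thus ?thesis by simp
qed

text \<open>The bound is made of powers that are integrable against exp (- s) on the half-line; near
  0 it is ln y \<le> y for y = x^(-1/2).\<close>

lemma abs_ln_le: "x > 0 \<Longrightarrow> \<bar>ln x\<bar> \<le> x + 2 * x powr (- 1 / 2)" for x :: real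
proof (cases "x \<ge> 1")
  case True
  thus ?thesis using ln_bound[of x] ln_ge_zero[of x] powr_ge_zero[of x "- 1 / 2"] by linarith
next
  case False
  assume x: "x > 0"
  have "ln (x powr (- 1 / 2)) \<le> x powr (- 1 / 2)" using x by (intro ln_bound) auto
  hence "- ln x \<le> 2 * x powr (- 1 / 2)" using x by (simp add: ln_powr)
  moreover have "ln x < 0" using x False by simp
  ultimately show ?thesis using x by simp
qed

text \<open>Majorant of the first-order error in c: |ln s| comes from s powr (- i c), and the
  summand s from the logarithm of |1 - s v|, which is at most s |v|.\<close>

definition osc_weight :: "real \<Rightarrow> real" where
  "osc_weight s = exp (- s) * (1 + \<bar>ln s\<bar> + s)"

lemma integrable_osc_weight: "integrable halfline osc_weight"
proof -
  have "integrable halfline (\<lambda>s. s ^ 0 * exp (- 1 * s) + 2 * (s ^ 1 * exp (- 1 * s)) + 2 * (s powr (- 1 / 2) * exp (- 1 * s)))"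
    by (intro Bochner_Integration.integrable_add integrable_mult_right integrable_power_exp_halfline integrable_powr_exp_halfline) auto
  thus ?thesis
  proof (rule Bochner_Integration.integrable_bound)
    show "osc_weight \<in> borel_measurable halfline"
      unfolding osc_weight_def[abs_def] by (rule borel_measurable_halfline) measurable
    show "AE s in halfline. norm (osc_weight s) \<le> norm (s ^ 0 * exp (- 1 * s) + 2 * (s ^ 1 * exp (- 1 * s)) + 2 * (s powr (- 1 / 2) * exp (- 1 * s)))"
    proof (rule AE_I2)
      fix s assume "s \<in> space halfline"
      hence s: "s > 0" by simp
      have "osc_weight s \<le> exp (- s) * (1 + (s + 2 * s powr (- 1 / 2)) + s)"
        unfolding osc_weight_def using abs_ln_le[OF s] by (intro mult_left_mono) auto
      moreover have "osc_weight s \<ge> 0" using s by (simp add: osc_weight_def)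
      ultimately show "norm (osc_weight s) \<le> norm (s ^ 0 * exp (- 1 * s) + 2 * (s ^ 1 * exp (- 1 * s)) + 2 * (s powr (- 1 / 2) * exp (- 1 * s)))"
        using s by (simp add: algebra_simps)
    qed
  qed
qed

lemma rGamma_near_1:
  obtains K c0 where "K > 0" "0 < c0" "c0 \<le> 1" "\<And>c. \<bar>c\<bar> \<le> c0 \<Longrightarrow> norm (rGamma (1 - \<i> * complex_of_real c) - 1) \<le> K * \<bar>c\<bar>"
proof -
  obtain D where D: "(rGamma has_field_derivative D) (at (1::complex))"
    using has_field_derivative_rGamma by blast
  hence "((\<lambda>h. (rGamma (1 + h) - rGamma 1) / h) \<longlongrightarrow> D) (at (0::complex))" by (simp add: DERIV_def)
  hence "\<forall>\<^sub>F h in at (0::complex). dist ((rGamma (1 + h) - rGamma 1) / h) D < 1" by (rule tendstoD) simp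
  then obtain d where d: "d > 0" "\<And>h::complex. h \<noteq> 0 \<Longrightarrow> norm h < d \<Longrightarrow> norm ((rGamma (1 + h) - rGamma 1) / h - D) < 1"
    by (auto simp: eventually_at dist_norm)
  define c0 where "c0 = min 1 (d / 2)"
  have "norm (rGamma (1 - \<i> * complex_of_real c) - 1) \<le> (norm D + 1) * \<bar>c\<bar>" if c: "\<bar>c\<bar> \<le> c0" for c
  proof (cases "c = 0")
    case False
    define h where "h = - \<i> * complex_of_real c"
    have h: "h \<noteq> 0" "norm h = \<bar>c\<bar>" using False by (simp_all add: h_def norm_mult)
    have "norm h < d" using h c d(1) by (auto simp: c0_def)
    hence "norm ((rGamma (1 + h) - rGamma 1) / h - D) < 1" by (rule d(2)[OF h(1)])
    hence "norm ((rGamma (1 + h) - rGamma 1) / h) \<le> norm D + 1"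
      using norm_triangle_ineq2[of "(rGamma (1 + h) - rGamma 1) / h" D] by linarith
    hence "norm (rGamma (1 + h) - rGamma 1) \<le> (norm D + 1) * norm h"
      using h(1) by (simp add: norm_divide divide_le_eq)
    thus ?thesis using h by (simp add: h_def)
  qed simp
  moreover have "norm D + 1 > 0" using norm_ge_zero[of D] by linarith
  ultimately show ?thesis using that[of "norm D + 1" c0] d(1) by (auto simp: c0_def)
qed

text \<open>\<open>A\<close> restricts v to a cone, which keeps |1 - s v| away from 0, and
  \<open>B\<close> bounds |v|. Writing \<open>osc_E\<close> as exp (- s) exp y, the error is
  governed by |y| = |c| |ln s + Ln P|, while |c| \<le> 1 keeps |Re y| at most pi.\<close>

lemma osc_E_first_order:
  assumes "A \<ge> 0" "B \<ge> 0"
  obtains K c0 where "K > 0" "0 < c0" "c0 \<le> 1"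
    "\<And>c v s. \<bar>c\<bar> \<le> c0 \<Longrightarrow> Im v > 0 \<Longrightarrow> norm v \<le> (1 + A) * Im v \<Longrightarrow> norm v \<le> B \<Longrightarrow> s > 0 \<Longrightarrow>
       norm (rGamma (1 - \<i> * of_real c) * osc_E c v s - exp (- of_real s)) \<le> K * \<bar>c\<bar> * osc_weight s"
    "\<And>c. \<bar>c\<bar> \<le> c0 \<Longrightarrow> norm (rGamma (1 - \<i> * complex_of_real c)) \<le> K"
proof -
  obtain K1 c0 where K1: "K1 > 0" "0 < c0" "c0 \<le> 1" "\<And>c. \<bar>c\<bar> \<le> c0 \<Longrightarrow> norm (rGamma (1 - \<i> * complex_of_real c) - 1) \<le> K1 * \<bar>c\<bar>"
    by (rule rGamma_near_1) blast
  define L where "L = ln (1 + A) + pi + B + 1"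
  have L: "L \<ge> 1" using assms pi_ge_zero by (simp add: L_def)
  define K where "K = K1 * exp pi + exp pi * L + K1 + 1"
  have "norm (rGamma (1 - \<i> * of_real c) * osc_E c v s - exp (- of_real s)) \<le> K * \<bar>c\<bar> * osc_weight s"
    if c: "\<bar>c\<bar> \<le> c0" and v: "Im v > 0" "norm v \<le> (1 + A) * Im v" "norm v \<le> B" and s: "s > 0" for c v s
  proof -
    define P where "P = 1 - of_real s * v"
    have P0: "P \<noteq> 0" using osc_P(2)[OF v(1) s] by (simp add: P_def)
    have v0: "norm v > 0" using v(1) by auto
    have "1 / (1 + A) \<le> Im v / norm v" using v v0 assms by (simp add: field_simps)
    also have "\<dots> \<le> norm P" unfolding P_def by (rule norm_osc_P_ge[OF v(1) s])
    finally have "1 / (1 + A) \<le> norm P" .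
    hence "ln (1 / (1 + A)) \<le> ln (norm P)" using P0 assms by (intro ln_mono) auto
    hence "- ln (1 + A) \<le> ln (norm P)" using assms by (simp add: ln_div)
    moreover have "ln (norm P) \<le> s * B"
    proof -
      have "norm P \<le> 1 + norm (of_real s * v)" unfolding P_def using norm_triangle_ineq4[of 1 "of_real s * v"] by simp
      also have "\<dots> \<le> 1 + s * B" using v s by (simp add: norm_mult mult_left_mono)
      finally have "ln (norm P) \<le> ln (1 + s * B)" using P0 by (intro ln_mono) auto
      also have "\<dots> \<le> s * B" using s assms by (intro ln_add_one_self_le_self) auto
      finally show ?thesis .
    qed
    moreover have "0 \<le> ln (1 + A)" "0 \<le> s * B" using assms s by simp_all
    ultimately have "\<bar>ln (norm P)\<bar> \<le> ln (1 + A) + s * B" by linarith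
    hence LnP: "norm (Ln P) \<le> ln (1 + A) + s * B + pi"
      using cmod_le[of "Ln P"] P0 Im_Ln_le_pi[OF P0] mpi_less_Im_Ln[OF P0] by simp
    define y where "y = - \<i> * of_real c * (of_real (ln s) + Ln P)"
    have E: "osc_E c v s = exp (- of_real s) * exp y"
      using s P0 unfolding osc_E_def P_def[symmetric]
      by (simp add: y_def powr_def Ln_of_real algebra_simps flip: exp_add)
    have "norm y = \<bar>c\<bar> * norm (of_real (ln s) + Ln P)" by (simp add: y_def norm_mult)
    also have "norm (of_real (ln s) + Ln P) \<le> \<bar>ln s\<bar> + (ln (1 + A) + s * B + pi)"
      using LnP norm_triangle_ineq[of "of_real (ln s)" "Ln P"] by simp
    also have "\<dots> \<le> L * (1 + \<bar>ln s\<bar> + s)"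
    proof -
      have "\<bar>ln s\<bar> \<le> L * \<bar>ln s\<bar>" using L by (simp add: mult_le_cancel_right1)
      moreover have "ln (1 + A) + pi \<le> L" using assms by (simp add: L_def)
      moreover have "s * B \<le> L * s" using s assms pi_ge_zero by (simp add: L_def mult.commute[of s])
      ultimately show ?thesis by (simp add: algebra_simps)
    qed
    finally have ny: "norm y \<le> \<bar>c\<bar> * (L * (1 + \<bar>ln s\<bar> + s))" by (simp add: mult_left_mono)
    have "\<bar>Re y\<bar> \<le> pi"
    proof -
      have "Re y = c * Im (Ln P)" by (simp add: y_def)
      hence "\<bar>Re y\<bar> = \<bar>c\<bar> * \<bar>Im (Ln P)\<bar>" by (simp add: abs_mult)
      also have "\<dots> \<le> 1 * pi" using c K1(3) Im_Ln_le_pi[OF P0] mpi_less_Im_Ln[OF P0] by (intro mult_mono) auto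
      finally show ?thesis by simp
    qed
    hence ey: "norm (exp y) \<le> exp pi" "exp \<bar>Re y\<bar> \<le> exp pi" by auto
    have e1: "norm (exp y - 1) \<le> exp pi * (\<bar>c\<bar> * (L * (1 + \<bar>ln s\<bar> + s)))"
      by (rule order_trans[OF norm_exp_minus_1_le]) (intro mult_mono ny ey, auto)
    let ?G = "rGamma (1 - \<i> * complex_of_real c)"
    have "norm (?G * exp y - 1) \<le> norm ((?G - 1) * exp y) + norm (exp y - 1)"
      using norm_triangle_ineq[of "(?G - 1) * exp y" "exp y - 1"] by (simp add: algebra_simps)
    also have "norm ((?G - 1) * exp y) \<le> (K1 * \<bar>c\<bar>) * exp pi"
      unfolding norm_mult using K1(4)[OF c] ey K1(1) by (intro mult_mono) auto
    also have "(K1 * \<bar>c\<bar>) * exp pi \<le> (K1 * \<bar>c\<bar>) * exp pi * (1 + \<bar>ln s\<bar> + s)"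
      using s K1(1) mult_left_mono[of 1 "1 + \<bar>ln s\<bar> + s" "(K1 * \<bar>c\<bar>) * exp pi"] by simp
    finally have "norm (?G * exp y - 1) \<le> (K1 * exp pi + exp pi * L) * \<bar>c\<bar> * (1 + \<bar>ln s\<bar> + s)"
      using e1 by (simp add: algebra_simps)
    also have "\<dots> \<le> K * \<bar>c\<bar> * (1 + \<bar>ln s\<bar> + s)"
      using s K1(1) by (intro mult_right_mono) (auto simp: K_def)
    finally have "exp (- s) * norm (?G * exp y - 1) \<le> exp (- s) * (K * \<bar>c\<bar> * (1 + \<bar>ln s\<bar> + s))"
      by (intro mult_left_mono) auto
    moreover have "?G * osc_E c v s - exp (- of_real s) = exp (- of_real s) * (?G * exp y - 1)"
      unfolding E by (simp add: algebra_simps)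
    ultimately show ?thesis by (simp add: norm_mult osc_weight_def mult_ac)
  qed
  moreover have "norm (rGamma (1 - \<i> * complex_of_real c)) \<le> K" if c: "\<bar>c\<bar> \<le> c0" for c
  proof -
    have "norm (rGamma (1 - \<i> * complex_of_real c)) \<le> 1 + norm (rGamma (1 - \<i> * complex_of_real c) - 1)"
      using norm_triangle_ineq[of 1 "rGamma (1 - \<i> * complex_of_real c) - 1"] by simp
    also have "\<dots> \<le> 1 + K1 * 1"
    proof -
      have "K1 * \<bar>c\<bar> \<le> K1 * 1" using K1(1,3) c by (intro mult_left_mono) auto
      thus ?thesis using K1(4)[OF c] by linarith
    qed
    also have "\<dots> \<le> K" using K1(1) L by (simp add: K_def)
    finally show ?thesis .
  qed
  moreover have "K > 0" using K1(1) L by (simp add: K_def add_pos_pos)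
  ultimately show ?thesis using that[of K c0] K1(2,3) by blast
qed

text \<open>Each bound carries the factor |v|, of order 1 / m later, which secures summability over
  the frequencies. For \<open>osc_b\<close> it is the explicit factor v. For \<open>osc_a\<close>
  the derivative c^2 q is bounded along the segment towards 0, on which the cone condition is
  inherited.\<close>

theorem osc_first_order:
  assumes A: "A \<ge> 0" and B: "B \<ge> 0"
  obtains C c0 where "C > 0" "0 < c0" "c0 \<le> 1"
    "\<And>c v. \<bar>c\<bar> \<le> c0 \<Longrightarrow> Im v > 0 \<Longrightarrow> norm v \<le> (1 + A) * Im v \<Longrightarrow> norm v \<le> B \<Longrightarrow>
       norm (osc_b c v - of_real c * osc_first v) \<le> C * c\<^sup>2 * norm v \<and>
       norm (osc_b c v) \<le> C * \<bar>c\<bar> * norm v \<and> norm (osc_a c v - 1) \<le> C * c\<^sup>2 * norm v"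
proof -
  obtain K c0 where K: "K > 0" "0 < c0" "c0 \<le> 1"
    "\<And>c v s. \<bar>c\<bar> \<le> c0 \<Longrightarrow> Im v > 0 \<Longrightarrow> norm v \<le> (1 + A) * Im v \<Longrightarrow> norm v \<le> B \<Longrightarrow> s > 0 \<Longrightarrow>
       norm (rGamma (1 - \<i> * of_real c) * osc_E c v s - exp (- of_real s)) \<le> K * \<bar>c\<bar> * osc_weight s"
    "\<And>c. \<bar>c\<bar> \<le> c0 \<Longrightarrow> norm (rGamma (1 - \<i> * complex_of_real c)) \<le> K"
    by (rule osc_E_first_order[OF A B]) blast
  define W where "W = integral\<^sup>L halfline osc_weight"
  have W0: "W \<ge> 0" unfolding W_def by (rule Bochner_Integration.integral_nonneg) (auto simp: osc_weight_def)
  define C where "C = (1 + A) * K * W + K * exp pi * (1 + A)"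
  have P: "1 / norm (1 - of_real s * v) \<le> 1 + A" if v: "Im v > 0" "norm v \<le> (1 + A) * Im v" and s: "s > 0" for v s
  proof -
    have v0: "norm v > 0" using v(1) by auto
    have "1 / (1 + A) \<le> Im v / norm v" using v v0 A by (simp add: field_simps)
    also have "\<dots> \<le> norm (1 - of_real s * v)" by (rule norm_osc_P_ge[OF v(1) s])
    finally have "1 / (1 + A) \<le> norm (1 - of_real s * v)" .
    moreover have "norm (1 - of_real s * v) > 0" using osc_P(2)[OF v(1) s] by simp
    ultimately show ?thesis using A by (simp add: field_simps)
  qed
  have qb: "norm (osc_q c v) \<le> K * exp pi * (1 + A)"
    if c: "\<bar>c\<bar> \<le> c0" and v: "Im v > 0" "norm v \<le> (1 + A) * Im v" for c v
  proof -
    have "norm (LH s. osc_E c v s / (1 - of_real s * v)) \<le> (LH s. (exp pi * (1 + A)) * (s ^ 0 * exp (- 1 * s)))"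
    proof (rule order_trans[OF integral_norm_bound], rule integral_mono)
      show "integrable halfline (\<lambda>s. norm (osc_E c v s / (1 - of_real s * v)))"
        using integrable_norm[OF integrable_osc[OF v(1), of c 0 1]] by simp
      show "integrable halfline (\<lambda>s. (exp pi * (1 + A)) * (s ^ 0 * exp (- 1 * s)))"
        by (intro integrable_mult_right integrable_power_exp_halfline) simp
      fix s assume "s \<in> space halfline"
      hence s: "s > 0" by simp
      have "norm (osc_E c v s) \<le> exp (pi * \<bar>c\<bar>) * exp (- s)" by (rule norm_osc_E_le[OF s])
      also have "\<dots> \<le> exp pi * exp (- s)" using c K(3) by (intro mult_right_mono) (auto simp: mult_le_cancel_left1)
      finally have "norm (osc_E c v s) * (1 / norm (1 - of_real s * v)) \<le> (exp pi * exp (- s)) * (1 + A)"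
        using P[OF v s] by (intro mult_mono) auto
      thus "norm (osc_E c v s / (1 - of_real s * v)) \<le> (exp pi * (1 + A)) * (s ^ 0 * exp (- 1 * s))"
        by (simp add: norm_divide mult_ac)
    qed
    also have "\<dots> = exp pi * (1 + A)"
      by (subst integral_mult_right_zero, subst integral_power_exp_halfline) auto
    finally have "norm (osc_q c v) \<le> K * (exp pi * (1 + A))"
      unfolding osc_q_def norm_mult using K(5)[OF c] K(1) by (intro mult_mono) auto
    thus ?thesis by (simp only: mult.assoc)
  qed
  have main: "norm (osc_b c v - of_real c * osc_first v) \<le> C * c\<^sup>2 * norm v \<and>
       norm (osc_b c v) \<le> C * \<bar>c\<bar> * norm v \<and> norm (osc_a c v - 1) \<le> C * c\<^sup>2 * norm v"
    if c: "\<bar>c\<bar> \<le> c0" and v: "Im v > 0" "norm v \<le> (1 + A) * Im v" "norm v \<le> B" for c v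
  proof (intro conjI)
    let ?G = "rGamma (1 - \<i> * complex_of_real c)"
    have i1: "integrable halfline (\<lambda>s. osc_E c v s / (1 - of_real s * v))"
      using integrable_osc[OF v(1), of c 0 1] by simp
    have i2: "integrable halfline (\<lambda>s. exp (- of_real s) / (1 - of_real s * v))"
      using integrable_osc[OF v(1), of 0 0 1]
      by (rule Bochner_Integration.integrable_cong[THEN iffD1, rotated -1])
         (use osc_P(2)[OF v(1)] in \<open>auto simp: osc_E_def\<close>)
    have "?G * (LH s. osc_E c v s / (1 - of_real s * v)) - (LH s. exp (- of_real s) / (1 - of_real s * v)) =
       (LH s. (?G * osc_E c v s - exp (- of_real s)) / (1 - of_real s * v))"
      by (subst integral_mult_right_zero[symmetric], subst Bochner_Integration.integral_diff[symmetric])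
         (use i1 i2 integrable_mult_right[OF i1, of ?G] in \<open>auto simp: diff_divide_distrib\<close>)
    moreover have "norm (LH s. (?G * osc_E c v s - exp (- of_real s)) / (1 - of_real s * v)) \<le>
       (LH s. ((1 + A) * K * \<bar>c\<bar>) * osc_weight s)"
    proof (rule order_trans[OF integral_norm_bound], rule integral_mono)
      have "integrable halfline (\<lambda>s. ?G * (osc_E c v s / (1 - of_real s * v)) - exp (- of_real s) / (1 - of_real s * v))"
        by (intro Bochner_Integration.integrable_diff integrable_mult_right i1 i2)
      thus "integrable halfline (\<lambda>s. norm ((?G * osc_E c v s - exp (- of_real s)) / (1 - of_real s * v)))"
        by (intro integrable_norm) (simp add: diff_divide_distrib)
      show "integrable halfline (\<lambda>s. ((1 + A) * K * \<bar>c\<bar>) * osc_weight s)"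
        by (intro integrable_mult_right integrable_osc_weight)
      fix s assume "s \<in> space halfline"
      hence s: "s > 0" by simp
      have "norm (?G * osc_E c v s - exp (- of_real s)) * (1 / norm (1 - of_real s * v)) \<le> (K * \<bar>c\<bar> * osc_weight s) * (1 + A)"
        using K(4)[OF c v s] P[OF v(1,2) s] K(1) s by (intro mult_mono) (auto simp: osc_weight_def)
      thus "norm ((?G * osc_E c v s - exp (- of_real s)) / (1 - of_real s * v)) \<le> ((1 + A) * K * \<bar>c\<bar>) * osc_weight s"
        by (simp add: norm_divide mult_ac)
    qed
    moreover have "(LH s. ((1 + A) * K * \<bar>c\<bar>) * osc_weight s) = ((1 + A) * K * \<bar>c\<bar>) * W"
      unfolding W_def by (rule integral_mult_right_zero)
    ultimately have d: "norm (osc_q c v - (LH s. exp (- of_real s) / (1 - of_real s * v))) \<le> ((1 + A) * K * \<bar>c\<bar>) * W"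
      by (simp only: osc_q_def)
    have "osc_b c v - of_real c * osc_first v = of_real c * v * (osc_q c v - (LH s. exp (- of_real s) / (1 - of_real s * v)))"
      by (simp add: osc_b_def osc_first_def algebra_simps)
    hence "norm (osc_b c v - of_real c * osc_first v) \<le> \<bar>c\<bar> * norm v * (((1 + A) * K * \<bar>c\<bar>) * W)"
      using d by (simp add: norm_mult mult_left_mono)
    also have "\<dots> = ((1 + A) * K * W) * c\<^sup>2 * norm v" by (simp add: power2_eq_square)
    also have "\<dots> \<le> C * c\<^sup>2 * norm v"
      using K(1) A by (intro mult_right_mono) (auto simp: C_def)
    finally show "norm (osc_b c v - of_real c * osc_first v) \<le> C * c\<^sup>2 * norm v" .
    have KC: "K * exp pi * (1 + A) \<le> C" using K(1) A W0 by (simp add: C_def)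
    have "norm (osc_b c v) = \<bar>c\<bar> * norm v * norm (osc_q c v)" by (simp add: osc_b_def norm_mult)
    also have "\<dots> \<le> \<bar>c\<bar> * norm v * C" using order_trans[OF qb[OF c v(1,2)] KC] by (intro mult_left_mono) auto
    finally show "norm (osc_b c v) \<le> C * \<bar>c\<bar> * norm v" by (simp add: mult_ac)
    \<comment> \<open>The segment stops short of 0, where \<open>osc_a\<close> only has a limit;
      afterwards e tends to 0.\<close>
    have seg: "norm (osc_a c v - osc_a c (of_real e * v)) \<le> C * c\<^sup>2 * norm v" if e: "0 < e" "e < 1" for e :: real
    proof -
      have "norm (osc_a c v - osc_a c (of_real e * v)) \<le> (c\<^sup>2 * C) * norm (v - of_real e * v)"
      proof (rule field_differentiable_bound[where S="closed_segment (of_real e * v) v" and f'="\<lambda>w. of_real c ^ 2 * osc_q c w"])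
        fix w assume "w \<in> closed_segment (of_real e * v) v"
        then obtain t where t: "0 \<le> t" "t \<le> 1" "w = (1 - t) *\<^sub>R (of_real e * v) + t *\<^sub>R v" by (auto simp: closed_segment_def)
        define r where "r = (1 - t) * e + t"
        have w: "w = of_real r * v" unfolding t(3) r_def by (simp add: scaleR_conv_of_real algebra_simps)
        have r: "r > 0"
        proof (cases "t = 0")
          case False
          thus ?thesis using t e by (simp add: r_def add_nonneg_pos)
        qed (simp add: r_def e)
        have w1: "Im w > 0" using w r v(1) by simp
        have "norm w \<le> (1 + A) * Im w" using mult_left_mono[OF v(2), of r] r unfolding w by (simp add: norm_mult mult_ac)
        hence "norm (osc_q c w) \<le> C" using order_trans[OF qb[OF c w1] KC] by blast
        thus "norm (of_real c ^ 2 * osc_q c w) \<le> c\<^sup>2 * C"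
          by (simp add: norm_mult norm_power mult_left_mono)
        show "(osc_a c has_field_derivative of_real c ^ 2 * osc_q c w) (at w within closed_segment (of_real e * v) v)"
          by (rule has_field_derivative_at_within[OF osc_a_deriv[OF w1]])
      qed auto
      also have "\<dots> \<le> (c\<^sup>2 * C) * norm v"
      proof (rule mult_left_mono)
        have "v - of_real e * v = of_real (1 - e) * v" by (simp add: algebra_simps)
        hence "norm (v - of_real e * v) = norm (complex_of_real (1 - e)) * norm v" by (simp only: norm_mult)
        also have "norm (complex_of_real (1 - e)) = 1 - e" using e by (simp only: norm_of_real)
        finally have "norm (v - of_real e * v) = (1 - e) * norm v" .
        thus "norm (v - of_real e * v) \<le> norm v" using e by (simp add: mult_left_le_one_le)
        show "0 \<le> c\<^sup>2 * C" using K(1) A W0 by (simp add: C_def)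
      qed
      finally show ?thesis by (simp only: mult.commute[of "c\<^sup>2"])
    qed
    have "((\<lambda>e::real. of_real e * v) \<longlongrightarrow> of_real 0 * v) (at_right 0)" by (intro tendsto_intros)
    hence "filterlim (\<lambda>e::real. of_real e * v) (at 0 within {v. Im v > 0}) (at_right 0)"
      unfolding filterlim_at using v(1) by (auto intro: eventually_mono[OF eventually_at_right_less])
    hence "((\<lambda>e::real. osc_a c (of_real e * v)) \<longlongrightarrow> 1) (at_right 0)"
      by (rule filterlim_compose[OF osc_a_tendsto])
    hence "((\<lambda>e::real. norm (osc_a c v - osc_a c (of_real e * v))) \<longlongrightarrow> norm (osc_a c v - 1)) (at_right 0)"
      by (intro tendsto_intros)
    moreover have "\<forall>\<^sub>F e::real in at_right 0. norm (osc_a c v - osc_a c (of_real e * v)) \<le> C * c\<^sup>2 * norm v"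
      using eventually_at_right_real[OF zero_less_one] by eventually_elim (use seg in auto)
    ultimately show "norm (osc_a c v - 1) \<le> C * c\<^sup>2 * norm v"
      by (rule tendsto_upperbound) simp
  qed
  have "C > 0" using K(1) A W0 by (simp add: C_def add_nonneg_pos)
  thus ?thesis using that[of C c0] K(2,3) main by blast
qed

no_notation fps_nth (infixl "$" 75)

subsection \<open>Simple oscillators\<close>

lemma mat2_eqI:
  fixes A B :: "complex ^ 2 ^ 2"
  assumes "A $ 1 $ 1 = B $ 1 $ 1" "A $ 1 $ 2 = B $ 1 $ 2" "A $ 2 $ 1 = B $ 2 $ 1" "A $ 2 $ 2 = B $ 2 $ 2"
  shows "A = B"
  using assms by (simp add: vec_eq_iff forall_2)

lemma mat2_mult:
  fixes A B :: "complex ^ 2 ^ 2"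
  shows "(A ** B) $ i $ j = A $ i $ 1 * B $ 1 $ j + A $ i $ 2 * B $ 2 $ j"
  by (simp add: matrix_matrix_mult_def sum_2)

lemma mat2_1: "(mat 1 :: complex ^ 2 ^ 2) $ 1 $ 1 = 1" "(mat 1 :: complex ^ 2 ^ 2) $ 1 $ 2 = 0"
    "(mat 1 :: complex ^ 2 ^ 2) $ 2 $ 1 = 0" "(mat 1 :: complex ^ 2 ^ 2) $ 2 $ 2 = 1"
  by (simp_all add: mat_def)

lemma mat2_tendstoI:
  fixes f :: "'a \<Rightarrow> complex ^ 2 ^ 2"
  assumes "\<And>i j. ((\<lambda>x. f x $ i $ j) \<longlongrightarrow> L $ i $ j) F"
  shows "(f \<longlongrightarrow> L) F"
  by (intro vec_tendstoI assms)

lemma mat2_sums: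
  fixes f :: "nat \<Rightarrow> complex ^ 2 ^ 2"
  assumes "\<And>i j. (\<lambda>n. f n $ i $ j) sums (L $ i $ j)"
  shows "f sums L"
  unfolding sums_def by (rule mat2_tendstoI) (use assms in \<open>simp add: sums_def sum_component\<close>)

definition diag2 :: "complex \<Rightarrow> complex \<Rightarrow> complex ^ 2 ^ 2" where
  "diag2 a b = vector [vector [a, 0], vector [0, b]]"

lemma diag2_nth [simp]: "diag2 a b $ 1 $ 1 = a" "diag2 a b $ 1 $ 2 = 0" "diag2 a b $ 2 $ 1 = 0" "diag2 a b $ 2 $ 2 = b"
  by (simp_all add: diag2_def)

lemma mat_exp_diag2: "mat_exp (diag2 a b) = diag2 (exp a) (exp b)"
proof -
  have p: "mat_power (diag2 a b) n = diag2 (a ^ n) (b ^ n)" for n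
    by (induction n) (auto intro!: mat2_eqI simp: mat_power_def mat2_mult mat2_1)
  have "(\<lambda>n. mat_scale (1 / fact n) (mat_power (diag2 a b) n)) sums diag2 (exp a) (exp b)"
  proof (rule mat2_sums)
    have e: "(\<lambda>n. 1 / fact n * z ^ n) sums exp z" for z :: complex
      using exp_converges[of z] by (simp add: scaleR_conv_of_real field_simps)
    fix i j :: 2
    show "(\<lambda>n. mat_scale (1 / fact n) (mat_power (diag2 a b) n) $ i $ j) sums diag2 (exp a) (exp b) $ i $ j"
      using exhaust_2[of i] exhaust_2[of j] e[of a] e[of b] by (auto simp: p mat_scale_def)
  qed
  thus ?thesis unfolding mat_exp_def by (rule sums_unique[symmetric])
qed

text \<open>The normalised oscillator equation in the coordinate \<open>v = t / (m Z(\<gamma>))\<close>.\<close>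

definition osc_system :: "real \<Rightarrow> (complex \<Rightarrow> complex ^ 2 ^ 2) \<Rightarrow> bool" where
  "osc_system c X \<longleftrightarrow>
     (\<forall>v. Im v > 0 \<longrightarrow>
       ((\<lambda>v. X v $ 1 $ 1) has_field_derivative of_real c / v * X v $ 2 $ 1) (at v) \<and>
       ((\<lambda>v. X v $ 2 $ 1) has_field_derivative X v $ 2 $ 1 / v\<^sup>2 - of_real c / v * X v $ 1 $ 1) (at v) \<and>
       ((\<lambda>v. X v $ 1 $ 2) has_field_derivative - (X v $ 1 $ 2 / v\<^sup>2) + of_real c / v * X v $ 2 $ 2) (at v) \<and>
       ((\<lambda>v. X v $ 2 $ 2) has_field_derivative - (of_real c / v * X v $ 1 $ 2)) (at v)) \<and>
     (X \<longlongrightarrow> mat 1) (at 0 within {v. Im v > 0})"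

text \<open>After conjugation, v -> - cnj v reverses the sign of d/dv and of 1 / v but not that of 1
  / v^2. So only the term with 1 / v^2 changes sign relative to the derivative, which turns the
  equations of the first column into those of the second, up to the sign put into the off-diagonal
  entry.\<close>

definition osc_Psi :: "real \<Rightarrow> complex \<Rightarrow> complex ^ 2 ^ 2" where
  "osc_Psi c v = vector [vector [osc_a c v, - cnj (osc_b c (- cnj v))],
                         vector [osc_b c v, cnj (osc_a c (- cnj v))]]"

lemma osc_Psi_nth [simp]:
  "osc_Psi c v $ 1 $ 1 = osc_a c v" "osc_Psi c v $ 1 $ 2 = - cnj (osc_b c (- cnj v))"
  "osc_Psi c v $ 2 $ 1 = osc_b c v" "osc_Psi c v $ 2 $ 2 = cnj (osc_a c (- cnj v))"
  by (simp_all add: osc_Psi_def)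

lemma deriv_cnj_reflect:
  assumes "(f has_field_derivative F) (at (- cnj v))"
  shows "((\<lambda>w. cnj (f (- cnj w))) has_field_derivative - cnj F) (at v)"
proof -
  have "(f has_field_derivative F) (at (cnj (- v)))" using assms by simp
  from has_field_derivative_cnj_cnj[OF this] have "(cnj \<circ> f \<circ> cnj has_field_derivative cnj F) (at (- v))" by simp
  from DERIV_chain2[where g="\<lambda>w. - w" and s=UNIV, OF this DERIV_minus[OF DERIV_ident]] show ?thesis
    by (simp add: comp_def)
qed

lemma filterlim_reflect: "filterlim (\<lambda>v. - cnj v) (at 0 within {v. Im v > 0}) (at 0 within {v. Im v > 0})"
  unfolding filterlim_at
proof (intro conjI)
  have "((\<lambda>v. - cnj v) \<longlongrightarrow> - cnj 0) (at 0 within {v. Im v > 0})" by (intro tendsto_intros)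
  thus "((\<lambda>v. - cnj v) \<longlongrightarrow> 0) (at 0 within {v. Im v > 0})" by simp
qed (simp add: eventually_at_filter)

lemma osc_system_Psi: "osc_system c (osc_Psi c)"
  unfolding osc_system_def
proof (intro conjI allI impI)
  fix v assume v: "Im v > 0"
  have v0: "v \<noteq> 0" and v': "Im (- cnj v) > 0" using v by auto
  have a: "(osc_a c has_field_derivative of_real c / v * osc_b c v) (at v)" if "Im v > 0" for v
    using osc_a_deriv[OF that, of c] that by (auto simp: osc_b_def power2_eq_square mult.assoc)
  show "((\<lambda>v. osc_Psi c v $ 1 $ 1) has_field_derivative of_real c / v * osc_Psi c v $ 2 $ 1) (at v)"
    using a[OF v] by simp
  show "((\<lambda>v. osc_Psi c v $ 2 $ 1) has_field_derivative osc_Psi c v $ 2 $ 1 / v\<^sup>2 - of_real c / v * osc_Psi c v $ 1 $ 1) (at v)"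
    using osc_b_deriv[OF v] by simp
  show "((\<lambda>v. osc_Psi c v $ 1 $ 2) has_field_derivative - (osc_Psi c v $ 1 $ 2 / v\<^sup>2) + of_real c / v * osc_Psi c v $ 2 $ 2) (at v)"
    using DERIV_minus[OF deriv_cnj_reflect[OF osc_b_deriv[OF v', of c]]] v0 by (simp add: add.commute)
  show "((\<lambda>v. osc_Psi c v $ 2 $ 2) has_field_derivative - (of_real c / v * osc_Psi c v $ 1 $ 2)) (at v)"
    using deriv_cnj_reflect[OF a[OF v']] v0 by simp
next
  have a: "((\<lambda>v. cnj (osc_a c (- cnj v))) \<longlongrightarrow> cnj 1) (at 0 within {v. Im v > 0})"
    by (intro tendsto_cnj filterlim_compose[OF osc_a_tendsto filterlim_reflect])
  have b: "((\<lambda>v. - cnj (osc_b c (- cnj v))) \<longlongrightarrow> - cnj 0) (at 0 within {v. Im v > 0})"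
    by (intro tendsto_minus tendsto_cnj filterlim_compose[OF osc_b_tendsto filterlim_reflect])
  show "(osc_Psi c \<longlongrightarrow> mat 1) (at 0 within {v. Im v > 0})"
  proof (rule mat2_tendstoI)
    fix i j :: 2
    show "((\<lambda>v. osc_Psi c v $ i $ j) \<longlongrightarrow> mat 1 $ i $ j) (at 0 within {v. Im v > 0})"
      using exhaust_2[of i] exhaust_2[of j] a b osc_a_tendsto[of c] osc_b_tendsto[of c]
      by (auto simp: mat2_1)
  qed
qed

lemma upper_half_plane_approach: "filterlim (\<lambda>r::real. of_real r * \<i>) (at 0 within {v. Im v > 0}) (at_right 0)"
  unfolding filterlim_at
proof (intro conjI)
  have "((\<lambda>r::real. of_real r * \<i>) \<longlongrightarrow> of_real 0 * \<i>) (at_right 0)" by (intro tendsto_intros)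
  thus "((\<lambda>r::real. of_real r * \<i>) \<longlongrightarrow> 0) (at_right 0)" by simp
  show "\<forall>\<^sub>F r::real in at_right 0. of_real r * \<i> \<in> {v. Im v > 0} \<and> of_real r * \<i> \<noteq> 0"
    using eventually_at_right_less by eventually_elim auto
qed

text \<open>The limit is required along the imaginary axis only, where factors exp (1 / v) and exp
  (- 1 / v) have norm 1 and can be inserted without disturbing it.\<close>

lemma upper_half_plane_constant:
  fixes f :: "complex \<Rightarrow> complex"
  assumes d: "\<And>v. Im v > 0 \<Longrightarrow> (f has_field_derivative 0) (at v)"
    and l: "((\<lambda>r::real. norm (f (of_real r * \<i>) - L)) \<longlongrightarrow> 0) (at_right 0)" and v: "Im v > 0"
  shows "f v = L"
proof -
  have "\<exists>k. \<forall>v\<in>{v. Im v > 0}. f v = k"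
    by (rule has_field_derivative_zero_constant)
       (auto simp: convex_halfspace_Im_gt intro: has_field_derivative_at_within d)
  then obtain k where k: "\<And>v. Im v > 0 \<Longrightarrow> f v = k" by auto
  have "((\<lambda>r::real. norm (f (of_real r * \<i>) - L)) \<longlongrightarrow> norm (k - L)) (at_right 0)"
  proof (rule tendsto_eventually)
    show "\<forall>\<^sub>F r::real in at_right 0. norm (f (of_real r * \<i>) - L) = norm (k - L)"
      using eventually_at_right_less by eventually_elim (simp add: k)
  qed
  hence "norm (k - L) = 0" using l by (rule tendsto_unique[OF trivial_limit_at_right_real])
  thus ?thesis using k[OF v] by simp
qed

lemma osc_systemD:
  assumes "osc_system c X" "Im v > 0"
  shows "((\<lambda>v. X v $ 1 $ 1) has_field_derivative of_real c / v * X v $ 2 $ 1) (at v)"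
    and "((\<lambda>v. X v $ 2 $ 1) has_field_derivative X v $ 2 $ 1 / v\<^sup>2 - of_real c / v * X v $ 1 $ 1) (at v)"
    and "((\<lambda>v. X v $ 1 $ 2) has_field_derivative - (X v $ 1 $ 2 / v\<^sup>2) + of_real c / v * X v $ 2 $ 2) (at v)"
    and "((\<lambda>v. X v $ 2 $ 2) has_field_derivative - (of_real c / v * X v $ 1 $ 2)) (at v)"
  using assms by (auto simp: osc_system_def)

text \<open>These are the entries of the adjugate of X times Y; for Y = X the second identity says
  det X = 1, so the adjugate is the inverse. The diagonal entries have derivative 0, the
  off-diagonal ones satisfy f' = f / v^2 and f' = - f / v^2.\<close>

lemma osc_system_quotient:
  assumes X: "osc_system c X" and Y: "osc_system c Y" and v: "Im v > 0"
  shows "X v $ 2 $ 2 * Y v $ 1 $ 1 - X v $ 1 $ 2 * Y v $ 2 $ 1 = 1" (is "?c11 v = 1")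
    and "X v $ 1 $ 1 * Y v $ 2 $ 2 - X v $ 2 $ 1 * Y v $ 1 $ 2 = 1" (is "?c22 v = 1")
    and "X v $ 1 $ 1 * Y v $ 2 $ 1 - X v $ 2 $ 1 * Y v $ 1 $ 1 = 0" (is "?c21 v = 0")
    and "X v $ 2 $ 2 * Y v $ 1 $ 2 - X v $ 1 $ 2 * Y v $ 2 $ 2 = 0" (is "?c12 v = 0")
proof -
  let ?H = "at (0 :: complex) within {v. Im v > 0}"
  note dX = osc_systemD[OF X] and dY = osc_systemD[OF Y]
  have lX: "((\<lambda>v. X v $ i $ j) \<longlongrightarrow> mat 1 $ i $ j) ?H" for i j
    using X by (auto simp: osc_system_def intro!: tendsto_vec_nth)
  have lY: "((\<lambda>v. Y v $ i $ j) \<longlongrightarrow> mat 1 $ i $ j) ?H" for i j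
    using Y by (auto simp: osc_system_def intro!: tendsto_vec_nth)
  note L = lX[where i=1 and j=1, unfolded mat2_1] lX[where i=1 and j=2, unfolded mat2_1]
    lX[where i=2 and j=1, unfolded mat2_1] lX[where i=2 and j=2, unfolded mat2_1]
    lY[where i=1 and j=1, unfolded mat2_1] lY[where i=1 and j=2, unfolded mat2_1]
    lY[where i=2 and j=1, unfolded mat2_1] lY[where i=2 and j=2, unfolded mat2_1]
  note up = filterlim_compose[OF _ upper_half_plane_approach]
  have "((\<lambda>v. norm (?c11 v - 1)) \<longlongrightarrow> norm ((1 * 1 - 0 * 0) - 1 :: complex)) ?H"
    by (intro tendsto_intros L)
  hence l11: "((\<lambda>r::real. norm (?c11 (of_real r * \<i>) - 1)) \<longlongrightarrow> 0) (at_right 0)" by (intro up) simp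
  have "((\<lambda>v. norm (?c22 v - 1)) \<longlongrightarrow> norm ((1 * 1 - 0 * 0) - 1 :: complex)) ?H"
    by (intro tendsto_intros L)
  hence l22: "((\<lambda>r::real. norm (?c22 (of_real r * \<i>) - 1)) \<longlongrightarrow> 0) (at_right 0)" by (intro up) simp
  have "((\<lambda>v. norm (?c21 v)) \<longlongrightarrow> norm ((1 * 0 - 0 * 1) :: complex)) ?H"
    by (intro tendsto_intros L)
  hence l21: "((\<lambda>r::real. norm (?c21 (of_real r * \<i>))) \<longlongrightarrow> 0) (at_right 0)" by (intro up) simp
  have "((\<lambda>v. norm (?c12 v)) \<longlongrightarrow> norm ((1 * 0 - 0 * 1) :: complex)) ?H"
    by (intro tendsto_intros L)
  hence l12: "((\<lambda>r::real. norm (?c12 (of_real r * \<i>))) \<longlongrightarrow> 0) (at_right 0)" by (intro up) simp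
  show "?c11 v = 1"
  proof (rule upper_half_plane_constant[OF _ l11 v])
    fix w :: complex assume w: "Im w > 0"
    show "(?c11 has_field_derivative 0) (at w)"
      by (rule DERIV_cong[OF DERIV_diff[OF DERIV_mult[OF dX(4)[OF w] dY(1)[OF w]] DERIV_mult[OF dX(3)[OF w] dY(2)[OF w]]]])
         (simp add: algebra_simps)
  qed
  show "?c22 v = 1"
  proof (rule upper_half_plane_constant[OF _ l22 v])
    fix w :: complex assume w: "Im w > 0"
    show "(?c22 has_field_derivative 0) (at w)"
      by (rule DERIV_cong[OF DERIV_diff[OF DERIV_mult[OF dX(1)[OF w] dY(4)[OF w]] DERIV_mult[OF dX(2)[OF w] dY(3)[OF w]]]])
         (simp add: algebra_simps)
  qed
  have e: "norm (exp (1 / (of_real r * \<i>))) = 1" "norm (exp (- (1 / (of_real r * \<i>)))) = 1" for r :: real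
    by (simp_all add: Re_divide)
  have "?c21 v * exp (1 / v) = 0"
  proof (rule upper_half_plane_constant[OF _ _ v])
    show "((\<lambda>r::real. norm (?c21 (of_real r * \<i>) * exp (1 / (of_real r * \<i>)) - 0)) \<longlongrightarrow> 0) (at_right 0)"
      using l21 unfolding diff_zero norm_mult[of _ "exp _"] e mult_1_right by simp
    fix w :: complex assume w: "Im w > 0"
    have w0: "w \<noteq> 0" using w by auto
    have ex: "((\<lambda>v. exp (1 / v)) has_field_derivative - (exp (1 / w) / w\<^sup>2)) (at w)"
      using w0 by (auto intro!: derivative_eq_intros simp: power2_eq_square)
    have "(?c21 has_field_derivative ?c21 w / w\<^sup>2) (at w)"
      by (rule DERIV_cong[OF DERIV_diff[OF DERIV_mult[OF dX(1)[OF w] dY(2)[OF w]] DERIV_mult[OF dX(2)[OF w] dY(1)[OF w]]]])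
         (simp add: algebra_simps diff_divide_distrib)
    from DERIV_mult[OF this ex] show "((\<lambda>v. ?c21 v * exp (1 / v)) has_field_derivative 0) (at w)"
      by (rule DERIV_cong) simp
  qed
  thus "?c21 v = 0" by simp
  have "?c12 v * exp (- (1 / v)) = 0"
  proof (rule upper_half_plane_constant[OF _ _ v])
    show "((\<lambda>r::real. norm (?c12 (of_real r * \<i>) * exp (- (1 / (of_real r * \<i>))) - 0)) \<longlongrightarrow> 0) (at_right 0)"
      using l12 unfolding diff_zero norm_mult[of _ "exp _"] e mult_1_right by simp
    fix w :: complex assume w: "Im w > 0"
    have w0: "w \<noteq> 0" using w by auto
    have ex: "((\<lambda>v. exp (- (1 / v))) has_field_derivative exp (- (1 / w)) / w\<^sup>2) (at w)"
      using w0 by (auto intro!: derivative_eq_intros simp: power2_eq_square)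
    have "(?c12 has_field_derivative - (?c12 w / w\<^sup>2)) (at w)"
      by (rule DERIV_cong[OF DERIV_diff[OF DERIV_mult[OF dX(4)[OF w] dY(3)[OF w]] DERIV_mult[OF dX(3)[OF w] dY(4)[OF w]]]])
         (simp add: algebra_simps diff_divide_distrib)
    from DERIV_mult[OF this ex] show "((\<lambda>v. ?c12 v * exp (- (1 / v))) has_field_derivative 0) (at w)"
      by (rule DERIV_cong) simp
  qed
  thus "?c12 v = 0" by simp
qed

lemma osc_system_unique:
  assumes X: "osc_system c X" and Y: "osc_system c Y" and v: "Im v > 0"
  shows "Y v = X v"
proof -
  note q = osc_system_quotient[OF X Y v]
  define a b d e where "a = X v $ 1 $ 1" and "b = X v $ 1 $ 2" and "d = X v $ 2 $ 1" and "e = X v $ 2 $ 2"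
  have det: "a * e - d * b = 1"
    using osc_system_quotient(2)[OF X X v] unfolding a_def b_def d_def e_def by simp
  have inv: "p = (a * e - d * b) * p" for p unfolding det by simp
  show ?thesis
  proof (rule mat2_eqI)
    have "Y v $ 1 $ 1 = (a * e - d * b) * Y v $ 1 $ 1" by (rule inv)
    also have "\<dots> = a * (e * Y v $ 1 $ 1 - b * Y v $ 2 $ 1) + b * (a * Y v $ 2 $ 1 - d * Y v $ 1 $ 1)"
      by (simp add: algebra_simps)
    finally show "Y v $ 1 $ 1 = X v $ 1 $ 1" using q unfolding a_def b_def d_def e_def by simp
    have "Y v $ 2 $ 1 = (a * e - d * b) * Y v $ 2 $ 1" by (rule inv)
    also have "\<dots> = d * (e * Y v $ 1 $ 1 - b * Y v $ 2 $ 1) + e * (a * Y v $ 2 $ 1 - d * Y v $ 1 $ 1)"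
      by (simp add: algebra_simps)
    finally show "Y v $ 2 $ 1 = X v $ 2 $ 1" using q unfolding a_def b_def d_def e_def by simp
    have "Y v $ 1 $ 2 = (a * e - d * b) * Y v $ 1 $ 2" by (rule inv)
    also have "\<dots> = a * (e * Y v $ 1 $ 2 - b * Y v $ 2 $ 2) + b * (a * Y v $ 2 $ 2 - d * Y v $ 1 $ 2)"
      by (simp add: algebra_simps)
    finally show "Y v $ 1 $ 2 = X v $ 1 $ 2" using q unfolding a_def b_def d_def e_def by simp
    have "Y v $ 2 $ 2 = (a * e - d * b) * Y v $ 2 $ 2" by (rule inv)
    also have "\<dots> = d * (e * Y v $ 1 $ 2 - b * Y v $ 2 $ 2) + e * (a * Y v $ 2 $ 2 - d * Y v $ 1 $ 2)"
      by (simp add: algebra_simps)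
    finally show "Y v $ 2 $ 2 = X v $ 2 $ 2" using q unfolding a_def b_def d_def e_def by simp
  qed
qed

section \<open>Transfer between the oscillator equation and its normalised form\<close>

definition rot2 :: "complex \<Rightarrow> complex ^ 2 ^ 2" where
  "rot2 c = vector [vector [0, c], vector [- c, 0]]"

lemma rot2_nth [simp]: "rot2 a $ 1 $ 1 = 0" "rot2 a $ 1 $ 2 = a" "rot2 a $ 2 $ 1 = - a" "rot2 a $ 2 $ 2 = 0"
  by (simp_all add: rot2_def)

lemma standard_normalisation_diag2:
  "standard_normalisation (diag2 p q) Y t $ i $ 1 = Y t $ i $ 1 * exp (- (p / t))"
  "standard_normalisation (diag2 p q) Y t $ i $ 2 = Y t $ i $ 2 * exp (- (q / t))"
proof -
  have "mat_scale (- (1 / t)) (diag2 p q) = diag2 (- (p / t)) (- (q / t))"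
    by (rule mat2_eqI) (simp_all add: mat_scale_def)
  thus "standard_normalisation (diag2 p q) Y t $ i $ 1 = Y t $ i $ 1 * exp (- (p / t))"
    "standard_normalisation (diag2 p q) Y t $ i $ 2 = Y t $ i $ 2 * exp (- (q / t))"
    by (simp_all add: standard_normalisation_def mat_exp_diag2 mat2_mult)
qed

lemma exp_over_deriv:
  assumes "t \<noteq> (0 :: complex)"
  shows "((\<lambda>t. exp (p / t)) has_field_derivative - (p / t\<^sup>2) * exp (p / t)) (at t)"
    and "((\<lambda>t. exp (- (p / t))) has_field_derivative (p / t\<^sup>2) * exp (- (p / t))) (at t)"
  using assms by (auto intro!: derivative_eq_intros simp: power2_eq_square)

abbreviation osc_matrix :: "complex \<Rightarrow> complex \<Rightarrow> real \<Rightarrow> complex \<Rightarrow> complex ^ 2 ^ 2" where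
  "osc_matrix p q c t \<equiv> mat_scale (- (1 / t\<^sup>2)) (diag2 p q) + mat_scale (1 / t) (rot2 (of_real c))"

abbreviation osc_fundamental :: "complex \<Rightarrow> complex \<Rightarrow> real \<Rightarrow> (complex \<Rightarrow> complex ^ 2 ^ 2) \<Rightarrow> bool" where
  "osc_fundamental p q c Y \<equiv> fundamental_solution (diag2 p q) (rot2 (of_real c)) {t. Im (t / (p - q)) > 0} Y"

abbreviation osc_normalised :: "complex \<Rightarrow> complex \<Rightarrow> (complex \<Rightarrow> complex ^ 2 ^ 2) \<Rightarrow> bool" where
  "osc_normalised p q Y \<equiv> (standard_normalisation (diag2 p q) Y \<longlongrightarrow> mat 1) (at 0 within {t. Im (t / (p - q)) > 0})"

lemma fundamental_solution_rot:
  assumes "fundamental_solution (diag2 p q) (rot2 (of_real c)) S Y" and "t \<in> S"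
  shows "((\<lambda>s. Y s $ 1 $ j) has_field_derivative - (p / t\<^sup>2) * Y t $ 1 $ j + of_real c / t * Y t $ 2 $ j) (at t)"
    and "((\<lambda>s. Y s $ 2 $ j) has_field_derivative - (q / t\<^sup>2) * Y t $ 2 $ j - of_real c / t * Y t $ 1 $ j) (at t)"
proof -
  have "((\<lambda>s. Y s $ i $ j) has_field_derivative
     (osc_matrix p q c t ** Y t) $ i $ j) (at t)" for i
    using assms unfolding fundamental_solution_def by blast
  note D = this
  show "((\<lambda>s. Y s $ 1 $ j) has_field_derivative - (p / t\<^sup>2) * Y t $ 1 $ j + of_real c / t * Y t $ 2 $ j) (at t)"
    "((\<lambda>s. Y s $ 2 $ j) has_field_derivative - (q / t\<^sup>2) * Y t $ 2 $ j - of_real c / t * Y t $ 1 $ j) (at t)"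
    by (rule DERIV_cong[OF D], simp add: mat2_mult mat_scale_def)+
qed

text \<open>Multiplying the columns by exp (- p / t) and exp (- q / t) leaves only the difference p
  - q in the equations, and the rescaling t = (p - q) v removes it.\<close>

lemma normalisation_osc_system:
  assumes d: "p - q \<noteq> 0" and Y: "osc_fundamental p q c Y"
    and l: "osc_normalised p q Y"
  shows "osc_system c (\<lambda>v. standard_normalisation (diag2 p q) Y ((p - q) * v))"
proof -
  define X where "X = standard_normalisation (diag2 p q) Y"
  have N: "X t $ i $ 1 = Y t $ i $ 1 * exp (- (p / t))" "X t $ i $ 2 = Y t $ i $ 2 * exp (- (q / t))" for t i
    unfolding X_def by (rule standard_normalisation_diag2)+
  have D: "((\<lambda>v. f ((p - q) * v)) has_field_derivative D * (p - q)) (at v)"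
    if "(f has_field_derivative D) (at ((p - q) * v))" for f D v
    by (rule DERIV_chain2[where g="\<lambda>v. (p - q) * v", OF that]) (auto intro!: derivative_eq_intros)
  have main: "((\<lambda>v. X ((p - q) * v) $ 1 $ 1) has_field_derivative of_real c / v * X ((p - q) * v) $ 2 $ 1) (at v)"
       "((\<lambda>v. X ((p - q) * v) $ 2 $ 1) has_field_derivative X ((p - q) * v) $ 2 $ 1 / v\<^sup>2 - of_real c / v * X ((p - q) * v) $ 1 $ 1) (at v)"
       "((\<lambda>v. X ((p - q) * v) $ 1 $ 2) has_field_derivative - (X ((p - q) * v) $ 1 $ 2 / v\<^sup>2) + of_real c / v * X ((p - q) * v) $ 2 $ 2) (at v)"
       "((\<lambda>v. X ((p - q) * v) $ 2 $ 2) has_field_derivative - (of_real c / v * X ((p - q) * v) $ 1 $ 2)) (at v)"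
    if v: "Im v > 0" for v
  proof -
    have v0: "v \<noteq> 0" using v by auto
    define t where "t = (p - q) * v"
    have t: "t \<in> {t. Im (t / (p - q)) > 0}" "t \<noteq> 0" using d v v0 by (auto simp: t_def)
    have vt: "v = t / (p - q)" using d by (simp add: t_def)
    note Yd = fundamental_solution_rot[OF Y t(1)]
    have alg: "((p - q) / t\<^sup>2 * y) * (p - q) = y / v\<^sup>2" "(of_real c / t * y) * (p - q) = of_real c / v * y" for y
      unfolding vt using d t(2) by (simp_all add: field_simps power2_eq_square)
    have "((\<lambda>t. X t $ 1 $ 1) has_field_derivative of_real c / t * X t $ 2 $ 1) (at t)"
      unfolding N by (rule DERIV_cong[OF DERIV_mult[OF Yd(1) exp_over_deriv(2)[OF t(2)]]]) (simp add: algebra_simps)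
    from D[OF this[unfolded t_def]]
    show "((\<lambda>v. X ((p - q) * v) $ 1 $ 1) has_field_derivative of_real c / v * X ((p - q) * v) $ 2 $ 1) (at v)"
      unfolding t_def[symmetric] alg .
    have "((\<lambda>t. X t $ 2 $ 1) has_field_derivative (p - q) / t\<^sup>2 * X t $ 2 $ 1 - of_real c / t * X t $ 1 $ 1) (at t)"
      unfolding N by (rule DERIV_cong[OF DERIV_mult[OF Yd(2) exp_over_deriv(2)[OF t(2)]]])
         (simp add: algebra_simps diff_divide_distrib)
    from D[OF this[unfolded t_def]]
    show "((\<lambda>v. X ((p - q) * v) $ 2 $ 1) has_field_derivative X ((p - q) * v) $ 2 $ 1 / v\<^sup>2 - of_real c / v * X ((p - q) * v) $ 1 $ 1) (at v)"
      unfolding t_def[symmetric] left_diff_distrib[of "_ / _ * _" "_ * _"] alg .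
    have "((\<lambda>t. X t $ 1 $ 2) has_field_derivative of_real c / t * X t $ 2 $ 2 - (p - q) / t\<^sup>2 * X t $ 1 $ 2) (at t)"
      unfolding N by (rule DERIV_cong[OF DERIV_mult[OF Yd(1) exp_over_deriv(2)[OF t(2)]]])
         (simp add: algebra_simps diff_divide_distrib)
    from D[OF this[unfolded t_def]]
    show "((\<lambda>v. X ((p - q) * v) $ 1 $ 2) has_field_derivative - (X ((p - q) * v) $ 1 $ 2 / v\<^sup>2) + of_real c / v * X ((p - q) * v) $ 2 $ 2) (at v)"
      unfolding t_def[symmetric] left_diff_distrib[of "_ / _ * _" "_ * _"] alg by simp
    have "((\<lambda>t. X t $ 2 $ 2) has_field_derivative of_real c / t * - X t $ 1 $ 2) (at t)"
      unfolding N by (rule DERIV_cong[OF DERIV_mult[OF Yd(2) exp_over_deriv(2)[OF t(2)]]]) (simp add: algebra_simps)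
    from D[OF this[unfolded t_def]]
    show "((\<lambda>v. X ((p - q) * v) $ 2 $ 2) has_field_derivative - (of_real c / v * X ((p - q) * v) $ 1 $ 2)) (at v)"
      unfolding t_def[symmetric] alg by simp
  qed
  have "filterlim (\<lambda>v. (p - q) * v) (at 0 within {t. Im (t / (p - q)) > 0}) (at 0 within {v. Im v > 0})"
    unfolding filterlim_at
  proof (intro conjI)
    have "((\<lambda>v. (p - q) * v) \<longlongrightarrow> (p - q) * 0) (at 0 within {v. Im v > 0})" by (intro tendsto_intros)
    thus "((\<lambda>v. (p - q) * v) \<longlongrightarrow> 0) (at 0 within {v. Im v > 0})" by simp
  qed (use d in \<open>auto simp: eventually_at_filter\<close>)
  from filterlim_compose[OF l this] main show ?thesis
    unfolding osc_system_def X_def[symmetric] by blast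
qed

text \<open>Existence, by undoing the normalisation; invertibility follows from det
  \<open>osc_Psi\<close> = 1.\<close>

lemma osc_fundamental_solution:
  fixes c :: real and p q :: complex
  assumes d: "p - q \<noteq> 0"
  defines "Y \<equiv> (\<lambda>t. osc_Psi c (t / (p - q)) ** diag2 (exp (p / t)) (exp (q / t)))"
  shows "osc_fundamental p q c Y"
    and "standard_normalisation (diag2 p q) Y t = osc_Psi c (t / (p - q))"
    and "osc_normalised p q Y"
proof -
  have Y: "Y t $ i $ 1 = osc_Psi c (t / (p - q)) $ i $ 1 * exp (p / t)"
    "Y t $ i $ 2 = osc_Psi c (t / (p - q)) $ i $ 2 * exp (q / t)" for t i
    by (simp_all add: Y_def mat2_mult)
  show n: "standard_normalisation (diag2 p q) Y t = osc_Psi c (t / (p - q))" for t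
    by (rule mat2_eqI) (simp_all only: standard_normalisation_diag2 Y mult.assoc exp_add[symmetric] right_minus exp_zero mult_1_right)
  have f: "filterlim (\<lambda>t. t / (p - q)) (at 0 within {v. Im v > 0}) (at 0 within {t. Im (t / (p - q)) > 0})"
    unfolding filterlim_at
  proof (intro conjI)
    have "((\<lambda>v. v / (p - q)) \<longlongrightarrow> 0 / (p - q)) (at 0 within {t. Im (t / (p - q)) > 0})" using d by (intro tendsto_intros)
    thus "((\<lambda>v. v / (p - q)) \<longlongrightarrow> 0) (at 0 within {t. Im (t / (p - q)) > 0})" by simp
  qed (use d in \<open>auto simp: eventually_at_filter\<close>)
  have S: "osc_system c (osc_Psi c)" by (rule osc_system_Psi)
  hence "(osc_Psi c \<longlongrightarrow> mat 1) (at 0 within {v. Im v > 0})" by (simp add: osc_system_def)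
  from filterlim_compose[OF this f] show "osc_normalised p q Y"
    unfolding n[abs_def] .
  show "osc_fundamental p q c Y"
    unfolding fundamental_solution_def
  proof (intro ballI conjI allI)
    fix t assume "t \<in> {t. Im (t / (p - q)) > 0}"
    hence v: "Im (t / (p - q)) > 0" by simp
    hence t0: "t \<noteq> 0" by auto
    define X where "X = (\<lambda>t. osc_Psi c (t / (p - q)))"
    have "det (Y t) = (osc_a c (t / (p - q)) * osc_Psi c (t / (p - q)) $ 2 $ 2 -
        osc_Psi c (t / (p - q)) $ 2 $ 1 * osc_Psi c (t / (p - q)) $ 1 $ 2) * (exp (p / t) * exp (q / t))"
      unfolding det_2 Y by (simp add: algebra_simps)
    also have "\<dots> = exp (p / t) * exp (q / t)" using osc_system_quotient(2)[OF S S v] by simp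
    finally show "invertible (Y t)" by (simp add: invertible_det_nz)
    have D: "((\<lambda>t. f (t / (p - q))) has_field_derivative D * (1 / (p - q))) (at t)"
      if "(f has_field_derivative D) (at (t / (p - q)))" for f D
      by (rule DERIV_chain2[where g="\<lambda>t. t / (p - q)", OF that]) (use d in \<open>auto intro!: derivative_eq_intros\<close>)
    have alg: "(y / (t / (p - q))\<^sup>2) * (1 / (p - q)) = (p - q) / t\<^sup>2 * y"
        "(of_real c / (t / (p - q)) * y) * (1 / (p - q)) = of_real c / t * y" for y
      using d t0 by (simp_all add: field_simps power2_eq_square)
    from S v have S': "((\<lambda>v. osc_Psi c v $ 1 $ 1) has_field_derivative of_real c / (t / (p - q)) * X t $ 2 $ 1) (at (t / (p - q)))"
       "((\<lambda>v. osc_Psi c v $ 2 $ 1) has_field_derivative X t $ 2 $ 1 / (t / (p - q))\<^sup>2 - of_real c / (t / (p - q)) * X t $ 1 $ 1) (at (t / (p - q)))"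
       "((\<lambda>v. osc_Psi c v $ 1 $ 2) has_field_derivative - (X t $ 1 $ 2 / (t / (p - q))\<^sup>2) + of_real c / (t / (p - q)) * X t $ 2 $ 2) (at (t / (p - q)))"
       "((\<lambda>v. osc_Psi c v $ 2 $ 2) has_field_derivative - (of_real c / (t / (p - q)) * X t $ 1 $ 2)) (at (t / (p - q)))"
      unfolding osc_system_def X_def by blast+
    have X1: "((\<lambda>t. X t $ 1 $ 1) has_field_derivative of_real c / t * X t $ 2 $ 1) (at t)"
      using D[OF S'(1)] unfolding alg X_def .
    have X2: "((\<lambda>t. X t $ 2 $ 1) has_field_derivative (p - q) / t\<^sup>2 * X t $ 2 $ 1 - of_real c / t * X t $ 1 $ 1) (at t)"
      using D[OF S'(2)] unfolding left_diff_distrib[of "_ / _" "_ * _"] alg X_def .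
    have X3: "((\<lambda>t. X t $ 1 $ 2) has_field_derivative - ((p - q) / t\<^sup>2 * X t $ 1 $ 2) + of_real c / t * X t $ 2 $ 2) (at t)"
      using D[OF S'(3)] unfolding distrib_right[of "- _" "_ * _"] minus_mult_left[symmetric] alg X_def .
    have X4: "((\<lambda>t. X t $ 2 $ 2) has_field_derivative - (of_real c / t * X t $ 1 $ 2)) (at t)"
      using D[OF S'(4)] unfolding minus_mult_left[symmetric] alg X_def .
    have Y': "Y s $ i $ 1 = X s $ i $ 1 * exp (p / s)" "Y s $ i $ 2 = X s $ i $ 2 * exp (q / s)" for s i
      unfolding X_def by (rule Y)+
    have R: "(osc_matrix p q c t ** Y t) $ 1 $ j =
        - (p / t\<^sup>2) * Y t $ 1 $ j + of_real c / t * Y t $ 2 $ j"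
        "(osc_matrix p q c t ** Y t) $ 2 $ j =
        - (q / t\<^sup>2) * Y t $ 2 $ j - of_real c / t * Y t $ 1 $ j" for j
      by (simp_all add: mat2_mult mat_scale_def)
    fix i j :: 2
    have "i = 1 \<or> i = 2" "j = 1 \<or> j = 2" by (rule exhaust_2)+
    moreover have "((\<lambda>s. Y s $ 1 $ 1) has_field_derivative
        (osc_matrix p q c t ** Y t) $ 1 $ 1) (at t)"
      unfolding R Y' by (rule DERIV_cong[OF DERIV_mult[OF X1 exp_over_deriv(1)[OF t0]]]) (simp add: algebra_simps)
    moreover have "((\<lambda>s. Y s $ 2 $ 1) has_field_derivative
        (osc_matrix p q c t ** Y t) $ 2 $ 1) (at t)"
      unfolding R Y' by (rule DERIV_cong[OF DERIV_mult[OF X2 exp_over_deriv(1)[OF t0]]]) (simp add: algebra_simps diff_divide_distrib)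
    moreover have "((\<lambda>s. Y s $ 1 $ 2) has_field_derivative
        (osc_matrix p q c t ** Y t) $ 1 $ 2) (at t)"
      unfolding R Y' by (rule DERIV_cong[OF DERIV_mult[OF X3 exp_over_deriv(1)[OF t0]]]) (simp add: algebra_simps diff_divide_distrib)
    moreover have "((\<lambda>s. Y s $ 2 $ 2) has_field_derivative
        (osc_matrix p q c t ** Y t) $ 2 $ 2) (at t)"
      unfolding R Y' by (rule DERIV_cong[OF DERIV_mult[OF X4 exp_over_deriv(1)[OF t0]]]) (simp add: algebra_simps)
    ultimately show "((\<lambda>s. Y s $ i $ j) has_field_derivative
        (osc_matrix p q c t ** Y t) $ i $ j) (at t)"
      by blast
  qed
qed

lemma of_real_of_rat: "complex_of_real (of_rat q) = of_rat q"
  by (cases q) (simp add: of_rat_rat)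

text \<open>Existence and uniqueness give the definite description its value. As Z (\<gamma> + b)
  splits, p - q is m Z \<gamma>, so b matters only through its pairing with \<gamma>.\<close>

theorem simple_oscillator_eq:
  fixes form :: "int ^ 'n::finite \<Rightarrow> int ^ 'n \<Rightarrow> int"
  assumes Z: "Z (\<gamma> + b) = Z \<gamma> + Z b" "Z \<gamma> \<noteq> 0" and m: "m > 0" and t: "Im (t / Z \<gamma>) > 0"
  shows "simple_oscillator form Z \<Omega> hbar m \<gamma> b t =
     osc_Psi (of_int (form \<gamma> b) * hbar / (2 * pi) * of_rat (\<Omega> \<gamma>) * (- 1) powi (int m * form \<gamma> b)) (t / (of_nat m * Z \<gamma>))"
proof -
  define c where "c = of_int (form \<gamma> b) * hbar / (2 * pi) * real_of_rat (\<Omega> \<gamma>) * (- 1) powi (int m * form \<gamma> b)"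
  define p q where "p = of_nat m * Z (\<gamma> + b)" and "q = of_nat m * Z b"
  have pq: "p - q = of_nat m * Z \<gamma>" by (simp add: p_def q_def Z algebra_simps)
  have pq0: "p - q \<noteq> 0" unfolding pq using Z m by simp
  have "complex_of_real c = of_int (form \<gamma> b) * of_real hbar / (2 * of_real pi) * of_rat (\<Omega> \<gamma>) * (- 1) powi (int m * form \<gamma> b)"
    by (simp add: c_def of_real_of_rat)
  hence V: "oscillator_V form \<Omega> hbar m \<gamma> b = rot2 (of_real c)"
    by (intro mat2_eqI) (simp_all add: oscillator_V_def mat_scale_def)
  have U: "oscillator_U Z m \<gamma> b = diag2 p q" by (simp add: oscillator_U_def diag2_def p_def q_def)
  have Im: "Im (s / (of_nat m * Z \<gamma>)) > 0 \<longleftrightarrow> Im (s / Z \<gamma>) > 0" for s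
  proof -
    have "s / (of_nat m * Z \<gamma>) = of_real (1 / real m) * (s / Z \<gamma>)" by simp
    thus ?thesis using m by (simp only: Im_of_real_mult) (simp add: zero_less_divide_iff)
  qed
  have S: "oscillator_sector (Z \<gamma>) = {t. Im (t / (p - q)) > 0}"
    using half_plane_ray[OF Z(2)] by (auto simp: oscillator_sector_def pq Im)
  note E = osc_fundamental_solution[OF pq0, of c]
  have "(THE X. \<exists>Y. osc_fundamental p q c Y \<and> osc_normalised p q Y \<and> X = standard_normalisation (diag2 p q) Y t) = osc_Psi c (t / (p - q))"
  proof (rule the_equality)
    show "\<exists>Y. osc_fundamental p q c Y \<and> osc_normalised p q Y \<and> osc_Psi c (t / (p - q)) = standard_normalisation (diag2 p q) Y t"
      by (intro exI conjI, rule E(1), rule E(3), rule E(2)[symmetric])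
    fix X assume "\<exists>Y. osc_fundamental p q c Y \<and> osc_normalised p q Y \<and> X = standard_normalisation (diag2 p q) Y t"
    then obtain Y where Y: "osc_fundamental p q c Y"
           "osc_normalised p q Y"
           "X = standard_normalisation (diag2 p q) Y t" by blast
    have v: "Im (t / (p - q)) > 0" using t by (simp add: pq Im)
    have r: "(p - q) * (t / (p - q)) = t" using pq0 by simp
    show "X = osc_Psi c (t / (p - q))"
      using osc_system_unique[OF osc_system_Psi normalisation_osc_system[OF pq0 Y(1,2)] v] unfolding r Y(3) .
  qed
  thus ?thesis unfolding simple_oscillator_def Let_def U V S c_def[symmetric] pq .
qed

subsection \<open>The logarithm of an oscillator\<close>

definition entry_sum :: "complex ^ 2 ^ 2 \<Rightarrow> complex" where
  "entry_sum M = M $ 1 $ 1 + M $ 1 $ 2 + (M $ 2 $ 1 + M $ 2 $ 2)"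

lemma coord_sum_xi_hat: "coord_sum (M *v xi_hat) = entry_sum M"
  by (simp add: coord_sum_def matrix_vector_mult_def sum_2 xi_hat_def entry_sum_def)

lemma mat_power_Suc: "mat_power M (Suc n) = M ** mat_power M n"
  by (simp add: mat_power_def)

lemma norm_mat_power_le:
  assumes "\<And>i j. norm (M $ i $ j) \<le> e"
  shows "norm (mat_power M n $ i $ j) \<le> (2 * e) ^ n"
proof (induction n arbitrary: i j)
  case 0
  show ?case by (simp add: mat_power_def mat_def)
next
  case (Suc n)
  have e: "e \<ge> 0" using assms[of i j] norm_ge_zero[of "M $ i $ j"] by linarith
  have "norm (mat_power M (Suc n) $ i $ j) \<le> norm (M $ i $ 1 * mat_power M n $ 1 $ j) + norm (M $ i $ 2 * mat_power M n $ 2 $ j)"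
    unfolding mat_power_Suc mat2_mult by (rule norm_triangle_ineq)
  also have "\<dots> \<le> e * (2 * e) ^ n + e * (2 * e) ^ n"
    unfolding norm_mult using assms Suc e by (intro add_mono mult_mono) auto
  also have "\<dots> = (2 * e) ^ Suc n" by (simp only: power_Suc mult_2 distrib_right)
  finally show ?case .
qed

lemma norm_entry_sum_le:
  assumes "\<And>i j. norm (M $ i $ j) \<le> e"
  shows "norm (entry_sum M) \<le> 4 * e"
proof -
  have "norm (entry_sum M) \<le> (norm (M $ 1 $ 1) + norm (M $ 1 $ 2)) + (norm (M $ 2 $ 1) + norm (M $ 2 $ 2))"
    unfolding entry_sum_def by (intro order_trans[OF norm_triangle_ineq] add_mono norm_triangle_ineq)
  thus ?thesis using assms[of 1 1] assms[of 1 2] assms[of 2 1] assms[of 2 2] by linarith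
qed

lemma mat_log_term_le:
  assumes M: "\<And>i j. norm (M $ i $ j) \<le> e" and e: "e \<le> 1 / 4"
  shows "norm ((- 1) ^ n / of_nat (Suc n) * mat_power M (Suc n) $ i $ j) \<le> (2 * e) ^ Suc n"
    and "norm ((- 1) ^ n / of_nat (Suc n) * entry_sum (mat_power M (Suc n))) \<le> 4 * (2 * e) ^ Suc n"
proof -
  have *: "norm ((- 1) ^ n / of_nat (Suc n) * z) \<le> norm z" for z :: complex
  proof -
    have "norm ((- 1) ^ n / of_nat (Suc n) * z) = (1 / real (Suc n)) * norm z"
      by (simp add: norm_mult norm_divide norm_power del: of_nat_Suc)
    also have "\<dots> \<le> 1 * norm z" by (intro mult_right_mono) auto
    finally show ?thesis by simp
  qed
  show "norm ((- 1) ^ n / of_nat (Suc n) * mat_power M (Suc n) $ i $ j) \<le> (2 * e) ^ Suc n"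
    by (rule order_trans[OF * norm_mat_power_le[OF M]])
  show "norm ((- 1) ^ n / of_nat (Suc n) * entry_sum (mat_power M (Suc n))) \<le> 4 * (2 * e) ^ Suc n"
    by (rule order_trans[OF * norm_entry_sum_le[OF norm_mat_power_le[OF M]]])
qed

text \<open>Entries of size e make those of the n-th power at most (2 e)^n. Past its first term the
  logarithm series is therefore bounded by 16 e^2 times a geometric series of ratio 1/2, whence
  32.\<close>

lemma entry_sum_mat_log:
  assumes M: "\<And>i j. norm ((A - mat 1) $ i $ j) \<le> e" and e: "e \<le> 1 / 4"
  shows "(\<lambda>n. (- 1) ^ n / of_nat (Suc n) * entry_sum (mat_power (A - mat 1) (Suc n))) sums entry_sum (mat_log A)"
    and "norm (entry_sum (mat_log A) - entry_sum (A - mat 1)) \<le> 32 * e\<^sup>2"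
proof -
  define M where "M = A - mat 1"
  have Me: "norm (M $ i $ j) \<le> e" for i j using M by (simp add: M_def)
  have e0: "e \<ge> 0" using Me[of 1 1] norm_ge_zero[of "M $ 1 $ 1"] by linarith
  have g: "summable (\<lambda>n. (2 * e) ^ Suc n)"
    using e e0 by (intro summable_Suc_iff[THEN iffD2] summable_geometric) auto
  define f where "f i j n = (- 1) ^ n / of_nat (Suc n) * mat_power M (Suc n) $ i $ j" for i j n
  have fs: "f i j sums suminf (f i j)" for i j
    by (rule summable_sums, rule summable_comparison_test'[OF g, of 0]) (unfold f_def, rule mat_log_term_le(1)[OF Me e])
  define L :: "complex ^ 2 ^ 2" where "L = (\<chi> i j. suminf (f i j))"
  have "(\<lambda>n. mat_scale ((- 1) ^ n / of_nat (Suc n)) (mat_power M (Suc n))) sums L"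
    by (rule mat2_sums) (use fs in \<open>simp add: mat_scale_def L_def f_def[abs_def]\<close>)
  hence L: "mat_log A = L" unfolding mat_log_def M_def by (rule sums_unique[symmetric])
  have "(\<lambda>n. f 1 1 n + f 1 2 n + (f 2 1 n + f 2 2 n)) sums entry_sum L"
    unfolding entry_sum_def L_def vec_lambda_beta by (intro sums_add fs)
  also have "(\<lambda>n. f 1 1 n + f 1 2 n + (f 2 1 n + f 2 2 n)) = (\<lambda>n. (- 1) ^ n / of_nat (Suc n) * entry_sum (mat_power M (Suc n)))"
    unfolding f_def entry_sum_def by (simp only: distrib_left)
  finally have S: "(\<lambda>n. (- 1) ^ n / of_nat (Suc n) * entry_sum (mat_power M (Suc n))) sums entry_sum (mat_log A)"
    unfolding L .
  thus "(\<lambda>n. (- 1) ^ n / of_nat (Suc n) * entry_sum (mat_power (A - mat 1) (Suc n))) sums entry_sum (mat_log A)"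
    unfolding M_def .
  have "M ** mat 1 = M" by simp
  hence "mat_power M (Suc 0) = M" by (simp add: mat_power_def)
  hence "(\<lambda>n. (- 1) ^ Suc n / of_nat (Suc (Suc n)) * entry_sum (mat_power M (Suc (Suc n)))) sums
       (entry_sum (mat_log A) - entry_sum M)"
    using sums_split_initial_segment[OF S, of 1] by simp
  hence "entry_sum (mat_log A) - entry_sum M = (\<Sum>n. (- 1) ^ Suc n / of_nat (Suc (Suc n)) * entry_sum (mat_power M (Suc (Suc n))))"
    by (rule sums_unique)
  also have "norm \<dots> \<le> (\<Sum>n. (16 * e\<^sup>2) * (1 / 2) ^ n)"
  proof (rule norm_suminf_le)
    fix n
    have "norm ((- 1) ^ Suc n / of_nat (Suc (Suc n)) * entry_sum (mat_power M (Suc (Suc n)))) \<le> 4 * (2 * e) ^ Suc (Suc n)"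
      by (rule mat_log_term_le(2)[OF Me e])
    also have "\<dots> = (16 * e\<^sup>2) * (2 * e) ^ n" by (simp add: power2_eq_square)
    also have "\<dots> \<le> (16 * e\<^sup>2) * (1 / 2) ^ n"
      using e e0 by (intro mult_left_mono power_mono) auto
    finally show "norm ((- 1) ^ Suc n / of_nat (Suc (Suc n)) * entry_sum (mat_power M (Suc (Suc n)))) \<le> (16 * e\<^sup>2) * (1 / 2) ^ n" .
  qed (intro summable_mult summable_geometric, simp)
  also have "\<dots> = (16 * e\<^sup>2) * 2" by (subst suminf_mult) (auto simp: suminf_geometric summable_geometric)
  finally show "norm (entry_sum (mat_log A) - entry_sum (A - mat 1)) \<le> 32 * e\<^sup>2" by (simp add: M_def)
qed

text \<open>The M-test on closed discs and Weierstrass' theorem on locally uniform limits.\<close>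

lemma holomorphic_series:
  fixes f :: "nat \<Rightarrow> complex \<Rightarrow> complex"
  assumes "open S" and hol: "\<And>n. f n holomorphic_on S"
    and le: "\<And>n x. x \<in> S \<Longrightarrow> norm (f n x) \<le> B n" and B: "summable B"
  shows "(\<lambda>x. \<Sum>n. f n x) holomorphic_on S"
proof (rule holomorphic_uniform_sequence[OF \<open>open S\<close>])
  show "(\<lambda>x. \<Sum>n<N. f n x) holomorphic_on S" for N by (intro holomorphic_on_sum hol)
  fix x assume "x \<in> S"
  then obtain d where d: "d > 0" "cball x d \<subseteq> S" using \<open>open S\<close> open_contains_cball by blast
  have "uniform_limit (cball x d) (\<lambda>N x. \<Sum>n<N. f n x) (\<lambda>x. \<Sum>n. f n x) sequentially"
    by (rule Weierstrass_m_test[OF _ B]) (use le d in blast)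
  with d show "\<exists>d>0. cball x d \<subseteq> S \<and> uniform_limit (cball x d) (\<lambda>N x. \<Sum>n<N. f n x) (\<lambda>x. \<Sum>n. f n x) sequentially"
    by blast
qed

definition osc_log :: "real \<Rightarrow> complex \<Rightarrow> complex" where
  "osc_log c v = entry_sum (mat_log (osc_Psi c v))"

text \<open>The coefficient of c in \<open>osc_log\<close>: only the off-diagonal entries of
  \<open>osc_Psi\<close> contribute to first order, the diagonal ones being 1 + O(c^2).\<close>

definition osc_pair :: "complex \<Rightarrow> complex" where
  "osc_pair v = osc_first v - cnj (osc_first (- cnj v))"

lemma osc_Psi_holomorphic:
  assumes "\<And>v. v \<in> S \<Longrightarrow> Im v > 0"
  shows "(\<lambda>v. osc_Psi c v $ i $ j) holomorphic_on S"
proof -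
  have "\<exists>D. ((\<lambda>v. osc_Psi c v $ i $ j) has_field_derivative D) (at v)" if "v \<in> S" for v
    using osc_system_Psi[of c] assms[OF that] exhaust_2[of i] exhaust_2[of j]
    unfolding osc_system_def by blast
  thus ?thesis
    by (auto simp: holomorphic_on_def field_differentiable_def intro: has_field_derivative_at_within)
qed

lemma mat_power_holomorphic:
  assumes "\<And>i j. (\<lambda>v. A v $ i $ j) holomorphic_on S"
  shows "(\<lambda>v. mat_power (A v) n $ i $ j) holomorphic_on S"
proof (induction n arbitrary: i j)
  case 0
  show ?case by (simp add: mat_power_def)
next
  case (Suc n)
  show ?case unfolding mat_power_Suc mat2_mult by (intro holomorphic_intros assms Suc)
qed

lemma osc_log_holomorphic:
  assumes S: "open S" and v: "\<And>v. v \<in> S \<Longrightarrow> Im v > 0"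
    and e: "\<And>v i j. v \<in> S \<Longrightarrow> norm ((osc_Psi c v - mat 1) $ i $ j) \<le> 1 / 4"
  shows "osc_log c holomorphic_on S"
proof -
  have h: "(\<lambda>v. (osc_Psi c v - mat 1) $ i $ j) holomorphic_on S" for i j
    unfolding vector_minus_component by (intro holomorphic_intros osc_Psi_holomorphic v)
  have "(\<lambda>v. \<Sum>n. (- 1) ^ n / of_nat (Suc n) * entry_sum (mat_power (osc_Psi c v - mat 1) (Suc n))) holomorphic_on S"
  proof (rule holomorphic_series[OF S])
    show "(\<lambda>v. (- 1) ^ n / of_nat (Suc n) * entry_sum (mat_power (osc_Psi c v - mat 1) (Suc n))) holomorphic_on S" for n
      unfolding entry_sum_def by (intro holomorphic_intros mat_power_holomorphic h) (auto simp del: of_nat_Suc)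
    show "norm ((- 1) ^ n / of_nat (Suc n) * entry_sum (mat_power (osc_Psi c v - mat 1) (Suc n))) \<le> 4 * (2 * (1 / 4)) ^ Suc n"
      if "v \<in> S" for n v
      by (rule mat_log_term_le(2)[OF e[OF that]]) simp
    show "summable (\<lambda>n. 4 * (2 * (1 / 4)) ^ Suc n :: real)"
      by (intro summable_mult summable_Suc_iff[THEN iffD2] summable_geometric) auto
  qed
  thus ?thesis
  proof (rule holomorphic_transform)
    fix v assume "v \<in> S"
    from entry_sum_mat_log(1)[OF e[OF this] order_refl]
    show "(\<Sum>n. (- 1) ^ n / of_nat (Suc n) * entry_sum (mat_power (osc_Psi c v - mat 1) (Suc n))) = osc_log c v"
      unfolding osc_log_def by (rule sums_unique[symmetric])
  qed
qed

text \<open>The region for v is symmetric under v -> - cnj v, so the estimates for the first column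
  of \<open>osc_Psi\<close> also control the second.\<close>

theorem osc_log_first_order:
  assumes A: "A \<ge> 0" and B: "B \<ge> 0"
  obtains C c0 where "C > 0" "0 < c0"
    "\<And>c v. \<bar>c\<bar> \<le> c0 \<Longrightarrow> Im v > 0 \<Longrightarrow> norm v \<le> (1 + A) * Im v \<Longrightarrow> norm v \<le> B \<Longrightarrow>
       norm (osc_log c v - of_real c * osc_pair v) \<le> C * c\<^sup>2 * norm v \<and> norm (osc_log c v) \<le> C * \<bar>c\<bar> * norm v"
    "\<And>c S. \<bar>c\<bar> \<le> c0 \<Longrightarrow> open S \<Longrightarrow> (\<And>v. v \<in> S \<Longrightarrow> Im v > 0 \<and> norm v \<le> (1 + A) * Im v \<and> norm v \<le> B) \<Longrightarrow>
       osc_log c holomorphic_on S"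
proof -
  obtain K c1 where K: "K > 0" "0 < c1" "c1 \<le> 1"
    "\<And>c v. \<bar>c\<bar> \<le> c1 \<Longrightarrow> Im v > 0 \<Longrightarrow> norm v \<le> (1 + A) * Im v \<Longrightarrow> norm v \<le> B \<Longrightarrow>
       norm (osc_b c v - of_real c * osc_first v) \<le> K * c\<^sup>2 * norm v \<and>
       norm (osc_b c v) \<le> K * \<bar>c\<bar> * norm v \<and> norm (osc_a c v - 1) \<le> K * c\<^sup>2 * norm v"
    by (rule osc_first_order[OF A B]) blast
  \<comment> \<open>With this bound the entries of \<open>osc_Psi c v - mat 1\<close> are at most
    1/4, as the estimates of the logarithm series require.\<close>
  define c0 where "c0 = min c1 (1 / (4 * K * (B + 1)))"
  \<comment> \<open>With e = K |c| |v| \<le> 1/4, the second estimate needs 32 e^2 + 4 e \<le> 12 e;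
    the first needs 4 K from the four entries and 32 K^2 B from the tail of the logarithm.\<close>
  define C where "C = 12 * K + 32 * K\<^sup>2 * B"
  have c0: "0 < c0" "c0 \<le> c1" "c0 \<le> 1 / (4 * K * (B + 1))" using K B by (auto simp: c0_def)
  have good: "norm (osc_b c v - of_real c * osc_first v) \<le> K * c\<^sup>2 * norm v" "norm (osc_a c v - 1) \<le> K * c\<^sup>2 * norm v"
      "norm (osc_b c (- cnj v) - of_real c * osc_first (- cnj v)) \<le> K * c\<^sup>2 * norm v" "norm (osc_a c (- cnj v) - 1) \<le> K * c\<^sup>2 * norm v"
      "norm (osc_b c v) \<le> K * \<bar>c\<bar> * norm v" "norm (osc_b c (- cnj v)) \<le> K * \<bar>c\<bar> * norm v"
    if "\<bar>c\<bar> \<le> c0" "Im v > 0" "norm v \<le> (1 + A) * Im v" "norm v \<le> B" for c v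
    using K(4)[of c v] K(4)[of c "- cnj v"] that c0(2) by auto
  have e4: "K * \<bar>c\<bar> * norm v \<le> 1 / 4" if "\<bar>c\<bar> \<le> c0" "norm v \<le> B" for c and v :: complex
  proof -
    have "K * \<bar>c\<bar> * norm v \<le> K * (1 / (4 * K * (B + 1))) * (B + 1)"
      using that c0(3) K(1) B by (intro mult_mono) auto
    also have "\<dots> = 1 / 4"
    proof -
      have "K \<noteq> 0" "B + 1 \<noteq> 0" using K(1) B by auto
      thus ?thesis by simp
    qed
    finally show ?thesis .
  qed
  have entry: "norm ((osc_Psi c v - mat 1) $ i $ j) \<le> K * \<bar>c\<bar> * norm v"
    if c: "\<bar>c\<bar> \<le> c0" and v: "Im v > 0" "norm v \<le> (1 + A) * Im v" "norm v \<le> B" for c v i j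
  proof -
    note g = good[OF c v]
    have "\<bar>c\<bar> \<le> 1" using c c0(2) K(3) by linarith
    hence "\<bar>c\<bar> * \<bar>c\<bar> \<le> 1 * \<bar>c\<bar>" by (intro mult_right_mono) auto
    hence "K * c\<^sup>2 * norm v \<le> K * \<bar>c\<bar> * norm v"
      using K(1) by (intro mult_right_mono mult_left_mono) (auto simp: power2_eq_square)
    moreover have "norm (cnj (osc_a c (- cnj v)) - 1) = norm (osc_a c (- cnj v) - 1)"
      using complex_mod_cnj[of "osc_a c (- cnj v) - 1"] by simp
    ultimately show ?thesis
      using g exhaust_2[of i] exhaust_2[of j] by (auto simp: mat2_1)
  qed
  have first: "norm (osc_log c v - of_real c * osc_pair v) \<le> C * c\<^sup>2 * norm v \<and> norm (osc_log c v) \<le> C * \<bar>c\<bar> * norm v"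
    if c: "\<bar>c\<bar> \<le> c0" and v: "Im v > 0" "norm v \<le> (1 + A) * Im v" "norm v \<le> B" for c v
  proof
    define e where "e = K * \<bar>c\<bar> * norm v"
    have e0: "e \<ge> 0" using K(1) by (simp add: e_def)
    have e: "e \<le> 1 / 4" unfolding e_def by (rule e4[OF c v(3)])
    have M: "norm ((osc_Psi c v - mat 1) $ i $ j) \<le> e" for i j unfolding e_def by (rule entry[OF c v])
    have L: "norm (osc_log c v - entry_sum (osc_Psi c v - mat 1)) \<le> 32 * e\<^sup>2"
      unfolding osc_log_def by (rule entry_sum_mat_log(2)[OF M e])
    have "entry_sum (osc_Psi c v - mat 1) - of_real c * osc_pair v =
       ((osc_a c v - 1) - cnj (osc_b c (- cnj v) - of_real c * osc_first (- cnj v))) +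
       ((osc_b c v - of_real c * osc_first v) + cnj (osc_a c (- cnj v) - 1))"
      by (simp add: entry_sum_def mat2_1 osc_pair_def algebra_simps)
    also have "norm \<dots> \<le> (K * c\<^sup>2 * norm v + K * c\<^sup>2 * norm v) + (K * c\<^sup>2 * norm v + K * c\<^sup>2 * norm v)"
    proof (intro order_trans[OF norm_triangle_ineq] add_mono)
      note g = good[OF c v]
      show "norm ((osc_a c v - 1) - cnj (osc_b c (- cnj v) - of_real c * osc_first (- cnj v))) \<le> K * c\<^sup>2 * norm v + K * c\<^sup>2 * norm v"
        by (rule order_trans[OF norm_triangle_ineq4], unfold complex_mod_cnj, intro add_mono g)
      show "norm (osc_b c v - of_real c * osc_first v) \<le> K * c\<^sup>2 * norm v" by (rule g)
      show "norm (cnj (osc_a c (- cnj v) - 1)) \<le> K * c\<^sup>2 * norm v" unfolding complex_mod_cnj by (rule g)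
    qed
    also have "\<dots> = 4 * (K * c\<^sup>2 * norm v)" by (simp add: algebra_simps)
    finally have d: "norm (entry_sum (osc_Psi c v - mat 1) - of_real c * osc_pair v) \<le> 4 * (K * c\<^sup>2 * norm v)" .
    have "norm (osc_log c v - of_real c * osc_pair v) \<le> 32 * e\<^sup>2 + 4 * (K * c\<^sup>2 * norm v)"
      using norm_triangle_mono[OF L d] by simp
    also have "32 * e\<^sup>2 = 32 * K\<^sup>2 * (c\<^sup>2 * norm v) * norm v" by (simp add: e_def power2_eq_square)
    also have "\<dots> \<le> 32 * K\<^sup>2 * (c\<^sup>2 * norm v) * B" using v by (intro mult_left_mono) auto
    also have "32 * K\<^sup>2 * (c\<^sup>2 * norm v) * B + 4 * (K * c\<^sup>2 * norm v) \<le> 32 * K\<^sup>2 * (c\<^sup>2 * norm v) * B + 12 * (K * c\<^sup>2 * norm v)"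
      using K(1) by simp
    also have "\<dots> = C * c\<^sup>2 * norm v" by (simp add: C_def algebra_simps)
    finally show "norm (osc_log c v - of_real c * osc_pair v) \<le> C * c\<^sup>2 * norm v" by simp
    have "norm (osc_log c v) \<le> 32 * e\<^sup>2 + 4 * e"
      using norm_triangle_mono[OF L norm_entry_sum_le[OF M]] by simp
    also have "e\<^sup>2 \<le> (1 / 4) * e" using mult_right_mono[OF e e0] by (simp add: power2_eq_square)
    also have "32 * (1 / 4 * e) + 4 * e = 12 * K * (\<bar>c\<bar> * norm v)" by (simp add: e_def)
    also have "\<dots> \<le> C * (\<bar>c\<bar> * norm v)" using B by (intro mult_right_mono) (auto simp: C_def)
    finally show "norm (osc_log c v) \<le> C * \<bar>c\<bar> * norm v" by (simp add: mult.assoc)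
  qed
  have hol: "osc_log c holomorphic_on S"
    if c: "\<bar>c\<bar> \<le> c0" and S: "open S" "\<And>v. v \<in> S \<Longrightarrow> Im v > 0 \<and> norm v \<le> (1 + A) * Im v \<and> norm v \<le> B" for c S
  proof (rule osc_log_holomorphic[OF S(1)])
    fix v assume "v \<in> S"
    with S(2) have v: "Im v > 0" "norm v \<le> (1 + A) * Im v" "norm v \<le> B" by blast+
    show "Im v > 0" by (rule v)
    show "norm ((osc_Psi c v - mat 1) $ i $ j) \<le> 1 / 4" for i j
      by (rule order_trans[OF entry[OF c v] e4[OF c v(3)]])
  qed
  have "C > 0" using K(1) B by (simp add: C_def add_pos_nonneg)
  from that[OF this c0(1)] first hol show ?thesis by blast
qed

subsection \<open>Summation over the frequencies\<close>

lemma integrable_osc_first: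
  assumes "Im v > 0"
  shows "integrable halfline (\<lambda>s. exp (- of_real s) / (1 - of_real s * v))"
  using integrable_osc[OF assms, of 0 0 1]
  by (rule Bochner_Integration.integrable_cong[THEN iffD1, rotated -1])
     (use osc_P(2)[OF assms] in \<open>auto simp: osc_E_def\<close>)

text \<open>The conjugate reflection changes the denominator 1 - s v into 1 + s v, and the sum of
  both fractions is even in s v.\<close>

lemma osc_pair_integral:
  assumes v: "Im v > 0"
  shows "osc_pair v = v * (LH s. 2 * exp (- of_real s) / (1 - (of_real s * v)\<^sup>2))"
proof -
  have v': "Im (- cnj v) > 0" using v by simp
  have c: "cnj (exp (- of_real s) / (1 - of_real s * - cnj v)) = exp (- of_real s) / (1 + of_real s * v)" for s
    by (simp add: exp_cnj)
  have i2: "integrable halfline (\<lambda>s. exp (- complex_of_real s) / (1 + of_real s * v))"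
    using integrable_cnj[OF integrable_osc_first[OF v']] unfolding c .
  have "cnj (LH s. exp (- of_real s) / (1 - of_real s * - cnj v)) = (LH s. cnj (exp (- of_real s) / (1 - of_real s * - cnj v)))"
    by (rule integral_bounded_linear[OF bounded_linear_cnj integrable_osc_first[OF v'], symmetric])
  hence I: "cnj (LH s. exp (- of_real s) / (1 - of_real s * - cnj v)) = (LH s. exp (- of_real s) / (1 + of_real s * v))"
    unfolding c .
  have "cnj (osc_first (- cnj v)) = - v * (LH s. exp (- of_real s) / (1 + of_real s * v))"
    unfolding osc_first_def complex_cnj_mult I by simp
  hence "osc_pair v = v * ((LH s. exp (- of_real s) / (1 - of_real s * v)) +
      (LH s. exp (- of_real s) / (1 + of_real s * v)))"
    by (simp add: osc_pair_def osc_first_def algebra_simps)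
  also have "(LH s. exp (- of_real s) / (1 - of_real s * v)) + (LH s. exp (- of_real s) / (1 + of_real s * v)) =
      (LH s. exp (- of_real s) / (1 - of_real s * v) + exp (- of_real s) / (1 + of_real s * v))"
    by (rule Bochner_Integration.integral_add[symmetric, OF integrable_osc_first[OF v] i2])
  also have "\<dots> = (LH s. 2 * exp (- of_real s) / (1 - (of_real s * v)\<^sup>2))"
  proof (rule Bochner_Integration.integral_cong[OF refl])
    fix s assume "s \<in> space halfline"
    hence s: "s > 0" by simp
    have 1: "1 - of_real s * v \<noteq> 0" by (rule osc_P(2)[OF v s])
    have "Im (1 + of_real s * v) \<noteq> 0" using v s by simp
    hence 2: "1 + of_real s * v \<noteq> 0" by force
    have 3: "1 - (of_real s * v)\<^sup>2 = (1 - of_real s * v) * (1 + of_real s * v)" by (simp add: algebra_simps power2_eq_square)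
    show "exp (- of_real s) / (1 - of_real s * v) + exp (- of_real s) / (1 + of_real s * v) = 2 * exp (- of_real s) / (1 - (of_real s * v)\<^sup>2)"
      unfolding 3 add_frac_eq[OF 1 2] by (simp add: algebra_simps)
  qed
  finally show ?thesis .
qed

text \<open>For x = Z \<gamma> / t and k = 2 pi m this is the point (2 pi)^(-1) i t / (m Z \<gamma>)
  at which the normalised oscillator of frequency m is evaluated. Norm over imaginary part is |x| /
  Re x for every k, so a single cone contains all these points.\<close>

lemma osc_point:
  assumes x: "Re x > 0" and k: "k > 0"
  shows "norm (\<i> / (of_real k * x)) = 1 / (k * norm x)"
    and "Im (\<i> / (of_real k * x)) = Re x / (k * (norm x)\<^sup>2)" and "Im (\<i> / (of_real k * x)) > 0"
proof -
  show "norm (\<i> / (of_real k * x)) = 1 / (k * norm x)" using k by (simp add: norm_divide norm_mult)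
  have x0: "norm x > 0" using x by auto
  have "\<i> / (of_real k * x) = (\<i> * cnj x) / (of_real k * (x * cnj x))" using x0 by simp
  also have "x * cnj x = of_real ((norm x)\<^sup>2)" by (simp only: complex_norm_square)
  also have "(\<i> * cnj x) / (of_real k * of_real ((norm x)\<^sup>2)) = of_real (1 / (k * (norm x)\<^sup>2)) * (\<i> * cnj x)" by simp
  finally have "\<i> / (of_real k * x) = of_real (1 / (k * (norm x)\<^sup>2)) * (\<i> * cnj x)" .
  hence "Im (\<i> / (of_real k * x)) = 1 / (k * (norm x)\<^sup>2) * Re x" by (simp only: Im_of_real_mult) simp
  thus im: "Im (\<i> / (of_real k * x)) = Re x / (k * (norm x)\<^sup>2)" by simp
  show "Im (\<i> / (of_real k * x)) > 0" unfolding im using x k x0 by simp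
qed

text \<open>The substitution s = k u turns (s v)^2 into - u^2 / x^2.\<close>

lemma osc_pair_binet:
  assumes x: "Re x > 0" and k: "k > 0"
  shows "osc_pair (\<i> / (of_real k * x)) = 2 * \<i> * (LH u. of_real (exp (- k * u)) * (x / (x\<^sup>2 + of_real u ^ 2)))"
proof -
  have x0: "x \<noteq> 0" using x by auto
  define v where "v = \<i> / (of_real k * x)"
  define f where "f s = 2 * exp (- complex_of_real s) / (1 - (of_real s * v)\<^sup>2)" for s
  have "integral\<^sup>L halfline f = of_real k * (LH u. f (k * u))"
    using halfline_scale[OF k, of f] k by (simp add: scaleR_conv_of_real)
  hence "osc_pair v = (v * of_real k) * (LH u. f (k * u))"
    unfolding v_def using osc_pair_integral[OF osc_point(3)[OF x k]] by (simp add: f_def[abs_def] v_def)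
  also have "\<dots> = (LH u. (v * of_real k) * f (k * u))" by (rule integral_mult_right_zero[symmetric])
  also have "\<dots> = (LH u. 2 * \<i> * (of_real (exp (- k * u)) * (x / (x\<^sup>2 + of_real u ^ 2))))"
  proof (rule Bochner_Integration.integral_cong[OF refl])
    fix u
    have "of_real (k * u) * v = \<i> * of_real u / x" using k by (simp add: v_def)
    hence "(of_real (k * u) * v)\<^sup>2 = - (of_real u ^ 2 / x\<^sup>2)" by (simp only:) (simp add: power_divide power_mult_distrib)
    hence 1: "1 - (of_real (k * u) * v)\<^sup>2 = (x\<^sup>2 + of_real u ^ 2) / x\<^sup>2" using x0 by (simp only:) (simp add: field_simps)
    have 2: "v * of_real k = \<i> / x" using k by (simp add: v_def)
    have 3: "exp (- complex_of_real (k * u)) = of_real (exp (- k * u))" by (subst exp_of_real[symmetric]) simp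
    have 4: "\<i> / x * (2 * E / (q / x\<^sup>2)) = 2 * \<i> * (E * (x / q))" for E q
      using x0 by (simp add: power2_eq_square)
    show "(v * of_real k) * f (k * u) = 2 * \<i> * (of_real (exp (- k * u)) * (x / (x\<^sup>2 + of_real u ^ 2)))"
      unfolding f_def 1 2 3 4 ..
  qed
  also have "\<dots> = 2 * \<i> * (LH u. of_real (exp (- k * u)) * (x / (x\<^sup>2 + of_real u ^ 2)))"
    by (rule integral_mult_right_zero)
  finally show ?thesis by (simp only: v_def)
qed

lemma osc_pair_sums:
  assumes x: "Re x > 0"
  shows "(\<lambda>m. 1 / of_nat (Suc m) * osc_pair (\<i> / (of_real (freq m) * x))) sums (2 * of_real pi * \<i> * ln_Lambda x)"
proof -
  define J where "J m = (LH u. of_real (exp (- freq m * u)) * (x / (x\<^sup>2 + of_real u ^ 2)))" for m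
  have "(\<lambda>m. of_real (1 / (pi * real (Suc m))) * J m) sums ln_Lambda x"
    using binet_sums_cos[OF x] unfolding binet_eq[OF x] J_def .
  hence "(\<lambda>m. 2 * of_real pi * \<i> * (of_real (1 / (pi * real (Suc m))) * J m)) sums (2 * of_real pi * \<i> * ln_Lambda x)"
    by (rule sums_mult)
  moreover have "2 * of_real pi * \<i> * (of_real (1 / (pi * real (Suc m))) * J m) =
     1 / of_nat (Suc m) * osc_pair (\<i> / (of_real (freq m) * x))" for m
  proof -
    have p: "freq m > 0" by simp
    have "of_real pi * complex_of_real (1 / (pi * real (Suc m))) = 1 / of_nat (Suc m)"
      by (simp del: of_nat_Suc)
    hence "2 * of_real pi * \<i> * (of_real (1 / (pi * real (Suc m))) * J m) = 1 / of_nat (Suc m) * (2 * \<i> * J m)"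
      by (metis (no_types, lifting) mult.assoc mult.commute mult.left_commute)
    thus ?thesis unfolding osc_pair_binet[OF x p] J_def by simp
  qed
  ultimately show ?thesis by (simp only:)
qed

text \<open>The sign \<open>\<epsilon> m\<close> enters both the coupling and the outer weight, so
  it squares to 1 at first order. \<open>h\<close> stands for hbar times \<Omega>(\<gamma>) times
  the pairing, divided by 2 pi.\<close>

definition osc_term :: "(nat \<Rightarrow> real) \<Rightarrow> real \<Rightarrow> nat \<Rightarrow> complex \<Rightarrow> complex" where
  "osc_term \<epsilon> h m x = of_real (\<epsilon> m) / of_nat (Suc m) * osc_log (h * \<epsilon> m) (\<i> / (of_real (freq m) * x))"

lemma summable_inverse_square_Suc: "summable (\<lambda>m. 1 / (real (Suc m))\<^sup>2)"
  using summable_Suc_iff[THEN iffD2, OF inverse_power_summable[of 2, where ?'a=real]] by (simp add: divide_inverse)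

abbreviation signs :: "(nat \<Rightarrow> real) \<Rightarrow> bool" where
  "signs \<epsilon> \<equiv> \<forall>m. \<epsilon> m = 1 \<or> \<epsilon> m = - 1"

definition osc_full :: "(nat \<Rightarrow> real) \<Rightarrow> real \<Rightarrow> complex \<Rightarrow> complex" where
  "osc_full \<epsilon> h x = (\<Sum>m. osc_term \<epsilon> h m x)"

abbreviation osc_partial :: "nat \<Rightarrow> complex \<Rightarrow> complex" where
  "osc_partial N x \<equiv> (\<Sum>m<N. 1 / of_nat (Suc m) * osc_pair (\<i> / (of_real (freq m) * x)))"

text \<open>The estimate for partial sums is uniform in N. It yields the one for the full sum in the
  limit, and later permits a joint limit in hbar and N.\<close>

theorem osc_series:
  assumes a: "0 < a" and b: "0 < b"
  obtains C h0 where "C > 0" "0 < h0"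
    "\<And>\<epsilon> h x. signs \<epsilon> \<Longrightarrow> \<bar>h\<bar> \<le> h0 \<Longrightarrow> a < Re x \<Longrightarrow> norm x < b \<Longrightarrow>
       summable (\<lambda>m. osc_term \<epsilon> h m x) \<and>
       norm (osc_full \<epsilon> h x - of_real h * (2 * of_real pi * \<i> * ln_Lambda x)) \<le> C * h\<^sup>2"
    "\<And>\<epsilon> h x N. signs \<epsilon> \<Longrightarrow> \<bar>h\<bar> \<le> h0 \<Longrightarrow> a < Re x \<Longrightarrow> norm x < b \<Longrightarrow>
       norm ((\<Sum>m<N. osc_term \<epsilon> h m x) - of_real h * osc_partial N x) \<le> C * h\<^sup>2"
    "\<And>\<epsilon> h. signs \<epsilon> \<Longrightarrow> \<bar>h\<bar> \<le> h0 \<Longrightarrow> osc_full \<epsilon> h holomorphic_on {x. a < Re x \<and> norm x < b}"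
proof -
  \<comment> \<open>The cone comes from |v| / Im v = |x| / Re x < b / a, and the bound on |v| from
    |v| < 1 / (m a), where 2 pi > 1 has been dropped.\<close>
  define A B where "A = b / a" and "B = 1 / a"
  have AB: "A \<ge> 0" "B \<ge> 0" using a b by (auto simp: A_def B_def)
  obtain K h0 where K: "K > 0" "0 < h0"
    "\<And>c v. \<bar>c\<bar> \<le> h0 \<Longrightarrow> Im v > 0 \<Longrightarrow> norm v \<le> (1 + A) * Im v \<Longrightarrow> norm v \<le> B \<Longrightarrow>
       norm (osc_log c v - of_real c * osc_pair v) \<le> K * c\<^sup>2 * norm v \<and> norm (osc_log c v) \<le> K * \<bar>c\<bar> * norm v"
    "\<And>c S. \<bar>c\<bar> \<le> h0 \<Longrightarrow> open S \<Longrightarrow> (\<And>v. v \<in> S \<Longrightarrow> Im v > 0 \<and> norm v \<le> (1 + A) * Im v \<and> norm v \<le> B) \<Longrightarrow>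
       osc_log c holomorphic_on S"
    by (rule osc_log_first_order[OF AB]) blast
  define V where "V m x = \<i> / (of_real (freq m) * x)" for m x
  define D where "D = {x. a < Re x \<and> norm x < b}"
  define G where "G = {v. Im v > 0 \<and> norm v < (1 + A) * Im v \<and> norm v < B}"
  define S where "S = (\<Sum>m. 1 / (real (Suc m))\<^sup>2)"
  have S0: "S \<ge> 0" unfolding S_def by (intro suminf_nonneg summable_inverse_square_Suc) simp
  define C where "C = K * B * (S + 1)"
  have KB: "K * B > 0" using K(1) a by (simp add: B_def)
  have "C = K * B * S + K * B" by (simp add: C_def algebra_simps)
  moreover have "K * B * S \<ge> 0" by (rule mult_nonneg_nonneg[OF less_imp_le[OF KB] S0])
  ultimately have C: "C > 0" "K * B \<le> C" "K * B * S \<le> C" using KB by linarith+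
  have V: "V m x \<in> G" "norm (V m x) \<le> B / real (Suc m)" if "x \<in> D" for m x
  proof -
    define k where "k = 2 * pi * real (Suc m)"
    have x: "a < Re x" "norm x < b" "Re x > 0" using that a by (auto simp: D_def)
    have k: "k > 0" by (simp add: k_def)
    have pi1: "1 < 2 * pi" using pi_gt3 by simp
    have k1: "k > 1 * real (Suc m)" unfolding k_def using pi1 by (intro mult_strict_right_mono) auto
    have x0: "norm x > 0" using x by auto
    have ax: "a < norm x" using x complex_Re_le_cmod[of x] by linarith
    note P = osc_point[OF x(3) k]
    have n: "norm (V m x) < 1 / (real (Suc m) * a)"
      unfolding V_def k_def[symmetric] P(1) using k1 ax a k x0
      by (intro divide_strict_left_mono mult_strict_mono) (auto intro!: mult_pos_pos)
    thus "norm (V m x) \<le> B / real (Suc m)" by (simp add: B_def mult.commute)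
    have "1 * a \<le> real (Suc m) * a" using a by (intro mult_right_mono) auto
    hence "1 / (real (Suc m) * a) \<le> 1 / (1 * a)" using a by (intro divide_left_mono) auto
    hence nB: "norm (V m x) < B" using n by (simp add: B_def)
    have "norm x * a < b * Re x" using x(1,2) a by (intro mult_strict_mono') auto
    hence "norm x < A * Re x" using a by (simp add: A_def field_simps)
    hence "norm x < (1 + A) * Re x" using x(3) by (simp add: ring_distribs)
    hence "norm x / (k * (norm x)\<^sup>2) < (1 + A) * Re x / (k * (norm x)\<^sup>2)"
      using k x0 by (intro divide_strict_right_mono) auto
    hence "norm (V m x) < (1 + A) * Im (V m x)"
      unfolding V_def k_def[symmetric] P(1,2) using x0 by (simp add: power2_eq_square)
    thus "V m x \<in> G" using nB P(3) unfolding G_def V_def k_def by blast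
  qed
  have G: "open G" unfolding G_def by (intro open_Collect_conj open_Collect_less continuous_intros)
  have G': "Im v > 0 \<and> norm v \<le> (1 + A) * Im v \<and> norm v \<le> B" if "v \<in> G" for v
    using that by (auto simp: G_def)
  show ?thesis
  proof (rule that[OF C(1) K(2)])
    fix \<epsilon> :: "nat \<Rightarrow> real" and h
    assume \<epsilon>: "signs \<epsilon>" and h: "\<bar>h\<bar> \<le> h0"
    have h\<epsilon>: "\<bar>h * \<epsilon> m\<bar> = \<bar>h\<bar>" "(h * \<epsilon> m)\<^sup>2 = h\<^sup>2" "\<bar>\<epsilon> m\<bar> = 1" "\<epsilon> m * \<epsilon> m = 1" for m using \<epsilon>[rule_format, of m] by auto
    have h': "\<bar>h * \<epsilon> m\<bar> \<le> h0" for m using h h\<epsilon> by simp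
    have T: "osc_term \<epsilon> h m x = of_real (\<epsilon> m) / of_nat (Suc m) * osc_log (h * \<epsilon> m) (V m x)" for m x
      by (simp add: osc_term_def V_def)
    have holt: "osc_term \<epsilon> h m holomorphic_on {x. a < Re x \<and> norm x < b}" for m
    proof -
      have "V m holomorphic_on D" unfolding V_def[abs_def] by (intro holomorphic_intros) (use a in \<open>auto simp: D_def simp del: of_nat_Suc\<close>)
      hence "(osc_log (h * \<epsilon> m) \<circ> V m) holomorphic_on D"
        by (rule holomorphic_on_compose_gen[OF _ K(4)[OF h' G G']]) (use V in auto)
      hence "(\<lambda>x. of_real (\<epsilon> m) / of_nat (Suc m) * (osc_log (h * \<epsilon> m) \<circ> V m) x) holomorphic_on D"
        by (intro holomorphic_on_mult holomorphic_on_const)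
      thus ?thesis unfolding T[abs_def] D_def comp_def .
    qed
    have est: "norm (osc_term \<epsilon> h m x) \<le> C * \<bar>h\<bar> * (1 / (real (Suc m))\<^sup>2)"
        "norm ((\<Sum>m<N. osc_term \<epsilon> h m x) - of_real h * osc_partial N x) \<le> C * h\<^sup>2"
      if "a < Re x" "norm x < b" for x m N
    proof -
      from that have x: "x \<in> D" by (simp add: D_def)
      have b1: "norm (osc_log (h * \<epsilon> m) (V m x) - of_real (h * \<epsilon> m) * osc_pair (V m x)) \<le> K * h\<^sup>2 * norm (V m x)"
        "norm (osc_log (h * \<epsilon> m) (V m x)) \<le> K * \<bar>h\<bar> * norm (V m x)" for m
        using K(3)[OF h'[of m]] G'[OF V(1)[OF x, of m]] unfolding h\<epsilon> by blast+
      have b2: "1 / real (Suc m) * (k * norm (V m x)) \<le> k * B * (1 / (real (Suc m))\<^sup>2)" if "k \<ge> 0" for k m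
      proof -
        have "1 / real (Suc m) * (k * norm (V m x)) \<le> 1 / real (Suc m) * (k * (B / real (Suc m)))"
          using V(2)[OF x, of m] that by (intro mult_left_mono) auto
        thus ?thesis by (simp add: power2_eq_square del: of_nat_Suc)
      qed
      show "norm (osc_term \<epsilon> h m x) \<le> C * \<bar>h\<bar> * (1 / (real (Suc m))\<^sup>2)"
      proof -
        have "norm (osc_term \<epsilon> h m x) = 1 / real (Suc m) * norm (osc_log (h * \<epsilon> m) (V m x))"
          unfolding T norm_mult norm_divide norm_of_real h\<epsilon> norm_of_nat ..
        also have "\<dots> \<le> 1 / real (Suc m) * (K * \<bar>h\<bar> * norm (V m x))" using b1(2) by (intro mult_left_mono) auto
        also have "\<dots> \<le> (K * \<bar>h\<bar>) * B * (1 / (real (Suc m))\<^sup>2)" using K(1) by (intro b2) simp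
        also have "\<dots> = K * B * (\<bar>h\<bar> * (1 / (real (Suc m))\<^sup>2))" by simp
        also have "\<dots> \<le> C * (\<bar>h\<bar> * (1 / (real (Suc m))\<^sup>2))" using C(2) by (intro mult_right_mono) auto
        finally show ?thesis by (simp only: mult.assoc)
      qed
      have "(\<Sum>m<N. osc_term \<epsilon> h m x) - of_real h * (\<Sum>m<N. 1 / of_nat (Suc m) * osc_pair (V m x)) =
          (\<Sum>m<N. of_real (\<epsilon> m) / of_nat (Suc m) * (osc_log (h * \<epsilon> m) (V m x) - of_real (h * \<epsilon> m) * osc_pair (V m x)))"
        unfolding sum_distrib_left sum_subtractf[symmetric]
      proof (rule sum.cong[OF refl])
        fix m
        have "complex_of_real (\<epsilon> m) * of_real (\<epsilon> m) = 1" using h\<epsilon>(4)[of m] by (metis of_real_1 of_real_mult)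
        hence "of_real (\<epsilon> m) / of_nat (Suc m) * (of_real (h * \<epsilon> m) * osc_pair (V m x)) = of_real h * (1 / of_nat (Suc m) * osc_pair (V m x))"
          by (simp add: field_simps del: of_nat_Suc)
        thus "osc_term \<epsilon> h m x - of_real h * (1 / of_nat (Suc m) * osc_pair (V m x)) =
           of_real (\<epsilon> m) / of_nat (Suc m) * (osc_log (h * \<epsilon> m) (V m x) - of_real (h * \<epsilon> m) * osc_pair (V m x))"
          unfolding T right_diff_distrib by simp
      qed
      also have "norm \<dots> \<le> (\<Sum>m<N. K * h\<^sup>2 * B * (1 / (real (Suc m))\<^sup>2))"
      proof (rule order_trans[OF norm_sum], rule sum_mono)
        fix m
        have "norm (of_real (\<epsilon> m) / of_nat (Suc m) * (osc_log (h * \<epsilon> m) (V m x) - of_real (h * \<epsilon> m) * osc_pair (V m x))) =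
            1 / real (Suc m) * norm (osc_log (h * \<epsilon> m) (V m x) - of_real (h * \<epsilon> m) * osc_pair (V m x))"
          unfolding norm_mult norm_divide norm_of_real h\<epsilon> norm_of_nat ..
        also have "\<dots> \<le> 1 / real (Suc m) * (K * h\<^sup>2 * norm (V m x))" using b1(1) by (intro mult_left_mono) auto
        also have "\<dots> \<le> K * h\<^sup>2 * B * (1 / (real (Suc m))\<^sup>2)" using K(1) by (intro b2) simp
        finally show "norm (of_real (\<epsilon> m) / of_nat (Suc m) * (osc_log (h * \<epsilon> m) (V m x) - of_real (h * \<epsilon> m) * osc_pair (V m x))) \<le>
            K * h\<^sup>2 * B * (1 / (real (Suc m))\<^sup>2)" .
      qed
      also have "\<dots> = (K * h\<^sup>2 * B) * (\<Sum>m<N. 1 / (real (Suc m))\<^sup>2)" by (rule sum_distrib_left[symmetric])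
      also have "\<dots> \<le> (K * h\<^sup>2 * B) * S"
        unfolding S_def using K(1) AB by (intro mult_left_mono sum_le_suminf summable_inverse_square_Suc) auto
      also have "\<dots> = (K * B * S) * h\<^sup>2" by simp
      also have "\<dots> \<le> C * h\<^sup>2" using C(3) by (intro mult_right_mono) auto
      finally show "norm ((\<Sum>m<N. osc_term \<epsilon> h m x) - of_real h * osc_partial N x) \<le> C * h\<^sup>2"
        unfolding V_def .
    qed
    have sq: "summable (\<lambda>m. C * \<bar>h\<bar> * (1 / (real (Suc m))\<^sup>2))"
      by (intro summable_mult summable_inverse_square_Suc)
    have "open {x. a < Re x \<and> norm x < b}"
      by (intro open_Collect_conj open_Collect_less continuous_intros)
    thus "osc_full \<epsilon> h holomorphic_on {x. a < Re x \<and> norm x < b}"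
      unfolding osc_full_def[abs_def] by (rule holomorphic_series[OF _ holt _ sq]) (use est(1) in auto)
    fix x assume x: "a < Re x" "norm x < b"
    show p: "norm ((\<Sum>m<N. osc_term \<epsilon> h m x) - of_real h * osc_partial N x) \<le> C * h\<^sup>2" for N
      by (rule est(2)[OF x])
    have s: "summable (\<lambda>m. osc_term \<epsilon> h m x)"
      by (rule summable_comparison_test'[OF sq, of 0]) (rule est(1)[OF x])
    have "Re x > 0" using a x by linarith
    from osc_pair_sums[OF this] have "(\<lambda>N. osc_partial N x) \<longlonglongrightarrow> 2 * of_real pi * \<i> * ln_Lambda x"
      by (simp only: sums_def)
    moreover have "(\<lambda>N. \<Sum>m<N. osc_term \<epsilon> h m x) \<longlonglongrightarrow> osc_full \<epsilon> h x"
      using summable_sums[OF s] by (simp only: sums_def osc_full_def)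
    ultimately have "(\<lambda>N. norm ((\<Sum>m<N. osc_term \<epsilon> h m x) - of_real h * osc_partial N x)) \<longlonglongrightarrow>
        norm (osc_full \<epsilon> h x - of_real h * (2 * of_real pi * \<i> * ln_Lambda x))"
      by (intro tendsto_intros)
    hence "norm (osc_full \<epsilon> h x - of_real h * (2 * of_real pi * \<i> * ln_Lambda x)) \<le> C * h\<^sup>2"
      by (rule LIMSEQ_le_const2) (use p in blast)
    with s show "summable (\<lambda>m. osc_term \<epsilon> h m x) \<and>
       norm (osc_full \<epsilon> h x - of_real h * (2 * of_real pi * \<i> * ln_Lambda x)) \<le> C * h\<^sup>2" by blast
  qed
qed

subsection \<open>Lattice bases and period coordinates\<close>

lemma additive_scale:
  fixes f :: "int ^ 'n::finite \<Rightarrow> 'b::ring_1"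
  assumes "Modules.additive f"
  shows "f (k *s x) = of_int k * f x"
proof (induction k rule: int_induct[where k=0])
  case base
  show ?case by (simp add: additive.zero[OF assms])
next
  case (step1 i)
  have "(i + 1) *s x = i *s x + x" by (simp add: vec_eq_iff algebra_simps)
  thus ?case using step1 by (simp add: additive.add[OF assms] algebra_simps)
next
  case (step2 i)
  have "(i - 1) *s x = i *s x - x" by (simp add: vec_eq_iff algebra_simps)
  thus ?case using step2 by (simp add: additive.diff[OF assms] algebra_simps)
qed

definition lattice_coeff :: "('n::finite \<Rightarrow> int ^ 'n) \<Rightarrow> int ^ 'n \<Rightarrow> 'n \<Rightarrow> int" where
  "lattice_coeff \<beta> \<gamma> = (THE c. \<gamma> = (\<Sum>j\<in>UNIV. c j *s \<beta> j))"

lemma coeff_expansion: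
  assumes "lattice_basis \<beta>"
  shows "\<gamma> = (\<Sum>j\<in>UNIV. lattice_coeff \<beta> \<gamma> j *s \<beta> j)"
proof -
  have "\<exists>!c. \<gamma> = (\<Sum>j\<in>UNIV. c j *s \<beta> j)" using assms by (simp add: lattice_basis_def)
  thus ?thesis unfolding lattice_coeff_def by (rule theI')
qed

lemma coeff_unique:
  assumes "lattice_basis \<beta>" "\<gamma> = (\<Sum>j\<in>UNIV. c j *s \<beta> j)"
  shows "lattice_coeff \<beta> \<gamma> = c"
  using assms coeff_expansion[OF assms(1), of \<gamma>] unfolding lattice_basis_def by blast

lemma additive_expansion:
  fixes f :: "int ^ 'n::finite \<Rightarrow> 'b::ring_1"
  assumes "lattice_basis \<beta>" "Modules.additive f"
  shows "f \<gamma> = (\<Sum>j\<in>UNIV. of_int (lattice_coeff \<beta> \<gamma> j) * f (\<beta> j))"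
proof -
  have "f \<gamma> = f (\<Sum>j\<in>UNIV. lattice_coeff \<beta> \<gamma> j *s \<beta> j)"
    using coeff_expansion[OF assms(1), of \<gamma>] by simp
  thus ?thesis by (simp add: additive.sum[OF assms(2)] additive_scale[OF assms(2)])
qed

definition change_coords :: "('n::finite \<Rightarrow> int ^ 'n) \<Rightarrow> ('n \<Rightarrow> int ^ 'n) \<Rightarrow> complex ^ 'n \<Rightarrow> complex ^ 'n" where
  "change_coords b \<beta> y = (\<chi> j. \<Sum>i\<in>UNIV. of_int (lattice_coeff b (\<beta> j) i) * y $ i)"

lemma continuous_on_change_coords: "continuous_on S (change_coords b \<beta>)"
  unfolding change_coords_def by (intro continuous_intros)

text \<open>The transition matrices are inverse to each other, by uniqueness of the coefficients of
  \<open>b k\<close> in the basis b.\<close>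

lemma coeff_compose:
  assumes b: "lattice_basis b" and \<beta>: "lattice_basis \<beta>"
  shows "(\<Sum>j\<in>UNIV. lattice_coeff \<beta> (b k) j * lattice_coeff b (\<beta> j) i) = (if i = k then 1 else 0)"
proof -
  have "b k = (\<Sum>j\<in>UNIV. lattice_coeff \<beta> (b k) j *s (\<Sum>i\<in>UNIV. lattice_coeff b (\<beta> j) i *s b i))"
    unfolding coeff_expansion[OF b, symmetric] by (rule coeff_expansion[OF \<beta>])
  also have "\<dots> = (\<Sum>i\<in>UNIV. (\<Sum>j\<in>UNIV. lattice_coeff \<beta> (b k) j * lattice_coeff b (\<beta> j) i) *s b i)"
    by (simp add: vec_eq_iff sum_component sum_distrib_left sum_distrib_right mult.assoc) (auto intro: sum.swap)
  finally have "lattice_coeff b (b k) = (\<lambda>i. \<Sum>j\<in>UNIV. lattice_coeff \<beta> (b k) j * lattice_coeff b (\<beta> j) i)"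
    by (rule coeff_unique[OF b])
  moreover have "b k = (\<Sum>i\<in>UNIV. (if i = k then 1 else 0) *s b i)"
    by (simp add: if_distrib[of "\<lambda>c. c *s _"] cong: if_cong)
  hence "lattice_coeff b (b k) = (\<lambda>i. if i = k then 1 else 0)" by (rule coeff_unique[OF b])
  ultimately show ?thesis by metis
qed

lemma change_coords_inverse:
  assumes b: "lattice_basis b" and \<beta>: "lattice_basis \<beta>"
  shows "change_coords \<beta> b (change_coords b \<beta> y) = y"
proof -
  have "(\<Sum>j\<in>UNIV. of_int (lattice_coeff \<beta> (b k) j) * (\<Sum>i\<in>UNIV. of_int (lattice_coeff b (\<beta> j) i) * y $ i)) = y $ k" for k
  proof -
    have "(\<Sum>j\<in>UNIV. of_int (lattice_coeff \<beta> (b k) j) * (\<Sum>i\<in>UNIV. of_int (lattice_coeff b (\<beta> j) i) * y $ i)) =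
        (\<Sum>j\<in>UNIV. \<Sum>i\<in>UNIV. of_int (lattice_coeff \<beta> (b k) j * lattice_coeff b (\<beta> j) i) * y $ i)"
      by (simp add: sum_distrib_left mult.assoc)
    also have "\<dots> = (\<Sum>i\<in>UNIV. \<Sum>j\<in>UNIV. of_int (lattice_coeff \<beta> (b k) j * lattice_coeff b (\<beta> j) i) * y $ i)"
      by (rule sum.swap)
    also have "\<dots> = (\<Sum>i\<in>UNIV. of_int (\<Sum>j\<in>UNIV. lattice_coeff \<beta> (b k) j * lattice_coeff b (\<beta> j) i) * y $ i)"
      by (simp only: of_int_sum sum_distrib_right)
    also have "\<dots> = (\<Sum>i\<in>UNIV. (if i = k then y $ i else 0))"
      unfolding coeff_compose[OF b \<beta>] by (intro sum.cong) auto
    finally show ?thesis by simp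
  qed
  thus ?thesis by (simp add: change_coords_def vec_eq_iff)
qed

text \<open>Miniversality provides charts for one basis only. Any other basis differs by an integer
  matrix with integer inverse, which is a linear homeomorphism of the coordinate space.\<close>

lemma chart_change_basis:
  fixes Z :: "'m::topological_space \<Rightarrow> int ^ 'n::finite \<Rightarrow> complex"
  assumes b: "lattice_basis b" and \<beta>: "lattice_basis \<beta>" and Z: "\<And>p. Modules.additive (Z p)"
    and ch: "is_chart U (period_coords Z b)"
  shows "is_chart U (period_coords Z \<beta>)"
proof -
  define T S where "T = change_coords b \<beta>" and "S = change_coords \<beta> b"
  have ST: "S (T y) = y" "T (S y) = y" for y
    unfolding S_def T_def by (rule change_coords_inverse[OF b \<beta>], rule change_coords_inverse[OF \<beta> b])
  have cont: "continuous_on A T" "continuous_on A S" for A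
    unfolding S_def T_def by (rule continuous_on_change_coords)+
  have P: "period_coords Z \<beta> p = T (period_coords Z b p)" for p
    unfolding period_coords_def T_def change_coords_def
    by (simp add: vec_eq_iff additive_expansion[OF b Z, of p "\<beta> _"])
  define V where "V = period_coords Z b ` U"
  have h: "homeomorphism U V (period_coords Z b) (inv_into U (period_coords Z b))" and oV: "open V" and oU: "open U"
    using ch by (auto simp: is_chart_def V_def)
  have "homeomorphism V (T ` V) T S"
    by (rule homeomorphismI) (use ST cont in auto)
  from homeomorphism_compose[OF h this]
  have H: "homeomorphism U (T ` V) (period_coords Z \<beta>) (inv_into U (period_coords Z b) \<circ> S)"
    unfolding comp_def P .
  have im: "period_coords Z \<beta> ` U = T ` V" using H by (simp add: homeomorphism_def)
  have "T ` V = S -` V"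
  proof (intro equalityI subsetI)
    fix x assume "x \<in> S -` V"
    hence "T (S x) \<in> T ` V" by blast
    thus "x \<in> T ` V" by (simp add: ST)
  qed (auto simp: ST)
  hence "open (T ` V)"
    using oV cont(2)[of UNIV] by (simp add: continuous_on_open_vimage)
  moreover have "homeomorphism U (T ` V) (period_coords Z \<beta>) (inv_into U (period_coords Z \<beta>))"
  proof (rule homeomorphism_cong[OF H])
    fix y assume "y \<in> T ` V"
    then obtain x where x: "x \<in> U" "y = period_coords Z \<beta> x" using im by blast
    have "inj_on (period_coords Z \<beta>) U" by (rule inj_on_inverseI) (rule homeomorphism_apply1[OF H])
    thus "inv_into U (period_coords Z \<beta>) y = (inv_into U (period_coords Z b) \<circ> S) y"
      using x homeomorphism_apply1[OF H] by simp
  qed auto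
  ultimately show ?thesis unfolding is_chart_def im using oU by blast
qed

text \<open>Moving the q-th period coordinate by h changes each Z \<gamma> by its q-th coefficient
  times h, since Z is additive. So f only has to be known, as a function g of h, at points with
  these central charges, and the chart drops out.\<close>

lemma has_coord_derivativeI:
  fixes Z :: "'m::topological_space \<Rightarrow> int ^ 'n::finite \<Rightarrow> complex"
  assumes \<beta>: "lattice_basis \<beta>" and Z: "\<And>p. Modules.additive (Z p)"
    and U: "p \<in> U" "is_chart U (period_coords Z \<beta>)"
    and g: "(g has_field_derivative D) (at 0)" and e: "e > 0"
    and f: "\<And>h p'. norm h < e \<Longrightarrow> (\<And>\<gamma>. Z p' \<gamma> = Z p \<gamma> + of_int (lattice_coeff \<beta> \<gamma> q) * h) \<Longrightarrow> f p' = g h"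
  shows "has_coord_derivative Z \<beta> q f D p"
  unfolding has_coord_derivative_def
proof (rule exI[of _ U], intro conjI U)
  define \<phi> where "\<phi> = period_coords Z \<beta>"
  have op: "open (\<phi> ` U)" using U by (simp add: is_chart_def \<phi>_def)
  have "continuous_on UNIV (\<lambda>h :: complex. \<phi> p + axis q h)"
  proof -
    have A: "continuous_on UNIV (\<lambda>h :: complex. if i = q then h else 0)" for i by (cases "i = q") auto
    thus ?thesis unfolding axis_def by (intro continuous_on_add continuous_on_const continuous_on_vec_lambda A)
  qed
  hence "open ((\<lambda>h. \<phi> p + axis q h) -` (\<phi> ` U))"
    using op by (simp add: continuous_on_open_vimage)
  moreover have "0 \<in> (\<lambda>h. \<phi> p + axis q h) -` (\<phi> ` U)" using U(1) by (simp add: axis_eq_0_iff[THEN iffD2])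
  ultimately obtain d where d: "d > 0" "ball 0 d \<subseteq> (\<lambda>h. \<phi> p + axis q h) -` (\<phi> ` U)"
    by (metis openE)
  show "((\<lambda>h. f (inv_into U (period_coords Z \<beta>) (period_coords Z \<beta> p + axis q h))) has_field_derivative D) (at 0)"
    unfolding \<phi>_def[symmetric]
  proof (rule has_field_derivative_transform_within[OF g])
    show "min d e > 0" using d e by simp
    fix h :: complex assume "dist h 0 < min d e"
    hence h: "norm h < d" "norm h < e" by auto
    define p' where "p' = inv_into U \<phi> (\<phi> p + axis q h)"
    have "\<phi> p' = \<phi> p + axis q h" unfolding p'_def using d(2) h(1) by (intro f_inv_into_f) auto
    hence *: "Z p' (\<beta> j) = Z p (\<beta> j) + (if j = q then h else 0)" for j
      by (simp add: \<phi>_def period_coords_def vec_eq_iff axis_def)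
    have **: "of_int k * (if j = q then h else 0) = (if j = q then of_int k * h else 0)" for k j by simp
    have "Z p' \<gamma> = Z p \<gamma> + of_int (lattice_coeff \<beta> \<gamma> q) * h" for \<gamma>
      unfolding additive_expansion[OF \<beta> Z, of _ \<gamma>] * distrib_left ** sum.distrib by simp
    thus "g h = f (inv_into U \<phi> (\<phi> p + axis q h))"
      unfolding p'_def[symmetric] using f[OF h(2)] by simp
  qed simp
qed

subsection \<open>Maximal sets of active classes in a half-plane\<close>

text \<open>Maximality is used twice. With l itself it forces the central charge of an uncovered
  class onto the boundary line of the half-plane. The class or its negative then lies on l, and a
  slightly turned half-plane contains it together with the finite set G.\<close>

lemma maximal_half_plane_cover:
  assumes bps: "bps_structure form Z \<Omega>" and fin: "finite_bps \<Omega>" and unc: "uncoupled form \<Omega>"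
    and max: "maximal_half_plane_classes \<Omega> Z l G" and \<gamma>: "\<Omega> \<gamma> \<noteq> 0"
  shows "\<gamma> \<in> G \<or> - \<gamma> \<in> G"
proof (rule ccontr)
  assume n: "\<not> (\<gamma> \<in> G \<or> - \<gamma> \<in> G)"
  note bfu = bps fin unc
  have l: "is_ray l" and GA: "G \<subseteq> active \<Omega>" and GH: "Z ` G \<subseteq> half_plane l"
    and mx: "\<And>G' l'. is_ray l' \<Longrightarrow> G' \<subseteq> active \<Omega> \<Longrightarrow> Z ` G' \<subseteq> half_plane l' \<Longrightarrow> G \<subseteq> G' \<Longrightarrow> G' = G"
    using max unfolding maximal_half_plane_classes_def by blast+
  obtain u where u: "u \<noteq> 0" "\<And>z. z \<in> half_plane l \<longleftrightarrow> Im (z / u) > 0"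
    using l by (auto elim: is_rayE)
  have out: "\<not> Im (Z \<delta> / u) > 0" if "\<Omega> \<delta> \<noteq> 0" "\<delta> \<notin> G" for \<delta>
  proof
    assume "Im (Z \<delta> / u) > 0"
    hence "insert \<delta> G = G"
      using that GA GH u(2) by (intro mx[OF l]) (auto simp: active_def)
    thus False using that by blast
  qed
  obtain \<delta> where \<delta>: "\<Omega> \<delta> \<noteq> 0" "\<delta> \<notin> G" "Re (Z \<delta> / u) > 0" "Im (Z \<delta> / u) = 0"
  proof -
    have "Im (Z \<gamma> / u) = 0"
      using out[of \<gamma>] out[of "- \<gamma>"] n \<gamma> by (simp add: \<Omega>_minus[OF bfu] Z_minus[OF bfu])
    moreover have "Z \<gamma> / u \<noteq> 0" using Z_active_nonzero[OF bfu \<gamma>] u(1) by simp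
    ultimately have re: "Re (Z \<gamma> / u) \<noteq> 0" using complex_eq_0 by (auto simp: complex_eq_iff)
    show ?thesis
    proof (cases "Re (Z \<gamma> / u) > 0")
      case True
      thus ?thesis using that[of \<gamma>] n \<gamma> \<open>Im (Z \<gamma> / u) = 0\<close> by blast
    next
      case False
      thus ?thesis
        using that[of "- \<gamma>"] n \<gamma> \<open>Im (Z \<gamma> / u) = 0\<close> re by (simp add: \<Omega>_minus[OF bfu] Z_minus[OF bfu])
    qed
  qed
  have "finite G" using GA fin by (auto simp: finite_bps_def intro: finite_subset)
  moreover have "\<forall>g\<in>G. \<forall>\<^sub>F e in at_right (0::real). Im (Z g / u) + e * Re (Z g / u) > 0"
  proof
    fix g assume "g \<in> G"
    hence "Im (Z g / u) > 0" using GH u(2) by blast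
    moreover have "((\<lambda>e. Im (Z g / u) + e * Re (Z g / u)) \<longlongrightarrow> Im (Z g / u) + 0 * Re (Z g / u)) (at_right (0::real))"
      by (intro tendsto_intros)
    ultimately show "\<forall>\<^sub>F e in at_right (0::real). Im (Z g / u) + e * Re (Z g / u) > 0"
      by (intro order_tendstoD(1)) auto
  qed
  ultimately have "\<forall>\<^sub>F e in at_right (0::real). \<forall>g\<in>G. Im (Z g / u) + e * Re (Z g / u) > 0"
    by (rule eventually_ball_finite)
  hence "\<forall>\<^sub>F e in at_right (0::real). e > 0 \<and> (\<forall>g\<in>G. Im (Z g / u) + e * Re (Z g / u) > 0)"
    using eventually_at_right_less by eventually_elim blast
  then obtain e :: real where e: "e > 0" "\<And>g. g \<in> G \<Longrightarrow> Im (Z g / u) + e * Re (Z g / u) > 0"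
    by (metis (no_types, lifting) eventually_happens trivial_limit_at_right_real)
  \<comment> \<open>Dividing u by 1 + i e multiplies z / u by 1 + i e, so its imaginary part becomes
    Im + e Re: a small tilt that takes in the ray l.\<close>
  define w where "w = u / Complex 1 e"
  have c0: "Complex 1 e \<noteq> 0" by (simp add: complex_eq_iff)
  have w: "w \<noteq> 0" using u c0 by (simp add: w_def)
  define l' where "l' = {of_real r * w | r. r > 0}"
  have "z / w = z / u * Complex 1 e" for z by (simp add: w_def)
  hence iw: "Im (z / w) = Im (z / u) + e * Re (z / u)" for z
    by (simp only: times_complex.sel complex.sel) (simp add: algebra_simps)
  have hl: "z \<in> half_plane l' \<longleftrightarrow> Im (z / u) + e * Re (z / u) > 0" for z
    unfolding l'_def half_plane_ray[OF w] iw ..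
  have "insert \<delta> G = G"
  proof (rule mx)
    show "is_ray l'" unfolding is_ray_def l'_def using w by blast
    show "insert \<delta> G \<subseteq> active \<Omega>" using GA \<delta>(1) by (simp add: active_def)
    have "Z \<delta> \<in> half_plane l'" unfolding hl \<delta>(4) using e(1) \<delta>(3) by simp
    thus "Z ` insert \<delta> G \<subseteq> half_plane l'" using e(2) by (auto simp: hl)
  qed blast
  thus False using \<delta>(2) by blast
qed

lemma Re_divide_pos_iff: "t \<noteq> 0 \<Longrightarrow> Re (z / t) > 0 \<longleftrightarrow> inner z t > 0"
proof -
  assume t: "t \<noteq> 0"
  hence "(Re t)\<^sup>2 + (Im t)\<^sup>2 > 0" by (simp add: complex_neq_0)
  thus ?thesis by (simp add: Re_divide inner_complex_def zero_less_divide_iff)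
qed

text \<open>For nonempty W the set is a finite intersection of open half-planes, hence convex. For
  empty W it is the punctured plane, connected but not convex.\<close>

lemma open_sector_Re_pos:
  assumes fin: "finite W"
  shows "open_sector {t. t \<noteq> 0 \<and> (\<forall>z\<in>W. Re (z / t) > 0)}"
proof (cases "W = {}")
  case True
  have "connected (- {0 :: complex})" by (rule connected_punctured_universe) simp
  moreover have "{t :: complex. t \<noteq> 0} = - {0}" by auto
  ultimately show ?thesis using True by (auto simp: open_sector_def open_delete)
next
  case False
  have eq: "{t. t \<noteq> 0 \<and> (\<forall>z\<in>W. Re (z / t) > 0)} = (\<Inter>z\<in>W. {t. inner z t > 0})"
  proof -
    have "t \<noteq> 0 \<and> (\<forall>z\<in>W. Re (z / t) > 0) \<longleftrightarrow> (\<forall>z\<in>W. inner z t > 0)" for t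
    proof (cases "t = 0")
      case True
      thus ?thesis using False by auto
    qed (simp add: Re_divide_pos_iff)
    thus ?thesis by auto
  qed
  have "open (\<Inter>z\<in>W. {t. inner z t > 0})" by (intro open_INT fin ballI open_halfspace_gt)
  moreover have "convex (\<Inter>z\<in>W. {t. inner z t > 0})" by (intro convex_INT convex_halfspace_gt)
  moreover have "inner z (of_real r * t) = r * inner z t" for z t :: complex and r
    by (simp add: inner_complex_def algebra_simps)
  ultimately show ?thesis
    unfolding open_sector_def eq using False by (auto intro: convex_connected)
qed

subsection \<open>Uncoupled variations\<close>

context
  fixes form :: "int ^ 'n::finite \<Rightarrow> int ^ 'n \<Rightarrow> int" and Z :: "'m::topological_space \<Rightarrow> int ^ 'n \<Rightarrow> complex"
    and \<Omega> :: "int ^ 'n \<Rightarrow> rat" and \<beta> :: "'n \<Rightarrow> int ^ 'n" and p0 :: 'm and l :: "complex set" and G :: "(int ^ 'n) set"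
  assumes bps: "\<And>p. bps_structure form (Z p) \<Omega>" and fin: "finite_bps \<Omega>" and unc: "uncoupled form \<Omega>"
    and basis: "lattice_basis \<beta>" and max: "maximal_half_plane_classes \<Omega> (Z p0) l G"
    and charts: "\<And>p. \<exists>U. p \<in> U \<and> is_chart U (period_coords Z \<beta>)"
begin

lemma ray: "is_ray l" and G_active: "\<gamma> \<in> G \<Longrightarrow> \<Omega> \<gamma> \<noteq> 0"
  using max by (auto simp: maximal_half_plane_classes_def active_def)

lemma finite_G: "finite G"
  by (rule finite_subset[OF _ finite_active[OF bps[of p0] fin unc]]) (use G_active in auto)

lemma Z_additive: "Modules.additive (Z p)"
  using bps by (auto simp: bps_structure_def)

lemma form_additive: "Modules.additive (form x)"
  using bps by (auto simp: bps_structure_def skew_form_def)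

lemma skew: "form x y = - form y x"
  by (rule form_skew[OF bps[of p0] fin unc])

definition dom_t :: "'m \<Rightarrow> complex set" where
  "dom_t p = {t. t \<noteq> 0 \<and> (\<forall>\<gamma>\<in>G. Re (Z p \<gamma> / t) > 0)}"

lemma tau_domain_iff: "(t, p) \<in> tau_domain Z l G \<longleftrightarrow> (\<forall>\<gamma>\<in>G. Z p \<gamma> \<in> half_plane l) \<and> t \<in> dom_t p"
  by (auto simp: tau_domain_def dom_t_def)

text \<open>Maximality at p0 puts every active class or its negative into G. If G still lies in the
  half-plane at another p, the negatives cannot, so products over the half-plane run over G at each
  such p.\<close>

lemma half_plane_classes:
  assumes "\<forall>\<gamma>\<in>G. Z p \<gamma> \<in> half_plane l"
  shows "{\<gamma>. \<Omega> \<gamma> \<noteq> 0 \<and> Z p \<gamma> \<in> half_plane l} = G"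
proof -
  obtain u where u: "u \<noteq> 0" "\<And>z. z \<in> half_plane l \<longleftrightarrow> Im (z / u) > 0" using ray by (auto elim: is_rayE)
  have "\<gamma> \<in> G" if \<gamma>: "\<Omega> \<gamma> \<noteq> 0" "Z p \<gamma> \<in> half_plane l" for \<gamma>
  proof (rule ccontr)
    assume "\<gamma> \<notin> G"
    hence "- \<gamma> \<in> G" using maximal_half_plane_cover[OF bps fin unc max \<gamma>(1)] by blast
    hence "Im (Z p (- \<gamma>) / u) > 0" using assms u(2) by blast
    hence "Im (Z p \<gamma> / u) < 0" by (simp add: Z_minus[OF bps fin unc])
    thus False using \<gamma>(2) u(2) by auto
  qed
  thus ?thesis using assms G_active by blast
qed

lemma open_dom_t: "open_sector (dom_t p)"
proof -
  have "dom_t p = {t. t \<noteq> 0 \<and> (\<forall>z\<in>Z p ` G. Re (z / t) > 0)}" by (auto simp: dom_t_def)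
  thus ?thesis using open_sector_Re_pos[of "Z p ` G"] finite_G by simp
qed

lemma dom_t_nonempty:
  assumes "\<forall>\<gamma>\<in>G. Z p \<gamma> \<in> half_plane l"
  shows "dom_t p \<noteq> {}"
proof -
  obtain u where u: "u \<noteq> 0" "\<And>z. z \<in> half_plane l \<longleftrightarrow> Im (z / u) > 0" using ray by (auto elim: is_rayE)
  \<comment> \<open>The direction i u is the centre of the half-plane, and Re (z / (i u)) is the
    imaginary part that defines it.\<close>
  have "Re (z / (\<i> * u)) = Im (z / u)" for z
  proof -
    have 1: "z / (\<i> * u) = - \<i> * (z / u)" using u(1) by (simp add: field_simps)
    have 2: "Re (- \<i> * w) = Im w" for w by simp
    show ?thesis unfolding 1 by (rule 2)
  qed
  hence "\<i> * u \<in> dom_t p" unfolding dom_t_def using u assms by auto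
  thus ?thesis by blast
qed

lemma Z_p0: "\<forall>\<gamma>\<in>G. Z p0 \<gamma> \<in> half_plane l"
  using max by (auto simp: maximal_half_plane_classes_def)

lemma Lambda_slit: "Re x > 0 \<Longrightarrow> x \<notin> \<real>\<^sub>\<le>\<^sub>0"
  by (auto simp: complex_nonpos_Reals_iff)

definition dlnL :: "complex \<Rightarrow> complex" where "dlnL x = Digamma x - Ln x + 1 / (2 * x)"

text \<open>The constants combine as 4 pi^2 / (2 pi) = 2 pi for each class.\<close>

lemma oscillator_tau_term_sums:
  assumes t: "t \<in> dom_t p"
  shows "(\<lambda>m. oscillator_tau_term (Z p) \<Omega> G hbar t (Suc m)) sums
     (of_real hbar * (\<Sum>\<gamma>\<in>G. of_rat (\<Omega> \<gamma>) * (2 * of_real pi) * (of_real (ln (2 * pi) / 12) - ln_Upsilon (Z p \<gamma> / t))))"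
proof -
  have t0: "t \<noteq> 0" using t by (simp add: dom_t_def)
  have G': "{\<gamma> \<in> G. \<Omega> \<gamma> \<noteq> 0} = G" using G_active by auto
  have "(\<lambda>m. log_oscillator_tau (Z p) \<Omega> hbar (Suc m) \<gamma> (1 / (2 * of_real pi) * \<i> * t)) sums
     (of_rat (\<Omega> \<gamma>) / (2 * of_real pi) * of_real hbar * (4 * of_real pi ^ 2 * (of_real (ln (2 * pi) / 12) - ln_Upsilon (Z p \<gamma> / t))))"
    if \<gamma>: "\<gamma> \<in> G" for \<gamma>
  proof -
    have x: "Re (Z p \<gamma> / t) > 0" using t \<gamma> by (simp add: dom_t_def)
    have "1 / (2 * of_real pi) * \<i> * t / \<i> = t / (2 * of_real pi)" by simp
    moreover have "Z p \<gamma> / (t / (2 * of_real pi)) = 2 * of_real pi * (Z p \<gamma> / t)" by simp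
    ultimately show ?thesis
      unfolding log_oscillator_tau_def Let_def by (simp only:) (rule sums_mult[OF oscillator_tau_sums[OF x]])
  qed
  hence "(\<lambda>m. oscillator_tau_term (Z p) \<Omega> G hbar t (Suc m)) sums
     (\<Sum>\<gamma>\<in>G. of_rat (\<Omega> \<gamma>) / (2 * of_real pi) * of_real hbar * (4 * of_real pi ^ 2 * (of_real (ln (2 * pi) / 12) - ln_Upsilon (Z p \<gamma> / t))))"
    unfolding oscillator_tau_term_def G' by (rule sums_sum)
  also have "(\<Sum>\<gamma>\<in>G. of_rat (\<Omega> \<gamma>) / (2 * of_real pi) * of_real hbar * (4 * of_real pi ^ 2 * (of_real (ln (2 * pi) / 12) - ln_Upsilon (Z p \<gamma> / t)))) =
     of_real hbar * (\<Sum>\<gamma>\<in>G. of_rat (\<Omega> \<gamma>) * (2 * of_real pi) * (of_real (ln (2 * pi) / 12) - ln_Upsilon (Z p \<gamma> / t)))"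
    unfolding sum_distrib_left
  proof (rule sum.cong[OF refl])
    fix \<gamma>
    have "w / (2 * of_real pi) * of_real hbar * (4 * of_real pi ^ 2 * y) = of_real hbar * (w * (2 * of_real pi) * y)" for w y :: complex
      by (simp add: power2_eq_square)
    thus "of_rat (\<Omega> \<gamma>) / (2 * of_real pi) * of_real hbar * (4 * of_real pi ^ 2 * (of_real (ln (2 * pi) / 12) - ln_Upsilon (Z p \<gamma> / t))) =
       of_real hbar * (of_rat (\<Omega> \<gamma>) * (2 * of_real pi) * (of_real (ln (2 * pi) / 12) - ln_Upsilon (Z p \<gamma> / t)))" .
  qed
  finally show ?thesis .
qed

text \<open>In the integral case this is a logarithm of \<open>tau_product\<close>; it also makes
  sense for rational \<Omega>, as needed for the statement modulo hbar.\<close>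

definition tau_exp :: "'m \<Rightarrow> complex \<Rightarrow> complex" where
  "tau_exp p t = (\<Sum>\<gamma>\<in>G. of_rat (\<Omega> \<gamma>) * ln_Upsilon (Z p \<gamma> / t))"

text \<open>The prefactor 1 / hbar cancels exactly, so the tau function built from the oscillators
  does not depend on hbar.\<close>

lemma oscillator_tau_exponent_eq:
  assumes "t \<in> dom_t p" "hbar > 0"
  shows "oscillator_tau_exponent (Z p) \<Omega> G hbar t =
    2 * of_real pi * (of_real (ln (2 * pi) / 12) * (\<Sum>\<gamma>\<in>G. of_rat (\<Omega> \<gamma>)) - tau_exp p t)"
proof -
  have "oscillator_tau_exponent (Z p) \<Omega> G hbar t =
     (\<Sum>\<gamma>\<in>G. of_rat (\<Omega> \<gamma>) * (2 * of_real pi) * (of_real (ln (2 * pi) / 12) - ln_Upsilon (Z p \<gamma> / t)))"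
    unfolding oscillator_tau_exponent_def sums_unique[OF oscillator_tau_term_sums[OF assms(1)], symmetric]
    using assms(2) by simp
  also have "\<dots> = 2 * of_real pi * (of_real (ln (2 * pi) / 12) * (\<Sum>\<gamma>\<in>G. of_rat (\<Omega> \<gamma>)) - tau_exp p t)"
    unfolding tau_exp_def sum_distrib_left sum_subtractf[symmetric] by (rule sum.cong) (simp_all only: right_diff_distrib mult_ac)
  finally show ?thesis .
qed

lemma tau_exp_rescale:
  assumes "t' = c * t" "t' \<noteq> 0" "\<forall>j. Z p' (\<beta> j) = c * Z p (\<beta> j)"
  shows "tau_exp p' t' = tau_exp p t"
proof -
  have "Z p' \<gamma> = c * Z p \<gamma>" for \<gamma>
    unfolding additive_expansion[OF basis Z_additive, of _ \<gamma>] using assms(3) by (simp add: sum_distrib_left mult.left_commute)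
  thus ?thesis using assms(1,2) by (simp add: tau_exp_def)
qed

abbreviation shift :: "'m \<Rightarrow> 'n \<Rightarrow> int ^ 'n \<Rightarrow> complex \<Rightarrow> complex" where
  "shift p q \<gamma> h \<equiv> Z p \<gamma> + of_int (lattice_coeff \<beta> \<gamma> q) * h"

text \<open>Membership amounts to finitely many open conditions on the Z \<gamma>. It has to persist
  along the q-th coordinate because the formulas for the tau functions hold on the domain.\<close>

lemma near_tau_domain:
  assumes D: "(t, p) \<in> tau_domain Z l G"
  obtains e where "e > 0" "\<And>h p'. norm h < e \<Longrightarrow> (\<And>\<gamma>. Z p' \<gamma> = shift p q \<gamma> h) \<Longrightarrow> (t, p') \<in> tau_domain Z l G"
proof -
  have t0: "t \<noteq> 0" using D by (simp add: tau_domain_def)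
  define A where "A = {h. \<forall>\<gamma>\<in>G. shift p q \<gamma> h \<in> half_plane l \<and> Re ((shift p q \<gamma> h) / t) > 0}"
  have o1: "open {h. shift p q \<gamma> h \<in> half_plane l}" for \<gamma>
  proof -
    have "open ((\<lambda>h. shift p q \<gamma> h) -` half_plane l)"
      by (intro open_vimage open_half_plane ray continuous_intros)
    thus ?thesis by (simp add: vimage_def)
  qed
  have o2: "open {h. Re ((shift p q \<gamma> h) / t) > 0}" for \<gamma>
    by (intro open_Collect_less continuous_intros) (use t0 in auto)
  have "open (\<Inter>\<gamma>\<in>G. {h. shift p q \<gamma> h \<in> half_plane l} \<inter>
      {h. Re ((shift p q \<gamma> h) / t) > 0})"
    by (intro open_INT finite_G ballI open_Int o1 o2)
  also have "(\<Inter>\<gamma>\<in>G. {h. shift p q \<gamma> h \<in> half_plane l} \<inter>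
      {h. Re ((shift p q \<gamma> h) / t) > 0}) = A"
    by (auto simp: A_def)
  finally have "open A" .
  moreover have "0 \<in> A" using D by (simp add: A_def tau_domain_def)
  ultimately obtain e where e: "e > 0" "ball 0 e \<subseteq> A" by (metis openE)
  show ?thesis
  proof (rule that[OF e(1)])
    fix h p' assume h: "norm h < e" and Z: "\<And>\<gamma>. Z p' \<gamma> = shift p q \<gamma> h"
    hence "h \<in> A" using e(2) by auto
    thus "(t, p') \<in> tau_domain Z l G" using t0 by (simp add: A_def tau_domain_def Z)
  qed
qed

text \<open>The derivative of \<open>tau_exp\<close> along the q-th period coordinate:
  \<open>x * dlnL x\<close> is the derivative of \<open>ln_Upsilon\<close>, and x = Z \<gamma> / t
  varies with rate coefficient over t.\<close>

definition dtau :: "complex \<Rightarrow> 'm \<Rightarrow> 'n \<Rightarrow> complex" where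
  "dtau t p q = (\<Sum>\<gamma>\<in>G. of_rat (\<Omega> \<gamma>) * (of_int (lattice_coeff \<beta> \<gamma> q) * (Z p \<gamma> / t * dlnL (Z p \<gamma> / t) / t)))"

text \<open>\<open>A\<close> and \<open>B\<close> cover both normalisations: B = 1 for the product
  of Upsilon functions, and B = - 2 pi / (2 pi i) = i for the oscillators.\<close>

lemma coord_derivative_exp_tau:
  assumes D: "(t, p) \<in> tau_domain Z l G"
    and f: "\<And>p'. (t, p') \<in> tau_domain Z l G \<Longrightarrow> f p' = exp (A + B * tau_exp p' t)"
  shows "has_coord_derivative Z \<beta> q f (B * dtau t p q * f p) p"
proof -
  obtain e where e: "e > 0" "\<And>h p'. norm h < e \<Longrightarrow> (\<And>\<gamma>. Z p' \<gamma> = shift p q \<gamma> h) \<Longrightarrow> (t, p') \<in> tau_domain Z l G"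
    by (rule near_tau_domain[OF D]) blast
  obtain U where U: "p \<in> U" "is_chart U (period_coords Z \<beta>)" using charts by blast
  define g where "g h = exp (A + B * (\<Sum>\<gamma>\<in>G. of_rat (\<Omega> \<gamma>) * ln_Upsilon ((shift p q \<gamma> h) / t)))" for h
  have t0: "t \<noteq> 0" and x: "\<And>\<gamma>. \<gamma> \<in> G \<Longrightarrow> Re (Z p \<gamma> / t) > 0" using D by (auto simp: tau_domain_def)
  have u: "((\<lambda>h. ln_Upsilon ((shift p q \<gamma> h) / t)) has_field_derivative
      of_int (lattice_coeff \<beta> \<gamma> q) * (Z p \<gamma> / t * dlnL (Z p \<gamma> / t) / t)) (at 0)" if "\<gamma> \<in> G" for \<gamma>
  proof -
    have "((\<lambda>h. (shift p q \<gamma> h) / t) has_field_derivative of_int (lattice_coeff \<beta> \<gamma> q) / t) (at 0)"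
      using t0 by (auto intro!: derivative_eq_intros)
    from DERIV_chain2[where g="\<lambda>h. (shift p q \<gamma> h) / t", OF _ this,
        of ln_Upsilon "Z p \<gamma> / t * dlnL (Z p \<gamma> / t)"] ln_Upsilon_deriv[OF x[OF that]]
    show ?thesis by (simp add: dlnL_def mult_ac)
  qed
  have "((\<lambda>h. A + B * (\<Sum>\<gamma>\<in>G. of_rat (\<Omega> \<gamma>) * ln_Upsilon ((shift p q \<gamma> h) / t))) has_field_derivative
      0 + B * dtau t p q) (at 0)"
    unfolding dtau_def by (intro DERIV_add DERIV_const DERIV_cmult DERIV_sum u)
  from DERIV_fun_exp[OF this] have g: "(g has_field_derivative g 0 * (B * dtau t p q)) (at 0)"
    unfolding g_def by simp
  have "f p = g 0" using f[OF D] by (simp add: g_def tau_exp_def)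
  hence "B * dtau t p q * f p = g 0 * (B * dtau t p q)" by simp
  moreover have "has_coord_derivative Z \<beta> q f (g 0 * (B * dtau t p q)) p"
  proof (rule has_coord_derivativeI[OF basis Z_additive U g e(1)])
    fix h p' assume h: "norm h < e" "\<And>\<gamma>. Z p' \<gamma> = shift p q \<gamma> h"
    show "f p' = g h" unfolding f[OF e(2)[OF h]] g_def tau_exp_def h(2) ..
  qed
  ultimately show ?thesis by (simp only:)
qed

text \<open>In the integral case a logarithm of 1 / \<open>Psi_product\<close>; the inversion is
  expressed by the order of the arguments of \<open>form\<close>.\<close>

definition lnPsi :: "int ^ 'n \<Rightarrow> 'm \<Rightarrow> complex \<Rightarrow> complex" where
  "lnPsi b p t = (\<Sum>\<gamma>\<in>G. of_rat (\<Omega> \<gamma>) * of_int (form \<gamma> b) * ln_Lambda (Z p \<gamma> / t))"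

text \<open>The tau equation in logarithmic form. The sign from d/dt of Z \<gamma> / t and the one
  from skewness cancel, and expanding \<gamma> in the basis turns the pairing with \<gamma> into the
  sum over q.\<close>

lemma lnPsi_deriv:
  assumes "t \<in> dom_t p"
  shows "(lnPsi (\<beta> j) p has_field_derivative (\<Sum>q\<in>UNIV. of_int (form (\<beta> j) (\<beta> q)) * dtau t p q)) (at t)"
proof -
  have t0: "t \<noteq> 0" and x: "\<And>\<gamma>. \<gamma> \<in> G \<Longrightarrow> Re (Z p \<gamma> / t) > 0" using assms by (auto simp: dom_t_def)
  define y where "y \<gamma> = Z p \<gamma> / t * dlnL (Z p \<gamma> / t) / t" for \<gamma>
  have L: "((\<lambda>t. ln_Lambda (Z p \<gamma> / t)) has_field_derivative - y \<gamma>) (at t)" if "\<gamma> \<in> G" for \<gamma>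
  proof -
    have "((\<lambda>t. Z p \<gamma> / t) has_field_derivative - (Z p \<gamma> / t / t)) (at t)"
      using t0 by (auto intro!: derivative_eq_intros)
    from DERIV_chain2[where g="\<lambda>t. Z p \<gamma> / t", OF _ this, of ln_Lambda "dlnL (Z p \<gamma> / t)"] ln_Lambda_deriv[OF Lambda_slit[OF x[OF that]]]
    show ?thesis by (simp add: dlnL_def y_def mult_ac)
  qed
  have "(lnPsi (\<beta> j) p has_field_derivative (\<Sum>\<gamma>\<in>G. of_rat (\<Omega> \<gamma>) * of_int (form \<gamma> (\<beta> j)) * - y \<gamma>)) (at t)"
    unfolding lnPsi_def[abs_def] by (intro DERIV_sum DERIV_cmult L)
  also have "(\<Sum>\<gamma>\<in>G. of_rat (\<Omega> \<gamma>) * of_int (form \<gamma> (\<beta> j)) * - y \<gamma>) =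
      (\<Sum>\<gamma>\<in>G. \<Sum>q\<in>UNIV. of_int (form (\<beta> j) (\<beta> q)) * (of_rat (\<Omega> \<gamma>) * (of_int (lattice_coeff \<beta> \<gamma> q) * y \<gamma>)))"
  proof (rule sum.cong[OF refl])
    fix \<gamma>
    have "form \<gamma> (\<beta> j) = - form (\<beta> j) \<gamma>" by (rule skew)
    also have "form (\<beta> j) \<gamma> = (\<Sum>q\<in>UNIV. lattice_coeff \<beta> \<gamma> q * form (\<beta> j) (\<beta> q))"
      using additive_expansion[OF basis form_additive, of "\<beta> j" \<gamma>] by simp
    finally have "complex_of_int (form \<gamma> (\<beta> j)) = - (\<Sum>q\<in>UNIV. of_int (lattice_coeff \<beta> \<gamma> q) * of_int (form (\<beta> j) (\<beta> q)))" by simp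
    hence "of_rat (\<Omega> \<gamma>) * of_int (form \<gamma> (\<beta> j)) * - y \<gamma> =
       (\<Sum>q\<in>UNIV. of_int (lattice_coeff \<beta> \<gamma> q) * of_int (form (\<beta> j) (\<beta> q))) * (of_rat (\<Omega> \<gamma>) * y \<gamma>)"
      by simp
    thus "of_rat (\<Omega> \<gamma>) * of_int (form \<gamma> (\<beta> j)) * - y \<gamma> =
      (\<Sum>q\<in>UNIV. of_int (form (\<beta> j) (\<beta> q)) * (of_rat (\<Omega> \<gamma>) * (of_int (lattice_coeff \<beta> \<gamma> q) * y \<gamma>)))"
      unfolding sum_distrib_right by (simp only: mult_ac)
  qed
  also have "\<dots> = (\<Sum>q\<in>UNIV. of_int (form (\<beta> j) (\<beta> q)) * dtau t p q)"
    unfolding dtau_def y_def sum_distrib_left by (rule sum.swap)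
  finally show ?thesis .
qed

text \<open>The power of -1 in the oscillator matrix and the one in the exponent are the same sign,
  as \<open>osc_term\<close> expects.\<close>

lemma oscillator_term_eq:
  assumes t: "t \<in> dom_t p"
  shows "oscillator_term form (Z p) \<Omega> G hbar b t (Suc m) =
    (\<Sum>\<gamma> | \<gamma> \<in> G \<and> form \<gamma> b \<noteq> 0.
      osc_term (\<lambda>m. (- 1) powi (int (Suc m) * form \<gamma> b)) (of_int (form \<gamma> b) / (2 * pi) * of_rat (\<Omega> \<gamma>) * hbar) m (Z p \<gamma> / t))"
  unfolding oscillator_term_def
proof (rule sum.cong[OF refl])
  fix \<gamma> assume "\<gamma> \<in> {\<gamma>. \<gamma> \<in> G \<and> form \<gamma> b \<noteq> 0}"
  hence \<gamma>: "\<gamma> \<in> G" by simp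
  have t0: "t \<noteq> 0" and x: "Re (Z p \<gamma> / t) > 0" using t \<gamma> by (auto simp: dom_t_def)
  have z0: "Z p \<gamma> \<noteq> 0" using x by auto
  define \<epsilon> :: real where "\<epsilon> = (- 1) powi (int (Suc m) * form \<gamma> b)"
  have \<epsilon>: "complex_of_real \<epsilon> = (- 1) powi (int (Suc m) * form \<gamma> b)" by (simp add: \<epsilon>_def)
  have "1 / (2 * of_real pi) * \<i> * t / Z p \<gamma> = \<i> / (of_real (2 * pi) * (Z p \<gamma> / t))" using t0 z0 by simp
  hence im: "Im (1 / (2 * of_real pi) * \<i> * t / Z p \<gamma>) > 0" using osc_point(3)[OF x, of "2 * pi"] by simp
  have v: "1 / (2 * of_real pi) * \<i> * t / (of_nat (Suc m) * Z p \<gamma>) = \<i> / (of_real (freq m) * (Z p \<gamma> / t))"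
    using t0 z0 by (simp del: of_nat_Suc)
  have c: "of_int (form \<gamma> b) * hbar / (2 * pi) * of_rat (\<Omega> \<gamma>) * \<epsilon> =
     of_int (form \<gamma> b) / (2 * pi) * of_rat (\<Omega> \<gamma>) * hbar * \<epsilon>" by simp
  show "(- 1) powi (int (Suc m) * form \<gamma> b) / of_nat (Suc m) *
      coord_sum (mat_log (simple_oscillator form (Z p) \<Omega> hbar (Suc m) \<gamma> b (1 / (2 * of_real pi) * \<i> * t)) *v xi_hat) =
     osc_term (\<lambda>m. (- 1) powi (int (Suc m) * form \<gamma> b)) (of_int (form \<gamma> b) / (2 * pi) * of_rat (\<Omega> \<gamma>) * hbar) m (Z p \<gamma> / t)"
    unfolding coord_sum_xi_hat simple_oscillator_eq[where Z="Z p", OF Z_add[OF bps fin unc] z0 zero_less_Suc im] c v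
      osc_term_def osc_log_def \<epsilon>_def[symmetric] \<epsilon>[symmetric] ..
qed

lemma lnPsi_altdef:
  "lnPsi b p t = (\<Sum>\<gamma> | \<gamma> \<in> G \<and> form \<gamma> b \<noteq> 0. of_rat (\<Omega> \<gamma>) * of_int (form \<gamma> b) * ln_Lambda (Z p \<gamma> / t))"
  unfolding lnPsi_def by (rule sum.mono_neutral_right) (use finite_G in auto)

text \<open>The full exponent is controlled on a closed disc around t, so that its derivative at t
  can be estimated; the partial sums are compared at t only, but uniformly in N.\<close>

lemma oscillator_exponent_estimate:
  assumes t: "t \<in> dom_t p"
  obtains r C h0 where "r > 0" "C > 0" "h0 > 0" "cball t r \<subseteq> dom_t p"
    "\<And>hbar s. 0 < hbar \<Longrightarrow> hbar \<le> h0 \<Longrightarrow> s \<in> cball t r \<Longrightarrow>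
       summable (\<lambda>m. oscillator_term form (Z p) \<Omega> G hbar b s (Suc m)) \<and>
       norm (oscillator_exponent form (Z p) \<Omega> G hbar b s - \<i> * lnPsi b p s) \<le> C * hbar"
    "\<And>hbar. 0 < hbar \<Longrightarrow> hbar \<le> h0 \<Longrightarrow> oscillator_exponent form (Z p) \<Omega> G hbar b holomorphic_on ball t r"
    "\<And>hbar. 0 < hbar \<Longrightarrow> hbar \<le> h0 \<Longrightarrow> continuous_on (cball t r) (oscillator_exponent form (Z p) \<Omega> G hbar b)"
    "\<And>hbar N. 0 < hbar \<Longrightarrow> hbar \<le> h0 \<Longrightarrow>
       norm (partial_oscillator_exponent form (Z p) \<Omega> G N hbar b t -
         (\<Sum>\<gamma> | \<gamma> \<in> G \<and> form \<gamma> b \<noteq> 0. of_real (of_int (form \<gamma> b) / (2 * pi) * of_rat (\<Omega> \<gamma>)) * osc_partial N (Z p \<gamma> / t))) \<le> C * hbar"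
proof -
  have t0: "t \<noteq> 0" and x: "\<And>\<gamma>. \<gamma> \<in> G \<Longrightarrow> Re (Z p \<gamma> / t) > 0" using t by (auto simp: dom_t_def)
  have "\<forall>\<^sub>F a in at_right (0::real). \<forall>\<gamma>\<in>G. a < Re (Z p \<gamma> / t)"
    by (rule eventually_ball_finite[OF finite_G]) (use x in \<open>auto intro!: order_tendstoD(2)[OF tendsto_ident_at]\<close>)
  hence "\<forall>\<^sub>F a in at_right (0::real). a > 0 \<and> (\<forall>\<gamma>\<in>G. a < Re (Z p \<gamma> / t))"
    using eventually_at_right_less by eventually_elim blast
  then obtain a where a: "a > 0" "\<And>\<gamma>. \<gamma> \<in> G \<Longrightarrow> a < Re (Z p \<gamma> / t)"
    by (metis (no_types, lifting) eventually_happens trivial_limit_at_right_real)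
  \<comment> \<open>The strict bounds a and bd on x = Z \<gamma> / t persist for nearby values of t,
    which yields a disc on which the estimates of the series apply.\<close>
  define bd where "bd = (\<Sum>\<gamma>\<in>G. norm (Z p \<gamma> / t)) + 1"
  have bd0: "bd > 0" unfolding bd_def by (intro add_nonneg_pos sum_nonneg) auto
  have bd: "norm (Z p \<gamma> / t) < bd" if "\<gamma> \<in> G" for \<gamma>
    using member_le_sum[OF that, of "\<lambda>\<gamma>. norm (Z p \<gamma> / t)"] finite_G unfolding bd_def by force
  define W where "W = (- {0}) \<inter> (\<Inter>\<gamma>\<in>G. {s \<in> - {0}. a < Re (Z p \<gamma> / s) \<and> norm (Z p \<gamma> / s) < bd})"
  have "open {s \<in> - {0}. a < Re (Z p \<gamma> / s) \<and> norm (Z p \<gamma> / s) < bd}" for \<gamma>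
  proof -
    have "open ((- {0}) \<inter> (\<lambda>s. Z p \<gamma> / s) -` ({z. a < Re z} \<inter> {z. norm z < bd}))"
      by (rule continuous_open_preimage)
         (auto intro!: continuous_intros open_Int open_halfspace_Re_gt open_Collect_less)
    also have "(- {0}) \<inter> (\<lambda>s. Z p \<gamma> / s) -` ({z. a < Re z} \<inter> {z. norm z < bd}) = {s \<in> - {0}. a < Re (Z p \<gamma> / s) \<and> norm (Z p \<gamma> / s) < bd}"
      by auto
    finally show ?thesis .
  qed
  hence "open W" unfolding W_def by (intro open_Int open_INT finite_G ballI) auto
  moreover have "t \<in> W" using t0 a bd by (auto simp: W_def)
  ultimately obtain r where r: "r > 0" "cball t r \<subseteq> W" using open_contains_cball by blast
  have in_O: "s \<noteq> 0" "\<And>\<gamma>. \<gamma> \<in> G \<Longrightarrow> a < Re (Z p \<gamma> / s)" "\<And>\<gamma>. \<gamma> \<in> G \<Longrightarrow> norm (Z p \<gamma> / s) < bd" if "s \<in> cball t r" for s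
    using r(2) that by (auto simp: W_def)
  have sub: "cball t r \<subseteq> dom_t p"
  proof
    fix s assume s: "s \<in> cball t r"
    have "Re (Z p \<gamma> / s) > 0" if "\<gamma> \<in> G" for \<gamma> using in_O(2)[OF s that] a(1) by linarith
    thus "s \<in> dom_t p" using in_O(1)[OF s] by (simp add: dom_t_def)
  qed
  obtain C h1 where C: "C > 0" "0 < h1"
    "\<And>\<epsilon> h x. signs \<epsilon> \<Longrightarrow> \<bar>h\<bar> \<le> h1 \<Longrightarrow> a < Re x \<Longrightarrow> norm x < bd \<Longrightarrow>
       summable (\<lambda>m. osc_term \<epsilon> h m x) \<and>
       norm (osc_full \<epsilon> h x - of_real h * (2 * of_real pi * \<i> * ln_Lambda x)) \<le> C * h\<^sup>2"
    "\<And>\<epsilon> h x N. signs \<epsilon> \<Longrightarrow> \<bar>h\<bar> \<le> h1 \<Longrightarrow> a < Re x \<Longrightarrow> norm x < bd \<Longrightarrow>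
       norm ((\<Sum>m<N. osc_term \<epsilon> h m x) - of_real h * osc_partial N x) \<le> C * h\<^sup>2"
    "\<And>\<epsilon> h. signs \<epsilon> \<Longrightarrow> \<bar>h\<bar> \<le> h1 \<Longrightarrow> osc_full \<epsilon> h holomorphic_on {x. a < Re x \<and> norm x < bd}"
    by (rule osc_series[OF a(1) bd0]) blast
  define G' where "G' = {\<gamma>. \<gamma> \<in> G \<and> form \<gamma> b \<noteq> 0}"
  have G': "finite G'" "\<And>\<gamma>. \<gamma> \<in> G' \<Longrightarrow> \<gamma> \<in> G" using finite_G by (auto simp: G'_def)
  define \<epsilon> :: "int ^ 'n \<Rightarrow> nat \<Rightarrow> real" where "\<epsilon> \<gamma> m = (- 1) powi (int (Suc m) * form \<gamma> b)" for \<gamma> m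
  have \<epsilon>: "signs (\<epsilon> \<gamma>)" for \<gamma>
    unfolding \<epsilon>_def by (auto simp: power_int_minus_left)
  define \<kappa> where "\<kappa> \<gamma> = of_int (form \<gamma> b) / (2 * pi) * real_of_rat (\<Omega> \<gamma>)" for \<gamma>
  define K where "K = (\<Sum>\<gamma>\<in>G'. \<bar>\<kappa> \<gamma>\<bar>) + 1"
  have K0: "K > 0" unfolding K_def by (intro add_nonneg_pos sum_nonneg) auto
  have K: "\<bar>\<kappa> \<gamma>\<bar> \<le> K" if "\<gamma> \<in> G'" for \<gamma>
    using member_le_sum[OF that, of "\<lambda>\<gamma>. \<bar>\<kappa> \<gamma>\<bar>"] G'(1) unfolding K_def by force
  \<comment> \<open>K dominates the couplings of all classes, so hbar \<le> h1 / K brings each of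
    them below the threshold of the series.\<close>
  define h0 where "h0 = h1 / K"
  have h0: "h0 > 0" using C(2) K0 by (simp add: h0_def)
  have small: "\<bar>\<kappa> \<gamma> * hbar\<bar> \<le> h1" if "0 < hbar" "hbar \<le> h0" "\<gamma> \<in> G'" for \<gamma> hbar
  proof -
    have "\<bar>\<kappa> \<gamma> * hbar\<bar> \<le> K * h0" unfolding abs_mult using that K K0 by (intro mult_mono) auto
    thus ?thesis using K0 by (simp add: h0_def)
  qed
  \<comment> \<open>The errors are quadratic in \<kappa> hbar, and one power of hbar is spent on the
    prefactor 1 / hbar. The summand 1 makes the constant positive when no class contributes.\<close>
  define C' where "C' = C * (\<Sum>\<gamma>\<in>G'. (\<kappa> \<gamma>)\<^sup>2) + 1"
  have C'0: "C' > 0" unfolding C'_def using C(1) by (intro add_nonneg_pos mult_nonneg_nonneg sum_nonneg) auto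
  have sumC: "norm (1 / of_real hbar * (\<Sum>\<gamma>\<in>G'. F \<gamma>)) \<le> C' * hbar"
    if hb: "0 < hbar" and F: "\<And>\<gamma>. \<gamma> \<in> G' \<Longrightarrow> norm (F \<gamma>) \<le> C * (\<kappa> \<gamma> * hbar)\<^sup>2" for hbar and F :: "int ^ 'n \<Rightarrow> complex"
  proof -
    have "norm (\<Sum>\<gamma>\<in>G'. F \<gamma>) \<le> (\<Sum>\<gamma>\<in>G'. C * (\<kappa> \<gamma> * hbar)\<^sup>2)" by (rule order_trans[OF norm_sum sum_mono[OF F]])
    also have "\<dots> = C * (\<Sum>\<gamma>\<in>G'. (\<kappa> \<gamma>)\<^sup>2) * hbar\<^sup>2" by (simp add: sum_distrib_left sum_distrib_right power_mult_distrib mult.assoc)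
    also have "\<dots> \<le> C' * hbar\<^sup>2" by (intro mult_right_mono) (auto simp: C'_def)
    finally have "1 / hbar * norm (\<Sum>\<gamma>\<in>G'. F \<gamma>) \<le> 1 / hbar * (C' * hbar\<^sup>2)" using hb by (intro mult_left_mono) auto
    thus ?thesis using hb by (simp add: norm_mult norm_divide power2_eq_square)
  qed
  have T: "oscillator_term form (Z p) \<Omega> G hbar b s (Suc m) = (\<Sum>\<gamma>\<in>G'. osc_term (\<epsilon> \<gamma>) (\<kappa> \<gamma> * hbar) m (Z p \<gamma> / s))"
    if "s \<in> cball t r" for s m hbar
    using oscillator_term_eq[of s p hbar b m] sub that unfolding G'_def \<epsilon>_def \<kappa>_def by blast
  have est: "summable (\<lambda>m. osc_term (\<epsilon> \<gamma>) (\<kappa> \<gamma> * hbar) m (Z p \<gamma> / s))"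
    "norm (osc_full (\<epsilon> \<gamma>) (\<kappa> \<gamma> * hbar) (Z p \<gamma> / s) - of_real (\<kappa> \<gamma> * hbar) * (2 * of_real pi * \<i> * ln_Lambda (Z p \<gamma> / s))) \<le> C * (\<kappa> \<gamma> * hbar)\<^sup>2"
    "norm ((\<Sum>m<N. osc_term (\<epsilon> \<gamma>) (\<kappa> \<gamma> * hbar) m (Z p \<gamma> / s)) - of_real (\<kappa> \<gamma> * hbar) * osc_partial N (Z p \<gamma> / s)) \<le> C * (\<kappa> \<gamma> * hbar)\<^sup>2"
    if "0 < hbar" "hbar \<le> h0" "s \<in> cball t r" "\<gamma> \<in> G'" for hbar s \<gamma> N
    using C(3)[of "\<epsilon> \<gamma>" "\<kappa> \<gamma> * hbar" "Z p \<gamma> / s", OF \<epsilon> small[OF that(1,2,4)] in_O(2)[OF that(3) G'(2)[OF that(4)]] in_O(3)[OF that(3) G'(2)[OF that(4)]]]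
      C(4)[of "\<epsilon> \<gamma>" "\<kappa> \<gamma> * hbar" "Z p \<gamma> / s" N, OF \<epsilon> small[OF that(1,2,4)] in_O(2)[OF that(3) G'(2)[OF that(4)]] in_O(3)[OF that(3) G'(2)[OF that(4)]]]
    by auto
  have S: "(\<lambda>m. oscillator_term form (Z p) \<Omega> G hbar b s (Suc m)) sums (\<Sum>\<gamma>\<in>G'. osc_full (\<epsilon> \<gamma>) (\<kappa> \<gamma> * hbar) (Z p \<gamma> / s))"
    if "0 < hbar" "hbar \<le> h0" "s \<in> cball t r" for hbar s
    unfolding T[OF that(3)] osc_full_def by (intro sums_sum summable_sums est(1)[OF that])
  have E: "oscillator_exponent form (Z p) \<Omega> G hbar b s = 1 / of_real hbar * (\<Sum>\<gamma>\<in>G'. osc_full (\<epsilon> \<gamma>) (\<kappa> \<gamma> * hbar) (Z p \<gamma> / s))"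
    if "0 < hbar" "hbar \<le> h0" "s \<in> cball t r" for hbar s
    unfolding oscillator_exponent_def sums_unique[OF S[OF that], symmetric] ..
  have hol: "(\<lambda>s. 1 / of_real hbar * (\<Sum>\<gamma>\<in>G'. osc_full (\<epsilon> \<gamma>) (\<kappa> \<gamma> * hbar) (Z p \<gamma> / s))) holomorphic_on cball t r"
    if hb: "0 < hbar" "hbar \<le> h0" for hbar
  proof -
    have H: "(osc_full (\<epsilon> \<gamma>) (\<kappa> \<gamma> * hbar) \<circ> (\<lambda>s. Z p \<gamma> / s)) holomorphic_on cball t r" if "\<gamma> \<in> G'" for \<gamma>
    proof (rule holomorphic_on_compose_gen[OF _ C(5)[OF \<epsilon> small[OF hb that]]])
      show "(\<lambda>s. Z p \<gamma> / s) holomorphic_on cball t r" using in_O(1) by (intro holomorphic_intros) auto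
    qed (use in_O G'(2)[OF that] in auto)
    show ?thesis by (intro holomorphic_on_mult holomorphic_on_const holomorphic_on_sum H[unfolded comp_def])
  qed
  show ?thesis
  proof (rule that[OF r(1) C'0 h0 sub])
    fix hbar :: real assume hb: "0 < hbar" "hbar \<le> h0"
    show "continuous_on (cball t r) (oscillator_exponent form (Z p) \<Omega> G hbar b)"
      using holomorphic_on_imp_continuous_on[OF hol[OF hb]] by (rule continuous_on_eq) (simp add: E[OF hb])
    show "oscillator_exponent form (Z p) \<Omega> G hbar b holomorphic_on ball t r"
      using holomorphic_on_subset[OF hol[OF hb] ball_subset_cball] by (rule holomorphic_transform) (simp add: E[OF hb])
    show "norm (partial_oscillator_exponent form (Z p) \<Omega> G N hbar b t -
         (\<Sum>\<gamma> | \<gamma> \<in> G \<and> form \<gamma> b \<noteq> 0. of_real (of_int (form \<gamma> b) / (2 * pi) * of_rat (\<Omega> \<gamma>)) * osc_partial N (Z p \<gamma> / t))) \<le> C' * hbar" for N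
    proof -
      have tt: "t \<in> cball t r" using r(1) by simp
      have "(\<Sum>m=1..N. oscillator_term form (Z p) \<Omega> G hbar b t m) = (\<Sum>m<N. oscillator_term form (Z p) \<Omega> G hbar b t (Suc m))"
        by (simp add: sum.atLeast1_atMost_eq)
      also have "\<dots> = (\<Sum>\<gamma>\<in>G'. \<Sum>m<N. osc_term (\<epsilon> \<gamma>) (\<kappa> \<gamma> * hbar) m (Z p \<gamma> / t))"
        unfolding T[OF tt] by (rule sum.swap)
      finally have "partial_oscillator_exponent form (Z p) \<Omega> G N hbar b t - (\<Sum>\<gamma>\<in>G'. of_real (\<kappa> \<gamma>) * osc_partial N (Z p \<gamma> / t)) =
        1 / of_real hbar * (\<Sum>\<gamma>\<in>G'. (\<Sum>m<N. osc_term (\<epsilon> \<gamma>) (\<kappa> \<gamma> * hbar) m (Z p \<gamma> / t)) - of_real (\<kappa> \<gamma> * hbar) * osc_partial N (Z p \<gamma> / t))"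
        using hb(1) unfolding partial_oscillator_exponent_def sum_subtractf right_diff_distrib
        by (simp add: sum_distrib_left mult.assoc mult.left_commute[of _ "of_real hbar"])
      also have "norm \<dots> \<le> C' * hbar" by (rule sumC[OF hb(1)]) (rule est(3)[OF hb tt])
      finally show ?thesis unfolding G'_def \<kappa>_def .
    qed
    fix s assume s: "s \<in> cball t r"
    have "\<i> * lnPsi b p s = 1 / of_real hbar * (\<Sum>\<gamma>\<in>G'. of_real (\<kappa> \<gamma> * hbar) * (2 * of_real pi * \<i> * ln_Lambda (Z p \<gamma> / s)))"
      unfolding lnPsi_altdef G'_def[symmetric] sum_distrib_left
    proof (rule sum.cong[OF refl])
      fix \<gamma>
      have "complex_of_real (\<kappa> \<gamma>) * (2 * of_real pi) = of_rat (\<Omega> \<gamma>) * of_int (form \<gamma> b)"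
        by (simp add: \<kappa>_def of_real_of_rat)
      thus "\<i> * (of_rat (\<Omega> \<gamma>) * of_int (form \<gamma> b) * ln_Lambda (Z p \<gamma> / s)) =
          1 / of_real hbar * (of_real (\<kappa> \<gamma> * hbar) * (2 * of_real pi * \<i> * ln_Lambda (Z p \<gamma> / s)))"
        using hb(1) by (simp add: mult_ac)
    qed
    hence "oscillator_exponent form (Z p) \<Omega> G hbar b s - \<i> * lnPsi b p s =
      1 / of_real hbar * (\<Sum>\<gamma>\<in>G'. osc_full (\<epsilon> \<gamma>) (\<kappa> \<gamma> * hbar) (Z p \<gamma> / s) - of_real (\<kappa> \<gamma> * hbar) * (2 * of_real pi * \<i> * ln_Lambda (Z p \<gamma> / s)))"
      unfolding E[OF hb s] sum_subtractf by (simp only: right_diff_distrib)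
    also have "norm \<dots> \<le> C' * hbar" by (rule sumC[OF hb(1)]) (rule est(2)[OF hb s])
    finally show "summable (\<lambda>m. oscillator_term form (Z p) \<Omega> G hbar b s (Suc m)) \<and>
       norm (oscillator_exponent form (Z p) \<Omega> G hbar b s - \<i> * lnPsi b p s) \<le> C' * hbar"
      using S[OF hb s] by (auto simp: sums_iff)
  qed
qed

lemma exp_tau_exponent:
  assumes "(t, p) \<in> tau_domain Z l G" "hbar > 0"
  shows "exp (c * oscillator_tau_exponent (Z p) \<Omega> G hbar t) =
    exp (c * (2 * of_real pi * (of_real (ln (2 * pi) / 12) * (\<Sum>\<gamma>\<in>G. of_rat (\<Omega> \<gamma>)))) + (- (c * (2 * of_real pi))) * tau_exp p t)"
proof -
  have t: "t \<in> dom_t p" using assms(1) by (simp add: tau_domain_iff)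
  have "c * (2 * of_real pi * (K - T)) = c * (2 * of_real pi * K) + (- (c * (2 * of_real pi))) * T" for K T :: complex
    by (simp add: algebra_simps)
  thus ?thesis unfolding oscillator_tau_exponent_eq[OF t assms(2)] by (simp only:)
qed

lemma tau_product_eq:
  assumes "integral_bps \<Omega>" "(t, p) \<in> tau_domain Z l G"
  shows "tau_product (Z p) \<Omega> l t = exp (tau_exp p t)"
proof -
  have D: "\<forall>\<gamma>\<in>G. Z p \<gamma> \<in> half_plane l" "t \<in> dom_t p" using assms(2) by (simp_all add: tau_domain_iff)
  have "tau_product (Z p) \<Omega> l t = (\<Prod>\<gamma>\<in>G. Upsilon_fun (Z p \<gamma> / t) powi \<lfloor>\<Omega> \<gamma>\<rfloor>)"
    unfolding tau_product_def half_plane_classes[OF D(1)] ..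
  also have "\<dots> = (\<Prod>\<gamma>\<in>G. exp (of_rat (\<Omega> \<gamma>) * ln_Upsilon (Z p \<gamma> / t)))"
  proof (rule prod.cong[OF refl])
    fix \<gamma> assume "\<gamma> \<in> G"
    hence x: "Re (Z p \<gamma> / t) > 0" using D(2) by (simp add: dom_t_def)
    have "\<Omega> \<gamma> = of_int \<lfloor>\<Omega> \<gamma>\<rfloor>" using assms(1) by (auto simp: integral_bps_def elim!: Ints_cases)
    hence "complex_of_rat (\<Omega> \<gamma>) = of_int \<lfloor>\<Omega> \<gamma>\<rfloor>" by (metis of_rat_of_int_eq)
    thus "Upsilon_fun (Z p \<gamma> / t) powi \<lfloor>\<Omega> \<gamma>\<rfloor> = exp (of_rat (\<Omega> \<gamma>) * ln_Upsilon (Z p \<gamma> / t))"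
      unfolding exp_ln_Upsilon[OF x, symmetric] exp_power_int by simp
  qed
  also have "\<dots> = exp (tau_exp p t)" unfolding tau_exp_def by (rule exp_sum[OF finite_G, symmetric])
  finally show ?thesis .
qed

lemma Psi_product_eq:
  assumes "integral_bps \<Omega>" "(t, p) \<in> tau_domain Z l G"
  shows "1 / Psi_product form (Z p) \<Omega> (half_plane l) b t = exp (lnPsi b p t)"
proof -
  have D: "\<forall>\<gamma>\<in>G. Z p \<gamma> \<in> half_plane l" "t \<in> dom_t p" using assms(2) by (simp_all add: tau_domain_iff)
  have "Psi_product form (Z p) \<Omega> (half_plane l) b t = (\<Prod>\<gamma>\<in>G. Lambda_fun (Z p \<gamma> / t) powi (\<lfloor>\<Omega> \<gamma>\<rfloor> * form b \<gamma>))"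
    unfolding Psi_product_def half_plane_classes[OF D(1)] ..
  also have "\<dots> = (\<Prod>\<gamma>\<in>G. exp (- (of_rat (\<Omega> \<gamma>) * of_int (form \<gamma> b) * ln_Lambda (Z p \<gamma> / t))))"
  proof (rule prod.cong[OF refl])
    fix \<gamma> assume "\<gamma> \<in> G"
    hence x: "Re (Z p \<gamma> / t) > 0" using D(2) by (simp add: dom_t_def)
    have "\<Omega> \<gamma> = of_int \<lfloor>\<Omega> \<gamma>\<rfloor>" using assms(1) by (auto simp: integral_bps_def elim!: Ints_cases)
    hence r: "complex_of_rat (\<Omega> \<gamma>) = of_int \<lfloor>\<Omega> \<gamma>\<rfloor>" by (metis of_rat_of_int_eq)
    have k: "form b \<gamma> = - form \<gamma> b" by (rule skew)
    show "Lambda_fun (Z p \<gamma> / t) powi (\<lfloor>\<Omega> \<gamma>\<rfloor> * form b \<gamma>) = exp (- (of_rat (\<Omega> \<gamma>) * of_int (form \<gamma> b) * ln_Lambda (Z p \<gamma> / t)))"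
      unfolding exp_ln_Lambda[OF Lambda_slit[OF x], symmetric] exp_power_int r by (simp add: k)
  qed
  also have "\<dots> = exp (- lnPsi b p t)"
    unfolding lnPsi_def sum_negf[symmetric] by (rule exp_sum[OF finite_G, symmetric])
  finally show ?thesis by (simp add: exp_minus inverse_eq_divide)
qed

abbreviation osc_tau :: "real \<Rightarrow> complex \<Rightarrow> 'm \<Rightarrow> complex" where
  "osc_tau hbar t p \<equiv> exp (1 / (2 * of_real pi * \<i>) * oscillator_tau_exponent (Z p) \<Omega> G hbar t)"

text \<open>The witnesses are the t-derivative of the exponent for a, and i times
  \<open>dtau\<close>, free of hbar, for b. The leading part i times \<open>lnPsi\<close> satisfies
  the equation exactly with this b, so only the derivative of the remainder has to be
  O(hbar).\<close>

lemma oscillator_tau_function_mod_hbar: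
  "tau_function_mod_hbar form Z \<beta> (tau_domain Z l G)
     (\<lambda>hbar j t p. exp (oscillator_exponent form (Z p) \<Omega> G hbar (\<beta> j) t))
     (\<lambda>hbar t p. exp (1 / (2 * of_real pi * \<i>) * oscillator_tau_exponent (Z p) \<Omega> G hbar t))"
  unfolding tau_function_mod_hbar_def
proof (intro conjI allI impI ballI; clarify?)
  fix t p j assume D: "(t, p) \<in> tau_domain Z l G"
  hence t: "t \<in> dom_t p" by (simp add: tau_domain_iff)
  let ?E = "\<lambda>hbar. oscillator_exponent form (Z p) \<Omega> G hbar (\<beta> j)"
  let ?L' = "\<Sum>q\<in>UNIV. of_int (form (\<beta> j) (\<beta> q)) * (\<i> * dtau t p q)"
  obtain r C h0 where r: "r > 0" "C > 0" "h0 > 0" "cball t r \<subseteq> dom_t p"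
    and E1: "\<And>hbar s. 0 < hbar \<Longrightarrow> hbar \<le> h0 \<Longrightarrow> s \<in> cball t r \<Longrightarrow>
       summable (\<lambda>m. oscillator_term form (Z p) \<Omega> G hbar (\<beta> j) s (Suc m)) \<and>
       norm (?E hbar s - \<i> * lnPsi (\<beta> j) p s) \<le> C * hbar"
    and E2: "\<And>hbar. 0 < hbar \<Longrightarrow> hbar \<le> h0 \<Longrightarrow> ?E hbar holomorphic_on ball t r"
    and E3: "\<And>hbar. 0 < hbar \<Longrightarrow> hbar \<le> h0 \<Longrightarrow> continuous_on (cball t r) (?E hbar)"
    by (rule oscillator_exponent_estimate[OF t, of "\<beta> j"]) blast
  have E': "(?E hbar has_field_derivative deriv (?E hbar) t) (at t)" if "0 < hbar" "hbar \<le> h0" for hbar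
    by (rule holomorphic_derivI[OF E2[OF that] open_ball]) (use r in simp)
  have ev: "\<forall>\<^sub>F hbar in at_right 0. hbar \<in> {0<..<h0}" by (rule eventually_at_right_real[OF r(3)])
  have "\<forall>\<^sub>F hbar in at_right 0. log_derivatives Z \<beta> (\<lambda>j t p. exp (oscillator_exponent form (Z p) \<Omega> G hbar (\<beta> j) t))
      (\<lambda>t p. osc_tau hbar t p) t p j
      (deriv (?E hbar) t) (\<lambda>q. \<i> * dtau t p q)"
    using ev
  proof eventually_elim
    case (elim hbar)
    hence hb: "0 < hbar" "hbar \<le> h0" by auto
    have "((\<lambda>s. exp (?E hbar s)) has_field_derivative exp (?E hbar t) * deriv (?E hbar) t) (at t)"
      by (rule DERIV_fun_exp[OF E'[OF hb]])
    moreover have "has_coord_derivative Z \<beta> q (\<lambda>p. osc_tau hbar t p)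
        (- (1 / (2 * of_real pi * \<i>) * (2 * of_real pi)) * dtau t p q * osc_tau hbar t p) p" for q
      by (rule coord_derivative_exp_tau[OF D]) (rule exp_tau_exponent[OF _ hb(1)])
    moreover have "- (1 / (2 * of_real pi * \<i>) * (2 * of_real pi)) = \<i>" by simp
    ultimately show ?case unfolding log_derivatives_def by (simp add: mult.commute)
  qed
  moreover have "(\<lambda>hbar. deriv (?E hbar) t - ?L') \<in> O[at_right 0](\<lambda>hbar. of_real hbar)"
  proof (rule bigoI[of _ "C / r"])
    show "\<forall>\<^sub>F hbar in at_right 0. norm (deriv (?E hbar) t - ?L') \<le> C / r * norm (complex_of_real hbar)"
      using ev
    proof eventually_elim
      case (elim hbar)
      hence hb: "0 < hbar" "hbar \<le> h0" by auto
      have L: "((\<lambda>s. \<i> * lnPsi (\<beta> j) p s) has_field_derivative \<i> * (\<Sum>q\<in>UNIV. of_int (form (\<beta> j) (\<beta> q)) * dtau s p q)) (at s)"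
        if "s \<in> cball t r" for s
        by (intro DERIV_cmult lnPsi_deriv) (use that r(4) in blast)
      have tc: "t \<in> cball t r" using r(1) by simp
      \<comment> \<open>R is at most C hbar on the boundary of a disc whose radius does not depend
        on hbar, so its derivative at the centre is at most C hbar / r.\<close>
      define R where "R s = ?E hbar s - \<i> * lnPsi (\<beta> j) p s" for s
      have Lh: "(\<lambda>s. \<i> * lnPsi (\<beta> j) p s) holomorphic_on cball t r"
        unfolding holomorphic_on_def field_differentiable_def using L has_field_derivative_at_within by blast
      have "R holomorphic_on ball t r"
        unfolding R_def[abs_def] by (intro holomorphic_on_diff E2[OF hb] holomorphic_on_subset[OF Lh ball_subset_cball])
      moreover have "continuous_on (cball t r) R"
        unfolding R_def[abs_def] by (intro continuous_on_diff E3[OF hb] holomorphic_on_imp_continuous_on[OF Lh])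
      moreover have "norm (R s) \<le> C * hbar" if "norm (t - s) = r" for s
        unfolding R_def using E1[OF hb, of s] that by (simp add: dist_norm)
      ultimately have "norm ((deriv ^^ 1) R t) \<le> fact 1 * (C * hbar) / r ^ 1"
        using r(1) by (intro Cauchy_inequality) auto
      moreover have "deriv R t = deriv (?E hbar) t - \<i> * (\<Sum>q\<in>UNIV. of_int (form (\<beta> j) (\<beta> q)) * dtau t p q)"
        unfolding R_def[abs_def] by (rule DERIV_imp_deriv[OF DERIV_diff[OF E'[OF hb] L[OF tc]]])
      moreover have "?L' = \<i> * (\<Sum>q\<in>UNIV. of_int (form (\<beta> j) (\<beta> q)) * dtau t p q)"
        by (simp add: sum_distrib_left mult.left_commute)
      ultimately show ?case using hb(1) by simp
    qed
  qed
  ultimately show "\<exists>a b. (\<forall>\<^sub>F hbar in at_right 0. log_derivatives Z \<beta> (\<lambda>j t p. exp (oscillator_exponent form (Z p) \<Omega> G hbar (\<beta> j) t))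
      (\<lambda>t p. osc_tau hbar t p) t p j (a hbar) (b hbar)) \<and>
      (\<lambda>hbar. a hbar - (\<Sum>q\<in>UNIV. of_int (form (\<beta> j) (\<beta> q)) * b hbar q)) \<in> O[at_right 0](\<lambda>hbar. of_real hbar)"
    by (intro exI[of _ "\<lambda>hbar. deriv (?E hbar) t"] exI[of _ "\<lambda>hbar q. \<i> * dtau t p q"] conjI)
next
  fix hbar :: real assume hb: "hbar > 0"
  show "rescaling_invariant Z \<beta> (tau_domain Z l G) (\<lambda>t p. osc_tau hbar t p)"
    unfolding rescaling_invariant_def
  proof (intro ballI; clarify)
    fix t p p' c
    assume D: "(t, p) \<in> tau_domain Z l G" "(c * t, p') \<in> tau_domain Z l G" and Z: "\<forall>j. Z p' (\<beta> j) = c * Z p (\<beta> j)"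
    have "c * t \<noteq> 0" using D(2) by (simp add: tau_domain_def)
    from tau_exp_rescale[OF refl this Z]
    show "exp (1 / (2 * of_real pi * \<i>) * oscillator_tau_exponent (Z p') \<Omega> G hbar (c * t)) =
      osc_tau hbar t p"
      unfolding exp_tau_exponent[OF D(1) hb] exp_tau_exponent[OF D(2) hb] by simp
  qed
qed

lemma tau_product_tau_function:
  assumes int: "integral_bps \<Omega>"
  shows "tau_function form Z \<beta> (tau_domain Z l G)
     (\<lambda>j t p. 1 / Psi_product form (Z p) \<Omega> (half_plane l) (\<beta> j) t) (\<lambda>t p. tau_product (Z p) \<Omega> l t)"
  unfolding tau_function_def
proof (intro conjI ballI; clarify?)
  fix t p j assume D: "(t, p) \<in> tau_domain Z l G"
  hence t: "t \<in> dom_t p" and H: "\<forall>\<gamma>\<in>G. Z p \<gamma> \<in> half_plane l" by (simp_all add: tau_domain_iff)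
  let ?a = "\<Sum>q\<in>UNIV. of_int (form (\<beta> j) (\<beta> q)) * dtau t p q"
  have "log_derivatives Z \<beta> (\<lambda>j t p. 1 / Psi_product form (Z p) \<Omega> (half_plane l) (\<beta> j) t) (\<lambda>t p. tau_product (Z p) \<Omega> l t) t p j
     ?a (dtau t p)"
    unfolding log_derivatives_def
  proof (intro conjI allI)
    show "1 / Psi_product form (Z p) \<Omega> (half_plane l) (\<beta> j) t \<noteq> 0" "tau_product (Z p) \<Omega> l t \<noteq> 0"
      unfolding Psi_product_eq[OF int D] tau_product_eq[OF int D] by simp_all
    have 1: "((\<lambda>s. exp (lnPsi (\<beta> j) p s)) has_field_derivative ?a * exp (lnPsi (\<beta> j) p t)) (at t)"
      using DERIV_fun_exp[OF lnPsi_deriv[OF t, of j]] by (simp only: mult.commute)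
    have 2: "open (dom_t p)" using open_dom_t by (simp add: open_sector_def)
    have 3: "exp (lnPsi (\<beta> j) p s) = 1 / Psi_product form (Z p) \<Omega> (half_plane l) (\<beta> j) s" if "s \<in> dom_t p" for s
      using Psi_product_eq[OF int, of s p "\<beta> j"] that H by (simp add: tau_domain_iff)
    show "((\<lambda>s. 1 / Psi_product form (Z p) \<Omega> (half_plane l) (\<beta> j) s) has_field_derivative
        ?a * (1 / Psi_product form (Z p) \<Omega> (half_plane l) (\<beta> j) t)) (at t)"
      unfolding Psi_product_eq[OF int D] by (rule has_field_derivative_transform_within_open[OF 1 2 t 3])
    show "has_coord_derivative Z \<beta> q (\<lambda>p. tau_product (Z p) \<Omega> l t) (dtau t p q * tau_product (Z p) \<Omega> l t) p" for q
      using coord_derivative_exp_tau[OF D, of "\<lambda>p. tau_product (Z p) \<Omega> l t" 0 1 q] tau_product_eq[OF int] by simp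
  qed
  thus "\<exists>a b. log_derivatives Z \<beta> (\<lambda>j t p. 1 / Psi_product form (Z p) \<Omega> (half_plane l) (\<beta> j) t) (\<lambda>t p. tau_product (Z p) \<Omega> l t) t p j a b \<and>
      a = (\<Sum>q\<in>UNIV. of_int (form (\<beta> j) (\<beta> q)) * b q)" by blast
next
  show "rescaling_invariant Z \<beta> (tau_domain Z l G) (\<lambda>t p. tau_product (Z p) \<Omega> l t)"
    unfolding rescaling_invariant_def
  proof (intro ballI; clarify)
    fix t p p' c
    assume D: "(t, p) \<in> tau_domain Z l G" "(c * t, p') \<in> tau_domain Z l G" and Z: "\<forall>j. Z p' (\<beta> j) = c * Z p (\<beta> j)"
    have "c * t \<noteq> 0" using D(2) by (simp add: tau_domain_def)
    from tau_exp_rescale[OF refl this Z]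
    show "tau_product (Z p') \<Omega> l (c * t) = tau_product (Z p) \<Omega> l t"
      unfolding tau_product_eq[OF int D(1)] tau_product_eq[OF int D(2)] by simp
  qed
qed

text \<open>The power of 2 pi collects the constants ln (2 pi) / 12 of the classes, weighted by
  \<Omega>.\<close>

lemma oscillator_tau_identity:
  assumes int: "integral_bps \<Omega>" and D: "(t, p) \<in> tau_domain Z l G" and hb: "hbar > 0"
  shows "exp (- (1 / (2 * of_real pi)) * oscillator_tau_exponent (Z p) \<Omega> G hbar t) =
     (2 * of_real pi) powr (- (\<Sum>\<gamma>\<in>G. of_rat (\<Omega> \<gamma>)) / 12) * tau_product (Z p) \<Omega> l t"
proof -
  define S where "S = (\<Sum>\<gamma>\<in>G. complex_of_rat (\<Omega> \<gamma>))"
  have 1: "- (1 / (2 * of_real pi)) * (2 * of_real pi * (of_real (ln (2 * pi) / 12) * S)) = - S / 12 * of_real (ln (2 * pi))"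
    by simp
  have 2: "- (- (1 / (2 * of_real pi)) * (2 * complex_of_real pi)) = 1" by simp
  show ?thesis
    unfolding exp_tau_exponent[OF D hb] tau_product_eq[OF int D] two_pi_powr S_def[symmetric] 1 2 by (simp only: exp_add mult_1_left)
qed

text \<open>The comparison with the sums \<open>s N\<close>, which are free of hbar, is uniform in
  N, so hbar and N may tend to their limits jointly in any relation. The limit of \<open>s N\<close>
  is i times \<open>lnPsi\<close>, whence the factor 1 / i.\<close>

lemma partial_exponent_limit:
  assumes int: "integral_bps \<Omega>" and D: "(t, p) \<in> tau_domain Z l G"
  shows "((\<lambda>(hbar, N). exp (1 / \<i> * partial_oscillator_exponent form (Z p) \<Omega> G N hbar b t))
     \<longlongrightarrow> 1 / Psi_product form (Z p) \<Omega> (half_plane l) b t) (at_right 0 \<times>\<^sub>F sequentially)"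
proof -
  have t: "t \<in> dom_t p" using D by (simp add: tau_domain_iff)
  let ?P = "\<lambda>hbar N. partial_oscillator_exponent form (Z p) \<Omega> G N hbar b t"
  define s where "s N = (\<Sum>\<gamma> | \<gamma> \<in> G \<and> form \<gamma> b \<noteq> 0. of_real (of_int (form \<gamma> b) / (2 * pi) * of_rat (\<Omega> \<gamma>)) * osc_partial N (Z p \<gamma> / t))" for N
  obtain C h0 where C: "h0 > 0" "\<And>hbar N. 0 < hbar \<Longrightarrow> hbar \<le> h0 \<Longrightarrow> norm (?P hbar N - s N) \<le> C * hbar"
    by (rule oscillator_exponent_estimate[OF t, of b]) (unfold s_def, blast)
  have "s \<longlonglongrightarrow> (\<Sum>\<gamma> | \<gamma> \<in> G \<and> form \<gamma> b \<noteq> 0. of_real (of_int (form \<gamma> b) / (2 * pi) * of_rat (\<Omega> \<gamma>)) * (2 * of_real pi * \<i> * ln_Lambda (Z p \<gamma> / t)))"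
    unfolding s_def
  proof (intro tendsto_sum tendsto_mult tendsto_const)
    fix \<gamma> assume "\<gamma> \<in> {\<gamma>. \<gamma> \<in> G \<and> form \<gamma> b \<noteq> 0}"
    hence "Re (Z p \<gamma> / t) > 0" using t by (simp add: dom_t_def)
    from osc_pair_sums[OF this] show "(\<lambda>N. osc_partial N (Z p \<gamma> / t)) \<longlonglongrightarrow> 2 * of_real pi * \<i> * ln_Lambda (Z p \<gamma> / t)"
      by (simp only: sums_def)
  qed
  also have "(\<Sum>\<gamma> | \<gamma> \<in> G \<and> form \<gamma> b \<noteq> 0. of_real (of_int (form \<gamma> b) / (2 * pi) * of_rat (\<Omega> \<gamma>)) * (2 * of_real pi * \<i> * ln_Lambda (Z p \<gamma> / t))) =
      \<i> * lnPsi b p t"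
    unfolding lnPsi_altdef sum_distrib_left by (rule sum.cong) (simp_all add: of_real_of_rat)
  finally have "((\<lambda>x. s (snd x)) \<longlongrightarrow> \<i> * lnPsi b p t) (at_right (0::real) \<times>\<^sub>F sequentially)"
    by (rule filterlim_compose[OF _ filterlim_snd])
  moreover have "((\<lambda>x. ?P (fst x) (snd x) - s (snd x)) \<longlongrightarrow> 0) (at_right 0 \<times>\<^sub>F sequentially)"
  proof (rule Lim_null_comparison)
    have "\<forall>\<^sub>F hbar in at_right 0. \<forall>N. norm (?P hbar N - s N) \<le> C * hbar"
      using eventually_at_right_real[OF C(1)] by eventually_elim (use C(2) in auto)
    hence "\<forall>\<^sub>F x in at_right 0 \<times>\<^sub>F (sequentially :: nat filter). \<forall>N. norm (?P (fst x) N - s N) \<le> C * fst x"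
      by (rule eventually_compose_filterlim[OF _ filterlim_fst])
    thus "\<forall>\<^sub>F x in at_right 0 \<times>\<^sub>F sequentially. norm (?P (fst x) (snd x) - s (snd x)) \<le> C * fst x"
      by eventually_elim blast
    have "((\<lambda>h. C * h) \<longlongrightarrow> C * 0) (at_right 0)" by (intro tendsto_intros)
    hence "((\<lambda>h. C * h) \<longlongrightarrow> 0) (at_right 0)" by simp
    thus "((\<lambda>x. C * fst x) \<longlongrightarrow> 0) (at_right 0 \<times>\<^sub>F (sequentially :: nat filter))"
      by (rule filterlim_compose[OF _ filterlim_fst])
  qed
  ultimately have "((\<lambda>x. exp (1 / \<i> * (s (snd x) + (?P (fst x) (snd x) - s (snd x))))) \<longlongrightarrow> exp (1 / \<i> * (\<i> * lnPsi b p t + 0))) (at_right 0 \<times>\<^sub>F sequentially)"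
    by (intro tendsto_intros)
  moreover have "1 / \<i> * (\<i> * lnPsi b p t + 0) = lnPsi b p t" by simp
  ultimately show ?thesis unfolding Psi_product_eq[OF int D] by (simp add: case_prod_unfold)
qed

end

lemma ball_pairI: "(\<And>x y. (x, y) \<in> D \<Longrightarrow> P x y) \<Longrightarrow> \<forall>(x, y)\<in>D. P x y"
  by auto

theorem theorem10:
  fixes \<A> :: "('m::{t2_space,second_countable_topology} set \<times> ('m \<Rightarrow> complex ^ 'd::finite)) set"
    and form :: "int ^ 'n::finite \<Rightarrow> int ^ 'n \<Rightarrow> int"
    and Z :: "'m \<Rightarrow> int ^ 'n \<Rightarrow> complex"
    and \<Omega> :: "int ^ 'n \<Rightarrow> rat"
    and \<beta> :: "'n \<Rightarrow> int ^ 'n"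
    and p0 :: 'm and l :: "complex set" and G :: "(int ^ 'n) set"
  assumes "framed_variation \<A> form Z \<Omega>"
    and "miniversal \<A> Z"
    and "finite_bps \<Omega>"
    and "uncoupled form \<Omega>"
    and "lattice_basis \<beta>"
    and "maximal_half_plane_classes \<Omega> (Z p0) l G"
  shows
    "open_sector {t. (t, p0) \<in> tau_domain Z l G} \<and> {t. (t, p0) \<in> tau_domain Z l G} \<noteq> {} \<and>
     (\<forall>(t, p)\<in>tau_domain Z l G. \<forall>j.
        (\<forall>\<^sub>F hbar in at_right 0. summable (\<lambda>m. oscillator_term form (Z p) \<Omega> G hbar (\<beta> j) t (Suc m))) \<and>
        (\<forall>hbar>0. summable (\<lambda>m. oscillator_tau_term (Z p) \<Omega> G hbar t (Suc m)))) \<and>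
     tau_function_mod_hbar form Z \<beta> (tau_domain Z l G)
       (\<lambda>hbar j t p. exp (oscillator_exponent form (Z p) \<Omega> G hbar (\<beta> j) t))
       (\<lambda>hbar t p. exp (1 / (2 * of_real pi * \<i>) * oscillator_tau_exponent (Z p) \<Omega> G hbar t)) \<and>
     (integral_bps \<Omega> \<longrightarrow>
       (\<forall>(t, p)\<in>tau_domain Z l G. \<forall>hbar>0.
          exp (- (1 / (2 * of_real pi)) * oscillator_tau_exponent (Z p) \<Omega> G hbar t) =
          (2 * of_real pi) powr (- (\<Sum>\<gamma>\<in>G. of_rat (\<Omega> \<gamma>)) / 12) * tau_product (Z p) \<Omega> l t) \<and>
       tau_function form Z \<beta> (tau_domain Z l G)
         (\<lambda>j t p. 1 / Psi_product form (Z p) \<Omega> (half_plane l) (\<beta> j) t)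
         (\<lambda>t p. tau_product (Z p) \<Omega> l t) \<and>
       (\<forall>p \<xi>. twisted_character form \<xi> \<and> (\<forall>\<gamma>\<in>active \<Omega>. \<xi> \<gamma> = 1) \<longrightarrow>
          solves_birational_RH form (Z p) \<Omega> \<xi> (Psi_solution form (Z p) \<Omega> \<xi>)) \<and>
       (\<forall>(t, p)\<in>tau_domain Z l G. \<forall>j.
          ((\<lambda>(hbar, N). exp (1 / \<i> * partial_oscillator_exponent form (Z p) \<Omega> G N hbar (\<beta> j) t))
             \<longlongrightarrow> 1 / Psi_product form (Z p) \<Omega> (half_plane l) (\<beta> j) t)
            (at_right 0 \<times>\<^sub>F sequentially)))"
proof -
  have bps: "bps_structure form (Z p) \<Omega>" for p using assms(1) by (simp add: framed_variation_def)
  have add: "Modules.additive (Z p)" for p using bps by (auto simp: bps_structure_def)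
  note fin = assms(3) and unc = assms(4) and basis = assms(5) and mx = assms(6)
  from assms(2) obtain b where b: "lattice_basis b"
    "\<forall>p. \<exists>U. p \<in> U \<and> is_chart U (period_coords Z b) \<and>
       (\<forall>(V, \<psi>)\<in>\<A>. holomorphic_transition U (period_coords Z b) V \<psi> \<and> holomorphic_transition V \<psi> U (period_coords Z b))"
    unfolding miniversal_def by (elim exE conjE) (rule that)
  \<comment> \<open>The given basis need not be the one whose period coordinates miniversality
    provides.\<close>
  have charts: "\<exists>U. p \<in> U \<and> is_chart U (period_coords Z \<beta>)" for p
  proof -
    from b(2)[rule_format, of p] obtain U where "p \<in> U" "is_chart U (period_coords Z b)" by (elim exE conjE) (rule that)
    thus ?thesis using chart_change_basis[where Z=Z, OF b(1) basis add] by blast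
  qed
  note ctx = bps fin unc basis mx charts
  have S: "{t. (t, p0) \<in> tau_domain Z l G} = dom_t Z G p0"
    using Z_p0[OF ctx] by (auto simp: tau_domain_iff[OF ctx])
  have sum1: "\<forall>\<^sub>F hbar in at_right 0. summable (\<lambda>m. oscillator_term form (Z p) \<Omega> G hbar (\<beta> j) t (Suc m))"
    if "(t, p) \<in> tau_domain Z l G" for t p j
  proof -
    have t: "t \<in> dom_t Z G p" using that by (simp add: tau_domain_iff[OF ctx])
    obtain r h0 where r: "r > 0" "h0 > 0" "\<And>hbar s. 0 < hbar \<Longrightarrow> hbar \<le> h0 \<Longrightarrow> s \<in> cball t r \<Longrightarrow>
       summable (\<lambda>m. oscillator_term form (Z p) \<Omega> G hbar (\<beta> j) s (Suc m))"
      by (rule oscillator_exponent_estimate[OF ctx t, of "\<beta> j"]) blast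
    show ?thesis
      using eventually_at_right_real[OF r(2)] by eventually_elim (use r in auto)
  qed
  have sum2: "summable (\<lambda>m. oscillator_tau_term (Z p) \<Omega> G hbar t (Suc m))" if "(t, p) \<in> tau_domain Z l G" for t p hbar
    using oscillator_tau_term_sums[OF ctx] that by (auto simp: tau_domain_iff[OF ctx] sums_iff)
  show ?thesis
    unfolding S
    apply (intro conjI impI)
    subgoal by (rule open_dom_t[OF ctx])
    subgoal by (rule dom_t_nonempty[OF ctx Z_p0[OF ctx]])
    subgoal by (intro ball_pairI allI conjI impI sum1 sum2)
    subgoal by (rule oscillator_tau_function_mod_hbar[OF ctx])
    subgoal by (intro ball_pairI allI impI oscillator_tau_identity[OF ctx])
    subgoal by (rule tau_product_tau_function[OF ctx])
    subgoal using Psi_solution_solves[OF bps fin unc] by blast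
    subgoal by (intro ball_pairI allI partial_exponent_limit[OF ctx])
    done
qed

end
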